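(* Let $H$ be a quasitriangular quasi-Hopf algebra, $A$ an object in ${}^{H}\mathscr{A}^{\mathrm{com}}$ and $V$ an object in ${}^{H}_{A}\mathscr{M}^{\mathrm{sym}}_{A}$. The object of differential operators $\mathrm{diff}(V)=\bigcup_{n\geq0}\mathrm{diff}^n(V)$ is a subobject, in the category of algebras in ${}^{H}\mathscr{M}$, of the algebra of internal endomorphisms $\mathrm{end}(V)$ (with product $\bullet$ and unit $\eta:I\to \mathrm{end}(V)$, $c\mapsto c\,(\beta\triangleright\cdot)$).
   Context: BASIC SETTING. $k$ is a commutative associative ring with unit. $H$ is a quasitriangular quasi-Hopf algebra over $k$, placed in degree $0$, with coproduct $\Delta(h)=h_{(1)}\otimes h_{(2)}$, counit $\epsilon$, invertible associator $\phi=\phi^{(1)}\otimes\phi^{(2)}\otimes\phi^{(3)}$ with inverse $\phi^{-1}=\phi^{(-1)}\otimes\phi^{(-2)}\otimes\phi^{(-3)}$, quasi-antipode $(S,\alpha,\beta)$ and universal $R$-matrix $R=R^{(1)}\otimes R^{(2)}$ (summations understood). Conventions: $(\mathrm{id}\otimes\Delta)\Delta(h)=\phi\,(\Delta\otimes\mathrm{id})\Delta(h)\,\phi^{-1}$; $S(h_{(1)})\alpha h_{(2)}=\epsilon(h)\alpha$; $h_{(1)}\beta S(h_{(2)})=\epsilon(h)\beta$; $\phi^{(1)}\beta S(\phi^{(2)})\alpha\phi^{(3)}=1=S(\phi^{(-1)})\alpha\phi^{(-2)}\beta S(\phi^{(-3)})$; $\Delta^{\mathrm{op}}(h)=R\,\Delta(h)\,R^{-1}$;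 the remaining axioms (pentagon, counit normalization, hexagons) are the ones making the following a braided monoidal category. ${}^{H}\mathscr{M}$: objects are bounded $\mathbb{Z}$-graded left $H$-modules $V=\bigoplus_n V_n$ ($V_n=0$ for all but finitely many $n$; action $\triangleright$ degree-preserving); morphisms are degree-preserving $H$-equivariant $k$-linear maps. $V\otimes W$ is the graded tensor product over $k$ with $h\triangleright(v\otimes w)=(h_{(1)}\triangleright v)\otimes(h_{(2)}\triangleright w)$; unit $I=k$ (degree $0$, action by $\epsilon$); associator $\Phi((v\otimes w)\otimes x)=(\phi^{(1)}\triangleright v)\otimes((\phi^{(2)}\triangleright w)\otimes(\phi^{(3)}\triangleright x))$; braiding $\tau(v\otimes w)=(-1)^{|v||w|}(R^{(2)}\triangleright w)\otimes(R^{(1)}\triangleright v)$. Internal hom: $\hom(V,W)=\bigoplus_n\bigoplus_{l-m=n}\mathrm{Hom}_k(V_m,W_l)$ with $h\triangleright L=(h_{(1)}\triangleright\cdot)\circ L\circ(S(h_{(2)})\triangleright\cdot)$. Currying bijection: for $f:V\otimes W\to X$, $\zeta(f)(v)=f((\phi^{(-1)}\triangleright v)\otimes((\phi^{(-2)}\beta S(\phi^{(-3)}))\triangleright(\cdot)))$; inverse: for $g:V\to\hom(W,X)$, $\zeta^{-1}(g)(v\otimes w)=\phi^{(1)}\triangleright(g(v)((S(\phi^{(2)})\alpha\phi^{(3)})\triangleright w))$. Evaluation $\mathrm{ev}=\zeta^{-1}(\mathrm{id}):\hom(V,W)\otimes V\to W$; internal composition $\bullet=\zeta(\mathrm{ev}\circ(\mathrm{id}\otimes\mathrm{ev})\circ\Phi):\hom(W,X)\otimes\hom(V,W)\to\hom(V,X)$.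 $\mathrm{end}(V)=\hom(V,V)$, unit $1=(\beta\triangleright\cdot)$. Commutator on $\mathrm{end}(V)$: $[L,L']=L\bullet L'-(-1)^{|L||L'|}(R^{(2)}\triangleright L')\bullet(R^{(1)}\triangleright L)$. ALGEBRAS AND BIMODULES. An algebra in ${}^{H}\mathscr{M}$ is an object $A$ with ${}^{H}\mathscr{M}$-morphisms product $\mu:A\otimes A\to A$ and unit $I\to A$, with $(aa')a''=(\phi^{(1)}\triangleright a)((\phi^{(2)}\triangleright a')(\phi^{(3)}\triangleright a''))$ and $1a=a=a1$; algebra morphisms are ${}^{H}\mathscr{M}$-morphisms preserving products and units; $A$ is braided commutative (an object of ${}^{H}\mathscr{A}^{\mathrm{com}}$) if $\mu\circ\tau=\mu$. An $A$-bimodule $V$ in ${}^{H}\mathscr{M}$ has ${}^{H}\mathscr{M}$-morphisms $l:A\otimes V\to V$, $r:V\otimes A\to V$ (written by juxtaposition) that are unital and satisfy the module and bimodule axioms with brackets changed by $\Phi$; it is symmetric if $r\circ\tau=l$ and $l\circ\tau=r$. ${}^{H}_{A}\mathscr{M}^{\mathrm{sym}}_{A}$ is the category of symmetric $A$-bimodules. $\hat l=\zeta(l):A\to\mathrm{end}(V)$, and $[L,a]:=[L,\hat l(a)]$ for $L\in\mathrm{end}(V)$, $a\in A$. DIFFERENTIAL OPERATORS. For $n\ge0$, $\mathrm{diff}^n(V)=\mathrm{Ker}\,\zeta\big([\cdot,\cdot]^{(n+1)}\circ\Phi^{(-(n+1))}\big)\subseteq\mathrm{end}(V)$, where $[\cdot,\cdot]^{(n+1)}$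 sends $(\cdots((L\otimes a_1)\otimes a_2)\cdots)\otimes a_{n+1}$ to $[[\cdots[[L,a_1],a_2],\cdots],a_{n+1}]$, and $\Phi^{(-(n+1))}$ is the rebracketing isomorphism (composite of associators) $\mathrm{end}(V)\otimes(A\otimes(A\otimes\cdots(A\otimes A)\cdots))\to(\cdots((\mathrm{end}(V)\otimes A)\otimes A)\cdots)\otimes A$ with $n+1$ factors of $A$. One has $\mathrm{diff}^n(V)\subseteq\mathrm{diff}^m(V)$ for $n\le m$. *)

theory Defs
  imports "HOL-Algebra.Module" "HOL-Library.FuncSet"
begin

text \<open>An element of a tensor product of two K-modules is an equivalence class of finite formal sums
  \<open>v\<^sub>1 \<otimes> w\<^sub>1 + \<dots> + v\<^sub>n \<otimes> w\<^sub>n\<close>, such a sum being represented by the list of its pairs.\<close>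

type_synonym ('v, 'w) tens = "('v \<times> 'w) list set"

inductive tens_eq ::
  "('k, 'm) ring_scheme \<Rightarrow> ('k, 'v, 'p) module_scheme \<Rightarrow> ('k, 'w, 'q) module_scheme
    \<Rightarrow> ('v \<times> 'w) list \<Rightarrow> ('v \<times> 'w) list \<Rightarrow> bool"
  for K V W where
  refl: "set xs \<subseteq> carrier V \<times> carrier W \<Longrightarrow> tens_eq K V W xs xs"
| sym: "tens_eq K V W xs ys \<Longrightarrow> tens_eq K V W ys xs"
| trans: "tens_eq K V W xs ys \<Longrightarrow> tens_eq K V W ys zs \<Longrightarrow> tens_eq K V W xs zs"
| append: "tens_eq K V W xs ys \<Longrightarrow> tens_eq K V W us vs \<Longrightarrow> tens_eq K V W (xs @ us) (ys @ vs)"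
| swap: "v \<in> carrier V \<Longrightarrow> w \<in> carrier W \<Longrightarrow> v' \<in> carrier V \<Longrightarrow> w' \<in> carrier W
    \<Longrightarrow> tens_eq K V W [(v, w), (v', w')] [(v', w'), (v, w)]"
| zero: "w \<in> carrier W \<Longrightarrow> tens_eq K V W [(\<zero>\<^bsub>V\<^esub>, w)] []"
| add_left: "v \<in> carrier V \<Longrightarrow> v' \<in> carrier V \<Longrightarrow> w \<in> carrier W
    \<Longrightarrow> tens_eq K V W [(v \<oplus>\<^bsub>V\<^esub> v', w)] [(v, w), (v', w)]"
| add_right: "v \<in> carrier V \<Longrightarrow> w \<in> carrier W \<Longrightarrow> w' \<in> carrier W
    \<Longrightarrow> tens_eq K V W [(v, w \<oplus>\<^bsub>W\<^esub> w')] [(v, w), (v, w')]"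
| smult: "c \<in> carrier K \<Longrightarrow> v \<in> carrier V \<Longrightarrow> w \<in> carrier W
    \<Longrightarrow> tens_eq K V W [(c \<odot>\<^bsub>V\<^esub> v, w)] [(v, c \<odot>\<^bsub>W\<^esub> w)]"

definition tclass where
  "tclass K V W xs = {ys. tens_eq K V W xs ys}"

definition trep :: "('v, 'w) tens \<Rightarrow> ('v \<times> 'w) list" where
  "trep t = (SOME xs. xs \<in> t)"

text \<open>The fields \<open>mult\<close> and \<open>one\<close> are meaningful only if \<open>V\<close> and \<open>W\<close> are K-algebras, where they give
  the usual tensor product algebra.\<close>

definition tensor ::
  "('k, 'm) ring_scheme \<Rightarrow> ('k, 'v, 'p) module_scheme \<Rightarrow> ('k, 'w, 'q) module_scheme
    \<Rightarrow> ('k, ('v, 'w) tens) module" where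
  "tensor K V W = \<lparr>
     carrier = tclass K V W ` {xs. set xs \<subseteq> carrier V \<times> carrier W},
     mult = (\<lambda>s t. tclass K V W
       [(v \<otimes>\<^bsub>V\<^esub> v', w \<otimes>\<^bsub>W\<^esub> w'). (v, w) \<leftarrow> trep s, (v', w') \<leftarrow> trep t]),
     one = tclass K V W [(\<one>\<^bsub>V\<^esub>, \<one>\<^bsub>W\<^esub>)],
     zero = tclass K V W [],
     add = (\<lambda>s t. tclass K V W (trep s @ trep t)),
     smult = (\<lambda>c t. tclass K V W (map (\<lambda>(v, w). (c \<odot>\<^bsub>V\<^esub> v, w)) (trep t))) \<rparr>"

text \<open>The linear map on a tensor product (of two, or of three right-bracketed factors) with values in
  \<open>X\<close> that is induced by the multilinear map \<open>f\<close>. On an element of \<open>H \<otimes> H\<close> or \<open>H \<otimes> (H \<otimes> H)\<close> this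
  renders Sweedler-type summations.\<close>

definition tlift :: "('x, 'm) ring_scheme \<Rightarrow> ('v \<Rightarrow> 'w \<Rightarrow> 'x) \<Rightarrow> ('v, 'w) tens \<Rightarrow> 'x" where
  "tlift X f t = foldr (\<lambda>(v, w) x. f v w \<oplus>\<^bsub>X\<^esub> x) (trep t) \<zero>\<^bsub>X\<^esub>"

definition tlift3 ::
  "('x, 'm) ring_scheme \<Rightarrow> ('u \<Rightarrow> 'v \<Rightarrow> 'w \<Rightarrow> 'x) \<Rightarrow> ('u, ('v, 'w) tens) tens \<Rightarrow> 'x" where
  "tlift3 X f t = tlift X (\<lambda>u s. tlift X (f u) s) t"

definition klinear ::
  "('k, 'm) ring_scheme \<Rightarrow> ('k, 'v, 'p) module_scheme \<Rightarrow> ('k, 'w, 'q) module_scheme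
    \<Rightarrow> ('v \<Rightarrow> 'w) \<Rightarrow> bool" where
  "klinear K V W f \<longleftrightarrow> f \<in> carrier V \<rightarrow> carrier W \<and>
     (\<forall>x\<in>carrier V. \<forall>y\<in>carrier V. f (x \<oplus>\<^bsub>V\<^esub> y) = f x \<oplus>\<^bsub>W\<^esub> f y) \<and>
     (\<forall>c\<in>carrier K. \<forall>x\<in>carrier V. f (c \<odot>\<^bsub>V\<^esub> x) = c \<odot>\<^bsub>W\<^esub> f x)"


section \<open>Quasitriangular quasi-Hopf algebras\<close>

record ('k, 'h) quasi_hopf = "('k, 'h) module" +
  comult :: "'h \<Rightarrow> ('h, 'h) tens"
  counit :: "'h \<Rightarrow> 'k"
  assoc :: "('h, ('h, 'h) tens) tens"
  antip :: "'h \<Rightarrow> 'h"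
  alph :: 'h
  beta :: 'h
  rmat :: "('h, 'h) tens"

locale hopf_data =
  fixes K :: "'k ring" and H :: "('k, 'h) quasi_hopf"
begin

abbreviation "HH \<equiv> tensor K H H"
abbreviation "HHH \<equiv> tensor K H HH"
abbreviation "HHHH \<equiv> tensor K H HHH"

abbreviation "h2 a b \<equiv> tclass K H H [(a, b)]"
abbreviation "h3 a b c \<equiv> tclass K H HH [(a, h2 b c)]"
abbreviation "h4 a b c d \<equiv> tclass K H HHH [(a, h3 b c d)]"

abbreviation "\<Delta> \<equiv> comult H"
abbreviation "\<epsilon> \<equiv> counit H"
abbreviation "\<phi> \<equiv> assoc H"
abbreviation "\<phi>inv \<equiv> inv\<^bsub>HHH\<^esub> (assoc H)"
abbreviation "S \<equiv> antip H"
abbreviation "\<alpha> \<equiv> alph H"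
abbreviation "\<beta> \<equiv> beta H"
abbreviation "\<R> \<equiv> rmat H"

end

locale quasi_bialgebra = hopf_data +
  assumes K_cring: "cring K"
    and H_ring: "ring H"
    and H_module: "module K H"
    and H_smult_left: "\<lbrakk>c \<in> carrier K; x \<in> carrier H; y \<in> carrier H\<rbrakk>
      \<Longrightarrow> (c \<odot>\<^bsub>H\<^esub> x) \<otimes>\<^bsub>H\<^esub> y = c \<odot>\<^bsub>H\<^esub> (x \<otimes>\<^bsub>H\<^esub> y)"
    and H_smult_right: "\<lbrakk>c \<in> carrier K; x \<in> carrier H; y \<in> carrier H\<rbrakk>
      \<Longrightarrow> x \<otimes>\<^bsub>H\<^esub> (c \<odot>\<^bsub>H\<^esub> y) = c \<odot>\<^bsub>H\<^esub> (x \<otimes>\<^bsub>H\<^esub> y)"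
    and comult_hom: "\<Delta> \<in> ring_hom H HH"
    and comult_smult: "\<lbrakk>c \<in> carrier K; x \<in> carrier H\<rbrakk> \<Longrightarrow> \<Delta> (c \<odot>\<^bsub>H\<^esub> x) = c \<odot>\<^bsub>HH\<^esub> \<Delta> x"
    and counit_hom: "\<epsilon> \<in> ring_hom H K"
    and counit_smult: "\<lbrakk>c \<in> carrier K; x \<in> carrier H\<rbrakk> \<Longrightarrow> \<epsilon> (c \<odot>\<^bsub>H\<^esub> x) = c \<otimes>\<^bsub>K\<^esub> \<epsilon> x"
    and counit_left: "x \<in> carrier H \<Longrightarrow> tlift H (\<lambda>a b. \<epsilon> a \<odot>\<^bsub>H\<^esub> b) (\<Delta> x) = x"
    and counit_right: "x \<in> carrier H \<Longrightarrow> tlift H (\<lambda>a b. \<epsilon> b \<odot>\<^bsub>H\<^esub> a) (\<Delta> x) = x"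
    and assoc_unit: "\<phi> \<in> Units HHH"
    and quasi_coassoc: "x \<in> carrier H \<Longrightarrow>
      tlift HHH (\<lambda>a b. tlift HHH (\<lambda>b1 b2. h3 a b1 b2) (\<Delta> b)) (\<Delta> x)
      = \<phi> \<otimes>\<^bsub>HHH\<^esub> tlift HHH (\<lambda>a b. tlift HHH (\<lambda>a1 a2. h3 a1 a2 b) (\<Delta> a)) (\<Delta> x) \<otimes>\<^bsub>HHH\<^esub> \<phi>inv"
    \<comment> \<open>\<open>(1 \<otimes> \<phi>) (id \<otimes> \<Delta> \<otimes> id)(\<phi>) (\<phi> \<otimes> 1) = (id \<otimes> id \<otimes> \<Delta>)(\<phi>) (\<Delta> \<otimes> id \<otimes> id)(\<phi>)\<close>\<close>
    and pentagon:
      "tlift3 HHHH (\<lambda>a b c. h4 \<one>\<^bsub>H\<^esub> a b c) \<phi>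
       \<otimes>\<^bsub>HHHH\<^esub> tlift3 HHHH (\<lambda>a b c. tlift HHHH (\<lambda>b1 b2. h4 a b1 b2 c) (\<Delta> b)) \<phi>
       \<otimes>\<^bsub>HHHH\<^esub> tlift3 HHHH (\<lambda>a b c. h4 a b c \<one>\<^bsub>H\<^esub>) \<phi>
      = tlift3 HHHH (\<lambda>a b c. tlift HHHH (\<lambda>c1 c2. h4 a b c1 c2) (\<Delta> c)) \<phi>
       \<otimes>\<^bsub>HHHH\<^esub> tlift3 HHHH (\<lambda>a b c. tlift HHHH (\<lambda>a1 a2. h4 a1 a2 b c) (\<Delta> a)) \<phi>"
    and assoc_counit: "tlift3 HH (\<lambda>a b c. \<epsilon> b \<odot>\<^bsub>HH\<^esub> h2 a c) \<phi> = \<one>\<^bsub>HH\<^esub>"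

locale quasi_hopf_algebra = quasi_bialgebra +
  assumes antip_linear: "klinear K H H S"
    and antip_mult: "\<lbrakk>x \<in> carrier H; y \<in> carrier H\<rbrakk> \<Longrightarrow> S (x \<otimes>\<^bsub>H\<^esub> y) = S y \<otimes>\<^bsub>H\<^esub> S x"
    and antip_one: "S \<one>\<^bsub>H\<^esub> = \<one>\<^bsub>H\<^esub>"
    and alpha_closed: "\<alpha> \<in> carrier H"
    and beta_closed: "\<beta> \<in> carrier H"
    and antip_alpha: "x \<in> carrier H \<Longrightarrow>
      tlift H (\<lambda>a b. S a \<otimes>\<^bsub>H\<^esub> \<alpha> \<otimes>\<^bsub>H\<^esub> b) (\<Delta> x) = \<epsilon> x \<odot>\<^bsub>H\<^esub> \<alpha>"
    and antip_beta: "x \<in> carrier H \<Longrightarrow>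
      tlift H (\<lambda>a b. a \<otimes>\<^bsub>H\<^esub> \<beta> \<otimes>\<^bsub>H\<^esub> S b) (\<Delta> x) = \<epsilon> x \<odot>\<^bsub>H\<^esub> \<beta>"
    and antip_assoc:
      "tlift3 H (\<lambda>a b c. a \<otimes>\<^bsub>H\<^esub> \<beta> \<otimes>\<^bsub>H\<^esub> S b \<otimes>\<^bsub>H\<^esub> \<alpha> \<otimes>\<^bsub>H\<^esub> c) \<phi> = \<one>\<^bsub>H\<^esub>"
    and antip_assoc_inv:
      "tlift3 H (\<lambda>a b c. S a \<otimes>\<^bsub>H\<^esub> \<alpha> \<otimes>\<^bsub>H\<^esub> b \<otimes>\<^bsub>H\<^esub> \<beta> \<otimes>\<^bsub>H\<^esub> S c) \<phi>inv = \<one>\<^bsub>H\<^esub>"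

text \<open>The two hexagon conditions on \<open>R\<close> are those equivalent to the hexagon identities of the braiding
  \<open>v \<otimes> w \<mapsto> (R\<^sup>(\<^sup>2\<^sup>) \<triangleright> w) \<otimes> (R\<^sup>(\<^sup>1\<^sup>) \<triangleright> v)\<close>. In Drinfeld's notation, where the subscripts of \<open>\<phi>\<close> give the
  positions of its first, second and third leg, they read
  \<open>(id \<otimes> \<Delta>)(R) = \<phi>\<^sub>2\<^sub>3\<^sub>1\<^sup>-\<^sup>1 R\<^sub>1\<^sub>3 \<phi>\<^sub>2\<^sub>1\<^sub>3 R\<^sub>1\<^sub>2 \<phi>\<^sup>-\<^sup>1\<close> and \<open>(\<Delta> \<otimes> id)(R) = \<phi>\<^sub>3\<^sub>1\<^sub>2 R\<^sub>1\<^sub>3 \<phi>\<^sub>1\<^sub>3\<^sub>2\<^sup>-\<^sup>1 R\<^sub>2\<^sub>3 \<phi>\<close>.\<close>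

locale quasitriangular_quasi_hopf_algebra = quasi_hopf_algebra +
  assumes rmat_unit: "\<R> \<in> Units HH"
    and rmat_op: "x \<in> carrier H \<Longrightarrow>
      tlift HH (\<lambda>a b. h2 b a) (\<Delta> x) = \<R> \<otimes>\<^bsub>HH\<^esub> \<Delta> x \<otimes>\<^bsub>HH\<^esub> inv\<^bsub>HH\<^esub> \<R>"
    and hexagon1:
      "tlift HHH (\<lambda>a b. tlift HHH (\<lambda>b1 b2. h3 a b1 b2) (\<Delta> b)) \<R>
      = tlift3 HHH (\<lambda>p q r. h3 r p q) \<phi>inv
        \<otimes>\<^bsub>HHH\<^esub> tlift HHH (\<lambda>a b. h3 a \<one>\<^bsub>H\<^esub> b) \<R>
        \<otimes>\<^bsub>HHH\<^esub> tlift3 HHH (\<lambda>p q r. h3 q p r) \<phi>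
        \<otimes>\<^bsub>HHH\<^esub> tlift HHH (\<lambda>a b. h3 a b \<one>\<^bsub>H\<^esub>) \<R>
        \<otimes>\<^bsub>HHH\<^esub> \<phi>inv"
    and hexagon2:
      "tlift HHH (\<lambda>a b. tlift HHH (\<lambda>a1 a2. h3 a1 a2 b) (\<Delta> a)) \<R>
      = tlift3 HHH (\<lambda>p q r. h3 q r p) \<phi>
        \<otimes>\<^bsub>HHH\<^esub> tlift HHH (\<lambda>a b. h3 a \<one>\<^bsub>H\<^esub> b) \<R>
        \<otimes>\<^bsub>HHH\<^esub> tlift3 HHH (\<lambda>p q r. h3 p r q) \<phi>inv
        \<otimes>\<^bsub>HHH\<^esub> tlift HHH (\<lambda>a b. h3 \<one>\<^bsub>H\<^esub> a b) \<R>
        \<otimes>\<^bsub>HHH\<^esub> \<phi>"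


section \<open>Bounded graded left H-modules\<close>

record ('k, 'h, 'v) hmod = "('k, 'v) module" +
  act :: "'h \<Rightarrow> 'v \<Rightarrow> 'v"
  gr :: "int \<Rightarrow> 'v set"

definition decomposes :: "('k, 'h, 'v, 'p) hmod_scheme \<Rightarrow> 'v \<Rightarrow> (int \<Rightarrow> 'v) \<Rightarrow> bool" where
  "decomposes V v c \<longleftrightarrow> (\<forall>n. c n \<in> gr V n) \<and> finite {n. c n \<noteq> \<zero>\<^bsub>V\<^esub>} \<and>
     v = (\<Oplus>\<^bsub>V\<^esub>n\<in>{n. c n \<noteq> \<zero>\<^bsub>V\<^esub>}. c n)"

definition hcomp :: "('k, 'h, 'v, 'p) hmod_scheme \<Rightarrow> 'v \<Rightarrow> int \<Rightarrow> 'v" where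
  "hcomp V v = (THE c. decomposes V v c)"

definition degrees :: "('k, 'h, 'v, 'p) hmod_scheme \<Rightarrow> int set" where
  "degrees V = {n. gr V n \<noteq> {\<zero>\<^bsub>V\<^esub>}}"

text \<open>Transport of structure along a map that is injective on the carrier.\<close>

definition relabel :: "('v \<Rightarrow> 'w) \<Rightarrow> ('k, 'h, 'v, 'p) hmod_scheme \<Rightarrow> ('k, 'h, 'w) hmod" where
  "relabel c V = (let d = inv_into (carrier V) c in \<lparr>
     carrier = c ` carrier V,
     mult = (\<lambda>x y. c (d x \<otimes>\<^bsub>V\<^esub> d y)),
     one = c \<one>\<^bsub>V\<^esub>,
     zero = c \<zero>\<^bsub>V\<^esub>,
     add = (\<lambda>x y. c (d x \<oplus>\<^bsub>V\<^esub> d y)),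
     smult = (\<lambda>a x. c (a \<odot>\<^bsub>V\<^esub> d x)),
     act = (\<lambda>h x. c (act V h (d x))),
     gr = (\<lambda>n. c ` gr V n) \<rparr>)"

record ('k, 'h, 'a) halg = "('k, 'h, 'a) hmod" +
  mu :: "('a, 'a) tens \<Rightarrow> 'a"
  eta :: "'k \<Rightarrow> 'a"

record ('k, 'h, 'a, 'v) hbimod = "('k, 'h, 'v) hmod" +
  lact :: "('a, 'v) tens \<Rightarrow> 'v"
  ract :: "('v, 'a) tens \<Rightarrow> 'v"

text \<open>HOL has no type depending on \<open>n\<close>, so the iterated tensor products
  \<open>A \<otimes> (A \<otimes> (\<dots> \<otimes> A))\<close> and \<open>((E \<otimes> A) \<otimes> \<dots>) \<otimes> A\<close> are realised, for all \<open>n\<close> at once, on the following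
  two types: at each step the binary tensor product is transported along \<open>rnode\<close> resp. \<open>lnode\<close>,
  which encode a class of formal sums by a chosen representative.\<close>

datatype 'a rpow = RLeaf 'a | RNode "('a \<times> 'a rpow) list"
datatype ('e, 'a) lpow = LLeaf 'e | LNode "(('e, 'a) lpow \<times> 'a) list"

definition rnode :: "('a, 'a rpow) tens \<Rightarrow> 'a rpow" where
  "rnode t = RNode (trep t)"

definition lnode :: "(('e, 'a) lpow, 'a) tens \<Rightarrow> ('e, 'a) lpow" where
  "lnode t = LNode (trep t)"

context hopf_data
begin

definition hmodule :: "('k, 'h, 'v, 'p) hmod_scheme \<Rightarrow> bool" where
  "hmodule V \<longleftrightarrow> module K V \<and>
     (\<forall>h\<in>carrier H. klinear K V V (act V h)) \<and>
     (\<forall>v\<in>carrier V. klinear K H V (\<lambda>h. act V h v)) \<and>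
     (\<forall>h\<in>carrier H. \<forall>h'\<in>carrier H. \<forall>v\<in>carrier V. act V (h \<otimes>\<^bsub>H\<^esub> h') v = act V h (act V h' v)) \<and>
     (\<forall>v\<in>carrier V. act V \<one>\<^bsub>H\<^esub> v = v) \<and>
     (\<forall>n. submodule (gr V n) K V) \<and>
     (\<forall>v\<in>carrier V. \<exists>!c. decomposes V v c) \<and>
     finite (degrees V) \<and>
     (\<forall>h\<in>carrier H. \<forall>n. \<forall>v\<in>gr V n. act V h v \<in> gr V n)"

text \<open>Morphisms are compared on the carrier of their domain only.\<close>

definition hmorphism ::
  "('k, 'h, 'v, 'p) hmod_scheme \<Rightarrow> ('k, 'h, 'w, 'q) hmod_scheme \<Rightarrow> ('v \<Rightarrow> 'w) \<Rightarrow> bool" where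
  "hmorphism V W f \<longleftrightarrow> klinear K V W f \<and>
     (\<forall>h\<in>carrier H. \<forall>v\<in>carrier V. f (act V h v) = act W h (f v)) \<and>
     (\<forall>n. \<forall>v\<in>gr V n. f v \<in> gr W n)"

definition unit_obj :: "('k, 'h, 'k) hmod" where
  "unit_obj = \<lparr>
     carrier = carrier K, mult = mult K, one = \<one>\<^bsub>K\<^esub>, zero = \<zero>\<^bsub>K\<^esub>, add = add K, smult = mult K,
     act = (\<lambda>h c. \<epsilon> h \<otimes>\<^bsub>K\<^esub> c),
     gr = (\<lambda>n. if n = 0 then carrier K else {\<zero>\<^bsub>K\<^esub>}) \<rparr>"

abbreviation pure ::
  "('k, 'h, 'v, 'p) hmod_scheme \<Rightarrow> ('k, 'h, 'w, 'q) hmod_scheme \<Rightarrow> 'v \<Rightarrow> 'w \<Rightarrow> ('v, 'w) tens" where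
  "pure V W v w \<equiv> tclass K V W [(v, w)]"

definition htensor ::
  "('k, 'h, 'v, 'p) hmod_scheme \<Rightarrow> ('k, 'h, 'w, 'q) hmod_scheme \<Rightarrow> ('k, 'h, ('v, 'w) tens) hmod"
  (infixl \<open>\<boxtimes>\<close> 75) where
  "V \<boxtimes> W = (let T = tensor K V W in \<lparr>
     carrier = carrier T, mult = mult T, one = one T, zero = zero T, add = add T, smult = smult T,
     act = (\<lambda>h. tlift T (\<lambda>v w. tlift T (\<lambda>a b. pure V W (act V a v) (act W b w)) (\<Delta> h))),
     gr = (\<lambda>n. tclass K V W ` {xs. \<forall>(v, w)\<in>set xs. \<exists>m. v \<in> gr V m \<and> w \<in> gr W (n - m)}) \<rparr>)"

definition tmap ::
  "('k, 'h, 'v, 'p) hmod_scheme \<Rightarrow> ('k, 'h, 'w, 'q) hmod_scheme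
    \<Rightarrow> ('u \<Rightarrow> 'v) \<Rightarrow> ('x \<Rightarrow> 'w) \<Rightarrow> ('u, 'x) tens \<Rightarrow> ('v, 'w) tens" where
  "tmap V W f g = tlift (V \<boxtimes> W) (\<lambda>u x. pure V W (f u) (g x))"

definition associator ::
  "('k, 'h, 'v, 'p) hmod_scheme \<Rightarrow> ('k, 'h, 'w, 'q) hmod_scheme \<Rightarrow> ('k, 'h, 'x, 'r) hmod_scheme
    \<Rightarrow> (('v, 'w) tens, 'x) tens \<Rightarrow> ('v, ('w, 'x) tens) tens" where
  "associator V W X = (let T = V \<boxtimes> (W \<boxtimes> X) in
     tlift T (\<lambda>s x. tlift T (\<lambda>v w. tlift3 T (\<lambda>a b c.
       pure V (W \<boxtimes> X) (act V a v) (pure W X (act W b w) (act X c x))) \<phi>) s))"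

definition associator_inv ::
  "('k, 'h, 'v, 'p) hmod_scheme \<Rightarrow> ('k, 'h, 'w, 'q) hmod_scheme \<Rightarrow> ('k, 'h, 'x, 'r) hmod_scheme
    \<Rightarrow> ('v, ('w, 'x) tens) tens \<Rightarrow> (('v, 'w) tens, 'x) tens" where
  "associator_inv V W X = (let T = (V \<boxtimes> W) \<boxtimes> X in
     tlift3 T (\<lambda>v w x. tlift3 T (\<lambda>a b c.
       pure (V \<boxtimes> W) X (pure V W (act V a v) (act W b w)) (act X c x)) \<phi>inv))"

text \<open>The sign depends on the degrees, so it is applied to the homogeneous components.\<close>

definition braiding ::
  "('k, 'h, 'v, 'p) hmod_scheme \<Rightarrow> ('k, 'h, 'w, 'q) hmod_scheme
    \<Rightarrow> ('v, 'w) tens \<Rightarrow> ('w, 'v) tens" where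
  "braiding V W = (let T = W \<boxtimes> V in
     tlift T (\<lambda>v w. \<Oplus>\<^bsub>T\<^esub>p\<in>degrees V \<times> degrees W.
       (let t = tlift T (\<lambda>a b. pure W V (act W b (hcomp W w (snd p))) (act V a (hcomp V v (fst p)))) \<R>
        in if even (fst p * snd p) then t else \<ominus>\<^bsub>T\<^esub> t)))"

text \<open>As the gradings are bounded, \<open>\<Oplus>\<^sub>n \<Oplus>\<^sub>l\<^sub>-\<^sub>m\<^sub>=\<^sub>n Hom(V\<^sub>m, W\<^sub>l)\<close> is the module of all K-linear maps
  \<open>V \<rightarrow> W\<close>, its part of degree \<open>n\<close> being formed by the maps that raise degrees by \<open>n\<close>. Linear maps are
  normalised to be \<open>undefined\<close> off the carrier. The ring fields \<open>mult\<close>, \<open>one\<close> play no role.\<close>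

definition ihom ::
  "('k, 'h, 'v, 'p) hmod_scheme \<Rightarrow> ('k, 'h, 'w, 'q) hmod_scheme \<Rightarrow> ('k, 'h, 'v \<Rightarrow> 'w) hmod" where
  "ihom V W = (let C = {L. klinear K V W L \<and> L \<in> extensional (carrier V)} in \<lparr>
     carrier = C,
     mult = undefined,
     one = undefined,
     zero = (\<lambda>v\<in>carrier V. \<zero>\<^bsub>W\<^esub>),
     add = (\<lambda>L L'. \<lambda>v\<in>carrier V. L v \<oplus>\<^bsub>W\<^esub> L' v),
     smult = (\<lambda>c L. \<lambda>v\<in>carrier V. c \<odot>\<^bsub>W\<^esub> L v),
     act = (\<lambda>h L. \<lambda>v\<in>carrier V. tlift W (\<lambda>a b. act W a (L (act V (S b) v))) (\<Delta> h)),
     gr = (\<lambda>n. {L \<in> C. \<forall>m. \<forall>v\<in>gr V m. L v \<in> gr W (m + n)}) \<rparr>)"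

definition zeta ::
  "('k, 'h, 'v, 'p) hmod_scheme \<Rightarrow> ('k, 'h, 'w, 'q) hmod_scheme \<Rightarrow> ('k, 'h, 'x, 'r) hmod_scheme
    \<Rightarrow> (('v, 'w) tens \<Rightarrow> 'x) \<Rightarrow> 'v \<Rightarrow> 'w \<Rightarrow> 'x" where
  "zeta V W X f v = (\<lambda>w\<in>carrier W.
     tlift3 X (\<lambda>a b c. f (pure V W (act V a v) (act W (b \<otimes>\<^bsub>H\<^esub> \<beta> \<otimes>\<^bsub>H\<^esub> S c) w))) \<phi>inv)"

definition zeta_inv ::
  "('k, 'h, 'w, 'q) hmod_scheme \<Rightarrow> ('k, 'h, 'x, 'r) hmod_scheme
    \<Rightarrow> ('v \<Rightarrow> 'w \<Rightarrow> 'x) \<Rightarrow> ('v, 'w) tens \<Rightarrow> 'x" where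
  "zeta_inv W X g =
     tlift X (\<lambda>v w. tlift3 X (\<lambda>a b c. act X a (g v (act W (S b \<otimes>\<^bsub>H\<^esub> \<alpha> \<otimes>\<^bsub>H\<^esub> c) w))) \<phi>)"

definition ev ::
  "('k, 'h, 'v, 'p) hmod_scheme \<Rightarrow> ('k, 'h, 'w, 'q) hmod_scheme \<Rightarrow> ('v \<Rightarrow> 'w, 'v) tens \<Rightarrow> 'w" where
  "ev V W = zeta_inv V W (\<lambda>L. L)"

definition icomp ::
  "('k, 'h, 'v, 'p) hmod_scheme \<Rightarrow> ('k, 'h, 'w, 'q) hmod_scheme \<Rightarrow> ('k, 'h, 'x, 'r) hmod_scheme
    \<Rightarrow> ('w \<Rightarrow> 'x, 'v \<Rightarrow> 'w) tens \<Rightarrow> 'v \<Rightarrow> 'x" where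
  "icomp V W X = zeta (ihom W X \<boxtimes> ihom V W) V X
     (ev W X \<circ> tmap (ihom W X) W (\<lambda>L. L) (ev V W) \<circ> associator (ihom W X) (ihom V W) V)"

definition end_alg :: "('k, 'h, 'v, 'p) hmod_scheme \<Rightarrow> ('k, 'h, 'v \<Rightarrow> 'v) halg" where
  "end_alg V = hmod.extend (ihom V V)
     (halg.fields (icomp V V V) (\<lambda>c. c \<odot>\<^bsub>ihom V V\<^esub> (\<lambda>v\<in>carrier V. act V \<beta> v)))"

text \<open>\<open>[L, L'] = L \<bullet> L' - (-1)\<^sup>|\<^sup>L\<^sup>|\<^sup>|\<^sup>L\<^sup>'\<^sup>| (R\<^sup>(\<^sup>2\<^sup>) \<triangleright> L') \<bullet> (R\<^sup>(\<^sup>1\<^sup>) \<triangleright> L)\<close>, as a map on \<open>end(V) \<otimes> end(V)\<close>.\<close>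

definition commutator ::
  "('k, 'h, 'v, 'p) hmod_scheme \<Rightarrow> ('v \<Rightarrow> 'v, 'v \<Rightarrow> 'v) tens \<Rightarrow> 'v \<Rightarrow> 'v" where
  "commutator V t = icomp V V V t \<ominus>\<^bsub>ihom V V\<^esub> icomp V V V (braiding (ihom V V) (ihom V V) t)"


section \<open>Algebras and bimodules\<close>

definition halgebra :: "('k, 'h, 'a, 'p) halg_scheme \<Rightarrow> bool" where
  "halgebra A \<longleftrightarrow> hmodule A \<and>
     hmorphism (A \<boxtimes> A) A (mu A) \<and> hmorphism unit_obj A (eta A) \<and>
     (\<forall>x\<in>carrier A. \<forall>y\<in>carrier A. \<forall>z\<in>carrier A.
        mu A (pure A A (mu A (pure A A x y)) z) =
        tlift3 A (\<lambda>a b c.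
          mu A (pure A A (act A a x) (mu A (pure A A (act A b y) (act A c z))))) \<phi>) \<and>
     (\<forall>x\<in>carrier A. mu A (pure A A (eta A \<one>\<^bsub>K\<^esub>) x) = x \<and> mu A (pure A A x (eta A \<one>\<^bsub>K\<^esub>)) = x)"

definition halg_morphism ::
  "('k, 'h, 'a, 'p) halg_scheme \<Rightarrow> ('k, 'h, 'b, 'q) halg_scheme \<Rightarrow> ('a \<Rightarrow> 'b) \<Rightarrow> bool" where
  "halg_morphism A B f \<longleftrightarrow> hmorphism A B f \<and>
     (\<forall>t\<in>carrier (A \<boxtimes> A). f (mu A t) = mu B (tmap B B f f t)) \<and>
     (\<forall>c\<in>carrier K. f (eta A c) = eta B c)"

definition braided_commutative :: "('k, 'h, 'a, 'p) halg_scheme \<Rightarrow> bool" where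
  "braided_commutative A \<longleftrightarrow> (\<forall>t\<in>carrier (A \<boxtimes> A). mu A (braiding A A t) = mu A t)"

definition hbimodule ::
  "('k, 'h, 'a, 'p) halg_scheme \<Rightarrow> ('k, 'h, 'a, 'v, 'q) hbimod_scheme \<Rightarrow> bool" where
  "hbimodule A V \<longleftrightarrow> hmodule V \<and>
     hmorphism (A \<boxtimes> V) V (lact V) \<and> hmorphism (V \<boxtimes> A) V (ract V) \<and>
     (\<forall>v\<in>carrier V. lact V (pure A V (eta A \<one>\<^bsub>K\<^esub>) v) = v \<and> ract V (pure V A v (eta A \<one>\<^bsub>K\<^esub>)) = v) \<and>
     (\<forall>x\<in>carrier A. \<forall>y\<in>carrier A. \<forall>v\<in>carrier V.
        lact V (pure A V (mu A (pure A A x y)) v) =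
        tlift3 V (\<lambda>a b c.
          lact V (pure A V (act A a x) (lact V (pure A V (act A b y) (act V c v))))) \<phi> \<and>
        ract V (pure V A (ract V (pure V A v x)) y) =
        tlift3 V (\<lambda>a b c.
          ract V (pure V A (act V a v) (mu A (pure A A (act A b x) (act A c y))))) \<phi> \<and>
        ract V (pure V A (lact V (pure A V x v)) y) =
        tlift3 V (\<lambda>a b c.
          lact V (pure A V (act A a x) (ract V (pure V A (act V b v) (act A c y))))) \<phi>)"

definition symmetric_bimodule ::
  "('k, 'h, 'a, 'p) halg_scheme \<Rightarrow> ('k, 'h, 'a, 'v, 'q) hbimod_scheme \<Rightarrow> bool" where
  "symmetric_bimodule A V \<longleftrightarrow> hbimodule A V \<and>
     (\<forall>t\<in>carrier (A \<boxtimes> V). ract V (braiding A V t) = lact V t) \<and>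
     (\<forall>t\<in>carrier (V \<boxtimes> A). lact V (braiding V A t) = ract V t)"


section \<open>Differential operators\<close>

text \<open>\<open>[L, a] = [L, \<zeta>(l)(a)]\<close>, as a map \<open>end(V) \<otimes> A \<rightarrow> end(V)\<close>.\<close>

definition commutator_alg ::
  "('k, 'h, 'a, 'p) halg_scheme \<Rightarrow> ('k, 'h, 'a, 'v, 'q) hbimod_scheme
    \<Rightarrow> ('v \<Rightarrow> 'v, 'a) tens \<Rightarrow> 'v \<Rightarrow> 'v" where
  "commutator_alg A V = commutator V \<circ> tmap (ihom V V) (ihom V V) (\<lambda>L. L) (zeta A V V (lact V))"

text \<open>\<open>rtensor A n\<close> is \<open>A \<otimes> (A \<otimes> (\<dots> \<otimes> A))\<close> with \<open>n + 1\<close> factors \<open>A\<close>, and \<open>ltensor E A n\<close> is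
  \<open>((E \<otimes> A) \<otimes> \<dots>) \<otimes> A\<close> with \<open>n\<close> factors \<open>A\<close>.\<close>

primrec rtensor :: "('k, 'h, 'a, 'p) hmod_scheme \<Rightarrow> nat \<Rightarrow> ('k, 'h, 'a rpow) hmod" where
  "rtensor A 0 = relabel RLeaf A"
| "rtensor A (Suc n) = relabel rnode (A \<boxtimes> rtensor A n)"

primrec ltensor ::
  "('k, 'h, 'e, 'p) hmod_scheme \<Rightarrow> ('k, 'h, 'a, 'q) hmod_scheme \<Rightarrow> nat
    \<Rightarrow> ('k, 'h, ('e, 'a) lpow) hmod" where
  "ltensor E A 0 = relabel LLeaf E"
| "ltensor E A (Suc n) = relabel lnode (ltensor E A n \<boxtimes> A)"

text \<open>\<open>rebracket E A n j\<close> is the composite of associators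
  \<open>ltensor E A j \<otimes> rtensor A n \<rightarrow> ltensor E A (j + n + 1)\<close>. For \<open>j = 0\<close> this is the isomorphism
  \<open>\<Phi>\<^sup>(\<^sup>-\<^sup>(\<^sup>n\<^sup>+\<^sup>1\<^sup>)\<^sup>)\<close>, up to the identification of \<open>E\<close> with \<open>ltensor E A 0\<close>.\<close>

primrec rebracket ::
  "('k, 'h, 'e, 'p) hmod_scheme \<Rightarrow> ('k, 'h, 'a, 'q) hmod_scheme \<Rightarrow> nat \<Rightarrow> nat
    \<Rightarrow> (('e, 'a) lpow, 'a rpow) tens \<Rightarrow> ('e, 'a) lpow" where
  "rebracket E A 0 j = lnode \<circ> tmap (ltensor E A j) A (\<lambda>x. x) (inv_into (carrier A) RLeaf)"
| "rebracket E A (Suc n) j =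
     rebracket E A n (Suc j) \<circ>
     tmap (ltensor E A (Suc j)) (rtensor A n) lnode (\<lambda>y. y) \<circ>
     associator_inv (ltensor E A j) A (rtensor A n) \<circ>
     tmap (ltensor E A j) (A \<boxtimes> rtensor A n) (\<lambda>x. x) (inv_into (carrier (A \<boxtimes> rtensor A n)) rnode)"

text \<open>\<open>(\<dots>(L \<otimes> a\<^sub>1) \<otimes> \<dots>) \<otimes> a\<^sub>n \<mapsto> [\<dots>[L, a\<^sub>1], \<dots>, a\<^sub>n]\<close>\<close>

primrec iter_commutator ::
  "('k, 'h, 'a, 'p) halg_scheme \<Rightarrow> ('k, 'h, 'a, 'v, 'q) hbimod_scheme \<Rightarrow> nat
    \<Rightarrow> ('v \<Rightarrow> 'v, 'a) lpow \<Rightarrow> 'v \<Rightarrow> 'v" where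
  "iter_commutator A V 0 = inv_into (carrier (ihom V V)) LLeaf"
| "iter_commutator A V (Suc n) =
     commutator_alg A V \<circ>
     tmap (ihom V V) A (iter_commutator A V n) (\<lambda>a. a) \<circ>
     inv_into (carrier (ltensor (ihom V V) A n \<boxtimes> A)) lnode"

definition diff_n ::
  "('k, 'h, 'a, 'p) halg_scheme \<Rightarrow> ('k, 'h, 'a, 'v, 'q) hbimod_scheme \<Rightarrow> nat \<Rightarrow> ('v \<Rightarrow> 'v) set" where
  "diff_n A V n = (let E = ihom V V; P = rtensor A n in
     {L \<in> carrier E.
        zeta E P E
          (iter_commutator A V (Suc n) \<circ> rebracket E A n 0 \<circ> tmap (ltensor E A 0) P LLeaf (\<lambda>y. y)) L
        = \<zero>\<^bsub>ihom P E\<^esub>})"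

text \<open>The structure that a subset \<open>D\<close> of \<open>E\<close> inherits from \<open>E\<close>. Its product is the restriction of the
  product of \<open>E\<close> along the map \<open>D \<otimes> D \<rightarrow> E \<otimes> E\<close> induced by the inclusion.\<close>

definition restrict_alg ::
  "('k, 'h, 'a, 'p) halg_scheme \<Rightarrow> 'a set \<Rightarrow> ('k, 'h, 'a) halg" where
  "restrict_alg E D = \<lparr>
     carrier = D, mult = mult E, one = one E, zero = zero E, add = add E, smult = smult E,
     act = act E,
     gr = (\<lambda>n. gr E n \<inter> D),
     mu = (\<lambda>t. mu E (tmap E E (\<lambda>x. x) (\<lambda>x. x) t)),
     eta = eta E \<rparr>"

definition diff_alg ::
  "('k, 'h, 'a, 'p) halg_scheme \<Rightarrow> ('k, 'h, 'a, 'v, 'q) hbimod_scheme \<Rightarrow> ('k, 'h, 'v \<Rightarrow> 'v) halg" where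
  "diff_alg A V = restrict_alg (end_alg V) (\<Union>n. diff_n A V n)"

text \<open>\<open>D\<close> is a subobject of \<open>E\<close> in the category of algebras, exhibited by an inclusion of carriers
  (being injective, a monomorphism).\<close>

definition alg_subobject ::
  "('k, 'h, 'a, 'p) halg_scheme \<Rightarrow> ('k, 'h, 'a, 'q) halg_scheme \<Rightarrow> bool" where
  "alg_subobject D E \<longleftrightarrow> halgebra D \<and> halgebra E \<and> carrier D \<subseteq> carrier E \<and>
     halg_morphism D E (\<lambda>x. x)"

end

end

theory Submission
  imports Defs
begin

text \<open>Tensor powers of \<open>H\<close> act from the right on multilinear maps by letting \<open>h \<otimes> k \<otimes> \<dots>\<close> act on the
  arguments, and every structure map is read as an identity between such actions. An element \<open>L\<close> of an
  internal hom is determined by its evaluations \<open>v \<mapsto> ev(L \<otimes> v)\<close>, so that associativity of \<open>\<bullet>\<close> and its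
  compatibility with the braiding become identities in tensor powers of \<open>H\<close>.

  Because the kernel of a curried map consists of those \<open>L\<close> for which the uncurried map vanishes on the
  whole \<open>H\<close>-orbit of \<open>L\<close>, and because rebracketing only moves actions of \<open>H\<close> around, \<open>diff\<^sup>n(V)\<close> consists of
  those \<open>L\<close> with \<open>[h \<triangleright> L, a] \<in> diff\<^sup>n\<^sup>-\<^sup>1(V)\<close> for all \<open>h\<close> and \<open>a\<close>. By the hexagon identity the bracket
  with \<open>a\<close> is a braided derivation of \<open>\<bullet>\<close>, and an induction gives
  \<open>diff\<^sup>n(V) \<bullet> diff\<^sup>m(V) \<subseteq> diff\<^sup>n\<^sup>+\<^sup>m(V)\<close>.\<close>

section \<open>Linear and bilinear maps\<close>

text \<open>What separates the quasi-Hopf case from the Hopf case is that (L, v) \<mapsto>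
  \<open>L v\<close> is in general not equivariant; only \<open>ap V W L v\<close>, dressed with
  \<phi>, S and \<alpha>, is. Moreover the inversion formula recovers \<open>L\<close> from the
  evaluations of \<open>act (ihom V W) h L\<close> for all \<open>h\<close>, since the first leg of
  \<open>\<phi>inv\<close> acts on \<open>L\<close>. Identities in an internal hom are therefore
  proved along a whole orbit, and equivariance is carried along with bilinearity. The axioms give a
  counit condition only for the middle leg of \<phi> and none for R. That \<phi> also acts trivially
  when an outer argument is invariant, and R when its first one is, has to be derived from the
  pentagon and from a hexagon, by cancelling an invertible operator. The derivation rule is never
  written out with its signs, R-matrices and associators. It is needed only modulo a submodule that
  contains the products with the bracket terms, where it becomes a chain of congruences, one for
  each factor of the hexagon.\<close>

named_theorems lin

definition bilin where
  "bilin K V W X f \<longleftrightarrow> (\<forall>w\<in>carrier W. klinear K V X (\<lambda>v. f v w)) \<and> (\<forall>v\<in>carrier V. klinear K W X (f v))"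

lemma klinearI:
  assumes "\<And>x. x \<in> carrier V \<Longrightarrow> f x \<in> carrier W"
    and "\<And>x y. x \<in> carrier V \<Longrightarrow> y \<in> carrier V \<Longrightarrow> f (x \<oplus>\<^bsub>V\<^esub> y) = f x \<oplus>\<^bsub>W\<^esub> f y"
    and "\<And>c x. c \<in> carrier K \<Longrightarrow> x \<in> carrier V \<Longrightarrow> f (c \<odot>\<^bsub>V\<^esub> x) = c \<odot>\<^bsub>W\<^esub> f x"
  shows "klinear K V W f"
  using assms unfolding klinear_def by auto

lemma klinear_closed: "klinear K V W f \<Longrightarrow> x \<in> carrier V \<Longrightarrow> f x \<in> carrier W"
  unfolding klinear_def by auto

lemma klinear_add:
  "klinear K V W f \<Longrightarrow> x \<in> carrier V \<Longrightarrow> y \<in> carrier V \<Longrightarrow> f (x \<oplus>\<^bsub>V\<^esub> y) = f x \<oplus>\<^bsub>W\<^esub> f y"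
  unfolding klinear_def by auto

lemma klinear_smult:
  "klinear K V W f \<Longrightarrow> c \<in> carrier K \<Longrightarrow> x \<in> carrier V \<Longrightarrow> f (c \<odot>\<^bsub>V\<^esub> x) = c \<odot>\<^bsub>W\<^esub> f x"
  unfolding klinear_def by auto

text \<open>Linearity of \<open>f\<close> also evaluates \<open>f\<close> at sums and multiples, so
  agreement on the carrier transfers it only because the carrier is closed under both. This is what
  the module hypothesis provides.\<close>

lemma klinear_cong:
  assumes "\<And>x. x \<in> carrier V \<Longrightarrow> f x = g x" "module K V"
  shows "klinear K V W f = klinear K V W g"
proof -
  interpret V: module K V by fact
  show ?thesis using assms(1) unfolding klinear_def by (auto simp: Pi_iff)
qed

lemma klinear_zero:
  assumes "module K V" "module K W" "klinear K V W f"
  shows "f \<zero>\<^bsub>V\<^esub> = \<zero>\<^bsub>W\<^esub>"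
proof -
  interpret V: module K V by fact
  interpret W: module K W by fact
  have "f (\<zero>\<^bsub>K\<^esub> \<odot>\<^bsub>V\<^esub> \<zero>\<^bsub>V\<^esub>) = \<zero>\<^bsub>K\<^esub> \<odot>\<^bsub>W\<^esub> f \<zero>\<^bsub>V\<^esub>"
    using klinear_smult[OF assms(3)] by blast
  then show ?thesis using klinear_closed[OF assms(3), of "\<zero>\<^bsub>V\<^esub>"] by simp
qed

lemma klinear_minus:
  assumes "module K V" "module K W" "klinear K V W f" "x \<in> carrier V"
  shows "f (\<ominus>\<^bsub>V\<^esub> x) = \<ominus>\<^bsub>W\<^esub> f x"
proof -
  interpret V: module K V by fact
  interpret W: module K W by fact
  have "f (\<ominus>\<^bsub>V\<^esub> x) \<oplus>\<^bsub>W\<^esub> f x = \<zero>\<^bsub>W\<^esub>"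
    using klinear_add[OF assms(3), of "\<ominus>\<^bsub>V\<^esub> x" x] assms(4) klinear_zero[OF assms(1-3)] by (simp add: V.l_neg)
  then show ?thesis using klinear_closed[OF assms(3)] assms(4) by (simp add: W.minus_equality)
qed

lemma klinear_id [lin]: "klinear K V V (\<lambda>x. x)"
  unfolding klinear_def by auto

lemma klinear_comp: "klinear K V W g \<Longrightarrow> klinear K U V f \<Longrightarrow> klinear K U W (\<lambda>x. g (f x))"
  unfolding klinear_def by (auto simp: Pi_iff)

lemma klinear_const_zero [lin]:
  assumes "module K W" shows "klinear K V W (\<lambda>x. \<zero>\<^bsub>W\<^esub>)"
proof -
  interpret W: module K W by fact
  show ?thesis unfolding klinear_def by auto
qed

lemma klinear_plus [lin]:
  assumes "module K W" "klinear K V W f" "klinear K V W g"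
  shows "klinear K V W (\<lambda>x. f x \<oplus>\<^bsub>W\<^esub> g x)"
proof -
  interpret W: module K W by fact
  show ?thesis
    using assms(2,3) unfolding klinear_def
    by (auto simp: Pi_iff W.add.m_ac W.smult_r_distr)
qed

lemma klinear_uminus [lin]:
  assumes "module K W" "klinear K V W f"
  shows "klinear K V W (\<lambda>x. \<ominus>\<^bsub>W\<^esub> f x)"
proof -
  interpret W: module K W by fact
  show ?thesis
    using assms(2) unfolding klinear_def
    by (auto simp: Pi_iff W.minus_add W.smult_r_minus)
qed

lemma klinear_minus2 [lin]:
  assumes "module K W" "klinear K V W f" "klinear K V W g"
  shows "klinear K V W (\<lambda>x. f x \<ominus>\<^bsub>W\<^esub> g x)"
  unfolding a_minus_def by (intro lin assms)

lemma klinear_smult_right [lin]: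
  assumes "module K W" "klinear K V W f" "c \<in> carrier K"
  shows "klinear K V W (\<lambda>x. c \<odot>\<^bsub>W\<^esub> f x)"
proof -
  interpret W: module K W by fact
  show ?thesis
    using assms(2,3) unfolding klinear_def
    by (auto simp: Pi_iff W.smult_r_distr W.smult_assoc1[symmetric] W.m_comm)
qed

lemma bilinI:
  assumes "\<And>w. w \<in> carrier W \<Longrightarrow> klinear K V X (\<lambda>v. f v w)"
    and "\<And>v. v \<in> carrier V \<Longrightarrow> klinear K W X (f v)"
  shows "bilin K V W X f"
  using assms unfolding bilin_def by auto

lemma bilin_left: "bilin K V W X f \<Longrightarrow> klinear K U V g \<Longrightarrow> w \<in> carrier W \<Longrightarrow> klinear K U X (\<lambda>u. f (g u) w)"
  unfolding bilin_def using klinear_comp[where g="\<lambda>v. f v w" and f=g] by blast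

lemma bilin_right: "bilin K V W X f \<Longrightarrow> v \<in> carrier V \<Longrightarrow> klinear K U W g \<Longrightarrow> klinear K U X (\<lambda>u. f v (g u))"
  unfolding bilin_def using klinear_comp by blast

lemma bilin_closed: "bilin K V W X f \<Longrightarrow> v \<in> carrier V \<Longrightarrow> w \<in> carrier W \<Longrightarrow> f v w \<in> carrier X"
  unfolding bilin_def klinear_def by blast

section \<open>The tensor product of two modules\<close>

lemma tens_eq_closed:
  assumes "tens_eq K V W xs ys" "module K V" "module K W"
  shows "set xs \<subseteq> carrier V \<times> carrier W \<and> set ys \<subseteq> carrier V \<times> carrier W"
proof -
  interpret V: module K V by fact
  interpret W: module K W by fact
  show ?thesis using assms(1) by induct auto
qed

lemma tclass_self: "set xs \<subseteq> carrier V \<times> carrier W \<Longrightarrow> xs \<in> tclass K V W xs"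
  unfolding tclass_def by (auto intro: tens_eq.refl)

lemma tclass_eqI: "tens_eq K V W xs ys \<Longrightarrow> tclass K V W xs = tclass K V W ys"
  unfolding tclass_def by (auto intro: tens_eq.trans tens_eq.sym)

text \<open>\<open>trep\<close> picks an arbitrary list of the class. That it is equivalent to
  \<open>xs\<close> is all that is ever known about it, and well-definedness of the operations on
  tensors rests on this.\<close>

lemma trep_tclass: "set xs \<subseteq> carrier V \<times> carrier W \<Longrightarrow> tens_eq K V W xs (trep (tclass K V W xs))"
  using someI[of "\<lambda>ys. ys \<in> tclass K V W xs", OF tclass_self]
  unfolding trep_def by (auto simp: tclass_def)

lemma tensor_carrier: "carrier (tensor K V W) = tclass K V W ` {xs. set xs \<subseteq> carrier V \<times> carrier W}"
  by (simp add: tensor_def)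

lemma tensor_rep:
  assumes "t \<in> carrier (tensor K V W)" "module K V" "module K W"
  shows "set (trep t) \<subseteq> carrier V \<times> carrier W" "tclass K V W (trep t) = t"
proof -
  obtain xs where xs: "set xs \<subseteq> carrier V \<times> carrier W" "t = tclass K V W xs"
    using assms(1) unfolding tensor_carrier by blast
  show "set (trep t) \<subseteq> carrier V \<times> carrier W"
    using tens_eq_closed[OF trep_tclass[OF xs(1)] assms(2,3)] unfolding xs(2) ..
  show "tclass K V W (trep t) = t"
    using tclass_eqI[OF trep_tclass[OF xs(1)]] unfolding xs(2) ..
qed

text \<open>The sum behind \<open>tlift\<close>, on an arbitrary list. Lists admit induction,
  whereas \<open>trep\<close> fixes one uncontrolled list per class.\<close>

definition lsum where
  "lsum X f xs = foldr (\<lambda>(v, w) x. f v w \<oplus>\<^bsub>X\<^esub> x) xs \<zero>\<^bsub>X\<^esub>"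

lemma lsum_Nil [simp]: "lsum X f [] = \<zero>\<^bsub>X\<^esub>"
  by (simp add: lsum_def)

lemma lsum_Cons [simp]: "lsum X f ((v, w) # xs) = f v w \<oplus>\<^bsub>X\<^esub> lsum X f xs"
  by (simp add: lsum_def)

lemma tlift_lsum: "tlift X f t = lsum X f (trep t)"
  by (simp add: tlift_def lsum_def)

lemma lsum_closed:
  assumes "abelian_monoid X" "\<And>v w. (v, w) \<in> set xs \<Longrightarrow> f v w \<in> carrier X"
  shows "lsum X f xs \<in> carrier X"
proof -
  interpret X: abelian_monoid X by fact
  show ?thesis using assms(2) by (induct xs) auto
qed

lemma lsum_append:
  assumes "abelian_monoid X" "\<And>v w. (v, w) \<in> set xs \<union> set ys \<Longrightarrow> f v w \<in> carrier X"
  shows "lsum X f (xs @ ys) = lsum X f xs \<oplus>\<^bsub>X\<^esub> lsum X f ys"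
proof -
  interpret X: abelian_monoid X by fact
  show ?thesis using assms(2)
    by (induct xs) (auto simp: lsum_closed[OF assms(1)] X.add.m_assoc)
qed

lemma module_abelian_monoid: "module K X \<Longrightarrow> abelian_monoid X"
  by (simp add: module.axioms(2) abelian_group.axioms(1))

text \<open>A bilinear \<open>f\<close> respects each generating relation of \<open>tens_eq\<close>,
  and the remaining rules only close up under equivalence and concatenation. This is what makes
  \<open>tlift X f\<close> computable from any representative.\<close>

lemma lsum_tens_eq:
  assumes "tens_eq K V W xs ys" "module K V" "module K W" "module K X" "bilin K V W X f"
  shows "lsum X f xs = lsum X f ys"
proof -
  interpret V: module K V by fact
  interpret W: module K W by fact
  interpret X: module K X by fact
  have c: "f v w \<in> carrier X" if "v \<in> carrier V" "w \<in> carrier W" for v w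
    using that bilin_closed[OF assms(5)] by blast
  have l: "klinear K V X (\<lambda>v. f v w)" if "w \<in> carrier W" for w
    using that assms(5) unfolding bilin_def by blast
  have r: "klinear K W X (f v)" if "v \<in> carrier V" for v
    using that assms(5) unfolding bilin_def by blast
  show ?thesis using assms(1)
  proof induct
    case (append xs ys us vs)
    have "lsum X f (xs @ us) = lsum X f xs \<oplus>\<^bsub>X\<^esub> lsum X f us"
      "lsum X f (ys @ vs) = lsum X f ys \<oplus>\<^bsub>X\<^esub> lsum X f vs"
      using tens_eq_closed[OF append(1) assms(2,3)] tens_eq_closed[OF append(3) assms(2,3)]
      by (auto intro!: c lsum_append[OF X.abelian_monoid_axioms])
    then show ?case using append by simp
  next
    case (swap v w v' w')
    then show ?case by (simp add: c X.add.m_ac)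
  next
    case (zero w)
    then show ?case using klinear_zero[OF assms(2,4) l] by (simp add: c)
  next
    case (add_left v v' w)
    then show ?case using klinear_add[OF l] by (simp add: c X.add.m_ac)
  next
    case (add_right v w w')
    then show ?case using klinear_add[OF r] by (simp add: c X.add.m_ac)
  next
    case (smult a v w)
    then show ?case using klinear_smult[OF l] klinear_smult[OF r] by (simp add: c)
  qed auto
qed

lemma tlift_tclass:
  assumes "set xs \<subseteq> carrier V \<times> carrier W" "module K V" "module K W" "module K X" "bilin K V W X f"
  shows "tlift X f (tclass K V W xs) = lsum X f xs"
  unfolding tlift_lsum using lsum_tens_eq[OF trep_tclass[OF assms(1)] assms(2-)] by simp

text \<open>The rule \<open>swap\<close> exchanges two one-term sums. Since \<open>append\<close> is
  a congruence, one pair can be moved past a list, and then a list past a list.\<close>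

lemma tens_eq_comm:
  assumes "set xs \<subseteq> carrier V \<times> carrier W" "set ys \<subseteq> carrier V \<times> carrier W"
  shows "tens_eq K V W (xs @ ys) (ys @ xs)"
proof -
  have 1: "tens_eq K V W ([p] @ ys) (ys @ [p])"
    if "p \<in> carrier V \<times> carrier W" "set ys \<subseteq> carrier V \<times> carrier W" for p ys
    using that(2)
  proof (induct ys)
    case Nil
    then show ?case using that(1) by (auto intro: tens_eq.refl)
  next
    case (Cons q ys)
    have a: "tens_eq K V W ([p, q] @ ys) ([q, p] @ ys)"
      using Cons that(1) by (cases p, cases q, intro tens_eq.append[OF _ tens_eq.refl]) (auto intro: tens_eq.swap)
    have "tens_eq K V W ([q] @ ([p] @ ys)) ([q] @ (ys @ [p]))"
      using Cons by (intro tens_eq.append[OF tens_eq.refl]) auto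
    then show ?case using a by (auto intro: tens_eq.trans)
  qed
  show ?thesis using assms(1)
  proof (induct xs)
    case Nil
    then show ?case using assms(2) by (auto intro: tens_eq.refl)
  next
    case (Cons p xs)
    have a: "tens_eq K V W ([p] @ (xs @ ys)) ([p] @ (ys @ xs))"
      using Cons by (intro tens_eq.append[OF tens_eq.refl]) auto
    have "tens_eq K V W (([p] @ ys) @ xs) ((ys @ [p]) @ xs)"
      using Cons assms(2) by (intro tens_eq.append[OF 1 tens_eq.refl]) auto
    then show ?case using a by (auto intro: tens_eq.trans)
  qed
qed

lemma tensor_zero: "\<zero>\<^bsub>tensor K V W\<^esub> = tclass K V W []"
  by (simp add: tensor_def)

lemma tensor_add:
  assumes "set xs \<subseteq> carrier V \<times> carrier W" "set ys \<subseteq> carrier V \<times> carrier W"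
  shows "tclass K V W xs \<oplus>\<^bsub>tensor K V W\<^esub> tclass K V W ys = tclass K V W (xs @ ys)"
  by (simp add: tensor_def)
    (meson assms tclass_eqI tens_eq.append tens_eq.sym trep_tclass)

lemma tens_eq_smult:
  assumes "tens_eq K V W xs ys" "module K V" "module K W" "c \<in> carrier K"
  shows "tens_eq K V W (map (\<lambda>(v, w). (c \<odot>\<^bsub>V\<^esub> v, w)) xs) (map (\<lambda>(v, w). (c \<odot>\<^bsub>V\<^esub> v, w)) ys)"
proof -
  interpret V: module K V by fact
  interpret W: module K W by fact
  show ?thesis using assms(1)
  proof induct
    case (refl xs)
    then show ?case using assms(4) by (intro tens_eq.refl) auto
  next
    case (sym xs ys)
    then show ?case using tens_eq.sym by blast
  next
    case (trans xs ys zs)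
    then show ?case using tens_eq.trans by blast
  next
    case (append xs ys us vs)
    then show ?case by (simp add: tens_eq.append)
  next
    case (swap v w v' w')
    then show ?case using assms(4) by (auto intro!: tens_eq.swap)
  next
    case (zero w)
    then show ?case using assms(4) by (auto intro!: tens_eq.zero)
  next
    case (add_left v v' w)
    then show ?case using assms(4) by (auto simp: V.smult_r_distr intro!: tens_eq.add_left)
  next
    case (add_right v w w')
    then show ?case using assms(4) by (auto intro!: tens_eq.add_right)
  next
    case (smult a v w)
    have "c \<odot>\<^bsub>V\<^esub> (a \<odot>\<^bsub>V\<^esub> v) = a \<odot>\<^bsub>V\<^esub> (c \<odot>\<^bsub>V\<^esub> v)"
      using smult assms(4) by (simp add: V.smult_assoc1[symmetric] V.m_comm)
    then show ?case using assms(4) smult by (auto intro!: tens_eq.smult)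
  qed
qed

lemma tensor_smult:
  assumes "set xs \<subseteq> carrier V \<times> carrier W" "module K V" "module K W" "c \<in> carrier K"
  shows "c \<odot>\<^bsub>tensor K V W\<^esub> tclass K V W xs = tclass K V W (map (\<lambda>(v, w). (c \<odot>\<^bsub>V\<^esub> v, w)) xs)"
  using tclass_eqI[OF tens_eq_smult[OF trep_tclass[OF assms(1)] assms(2-)]]
  by (simp add: tensor_def)

lemma tensor_module:
  assumes "module K V" "module K W"
  shows "module K (tensor K V W)"
proof -
  interpret V: module K V by fact
  interpret W: module K W by fact
  let ?T = "tensor K V W" and ?C = "carrier V \<times> carrier W"
  note ta = tensor_add[where K=K and V=V and W=W]
    and ts = tensor_smult[OF _ assms]
  have C: "\<exists>xs. set xs \<subseteq> ?C \<and> t = tclass K V W xs" if "t \<in> carrier ?T" for t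
    using that by (auto simp: tensor_carrier)
  have I: "tclass K V W xs \<in> carrier ?T" if "set xs \<subseteq> ?C" for xs
    using that by (auto simp: tensor_carrier)
  \<comment> \<open>Additive inverses: negate the left entries. Each (-v, w) and (v, w) combine to
    (0, w), which is equivalent to the empty sum.\<close>
  have neg: "tens_eq K V W (map (\<lambda>(v, w). (\<ominus>\<^bsub>V\<^esub> v, w)) xs @ xs) []" if "set xs \<subseteq> ?C" for xs
    using that
  proof (induct xs)
    case Nil
    then show ?case by (auto intro: tens_eq.refl)
  next
    case (Cons p xs)
    obtain v w where p: "p = (v, w)" and vw: "v \<in> carrier V" "w \<in> carrier W" using Cons(2) by (cases p) auto
    let ?n = "map (\<lambda>(v, w). (\<ominus>\<^bsub>V\<^esub> v, w)) xs"
    have n: "set ?n \<subseteq> ?C" using Cons(2) by auto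
    have "tens_eq K V W [(\<ominus>\<^bsub>V\<^esub> v, w), (v, w)] [(\<ominus>\<^bsub>V\<^esub> v \<oplus>\<^bsub>V\<^esub> v, w)]"
      using vw by (intro tens_eq.sym[OF tens_eq.add_left]) auto
    then have 1: "tens_eq K V W [(\<ominus>\<^bsub>V\<^esub> v, w), (v, w)] []"
      using vw by (metis V.l_neg tens_eq.trans tens_eq.zero)
    \<comment> \<open>The new pair stands behind the negated tail, so it is first moved next to its
      own negative.\<close>
    have "tens_eq K V W ([(\<ominus>\<^bsub>V\<^esub> v, w)] @ (?n @ [(v, w)]) @ xs) ([(\<ominus>\<^bsub>V\<^esub> v, w)] @ ([(v, w)] @ ?n) @ xs)"
      using vw n Cons(2) by (intro tens_eq.append tens_eq_comm) (auto intro: tens_eq.refl)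
    moreover have "tens_eq K V W ([(\<ominus>\<^bsub>V\<^esub> v, w), (v, w)] @ (?n @ xs)) ([] @ [])"
      using 1 Cons by (intro tens_eq.append) auto
    ultimately show ?case using p tens_eq.trans by fastforce
  qed
  have ag: "abelian_group ?T"
  proof (rule abelian_groupI)
    fix x y z assume "x \<in> carrier ?T" "y \<in> carrier ?T" "z \<in> carrier ?T"
    then obtain xs ys zs where *: "set xs \<subseteq> ?C" "x = tclass K V W xs" "set ys \<subseteq> ?C" "y = tclass K V W ys"
      "set zs \<subseteq> ?C" "z = tclass K V W zs" using C by meson
    then show "x \<oplus>\<^bsub>?T\<^esub> y \<oplus>\<^bsub>?T\<^esub> z = x \<oplus>\<^bsub>?T\<^esub> (y \<oplus>\<^bsub>?T\<^esub> z)" by (simp add: ta)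
  next
    fix x y assume "x \<in> carrier ?T" "y \<in> carrier ?T"
    then obtain xs ys where *: "set xs \<subseteq> ?C" "x = tclass K V W xs" "set ys \<subseteq> ?C" "y = tclass K V W ys"
      using C by meson
    then show "x \<oplus>\<^bsub>?T\<^esub> y \<in> carrier ?T" by (simp add: ta I)
    show "x \<oplus>\<^bsub>?T\<^esub> y = y \<oplus>\<^bsub>?T\<^esub> x" using * by (simp add: ta tclass_eqI[OF tens_eq_comm])
  next
    show "\<zero>\<^bsub>?T\<^esub> \<in> carrier ?T" by (simp add: tensor_zero I)
  next
    fix x assume "x \<in> carrier ?T"
    then obtain xs where *: "set xs \<subseteq> ?C" "x = tclass K V W xs" using C by meson
    then show "\<zero>\<^bsub>?T\<^esub> \<oplus>\<^bsub>?T\<^esub> x = x" by (simp add: tensor_zero ta)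
    let ?n = "map (\<lambda>(v, w). (\<ominus>\<^bsub>V\<^esub> v, w)) xs"
    have n: "set ?n \<subseteq> ?C" using * by auto
    show "\<exists>y\<in>carrier ?T. y \<oplus>\<^bsub>?T\<^esub> x = \<zero>\<^bsub>?T\<^esub>"
      using * n by (intro bexI[of _ "tclass K V W ?n"]) (auto simp: tensor_zero ta I intro!: tclass_eqI neg)
  qed
  interpret T: abelian_group ?T by (fact ag)
  show ?thesis
  proof (rule moduleI[OF V.is_cring ag])
    fix a x assume a: "a \<in> carrier K" and "x \<in> carrier ?T"
    then obtain xs where *: "set xs \<subseteq> ?C" "x = tclass K V W xs" using C by meson
    then show "a \<odot>\<^bsub>?T\<^esub> x \<in> carrier ?T" using a by (force simp: ts intro!: I)
    fix b assume b: "b \<in> carrier K"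
    have 1: "set (map (\<lambda>(v, w). (c \<odot>\<^bsub>V\<^esub> v, w)) ys) \<subseteq> ?C" if "set ys \<subseteq> ?C" "c \<in> carrier K" for ys c
      using that by auto
    show "(a \<otimes>\<^bsub>K\<^esub> b) \<odot>\<^bsub>?T\<^esub> x = a \<odot>\<^bsub>?T\<^esub> (b \<odot>\<^bsub>?T\<^esub> x)"
      using * a b 1 by (force simp: ts V.smult_assoc1 comp_def case_prod_beta intro!: arg_cong[where f="tclass K V W"])
    \<comment> \<open>Scalars act on the left entries, so this is the relation
      \<open>add_left\<close>, used once for each entry of the list.\<close>
    show "(a \<oplus>\<^bsub>K\<^esub> b) \<odot>\<^bsub>?T\<^esub> x = a \<odot>\<^bsub>?T\<^esub> x \<oplus>\<^bsub>?T\<^esub> b \<odot>\<^bsub>?T\<^esub> x"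
      unfolding *(2) using *(1)
    proof (induct xs)
      case Nil
      then show ?case using a b by (simp add: ts ta)
    next
      case (Cons p xs)
      obtain v w where p: "p = (v, w)" and vw: "v \<in> carrier V" "w \<in> carrier W" using Cons(2) by (cases p) auto
      have e: "tclass K V W (p # xs) = tclass K V W [p] \<oplus>\<^bsub>?T\<^esub> tclass K V W xs"
        using Cons by (simp add: ta)
      have s: "c \<odot>\<^bsub>?T\<^esub> (tclass K V W [p] \<oplus>\<^bsub>?T\<^esub> tclass K V W xs) = c \<odot>\<^bsub>?T\<^esub> tclass K V W [p] \<oplus>\<^bsub>?T\<^esub> c \<odot>\<^bsub>?T\<^esub> tclass K V W xs"
        and cl: "c \<odot>\<^bsub>?T\<^esub> tclass K V W [p] \<in> carrier ?T" "c \<odot>\<^bsub>?T\<^esub> tclass K V W xs \<in> carrier ?T"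
        if "c \<in> carrier K" for c
        using Cons(2) that 1[of "[p]" c] 1[of xs c] by (auto simp add: ts ta I)
      have q: "tclass K V W [((a \<oplus>\<^bsub>K\<^esub> b) \<odot>\<^bsub>V\<^esub> v, w)] = tclass K V W [(a \<odot>\<^bsub>V\<^esub> v, w), (b \<odot>\<^bsub>V\<^esub> v, w)]"
        using vw a b by (simp add: V.smult_l_distr tclass_eqI[OF tens_eq.add_left])
      have "(a \<oplus>\<^bsub>K\<^esub> b) \<odot>\<^bsub>?T\<^esub> tclass K V W [p] = a \<odot>\<^bsub>?T\<^esub> tclass K V W [p] \<oplus>\<^bsub>?T\<^esub> b \<odot>\<^bsub>?T\<^esub> tclass K V W [p]"
        using p vw a b q by (simp add: ts ta)
      then show ?case using Cons a b by (simp add: e s cl T.add.m_ac)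
    qed
  next
    fix a x y assume a: "a \<in> carrier K" and "x \<in> carrier ?T" "y \<in> carrier ?T"
    then obtain xs ys where *: "set xs \<subseteq> ?C" "x = tclass K V W xs" "set ys \<subseteq> ?C" "y = tclass K V W ys"
      using C by meson
    have 1: "set (map (\<lambda>(v, w). (a \<odot>\<^bsub>V\<^esub> v, w)) ys) \<subseteq> ?C" if "set ys \<subseteq> ?C" for ys
      using that a by auto
    then show "a \<odot>\<^bsub>?T\<^esub> (x \<oplus>\<^bsub>?T\<^esub> y) = a \<odot>\<^bsub>?T\<^esub> x \<oplus>\<^bsub>?T\<^esub> a \<odot>\<^bsub>?T\<^esub> y"
      using * a by (simp add: ts ta)
  next
    fix x assume "x \<in> carrier ?T"
    then obtain xs where *: "set xs \<subseteq> ?C" "x = tclass K V W xs" using C by meson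
    have "map (\<lambda>(v, w). (\<one>\<^bsub>K\<^esub> \<odot>\<^bsub>V\<^esub> v, w)) xs = xs" using *(1) by (intro map_idI) auto
    then show "\<one>\<^bsub>K\<^esub> \<odot>\<^bsub>?T\<^esub> x = x" using * by (simp add: ts)
  qed
qed

lemma pure_closed: "v \<in> carrier V \<Longrightarrow> w \<in> carrier W \<Longrightarrow> tclass K V W [(v, w)] \<in> carrier (tensor K V W)"
  by (auto simp: tensor_carrier)

lemma pure_bilin:
  assumes "module K V" "module K W"
  shows "bilin K V W (tensor K V W) (\<lambda>v w. tclass K V W [(v, w)])"
proof -
  interpret V: module K V by fact
  interpret W: module K W by fact
  show ?thesis
    unfolding bilin_def klinear_def
    by (auto simp: pure_closed tensor_add tensor_smult[OF _ assms] intro!: tclass_eqI intro: tens_eq.add_left tens_eq.add_right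
        tens_eq.sym[OF tens_eq.smult])
qed

lemma tlift_pure:
  assumes "module K V" "module K W" "module K X" "bilin K V W X f" "v \<in> carrier V" "w \<in> carrier W"
  shows "tlift X f (tclass K V W [(v, w)]) = f v w"
proof -
  interpret X: module K X by fact
  show ?thesis
    using assms by (subst tlift_tclass[OF _ assms(1-4)]) (auto simp: bilin_closed[OF assms(4)])
qed

lemma lsum_linear:
  assumes "module K X" "module K Y" "klinear K X Y g" "\<And>v w. (v, w) \<in> set xs \<Longrightarrow> f v w \<in> carrier X"
  shows "g (lsum X f xs) = lsum Y (\<lambda>v w. g (f v w)) xs"
  using assms(4)
proof (induct xs)
  case Nil
  then show ?case using klinear_zero[OF assms(1-3)] by simp
next
  case (Cons p xs)
  obtain v w where p: "p = (v, w)" by (cases p)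
  have "lsum X f xs \<in> carrier X" using Cons by (intro lsum_closed module_abelian_monoid[OF assms(1)]) auto
  then show ?case using Cons p klinear_add[OF assms(3)] by simp
qed

lemma lsum_pure:
  assumes "set xs \<subseteq> carrier V \<times> carrier W" "module K V" "module K W"
  shows "lsum (tensor K V W) (\<lambda>v w. tclass K V W [(v, w)]) xs = tclass K V W xs"
  using assms(1)
proof (induct xs)
  case Nil
  then show ?case by (simp add: tensor_zero)
next
  case (Cons p xs)
  then show ?case by (cases p) (simp add: tensor_add)
qed

text \<open>The universal property of the tensor product. It is stated for a linear argument
  \<open>g\<close> instead of the identity so that it can serve as an introduction rule for
  composite terms.\<close>

lemma klinear_tlift:
  assumes "module K V" "module K W" "module K X" "bilin K V W X f" "klinear K U (tensor K V W) g"
  shows "klinear K U X (\<lambda>u. tlift X f (g u))"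
proof -
  interpret V: module K V by fact
  interpret W: module K W by fact
  interpret X: module K X by fact
  note l = tlift_tclass[OF _ assms(1-4)]
  have c: "f v w \<in> carrier X" if "v \<in> carrier V" "w \<in> carrier W" for v w
    using that bilin_closed[OF assms(4)] by blast
  have "klinear K (tensor K V W) X (tlift X f)"
  proof (rule klinearI)
    fix x assume "x \<in> carrier (tensor K V W)"
    then obtain xs where *: "set xs \<subseteq> carrier V \<times> carrier W" and x: "x = tclass K V W xs"
      by (auto simp: tensor_carrier)
    show "tlift X f x \<in> carrier X" unfolding x l[OF *] using * by (auto intro!: lsum_closed c X.abelian_monoid_axioms)
    fix y assume "y \<in> carrier (tensor K V W)"
    then obtain ys where **: "set ys \<subseteq> carrier V \<times> carrier W" and y: "y = tclass K V W ys"
      by (auto simp: tensor_carrier)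
    have "set (xs @ ys) \<subseteq> carrier V \<times> carrier W" using * ** by simp
    then show "tlift X f (x \<oplus>\<^bsub>tensor K V W\<^esub> y) = tlift X f x \<oplus>\<^bsub>X\<^esub> tlift X f y"
      using * ** unfolding x y tensor_add[OF * **] l[OF *] l[OF **]
      by (subst l) (auto intro!: lsum_append c X.abelian_monoid_axioms)
  next
    fix x a assume "x \<in> carrier (tensor K V W)" and a: "a \<in> carrier K"
    then obtain xs where *: "set xs \<subseteq> carrier V \<times> carrier W" and x: "x = tclass K V W xs"
      by (auto simp: tensor_carrier)
    have s: "lsum X f (map (\<lambda>(v, w). (a \<odot>\<^bsub>V\<^esub> v, w)) xs) = a \<odot>\<^bsub>X\<^esub> lsum X f xs" using *
    proof (induct xs)
      case Nil
      then show ?case using a by simp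
    next
      case (Cons p xs)
      obtain v w where p: "p = (v, w)" and vw: "v \<in> carrier V" "w \<in> carrier W" using Cons(2) by (cases p) auto
      have "lsum X f xs \<in> carrier X" using Cons(2) by (auto intro!: lsum_closed c X.abelian_monoid_axioms)
      then show ?case using Cons p vw a assms(4)
        by (auto simp: c X.smult_r_distr bilin_def klinear_def)
    qed
    have "set (map (\<lambda>(v, w). (a \<odot>\<^bsub>V\<^esub> v, w)) xs) \<subseteq> carrier V \<times> carrier W" using * a by auto
    then show "tlift X f (a \<odot>\<^bsub>tensor K V W\<^esub> x) = a \<odot>\<^bsub>X\<^esub> tlift X f x"
      unfolding x l[OF *] tensor_smult[OF * assms(1,2) a] by (simp add: l s)
  qed
  then show ?thesis using assms(5) klinear_comp[where f=g and g="tlift X f"] by blast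
qed

text \<open>Pure tensors generate the tensor product. Identities between linear maps on tensors are
  reduced to pure tensors by this rule.\<close>

lemma tensor_ext:
  assumes "module K V" "module K W" "module K X"
    and "klinear K (tensor K V W) X f" "klinear K (tensor K V W) X g"
    and "\<And>v w. v \<in> carrier V \<Longrightarrow> w \<in> carrier W \<Longrightarrow> f (tclass K V W [(v, w)]) = g (tclass K V W [(v, w)])"
    and "t \<in> carrier (tensor K V W)"
  shows "f t = g t"
proof -
  note T = tensor_module[OF assms(1,2)]
  obtain xs where xs: "set xs \<subseteq> carrier V \<times> carrier W" "t = tclass K V W xs"
    using assms(7) by (auto simp: tensor_carrier)
  have t: "t = lsum (tensor K V W) (\<lambda>v w. tclass K V W [(v, w)]) xs"
    using lsum_pure[OF xs(1) assms(1,2)] xs(2) by simp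
  have c: "\<And>v w. (v, w) \<in> set xs \<Longrightarrow> tclass K V W [(v, w)] \<in> carrier (tensor K V W)"
    using xs(1) by (auto intro!: pure_closed)
  have "lsum X (\<lambda>v w. f (tclass K V W [(v, w)])) xs = lsum X (\<lambda>v w. g (tclass K V W [(v, w)])) xs"
    using xs(1) assms(6) by (induct xs) auto
  then show ?thesis
    unfolding t by (simp add: lsum_linear[OF T assms(3,4) c] lsum_linear[OF T assms(3,5) c])
qed

lemma tlift_closed:
  assumes "module K V" "module K W" "module K X" "t \<in> carrier (tensor K V W)"
    "\<And>v w. v \<in> carrier V \<Longrightarrow> w \<in> carrier W \<Longrightarrow> f v w \<in> carrier X"
  shows "tlift X f t \<in> carrier X"
  unfolding tlift_lsum using tensor_rep[OF assms(4,1,2)] assms(5)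
  by (intro lsum_closed[OF module_abelian_monoid[OF assms(3)]]) auto

lemma lsum_cong: "(\<And>v w. (v, w) \<in> set xs \<Longrightarrow> f v w = g v w) \<Longrightarrow> lsum X f xs = lsum X g xs"
  by (induct xs) auto

lemma tlift_cong:
  assumes "module K V" "module K W" "t \<in> carrier (tensor K V W)"
    "\<And>v w. v \<in> carrier V \<Longrightarrow> w \<in> carrier W \<Longrightarrow> f v w = g v w"
  shows "tlift X f t = tlift X g t"
  unfolding tlift_lsum using tensor_rep[OF assms(3,1,2)] assms(4)
  by (intro lsum_cong) auto

lemma tlift_linear:
  assumes "module K V" "module K W" "module K X" "module K Y" "t \<in> carrier (tensor K V W)"
    "klinear K X Y g" "\<And>v w. v \<in> carrier V \<Longrightarrow> w \<in> carrier W \<Longrightarrow> f v w \<in> carrier X"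
  shows "g (tlift X f t) = tlift Y (\<lambda>v w. g (f v w)) t"
  unfolding tlift_lsum using tensor_rep[OF assms(5,1,2)] assms(7)
  by (intro lsum_linear[OF assms(3,4,6)]) auto

lemma klinear_lsum:
  assumes "module K X" "\<And>v w. (v, w) \<in> set xs \<Longrightarrow> klinear K U X (\<lambda>u. f u v w)"
  shows "klinear K U X (\<lambda>u. lsum X (f u) xs)"
  using assms(2)
proof (induct xs)
  case Nil
  then show ?case by (simp add: klinear_const_zero assms(1))
next
  case (Cons p xs)
  then show ?case by (cases p) (simp add: klinear_plus assms(1))
qed

text \<open>Complementary to \<open>klinear_tlift\<close>: the tensor is fixed and the integrand
  varies. The chosen representative is then fixed too, so no linearity in the summation variables is
  required.\<close>

lemma klinear_tlift_param:
  assumes "module K V" "module K W" "module K X" "t \<in> carrier (tensor K V W)"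
    "\<And>v w. v \<in> carrier V \<Longrightarrow> w \<in> carrier W \<Longrightarrow> klinear K U X (\<lambda>u. f u v w)"
  shows "klinear K U X (\<lambda>u. tlift X (f u) t)"
  unfolding tlift_lsum using tensor_rep[OF assms(4,1,2)] assms(5)
  by (intro klinear_lsum[OF assms(3)]) auto

lemma tlift_self:
  assumes "module K V" "module K W" "t \<in> carrier (tensor K V W)"
  shows "tlift (tensor K V W) (\<lambda>v w. tclass K V W [(v, w)]) t = t"
  unfolding tlift_lsum using tensor_rep[OF assms(3,1,2)] lsum_pure[OF _ assms(1,2)] by simp

lemma lsum_zero:
  assumes "abelian_monoid X" shows "lsum X (\<lambda>c d. \<zero>\<^bsub>X\<^esub>) ys = \<zero>\<^bsub>X\<^esub>"
proof -
  interpret X: abelian_monoid X by fact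
  show ?thesis by (induct ys) auto
qed

lemma lsum_add:
  assumes "abelian_monoid X" "\<And>c d. (c, d) \<in> set ys \<Longrightarrow> f c d \<in> carrier X \<and> g c d \<in> carrier X"
  shows "lsum X (\<lambda>c d. f c d \<oplus>\<^bsub>X\<^esub> g c d) ys = lsum X f ys \<oplus>\<^bsub>X\<^esub> lsum X g ys"
proof -
  interpret X: abelian_monoid X by fact
  show ?thesis
    using assms(2) by (induct ys) (auto simp: X.add.m_ac lsum_closed[OF assms(1)])
qed

text \<open>Both sides are double sums over the two fixed representatives, so they may be
  interchanged without any linearity of \<open>f\<close>.\<close>

lemma tlift_commute:
  assumes "module K V" "module K W" "module K V'" "module K W'" "module K X"
    "t \<in> carrier (tensor K V W)" "s \<in> carrier (tensor K V' W')"
    "\<And>a b c d. a \<in> carrier V \<Longrightarrow> b \<in> carrier W \<Longrightarrow> c \<in> carrier V' \<Longrightarrow> d \<in> carrier W' \<Longrightarrow> f a b c d \<in> carrier X"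
  shows "tlift X (\<lambda>a b. tlift X (f a b) s) t = tlift X (\<lambda>c d. tlift X (\<lambda>a b. f a b c d) t) s"
proof -
  interpret X: module K X by fact
  have "lsum X (\<lambda>a b. lsum X (f a b) ys) xs = lsum X (\<lambda>c d. lsum X (\<lambda>a b. f a b c d) xs) ys"
    if "set xs \<subseteq> carrier V \<times> carrier W" "set ys \<subseteq> carrier V' \<times> carrier W'" for xs ys
    using that(1)
  proof (induct xs)
    case Nil
    then show ?case by (simp add: lsum_zero[OF X.abelian_monoid_axioms])
  next
    case (Cons q xs)
    obtain v w where q: "q = (v, w)" by (cases q)
    have "lsum X (\<lambda>c d. lsum X (\<lambda>a b. f a b c d) (q # xs)) ys
        = lsum X (f v w) ys \<oplus>\<^bsub>X\<^esub> lsum X (\<lambda>c d. lsum X (\<lambda>a b. f a b c d) xs) ys"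
      unfolding q using Cons(2) that(2) q
        lsum_add[OF X.abelian_monoid_axioms, of ys "f v w" "\<lambda>c d. lsum X (\<lambda>a b. f a b c d) xs"]
      by (force intro!: assms(8) lsum_closed[OF X.abelian_monoid_axioms])
    then show ?case using Cons q by simp
  qed
  then show ?thesis
    unfolding tlift_lsum using tensor_rep[OF assms(6,1,2)] tensor_rep[OF assms(7,3,4)] by blast
qed

section \<open>Multilinear maps on iterated tensor products\<close>

definition trilin where
  "trilin K U V W X f \<longleftrightarrow>
     (\<forall>v\<in>carrier V. \<forall>w\<in>carrier W. klinear K U X (\<lambda>u. f u v w)) \<and>
     (\<forall>u\<in>carrier U. bilin K V W X (f u))"

definition quadlin where
  "quadlin K U V W Y X f \<longleftrightarrow>
     (\<forall>v\<in>carrier V. \<forall>w\<in>carrier W. \<forall>y\<in>carrier Y. klinear K U X (\<lambda>u. f u v w y)) \<and>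
     (\<forall>u\<in>carrier U. trilin K V W Y X (f u))"

definition tlift4 where
  "tlift4 X f t = tlift X (\<lambda>u s. tlift3 X (f u) s) t"

lemma trilinI:
  assumes "\<And>v w. v \<in> carrier V \<Longrightarrow> w \<in> carrier W \<Longrightarrow> klinear K U X (\<lambda>u. f u v w)"
    and "\<And>u w. u \<in> carrier U \<Longrightarrow> w \<in> carrier W \<Longrightarrow> klinear K V X (\<lambda>v. f u v w)"
    and "\<And>u v. u \<in> carrier U \<Longrightarrow> v \<in> carrier V \<Longrightarrow> klinear K W X (f u v)"
  shows "trilin K U V W X f"
  using assms unfolding trilin_def bilin_def by auto

lemma quadlinI:
  assumes "\<And>v w y. v \<in> carrier V \<Longrightarrow> w \<in> carrier W \<Longrightarrow> y \<in> carrier Y \<Longrightarrow> klinear K U X (\<lambda>u. f u v w y)"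
    and "\<And>u w y. u \<in> carrier U \<Longrightarrow> w \<in> carrier W \<Longrightarrow> y \<in> carrier Y \<Longrightarrow> klinear K V X (\<lambda>v. f u v w y)"
    and "\<And>u v y. u \<in> carrier U \<Longrightarrow> v \<in> carrier V \<Longrightarrow> y \<in> carrier Y \<Longrightarrow> klinear K W X (\<lambda>w. f u v w y)"
    and "\<And>u v w. u \<in> carrier U \<Longrightarrow> v \<in> carrier V \<Longrightarrow> w \<in> carrier W \<Longrightarrow> klinear K Y X (f u v w)"
  shows "quadlin K U V W Y X f"
  using assms unfolding quadlin_def by (auto intro!: trilinI)

lemma trilin_bilin: "trilin K U V W X f \<Longrightarrow> u \<in> carrier U \<Longrightarrow> bilin K V W X (f u)"
  unfolding trilin_def by blast

lemma quadlin_trilin: "quadlin K U V W Y X f \<Longrightarrow> u \<in> carrier U \<Longrightarrow> trilin K V W Y X (f u)"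
  unfolding quadlin_def by blast

lemma trilin_1:
  "trilin K U V W X f \<Longrightarrow> klinear K T U g \<Longrightarrow> v \<in> carrier V \<Longrightarrow> w \<in> carrier W \<Longrightarrow> klinear K T X (\<lambda>x. f (g x) v w)"
  unfolding trilin_def using klinear_comp[where g="\<lambda>u. f u v w" and f=g] by blast

lemma trilin_2:
  "trilin K U V W X f \<Longrightarrow> u \<in> carrier U \<Longrightarrow> klinear K T V g \<Longrightarrow> w \<in> carrier W \<Longrightarrow> klinear K T X (\<lambda>x. f u (g x) w)"
  by (rule bilin_left[OF trilin_bilin])

lemma trilin_3:
  "trilin K U V W X f \<Longrightarrow> u \<in> carrier U \<Longrightarrow> v \<in> carrier V \<Longrightarrow> klinear K T W g \<Longrightarrow> klinear K T X (\<lambda>x. f u v (g x))"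
  by (rule bilin_right[OF trilin_bilin])

lemma trilin_closed:
  "trilin K U V W X f \<Longrightarrow> u \<in> carrier U \<Longrightarrow> v \<in> carrier V \<Longrightarrow> w \<in> carrier W \<Longrightarrow> f u v w \<in> carrier X"
  by (rule bilin_closed[OF trilin_bilin])

lemma quadlin_1:
  "quadlin K U V W Y X f \<Longrightarrow> klinear K T U g \<Longrightarrow> v \<in> carrier V \<Longrightarrow> w \<in> carrier W \<Longrightarrow> y \<in> carrier Y
   \<Longrightarrow> klinear K T X (\<lambda>x. f (g x) v w y)"
  unfolding quadlin_def using klinear_comp[where g="\<lambda>u. f u v w y" and f=g] by blast

lemma quadlin_2:
  "quadlin K U V W Y X f \<Longrightarrow> u \<in> carrier U \<Longrightarrow> klinear K T V g \<Longrightarrow> w \<in> carrier W \<Longrightarrow> y \<in> carrier Y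
   \<Longrightarrow> klinear K T X (\<lambda>x. f u (g x) w y)"
  by (rule trilin_1[OF quadlin_trilin])

lemma quadlin_3:
  "quadlin K U V W Y X f \<Longrightarrow> u \<in> carrier U \<Longrightarrow> v \<in> carrier V \<Longrightarrow> klinear K T W g \<Longrightarrow> y \<in> carrier Y
   \<Longrightarrow> klinear K T X (\<lambda>x. f u v (g x) y)"
  by (rule trilin_2[OF quadlin_trilin])

lemma quadlin_4:
  "quadlin K U V W Y X f \<Longrightarrow> u \<in> carrier U \<Longrightarrow> v \<in> carrier V \<Longrightarrow> w \<in> carrier W \<Longrightarrow> klinear K T Y g
   \<Longrightarrow> klinear K T X (\<lambda>x. f u v w (g x))"
  by (rule trilin_3[OF quadlin_trilin])

lemma bilin_tlift:
  assumes "module K V" "module K W" "module K X" "trilin K U V W X f"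
  shows "bilin K U (tensor K V W) X (\<lambda>u s. tlift X (f u) s)"
  using assms
  by (intro bilinI klinear_tlift_param[where V=V and W=W] klinear_tlift[where V=V and W=W] klinear_id
      trilin_1[where U=U and V=V and W=W, of K X f U "\<lambda>u. u"] trilin_bilin)

context
  fixes K :: "('k, 'm) ring_scheme" and U :: "('k, 'u, 'p) module_scheme" and V :: "('k, 'v, 'q) module_scheme"
    and W :: "('k, 'w, 'r) module_scheme"
  assumes UVW: "module K U" "module K V" "module K W"
begin

abbreviation (input) "T3 \<equiv> tensor K U (tensor K V W)"

lemma T3_module: "module K T3"
  by (intro tensor_module UVW)

lemma tlift3_pure:
  assumes "module K X" "trilin K U V W X f" "u \<in> carrier U" "v \<in> carrier V" "w \<in> carrier W"
  shows "tlift3 X f (tclass K U (tensor K V W) [(u, tclass K V W [(v, w)])]) = f u v w"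
  unfolding tlift3_def using assms
  by (simp add: tlift_pure[OF UVW(1) tensor_module[OF UVW(2,3)] _ bilin_tlift[OF UVW(2,3)]] pure_closed
      tlift_pure[OF UVW(2,3) _ trilin_bilin])

lemma klinear_tlift3:
  assumes "module K X" "trilin K U V W X f" "klinear K Z T3 g"
  shows "klinear K Z X (\<lambda>z. tlift3 X f (g z))"
  unfolding tlift3_def using assms
  by (intro klinear_tlift[OF UVW(1) tensor_module[OF UVW(2,3)] _ bilin_tlift[OF UVW(2,3)]])

lemma klinear_tlift3_param:
  assumes "module K X" "t \<in> carrier T3"
    "\<And>u v w. u \<in> carrier U \<Longrightarrow> v \<in> carrier V \<Longrightarrow> w \<in> carrier W \<Longrightarrow> klinear K Z X (\<lambda>z. f z u v w)"
  shows "klinear K Z X (\<lambda>z. tlift3 X (f z) t)"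
  unfolding tlift3_def using assms
  by (intro klinear_tlift_param[OF UVW(1) tensor_module[OF UVW(2,3)]] klinear_tlift_param[OF UVW(2,3)])

lemma tlift3_linear:
  assumes "module K X" "module K Y" "t \<in> carrier T3" "klinear K X Y g"
    "\<And>u v w. u \<in> carrier U \<Longrightarrow> v \<in> carrier V \<Longrightarrow> w \<in> carrier W \<Longrightarrow> f u v w \<in> carrier X"
  shows "g (tlift3 X f t) = tlift3 Y (\<lambda>u v w. g (f u v w)) t"
  unfolding tlift3_def using assms
  by (subst tlift_linear[OF UVW(1) tensor_module[OF UVW(2,3)], where X=X and Y=Y])
    (auto intro!: tlift_closed[OF UVW(2,3)] tlift_cong[OF UVW(1) tensor_module[OF UVW(2,3)]] tlift_linear[OF UVW(2,3)])

lemma tlift3_cong: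
  assumes "t \<in> carrier T3"
    "\<And>u v w. u \<in> carrier U \<Longrightarrow> v \<in> carrier V \<Longrightarrow> w \<in> carrier W \<Longrightarrow> f u v w = g u v w"
  shows "tlift3 X f t = tlift3 X g t"
  unfolding tlift3_def using assms
  by (intro tlift_cong[OF UVW(1) tensor_module[OF UVW(2,3)]] tlift_cong[OF UVW(2,3)]) auto

lemma tlift3_closed:
  assumes "module K X" "t \<in> carrier T3"
    "\<And>u v w. u \<in> carrier U \<Longrightarrow> v \<in> carrier V \<Longrightarrow> w \<in> carrier W \<Longrightarrow> f u v w \<in> carrier X"
  shows "tlift3 X f t \<in> carrier X"
  unfolding tlift3_def using assms
  by (intro tlift_closed[OF UVW(1) tensor_module[OF UVW(2,3)]] tlift_closed[OF UVW(2,3)]) auto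

lemma tensor3_ext:
  assumes "module K X" "klinear K T3 X f" "klinear K T3 X g"
    and "\<And>u v w. u \<in> carrier U \<Longrightarrow> v \<in> carrier V \<Longrightarrow> w \<in> carrier W \<Longrightarrow>
      f (tclass K U (tensor K V W) [(u, tclass K V W [(v, w)])]) = g (tclass K U (tensor K V W) [(u, tclass K V W [(v, w)])])"
    and "t \<in> carrier T3"
  shows "f t = g t"
proof (rule tensor_ext[OF UVW(1) tensor_module[OF UVW(2,3)] assms(1-3) _ assms(5)])
  fix u s assume u: "u \<in> carrier U" and s: "s \<in> carrier (tensor K V W)"
  let ?p = "\<lambda>s. tclass K U (tensor K V W) [(u, s)]"
  have p: "klinear K (tensor K V W) T3 ?p"
    using bilin_right[OF pure_bilin[OF UVW(1) tensor_module[OF UVW(2,3)]] u klinear_id] .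
  show "f (?p s) = g (?p s)"
    using tensor_ext[OF UVW(2,3) assms(1) klinear_comp[OF assms(2) p] klinear_comp[OF assms(3) p] _ s] assms(4) u
    by blast
qed

end

lemma bilin_tlift3:
  assumes "module K V" "module K W" "module K Y" "module K X" "quadlin K U V W Y X f"
  shows "bilin K U (tensor K V (tensor K W Y)) X (\<lambda>u s. tlift3 X (f u) s)"
  using assms
  by (intro bilinI klinear_tlift3_param[OF assms(1-3)] klinear_tlift3[OF assms(1-3)] klinear_id
      quadlin_1[where U=U and V=V and W=W and Y=Y, of K X f U "\<lambda>u. u"] quadlin_trilin)

context
  fixes K :: "('k, 'm) ring_scheme" and U :: "('k, 'u, 'p) module_scheme" and V :: "('k, 'v, 'q) module_scheme"
    and W :: "('k, 'w, 'r) module_scheme" and Y :: "('k, 'y, 's) module_scheme"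
  assumes UVWY: "module K U" "module K V" "module K W" "module K Y"
begin

abbreviation (input) "T4 \<equiv> tensor K U (tensor K V (tensor K W Y))"

lemma tlift4_pure:
  assumes "module K X" "quadlin K U V W Y X f" "u \<in> carrier U" "v \<in> carrier V" "w \<in> carrier W" "y \<in> carrier Y"
  shows "tlift4 X f (tclass K U (tensor K V (tensor K W Y)) [(u, tclass K V (tensor K W Y) [(v, tclass K W Y [(w, y)])])]) = f u v w y"
  unfolding tlift4_def using assms
  by (simp add: tlift_pure[OF UVWY(1) T3_module[OF UVWY(2-4)] _ bilin_tlift3[OF UVWY(2-4)]] pure_closed
      tlift3_pure[OF UVWY(2-4) _ quadlin_trilin])

lemma klinear_tlift4:
  assumes "module K X" "quadlin K U V W Y X f" "klinear K Z T4 g"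
  shows "klinear K Z X (\<lambda>z. tlift4 X f (g z))"
  unfolding tlift4_def using assms
  by (intro klinear_tlift[OF UVWY(1) T3_module[OF UVWY(2-4)] _ bilin_tlift3[OF UVWY(2-4)]])

lemma klinear_tlift4_param:
  assumes "module K X" "t \<in> carrier T4"
    "\<And>u v w y. u \<in> carrier U \<Longrightarrow> v \<in> carrier V \<Longrightarrow> w \<in> carrier W \<Longrightarrow> y \<in> carrier Y \<Longrightarrow> klinear K Z X (\<lambda>z. f z u v w y)"
  shows "klinear K Z X (\<lambda>z. tlift4 X (f z) t)"
  unfolding tlift4_def using assms
  by (intro klinear_tlift_param[OF UVWY(1) T3_module[OF UVWY(2-4)]] klinear_tlift3_param[OF UVWY(2-4)])

lemma tlift4_closed:
  assumes "module K X" "t \<in> carrier T4"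
    "\<And>u v w y. u \<in> carrier U \<Longrightarrow> v \<in> carrier V \<Longrightarrow> w \<in> carrier W \<Longrightarrow> y \<in> carrier Y \<Longrightarrow> f u v w y \<in> carrier X"
  shows "tlift4 X f t \<in> carrier X"
  unfolding tlift4_def using assms
  by (intro tlift_closed[OF UVWY(1) T3_module[OF UVWY(2-4)]] tlift3_closed[OF UVWY(2-4)]) auto

lemma tensor4_ext:
  assumes "module K X" "klinear K T4 X f" "klinear K T4 X g"
    and "\<And>u v w y. u \<in> carrier U \<Longrightarrow> v \<in> carrier V \<Longrightarrow> w \<in> carrier W \<Longrightarrow> y \<in> carrier Y \<Longrightarrow>
      f (tclass K U (tensor K V (tensor K W Y)) [(u, tclass K V (tensor K W Y) [(v, tclass K W Y [(w, y)])])])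
      = g (tclass K U (tensor K V (tensor K W Y)) [(u, tclass K V (tensor K W Y) [(v, tclass K W Y [(w, y)])])])"
    and "t \<in> carrier T4"
  shows "f t = g t"
proof (rule tensor_ext[OF UVWY(1) T3_module[OF UVWY(2-4)] assms(1-3) _ assms(5)])
  fix u s assume u: "u \<in> carrier U" and s: "s \<in> carrier (tensor K V (tensor K W Y))"
  let ?p = "\<lambda>s. tclass K U (tensor K V (tensor K W Y)) [(u, s)]"
  have p: "klinear K (tensor K V (tensor K W Y)) T4 ?p"
    using bilin_right[OF pure_bilin[OF UVWY(1) T3_module[OF UVWY(2-4)]] u klinear_id] .
  show "f (?p s) = g (?p s)"
    using tensor3_ext[OF UVWY(2-4) assms(1) klinear_comp[OF assms(2) p] klinear_comp[OF assms(3) p] _ s] assms(4) u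
    by blast
qed

end

section \<open>Tensor products of algebras\<close>

definition kalg where
  "kalg K V \<longleftrightarrow> module K V \<and> monoid V \<and> bilin K V V V (\<lambda>x y. x \<otimes>\<^bsub>V\<^esub> y)"

text \<open>The product of tensors multiplies out two chosen representatives. Written as an iterated
  \<open>tlift\<close> it comes within reach of the linearity rules, from which bilinearity
  follows.\<close>

lemma tensor_mult:
  assumes "module K V" "module K W" "s \<in> carrier (tensor K V W)" "t \<in> carrier (tensor K V W)"
    and mV: "\<And>x y. x \<in> carrier V \<Longrightarrow> y \<in> carrier V \<Longrightarrow> x \<otimes>\<^bsub>V\<^esub> y \<in> carrier V"
    and mW: "\<And>x y. x \<in> carrier W \<Longrightarrow> y \<in> carrier W \<Longrightarrow> x \<otimes>\<^bsub>W\<^esub> y \<in> carrier W"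
  shows "s \<otimes>\<^bsub>tensor K V W\<^esub> t = tlift (tensor K V W) (\<lambda>v w. tlift (tensor K V W)
      (\<lambda>v' w'. tclass K V W [(v \<otimes>\<^bsub>V\<^esub> v', w \<otimes>\<^bsub>W\<^esub> w')]) t) s"
proof -
  let ?C = "carrier V \<times> carrier W"
  have 1: "tclass K V W (map (\<lambda>(v', w'). (v \<otimes>\<^bsub>V\<^esub> v', w \<otimes>\<^bsub>W\<^esub> w')) ys)
      = lsum (tensor K V W) (\<lambda>v' w'. tclass K V W [(v \<otimes>\<^bsub>V\<^esub> v', w \<otimes>\<^bsub>W\<^esub> w')]) ys"
    if "v \<in> carrier V" "w \<in> carrier W" "set ys \<subseteq> ?C" for v w ys
    using that(3)
  proof (induct ys)
    case Nil
    then show ?case by (simp add: tensor_zero)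
  next
    case (Cons p ys)
    have "set (map (\<lambda>(v', w'). (v \<otimes>\<^bsub>V\<^esub> v', w \<otimes>\<^bsub>W\<^esub> w')) (p # ys)) \<subseteq> ?C"
      using that(1,2) Cons(2) by (auto simp: subset_iff split: prod.splits intro!: mV mW)
    then show ?case using Cons by (cases p) (simp add: tensor_add flip: Cons(1))
  qed
  have "tclass K V W (concat (map (\<lambda>(v, w). map (\<lambda>(v', w'). (v \<otimes>\<^bsub>V\<^esub> v', w \<otimes>\<^bsub>W\<^esub> w')) ys) xs))
      = lsum (tensor K V W) (\<lambda>v w. lsum (tensor K V W) (\<lambda>v' w'. tclass K V W [(v \<otimes>\<^bsub>V\<^esub> v', w \<otimes>\<^bsub>W\<^esub> w')]) ys) xs"
    if "set xs \<subseteq> ?C" "set ys \<subseteq> ?C" for xs ys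
    using that(1)
  proof (induct xs)
    case Nil
    then show ?case by (simp add: tensor_zero)
  next
    case (Cons p xs)
    obtain v w where p: "p = (v, w)" "v \<in> carrier V" "w \<in> carrier W" using Cons(2) by (cases p) auto
    have "set (map (\<lambda>(v', w'). (v \<otimes>\<^bsub>V\<^esub> v', w \<otimes>\<^bsub>W\<^esub> w')) ys) \<subseteq> ?C"
      using that(2) p(2,3) by (auto simp: subset_iff split: prod.splits intro!: mV mW)
    moreover have "set (concat (map (\<lambda>(v, w). map (\<lambda>(v', w'). (v \<otimes>\<^bsub>V\<^esub> v', w \<otimes>\<^bsub>W\<^esub> w')) ys) xs)) \<subseteq> ?C"
      using that(2) Cons(2) by (auto simp: subset_iff split: prod.splits intro!: mV mW)
    ultimately show ?case using Cons p by (simp add: tensor_add[symmetric] 1[OF p(2,3) that(2)])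
  qed
  from this[OF tensor_rep(1)[OF assms(3,1,2)] tensor_rep(1)[OF assms(4,1,2)]] show ?thesis
    by (simp add: tensor_def tlift_lsum)
qed

lemma kalg_tensor:
  assumes "kalg K V" "kalg K W"
  shows "kalg K (tensor K V W)"
    and "v \<in> carrier V \<Longrightarrow> w \<in> carrier W \<Longrightarrow> v' \<in> carrier V \<Longrightarrow> w' \<in> carrier W \<Longrightarrow>
      tclass K V W [(v, w)] \<otimes>\<^bsub>tensor K V W\<^esub> tclass K V W [(v', w')] = tclass K V W [(v \<otimes>\<^bsub>V\<^esub> v', w \<otimes>\<^bsub>W\<^esub> w')]"
    and "\<one>\<^bsub>tensor K V W\<^esub> = tclass K V W [(\<one>\<^bsub>V\<^esub>, \<one>\<^bsub>W\<^esub>)]"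
proof -
  let ?T = "tensor K V W" and ?p = "\<lambda>v w. tclass K V W [(v, w)]"
  have m: "module K V" "module K W" and b: "bilin K V V V (\<lambda>x y. x \<otimes>\<^bsub>V\<^esub> y)" "bilin K W W W (\<lambda>x y. x \<otimes>\<^bsub>W\<^esub> y)"
    and mo: "monoid V" "monoid W"
    using assms unfolding kalg_def by blast+
  interpret V: monoid V by fact
  interpret W: monoid W by fact
  note T = tensor_module[OF m]
  note pb = pure_bilin[OF m]
  let ?m = "\<lambda>v w. tlift ?T (\<lambda>v' w'. ?p (v \<otimes>\<^bsub>V\<^esub> v') (w \<otimes>\<^bsub>W\<^esub> w'))"
  have pb2: "bilin K V W ?T (\<lambda>v' w'. ?p (v \<otimes>\<^bsub>V\<^esub> v') (w \<otimes>\<^bsub>W\<^esub> w'))" if "v \<in> carrier V" "w \<in> carrier W" for v w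
    using that by (intro bilinI bilin_left[OF pb] bilin_right[OF pb] bilin_right[OF b(1)] bilin_right[OF b(2)] klinear_id) auto
  have pb3: "bilin K V W ?T (\<lambda>v w. ?m v w t)" if "t \<in> carrier ?T" for t
    using that by (intro bilinI klinear_tlift_param[OF m T] bilin_left[OF pb] bilin_right[OF pb] bilin_left[OF b(1)] bilin_left[OF b(2)] klinear_id) auto
  have mult: "s \<otimes>\<^bsub>?T\<^esub> t = tlift ?T (\<lambda>v w. ?m v w t) s" if "s \<in> carrier ?T" "t \<in> carrier ?T" for s t
    using that by (intro tensor_mult m) auto
  have l1: "klinear K ?T ?T (\<lambda>s. s \<otimes>\<^bsub>?T\<^esub> t)" if "t \<in> carrier ?T" for t
    by (subst klinear_cong[OF mult[OF _ that] T]) (auto intro!: klinear_tlift[OF m T pb3[OF that]] klinear_id)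
  have l2: "klinear K ?T ?T (\<lambda>t. s \<otimes>\<^bsub>?T\<^esub> t)" if "s \<in> carrier ?T" for s
    by (subst klinear_cong[OF mult[OF that] T])
      (auto intro!: klinear_tlift_param[OF m T that] klinear_tlift[OF m T pb2] klinear_id)
  have bT: "bilin K ?T ?T ?T (\<lambda>s t. s \<otimes>\<^bsub>?T\<^esub> t)" by (intro bilinI l1 l2)
  show pp: "?p v w \<otimes>\<^bsub>?T\<^esub> ?p v' w' = ?p (v \<otimes>\<^bsub>V\<^esub> v') (w \<otimes>\<^bsub>W\<^esub> w')"
    if "v \<in> carrier V" "w \<in> carrier W" "v' \<in> carrier V" "w' \<in> carrier W" for v w v' w'
    using that by (simp add: mult pure_closed tlift_pure[OF m T] pb2 pb3)
  show one: "\<one>\<^bsub>?T\<^esub> = ?p \<one>\<^bsub>V\<^esub> \<one>\<^bsub>W\<^esub>" by (simp add: tensor_def)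
  have oc: "\<one>\<^bsub>?T\<^esub> \<in> carrier ?T" by (simp add: one pure_closed)
  note cl = bilin_closed[OF bT]
  have "monoid ?T"
  proof (rule monoidI)
    fix x y z assume xyz: "x \<in> carrier ?T" "y \<in> carrier ?T" "z \<in> carrier ?T"
    show "x \<otimes>\<^bsub>?T\<^esub> y \<in> carrier ?T" using xyz cl by blast
    \<comment> \<open>Associativity is linear in each factor, so three nested comparisons reduce it
      to pure tensors.\<close>
    show "x \<otimes>\<^bsub>?T\<^esub> y \<otimes>\<^bsub>?T\<^esub> z = x \<otimes>\<^bsub>?T\<^esub> (y \<otimes>\<^bsub>?T\<^esub> z)"
    proof (rule tensor_ext[OF m T _ _ _ xyz(1)])
      show "klinear K ?T ?T (\<lambda>x. x \<otimes>\<^bsub>?T\<^esub> y \<otimes>\<^bsub>?T\<^esub> z)" "klinear K ?T ?T (\<lambda>x. x \<otimes>\<^bsub>?T\<^esub> (y \<otimes>\<^bsub>?T\<^esub> z))"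
        using xyz by (intro bilin_left[OF bT] klinear_id cl; simp)+
      fix v w assume vw: "v \<in> carrier V" "w \<in> carrier W"
      show "?p v w \<otimes>\<^bsub>?T\<^esub> y \<otimes>\<^bsub>?T\<^esub> z = ?p v w \<otimes>\<^bsub>?T\<^esub> (y \<otimes>\<^bsub>?T\<^esub> z)"
      proof (rule tensor_ext[OF m T _ _ _ xyz(2)])
        show "klinear K ?T ?T (\<lambda>y. ?p v w \<otimes>\<^bsub>?T\<^esub> y \<otimes>\<^bsub>?T\<^esub> z)" "klinear K ?T ?T (\<lambda>y. ?p v w \<otimes>\<^bsub>?T\<^esub> (y \<otimes>\<^bsub>?T\<^esub> z))"
          using xyz vw by (intro bilin_left[OF bT] bilin_right[OF bT] klinear_id cl pure_closed; simp)+
        fix v' w' assume vw': "v' \<in> carrier V" "w' \<in> carrier W"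
        show "?p v w \<otimes>\<^bsub>?T\<^esub> ?p v' w' \<otimes>\<^bsub>?T\<^esub> z = ?p v w \<otimes>\<^bsub>?T\<^esub> (?p v' w' \<otimes>\<^bsub>?T\<^esub> z)"
        proof (rule tensor_ext[OF m T _ _ _ xyz(3)])
          show "klinear K ?T ?T (\<lambda>z. ?p v w \<otimes>\<^bsub>?T\<^esub> ?p v' w' \<otimes>\<^bsub>?T\<^esub> z)" "klinear K ?T ?T (\<lambda>z. ?p v w \<otimes>\<^bsub>?T\<^esub> (?p v' w' \<otimes>\<^bsub>?T\<^esub> z))"
            using xyz vw vw' by (intro bilin_left[OF bT] bilin_right[OF bT] klinear_id cl pure_closed; simp)+
        qed (use vw vw' in \<open>simp add: pp V.m_assoc W.m_assoc\<close>)
      qed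
    qed
  next
    show "\<one>\<^bsub>?T\<^esub> \<in> carrier ?T" by (fact oc)
  next
    fix x assume x: "x \<in> carrier ?T"
    show "\<one>\<^bsub>?T\<^esub> \<otimes>\<^bsub>?T\<^esub> x = x"
      by (rule tensor_ext[OF m T _ _ _ x]) (auto simp: one pp intro!: klinear_id bilin_right[OF bT] pure_closed)
    show "x \<otimes>\<^bsub>?T\<^esub> \<one>\<^bsub>?T\<^esub> = x"
      by (rule tensor_ext[OF m T _ _ _ x]) (auto simp: one pp intro!: klinear_id bilin_left[OF bT] pure_closed)
  qed
  then show "kalg K ?T" unfolding kalg_def using T bT by blast
qed

lemma kalg_closed: "kalg K V \<Longrightarrow> x \<in> carrier V \<Longrightarrow> y \<in> carrier V \<Longrightarrow> x \<otimes>\<^bsub>V\<^esub> y \<in> carrier V"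
  unfolding kalg_def by (elim conjE, rule bilin_closed[where f="\<lambda>x y. x \<otimes>\<^bsub>V\<^esub> y"])

lemma kalg_left:
  "kalg K V \<Longrightarrow> klinear K U V f \<Longrightarrow> y \<in> carrier V \<Longrightarrow> klinear K U V (\<lambda>u. f u \<otimes>\<^bsub>V\<^esub> y)"
  unfolding kalg_def by (elim conjE, rule bilin_left[where f="\<lambda>x y. x \<otimes>\<^bsub>V\<^esub> y"])

lemma kalg_right:
  "kalg K V \<Longrightarrow> x \<in> carrier V \<Longrightarrow> klinear K U V f \<Longrightarrow> klinear K U V (\<lambda>u. x \<otimes>\<^bsub>V\<^esub> f u)"
  unfolding kalg_def by (elim conjE, rule bilin_right[where f="\<lambda>x y. x \<otimes>\<^bsub>V\<^esub> y"])

section \<open>Modules over a quasi-bialgebra\<close>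

definition act2 where
  "act2 U V X F t x y = tlift X (\<lambda>a b. F (act U a x) (act V b y)) t"

definition act3 where
  "act3 U V W X F t x y z = tlift3 X (\<lambda>a b c. F (act U a x) (act V b y) (act W c z)) t"

definition act4 where
  "act4 U V W Y X F t x y z w = tlift4 X (\<lambda>a b c d. F (act U a x) (act V b y) (act W c z) (act Y d w)) t"

context hopf_data
begin

text \<open>An H-module whose grading is ignored. Identities between actions are proved at this
  level, because auxiliary modules such as \<open>regular\<close> carry no meaningful
  grading.\<close>

definition umodule :: "('k, 'h, 'v, 'p) hmod_scheme \<Rightarrow> bool" where
  "umodule V \<longleftrightarrow> module K V \<and> bilin K H V V (act V) \<and>
     (\<forall>h\<in>carrier H. \<forall>h'\<in>carrier H. \<forall>v\<in>carrier V. act V (h \<otimes>\<^bsub>H\<^esub> h') v = act V h (act V h' v)) \<and>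
     (\<forall>v\<in>carrier V. act V \<one>\<^bsub>H\<^esub> v = v)"

text \<open>H-linearity of the map induced on \<open>U \<boxtimes> V\<close>, phrased for the
  bilinear map. This is the form needed to replace two arguments by a single one.\<close>

definition equivar ::
  "('k, 'h, 'u, 'p) hmod_scheme \<Rightarrow> ('k, 'h, 'v, 'q) hmod_scheme \<Rightarrow> ('k, 'h, 'm, 'r) hmod_scheme
    \<Rightarrow> ('u \<Rightarrow> 'v \<Rightarrow> 'm) \<Rightarrow> bool" where
  "equivar U V M B \<longleftrightarrow> bilin K U V M B \<and>
     (\<forall>h\<in>carrier H. \<forall>x\<in>carrier U. \<forall>y\<in>carrier V. act M h (B x y) = act2 U V M B (\<Delta> h) x y)"

abbreviation "id_\<Delta> t \<equiv> tlift HHH (\<lambda>a b. tlift HHH (\<lambda>b1 b2. h3 a b1 b2) (\<Delta> b)) t"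
abbreviation "\<Delta>_id t \<equiv> tlift HHH (\<lambda>a b. tlift HHH (\<lambda>a1 a2. h3 a1 a2 b) (\<Delta> a)) t"
abbreviation "\<Delta>_id_id t \<equiv> tlift3 HHHH (\<lambda>a b c. tlift HHHH (\<lambda>a1 a2. h4 a1 a2 b c) (\<Delta> a)) t"
abbreviation "id_\<Delta>_id t \<equiv> tlift3 HHHH (\<lambda>a b c. tlift HHHH (\<lambda>b1 b2. h4 a b1 b2 c) (\<Delta> b)) t"
abbreviation "id_id_\<Delta> t \<equiv> tlift3 HHHH (\<lambda>a b c. tlift HHHH (\<lambda>c1 c2. h4 a b c1 c2) (\<Delta> c)) t"
abbreviation "one_tens t \<equiv> tlift3 HHHH (\<lambda>a b c. h4 \<one>\<^bsub>H\<^esub> a b c) t"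
abbreviation "tens_one t \<equiv> tlift3 HHHH (\<lambda>a b c. h4 a b c \<one>\<^bsub>H\<^esub>) t"

lemma umodule_module [simp, intro]: "umodule V \<Longrightarrow> module K V"
  by (simp add: umodule_def)

lemma act_closed [simp]: "umodule V \<Longrightarrow> h \<in> carrier H \<Longrightarrow> v \<in> carrier V \<Longrightarrow> act V h v \<in> carrier V"
  unfolding umodule_def by (elim conjE, rule bilin_closed[where f="act V"])

lemma act_mult: "umodule V \<Longrightarrow> h \<in> carrier H \<Longrightarrow> h' \<in> carrier H \<Longrightarrow> v \<in> carrier V \<Longrightarrow>
    act V (h \<otimes>\<^bsub>H\<^esub> h') v = act V h (act V h' v)"
  by (simp add: umodule_def)

lemma act_one [simp]: "umodule V \<Longrightarrow> v \<in> carrier V \<Longrightarrow> act V \<one>\<^bsub>H\<^esub> v = v"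
  by (simp add: umodule_def)

lemma klinear_act_l [lin]:
  "umodule V \<Longrightarrow> klinear K U H f \<Longrightarrow> v \<in> carrier V \<Longrightarrow> klinear K U V (\<lambda>u. act V (f u) v)"
  unfolding umodule_def by (elim conjE, rule bilin_left[where f="act V"])

lemma klinear_act_r [lin]:
  "umodule V \<Longrightarrow> h \<in> carrier H \<Longrightarrow> klinear K U V f \<Longrightarrow> klinear K U V (\<lambda>u. act V h (f u))"
  unfolding umodule_def by (elim conjE, rule bilin_right[where f="act V"])

lemma equivar_bilin: "equivar U V M B \<Longrightarrow> bilin K U V M B"
  by (simp add: equivar_def)

lemma equivar_act: "equivar U V M B \<Longrightarrow> h \<in> carrier H \<Longrightarrow> x \<in> carrier U \<Longrightarrow> y \<in> carrier V \<Longrightarrow>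
    act M h (B x y) = act2 U V M B (\<Delta> h) x y"
  by (simp add: equivar_def)

lemma hmodule_umodule: "hmodule V \<Longrightarrow> umodule V"
  unfolding hmodule_def umodule_def by (auto intro!: bilinI)

end

context quasi_bialgebra
begin

lemma H_monoid: "monoid H"
  using H_ring by (simp add: ring.is_monoid)

lemma kalg_H: "kalg K H"
proof -
  interpret H: ring H by (fact H_ring)
  interpret HM: module K H by (fact H_module)
  show ?thesis
    unfolding kalg_def
    by (auto intro!: H_module bilinI klinearI H_monoid simp: H.l_distr H.r_distr H_smult_left H_smult_right)
qed

lemma kalg_HH: "kalg K HH" and kalg_HHH: "kalg K HHH" and kalg_HHHH: "kalg K HHHH"
  by (simp_all add: kalg_tensor(1) kalg_H)

lemma H_modules [simp, intro]: "module K H" "module K HH" "module K HHH" "module K HHHH"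
  using kalg_H kalg_HH kalg_HHH kalg_HHHH unfolding kalg_def by auto

lemma H_mult_closed [simp]: "x \<in> carrier H \<Longrightarrow> y \<in> carrier H \<Longrightarrow> x \<otimes>\<^bsub>H\<^esub> y \<in> carrier H"
  by (rule kalg_closed[OF kalg_H])

lemma H_one_closed [simp]: "\<one>\<^bsub>H\<^esub> \<in> carrier H"
  using H_monoid by (simp add: monoid.one_closed)

lemma H_one [simp]: "x \<in> carrier H \<Longrightarrow> \<one>\<^bsub>H\<^esub> \<otimes>\<^bsub>H\<^esub> x = x" "x \<in> carrier H \<Longrightarrow> x \<otimes>\<^bsub>H\<^esub> \<one>\<^bsub>H\<^esub> = x"
  using H_monoid by (simp_all add: monoid.l_one monoid.r_one)

lemma H_assoc: "x \<in> carrier H \<Longrightarrow> y \<in> carrier H \<Longrightarrow> z \<in> carrier H \<Longrightarrow>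
    x \<otimes>\<^bsub>H\<^esub> y \<otimes>\<^bsub>H\<^esub> z = x \<otimes>\<^bsub>H\<^esub> (y \<otimes>\<^bsub>H\<^esub> z)"
  using H_monoid by (simp add: monoid.m_assoc)

lemmas klinear_mult_H [lin] = kalg_left[OF kalg_H] kalg_right[OF kalg_H]

lemma h_closed [simp]:
  "a \<in> carrier H \<Longrightarrow> b \<in> carrier H \<Longrightarrow> h2 a b \<in> carrier HH"
  "a \<in> carrier H \<Longrightarrow> t \<in> carrier HH \<Longrightarrow> tclass K H HH [(a, t)] \<in> carrier HHH"
  "a \<in> carrier H \<Longrightarrow> u \<in> carrier HHH \<Longrightarrow> tclass K H HHH [(a, u)] \<in> carrier HHHH"
  by (simp_all add: pure_closed)

lemma comult_closed [simp]: "h \<in> carrier H \<Longrightarrow> \<Delta> h \<in> carrier HH"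
  using comult_hom by (auto simp: ring_hom_def)

lemma comult_mult: "h \<in> carrier H \<Longrightarrow> h' \<in> carrier H \<Longrightarrow> \<Delta> (h \<otimes>\<^bsub>H\<^esub> h') = \<Delta> h \<otimes>\<^bsub>HH\<^esub> \<Delta> h'"
  using comult_hom by (auto simp: ring_hom_def)

lemma comult_one: "\<Delta> \<one>\<^bsub>H\<^esub> = \<one>\<^bsub>HH\<^esub>"
  using comult_hom by (auto simp: ring_hom_def)

lemma comult_linear: "klinear K H HH \<Delta>"
  using comult_hom by (intro klinearI) (auto simp: ring_hom_def comult_smult)

lemma counit_closed [simp]: "h \<in> carrier H \<Longrightarrow> \<epsilon> h \<in> carrier K"
  using counit_hom by (auto simp: ring_hom_def)

lemma counit_mult: "h \<in> carrier H \<Longrightarrow> h' \<in> carrier H \<Longrightarrow> \<epsilon> (h \<otimes>\<^bsub>H\<^esub> h') = \<epsilon> h \<otimes>\<^bsub>K\<^esub> \<epsilon> h'"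
  using counit_hom by (auto simp: ring_hom_def)

lemma counit_one [simp]: "\<epsilon> \<one>\<^bsub>H\<^esub> = \<one>\<^bsub>K\<^esub>"
  using counit_hom by (auto simp: ring_hom_def)

lemma klinear_counit [lin]:
  assumes "module K V" "klinear K U H f" "v \<in> carrier V"
  shows "klinear K U V (\<lambda>u. \<epsilon> (f u) \<odot>\<^bsub>V\<^esub> v)"
proof -
  interpret V: module K V by fact
  show ?thesis
    using assms(2,3) counit_hom unfolding klinear_def
    by (auto simp: Pi_iff V.smult_l_distr counit_smult V.smult_assoc1 ring_hom_def)
qed

lemma phi_closed [simp]: "\<phi> \<in> carrier HHH" "\<phi>inv \<in> carrier HHH"
  and phi_inv: "\<phi> \<otimes>\<^bsub>HHH\<^esub> \<phi>inv = \<one>\<^bsub>HHH\<^esub>" "\<phi>inv \<otimes>\<^bsub>HHH\<^esub> \<phi> = \<one>\<^bsub>HHH\<^esub>"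
proof -
  interpret M: monoid HHH using kalg_HHH by (simp add: kalg_def)
  show "\<phi> \<in> carrier HHH" "\<phi>inv \<in> carrier HHH"
    and "\<phi> \<otimes>\<^bsub>HHH\<^esub> \<phi>inv = \<one>\<^bsub>HHH\<^esub>" "\<phi>inv \<otimes>\<^bsub>HHH\<^esub> \<phi> = \<one>\<^bsub>HHH\<^esub>"
    using assoc_unit by (simp_all add: M.Units_closed)
qed

lemmas tlift_H = klinear_tlift[OF H_modules(1,1)] tlift_linear[OF H_modules(1,1)] tlift_cong[OF H_modules(1,1)]
  tlift_closed[OF H_modules(1,1)] tlift_pure[OF H_modules(1,1)] tensor_ext[OF H_modules(1,1)]
lemmas tlift3_H = klinear_tlift3[OF H_modules(1,1,1)] tlift3_linear[OF H_modules(1,1,1)] tlift3_cong[OF H_modules(1,1,1)]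
  tlift3_closed[OF H_modules(1,1,1)] tlift3_pure[OF H_modules(1,1,1)] tensor3_ext[OF H_modules(1,1,1)]
lemmas tlift4_H = klinear_tlift4[OF H_modules(1,1,1,1)]
  tlift4_closed[OF H_modules(1,1,1,1)] tlift4_pure[OF H_modules(1,1,1,1)] tensor4_ext[OF H_modules(1,1,1,1)]

lemmas klinear_tlift_H [lin] = klinear_tlift_param[OF H_modules(1,1)]
lemmas klinear_tlift3_H [lin] = klinear_tlift3_param[OF H_modules(1,1,1)]
lemmas klinear_tlift4_H [lin] = klinear_tlift4_param[OF H_modules(1,1,1,1)]

lemma klinear_pure_H [lin]:
  "klinear K U H f \<Longrightarrow> b \<in> carrier H \<Longrightarrow> klinear K U HH (\<lambda>u. h2 (f u) b)"
  "a \<in> carrier H \<Longrightarrow> klinear K U H f \<Longrightarrow> klinear K U HH (\<lambda>u. h2 a (f u))"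
  "klinear K U H f \<Longrightarrow> t \<in> carrier HH \<Longrightarrow> klinear K U HHH (\<lambda>u. tclass K H HH [(f u, t)])"
  "a \<in> carrier H \<Longrightarrow> klinear K U HH g \<Longrightarrow> klinear K U HHH (\<lambda>u. tclass K H HH [(a, g u)])"
  "klinear K U H f \<Longrightarrow> s \<in> carrier HHH \<Longrightarrow> klinear K U HHHH (\<lambda>u. tclass K H HHH [(f u, s)])"
  "a \<in> carrier H \<Longrightarrow> klinear K U HHH k \<Longrightarrow> klinear K U HHHH (\<lambda>u. tclass K H HHH [(a, k u)])"
  by (rule bilin_left[OF pure_bilin] bilin_right[OF pure_bilin]; simp)+

lemma tensor_mult_H:
  "\<lbrakk>a \<in> carrier H; b \<in> carrier H; a' \<in> carrier H; b' \<in> carrier H\<rbrakk>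
    \<Longrightarrow> h2 a b \<otimes>\<^bsub>HH\<^esub> h2 a' b' = h2 (a \<otimes>\<^bsub>H\<^esub> a') (b \<otimes>\<^bsub>H\<^esub> b')"
  "\<lbrakk>a \<in> carrier H; b \<in> carrier H; c \<in> carrier H; a' \<in> carrier H; b' \<in> carrier H; c' \<in> carrier H\<rbrakk>
    \<Longrightarrow> h3 a b c \<otimes>\<^bsub>HHH\<^esub> h3 a' b' c' = h3 (a \<otimes>\<^bsub>H\<^esub> a') (b \<otimes>\<^bsub>H\<^esub> b') (c \<otimes>\<^bsub>H\<^esub> c')"
  "\<lbrakk>a \<in> carrier H; b \<in> carrier H; c \<in> carrier H; d \<in> carrier H;
    a' \<in> carrier H; b' \<in> carrier H; c' \<in> carrier H; d' \<in> carrier H\<rbrakk>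
    \<Longrightarrow> h4 a b c d \<otimes>\<^bsub>HHHH\<^esub> h4 a' b' c' d' = h4 (a \<otimes>\<^bsub>H\<^esub> a') (b \<otimes>\<^bsub>H\<^esub> b') (c \<otimes>\<^bsub>H\<^esub> c') (d \<otimes>\<^bsub>H\<^esub> d')"
  by (simp_all add: kalg_tensor(2) kalg_H kalg_HH kalg_HHH)

lemma tensor_one_H: "\<one>\<^bsub>HH\<^esub> = h2 \<one>\<^bsub>H\<^esub> \<one>\<^bsub>H\<^esub>" "\<one>\<^bsub>HHH\<^esub> = h3 \<one>\<^bsub>H\<^esub> \<one>\<^bsub>H\<^esub> \<one>\<^bsub>H\<^esub>" "\<one>\<^bsub>HHHH\<^esub> = h4 \<one>\<^bsub>H\<^esub> \<one>\<^bsub>H\<^esub> \<one>\<^bsub>H\<^esub> \<one>\<^bsub>H\<^esub>"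
  by (simp_all add: kalg_tensor(3) kalg_H kalg_HH kalg_HHH)

subsection \<open>Actions of tensor powers on multilinear maps\<close>

context
  fixes U :: "('a, 'b, 'u, 'p) hmod_scheme" and V :: "('a, 'b, 'v, 'q) hmod_scheme" and X :: "('a, 'x, 'xx) module_scheme"
  assumes U: "umodule U" and V: "umodule V" and X: "module K X"
begin

lemma bilin_act_H:
  "bilin K U V X F \<Longrightarrow> x \<in> carrier U \<Longrightarrow> y \<in> carrier V \<Longrightarrow> bilin K H H X (\<lambda>a b. F (act U a x) (act V b y))"
  by (rule bilinI) (intro lin bilin_left[of K U V X F] bilin_right[of K U V X F] U V; simp add: U V)+

lemma act2_cong:
  assumes "\<And>x y. x \<in> carrier U \<Longrightarrow> y \<in> carrier V \<Longrightarrow> F x y = G x y" "t \<in> carrier HH" "x \<in> carrier U" "y \<in> carrier V"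
  shows "act2 U V X F t x y = act2 U V X G t x y"
  unfolding act2_def using assms U V by (intro tlift_H(3)) auto

context
  fixes F
  assumes F: "bilin K U V X F"
begin

lemma act2_bilin [intro]: "t \<in> carrier HH \<Longrightarrow> bilin K U V X (act2 U V X F t)"
  unfolding act2_def
  by (rule bilinI) (intro lin bilin_left[OF F] bilin_right[OF F] U V X; simp add: U V)+

lemma act2_klinear: "x \<in> carrier U \<Longrightarrow> y \<in> carrier V \<Longrightarrow> klinear K HH X (\<lambda>t. act2 U V X F t x y)"
  unfolding act2_def by (intro tlift_H(1) klinear_id bilin_act_H F X)

lemma act2_h2:
  "a \<in> carrier H \<Longrightarrow> b \<in> carrier H \<Longrightarrow> x \<in> carrier U \<Longrightarrow> y \<in> carrier V \<Longrightarrow>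
   act2 U V X F (h2 a b) x y = F (act U a x) (act V b y)"
  unfolding act2_def by (intro tlift_H(5) bilin_act_H F X)

lemma act2_one: "x \<in> carrier U \<Longrightarrow> y \<in> carrier V \<Longrightarrow> act2 U V X F \<one>\<^bsub>HH\<^esub> x y = F x y"
  by (simp add: tensor_one_H act2_h2 U V)

lemma act2_linear:
  assumes "module K Z" "klinear K X Z g" "t \<in> carrier HH" "x \<in> carrier U" "y \<in> carrier V"
  shows "g (act2 U V X F t x y) = act2 U V Z (\<lambda>x y. g (F x y)) t x y"
  unfolding act2_def using assms U V by (intro tlift_H(2) X) (auto intro!: bilin_closed[OF F])

text \<open>A product a a' acts on a vector by a' first and by a last, so a' ends up next to the
  argument and a next to \<open>F\<close>. Hence the action on maps is a right action: in a product
  of tensors the leftmost factor is applied to \<open>F\<close> first.\<close>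

lemma act2_mult:
  assumes st: "s \<in> carrier HH" "t \<in> carrier HH" and xy: "x \<in> carrier U" "y \<in> carrier V"
  shows "act2 U V X F (s \<otimes>\<^bsub>HH\<^esub> t) x y = act2 U V X (act2 U V X F s) t x y"
proof (rule tlift_H(6)[OF X _ _ _ st(2)])
  have b: "bilin K U V X (act2 U V X F s)" if "s \<in> carrier HH" for s using that by blast
  show "klinear K HH X (\<lambda>t. act2 U V X F (s \<otimes>\<^bsub>HH\<^esub> t) x y)"
    by (rule klinear_comp[OF act2_klinear[OF xy] kalg_right[OF kalg_HH st(1) klinear_id]])
  show "klinear K HH X (\<lambda>t. act2 U V X (act2 U V X F s) t x y)"
    unfolding act2_def[of U V X "act2 U V X F s"] by (intro tlift_H(1) klinear_id bilin_act_H b X xy st)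
  fix a b assume ab: "a \<in> carrier H" "b \<in> carrier H"
  have e: "act2 U V X (act2 U V X F s) (h2 a b) x y = act2 U V X F s (act U a x) (act V b y)" if "s \<in> carrier HH" for s
    unfolding act2_def[of U V X "act2 U V X F s"] by (intro tlift_H(5) bilin_act_H b X xy that ab)
  show "act2 U V X F (s \<otimes>\<^bsub>HH\<^esub> h2 a b) x y = act2 U V X (act2 U V X F s) (h2 a b) x y"
  proof (rule tlift_H(6)[OF X _ _ _ st(1)])
    show "klinear K HH X (\<lambda>s. act2 U V X F (s \<otimes>\<^bsub>HH\<^esub> h2 a b) x y)"
      by (rule klinear_comp[OF act2_klinear[OF xy] kalg_left[OF kalg_HH klinear_id]]) (simp add: ab)
    show "klinear K HH X (\<lambda>s. act2 U V X (act2 U V X F s) (h2 a b) x y)"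
      by (subst klinear_cong[OF e]) (simp_all add: act2_klinear xy U V ab)
  qed (simp add: ab xy e tensor_mult_H act2_h2 act_mult U V)
qed

end
end

context
  fixes U :: "('a, 'b, 'u, 'p) hmod_scheme" and V :: "('a, 'b, 'v, 'q) hmod_scheme" and W :: "('a, 'b, 'w, 'r) hmod_scheme"
    and X :: "('a, 'x, 'xx) module_scheme"
  assumes U: "umodule U" and V: "umodule V" and W: "umodule W" and X: "module K X"
begin

lemma trilin_act_H:
  "trilin K U V W X F \<Longrightarrow> x \<in> carrier U \<Longrightarrow> y \<in> carrier V \<Longrightarrow> z \<in> carrier W \<Longrightarrow>
   trilin K H H H X (\<lambda>a b c. F (act U a x) (act V b y) (act W c z))"
  by (rule trilinI) (intro lin trilin_1[of K U V W X F] trilin_2[of K U V W X F] trilin_3[of K U V W X F] U V W; simp add: U V W)+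

lemma act3_cong:
  assumes "\<And>x y z. x \<in> carrier U \<Longrightarrow> y \<in> carrier V \<Longrightarrow> z \<in> carrier W \<Longrightarrow> F x y z = G x y z"
    "t \<in> carrier HHH" "x \<in> carrier U" "y \<in> carrier V" "z \<in> carrier W"
  shows "act3 U V W X F t x y z = act3 U V W X G t x y z"
  unfolding act3_def using assms U V W by (intro tlift3_H(3)) auto

context
  fixes F
  assumes F: "trilin K U V W X F"
begin

lemma act3_trilin [intro]: "t \<in> carrier HHH \<Longrightarrow> trilin K U V W X (act3 U V W X F t)"
  unfolding act3_def
  by (rule trilinI) (intro lin trilin_1[OF F] trilin_2[OF F] trilin_3[OF F] U V W X; simp add: U V W)+

lemma act3_klinear: "x \<in> carrier U \<Longrightarrow> y \<in> carrier V \<Longrightarrow> z \<in> carrier W \<Longrightarrow> klinear K HHH X (\<lambda>t. act3 U V W X F t x y z)"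
  unfolding act3_def by (intro tlift3_H(1) klinear_id trilin_act_H F X)

lemma act3_h3:
  "a \<in> carrier H \<Longrightarrow> b \<in> carrier H \<Longrightarrow> c \<in> carrier H \<Longrightarrow> x \<in> carrier U \<Longrightarrow> y \<in> carrier V \<Longrightarrow> z \<in> carrier W \<Longrightarrow>
   act3 U V W X F (h3 a b c) x y z = F (act U a x) (act V b y) (act W c z)"
  unfolding act3_def by (intro tlift3_H(5) trilin_act_H F X)

lemma act3_one: "x \<in> carrier U \<Longrightarrow> y \<in> carrier V \<Longrightarrow> z \<in> carrier W \<Longrightarrow> act3 U V W X F \<one>\<^bsub>HHH\<^esub> x y z = F x y z"
  by (simp add: tensor_one_H act3_h3 U V W)

lemma act3_linear:
  assumes "module K Z" "klinear K X Z g" "t \<in> carrier HHH" "x \<in> carrier U" "y \<in> carrier V" "z \<in> carrier W"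
  shows "g (act3 U V W X F t x y z) = act3 U V W Z (\<lambda>x y z. g (F x y z)) t x y z"
  unfolding act3_def using assms U V W by (intro tlift3_H(2) X) (auto intro!: trilin_closed[OF F])

lemma act3_tlift:
  assumes "t \<in> carrier HH" "x \<in> carrier U" "y \<in> carrier V" "z \<in> carrier W"
    "\<And>a b. a \<in> carrier H \<Longrightarrow> b \<in> carrier H \<Longrightarrow> f a b \<in> carrier HHH"
  shows "act3 U V W X F (tlift HHH f t) x y z = tlift X (\<lambda>a b. act3 U V W X F (f a b) x y z) t"
  using assms by (intro tlift_H(2)[where g="\<lambda>t. act3 U V W X F t x y z"] act3_klinear X) auto

lemma act3_tlift3:
  assumes "t \<in> carrier HHH" "x \<in> carrier U" "y \<in> carrier V" "z \<in> carrier W"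
    "\<And>a b c. a \<in> carrier H \<Longrightarrow> b \<in> carrier H \<Longrightarrow> c \<in> carrier H \<Longrightarrow> f a b c \<in> carrier HHH"
  shows "act3 U V W X F (tlift3 HHH f t) x y z = tlift3 X (\<lambda>a b c. act3 U V W X F (f a b c) x y z) t"
  using assms by (intro tlift3_H(2)[where g="\<lambda>t. act3 U V W X F t x y z"] act3_klinear X) auto

lemma act3_mult:
  assumes st: "s \<in> carrier HHH" "t \<in> carrier HHH" and xyz: "x \<in> carrier U" "y \<in> carrier V" "z \<in> carrier W"
  shows "act3 U V W X F (s \<otimes>\<^bsub>HHH\<^esub> t) x y z = act3 U V W X (act3 U V W X F s) t x y z"
proof (rule tlift3_H(6)[OF X _ _ _ st(2)])
  have b: "trilin K U V W X (act3 U V W X F s)" if "s \<in> carrier HHH" for s using that by blast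
  show "klinear K HHH X (\<lambda>t. act3 U V W X F (s \<otimes>\<^bsub>HHH\<^esub> t) x y z)"
    by (rule klinear_comp[OF act3_klinear[OF xyz] kalg_right[OF kalg_HHH st(1) klinear_id]])
  show "klinear K HHH X (\<lambda>t. act3 U V W X (act3 U V W X F s) t x y z)"
    unfolding act3_def[of U V W X "act3 U V W X F s"] by (intro tlift3_H(1) klinear_id trilin_act_H b X xyz st)
  fix a b c assume abc: "a \<in> carrier H" "b \<in> carrier H" "c \<in> carrier H"
  have e: "act3 U V W X (act3 U V W X F s) (h3 a b c) x y z = act3 U V W X F s (act U a x) (act V b y) (act W c z)"
    if "s \<in> carrier HHH" for s
    unfolding act3_def[of U V W X "act3 U V W X F s"] by (intro tlift3_H(5) trilin_act_H b X xyz that abc)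
  show "act3 U V W X F (s \<otimes>\<^bsub>HHH\<^esub> h3 a b c) x y z = act3 U V W X (act3 U V W X F s) (h3 a b c) x y z"
  proof (rule tlift3_H(6)[OF X _ _ _ st(1)])
    show "klinear K HHH X (\<lambda>s. act3 U V W X F (s \<otimes>\<^bsub>HHH\<^esub> h3 a b c) x y z)"
      by (rule klinear_comp[OF act3_klinear[OF xyz] kalg_left[OF kalg_HHH klinear_id]]) (simp add: abc)
    show "klinear K HHH X (\<lambda>s. act3 U V W X (act3 U V W X F s) (h3 a b c) x y z)"
      by (subst klinear_cong[OF e]) (simp_all add: act3_klinear xyz U V W abc)
  qed (simp add: abc xyz e tensor_mult_H act3_h3 act_mult U V W)
qed

end
end

context
  fixes U :: "('a, 'b, 'u, 'p) hmod_scheme" and V :: "('a, 'b, 'v, 'q) hmod_scheme" and W :: "('a, 'b, 'w, 'r) hmod_scheme"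
    and Y :: "('a, 'b, 'y, 's) hmod_scheme" and X :: "('a, 'x, 'xx) module_scheme"
  assumes U: "umodule U" and V: "umodule V" and W: "umodule W" and Y: "umodule Y" and X: "module K X"
begin

lemma quadlin_act_H:
  "quadlin K U V W Y X F \<Longrightarrow> x \<in> carrier U \<Longrightarrow> y \<in> carrier V \<Longrightarrow> z \<in> carrier W \<Longrightarrow> w \<in> carrier Y \<Longrightarrow>
   quadlin K H H H H X (\<lambda>a b c d. F (act U a x) (act V b y) (act W c z) (act Y d w))"
  by (rule quadlinI) (intro lin quadlin_1[of K U V W Y X F] quadlin_2[of K U V W Y X F] quadlin_3[of K U V W Y X F]
      quadlin_4[of K U V W Y X F] U V W Y; simp add: U V W Y)+

context
  fixes F
  assumes F: "quadlin K U V W Y X F"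
begin

lemma act4_quadlin [intro]: "t \<in> carrier HHHH \<Longrightarrow> quadlin K U V W Y X (act4 U V W Y X F t)"
  unfolding act4_def
  by (rule quadlinI) (intro lin quadlin_1[OF F] quadlin_2[OF F] quadlin_3[OF F] quadlin_4[OF F] U V W Y X; simp add: U V W Y)+

lemma act4_klinear: "x \<in> carrier U \<Longrightarrow> y \<in> carrier V \<Longrightarrow> z \<in> carrier W \<Longrightarrow> w \<in> carrier Y \<Longrightarrow>
    klinear K HHHH X (\<lambda>t. act4 U V W Y X F t x y z w)"
  unfolding act4_def by (intro tlift4_H(1) klinear_id quadlin_act_H F X)

lemma act4_h4:
  "a \<in> carrier H \<Longrightarrow> b \<in> carrier H \<Longrightarrow> c \<in> carrier H \<Longrightarrow> d \<in> carrier H \<Longrightarrow>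
   x \<in> carrier U \<Longrightarrow> y \<in> carrier V \<Longrightarrow> z \<in> carrier W \<Longrightarrow> w \<in> carrier Y \<Longrightarrow>
   act4 U V W Y X F (h4 a b c d) x y z w = F (act U a x) (act V b y) (act W c z) (act Y d w)"
  unfolding act4_def by (intro tlift4_H(3) quadlin_act_H F X)

lemma act4_tlift:
  assumes "t \<in> carrier HH" "x \<in> carrier U" "y \<in> carrier V" "z \<in> carrier W" "w \<in> carrier Y"
    "\<And>a b. a \<in> carrier H \<Longrightarrow> b \<in> carrier H \<Longrightarrow> f a b \<in> carrier HHHH"
  shows "act4 U V W Y X F (tlift HHHH f t) x y z w = tlift X (\<lambda>a b. act4 U V W Y X F (f a b) x y z w) t"
  using assms by (intro tlift_H(2)[where g="\<lambda>t. act4 U V W Y X F t x y z w"] act4_klinear X) auto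

lemma act4_tlift3:
  assumes "t \<in> carrier HHH" "x \<in> carrier U" "y \<in> carrier V" "z \<in> carrier W" "w \<in> carrier Y"
    "\<And>a b c. a \<in> carrier H \<Longrightarrow> b \<in> carrier H \<Longrightarrow> c \<in> carrier H \<Longrightarrow> f a b c \<in> carrier HHHH"
  shows "act4 U V W Y X F (tlift3 HHHH f t) x y z w = tlift3 X (\<lambda>a b c. act4 U V W Y X F (f a b c) x y z w) t"
  using assms by (intro tlift3_H(2)[where g="\<lambda>t. act4 U V W Y X F t x y z w"] act4_klinear X) auto

lemma act4_mult:
  assumes st: "s \<in> carrier HHHH" "t \<in> carrier HHHH" and xyz: "x \<in> carrier U" "y \<in> carrier V" "z \<in> carrier W" "w \<in> carrier Y"
  shows "act4 U V W Y X F (s \<otimes>\<^bsub>HHHH\<^esub> t) x y z w = act4 U V W Y X (act4 U V W Y X F s) t x y z w"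
proof (rule tlift4_H(4)[OF X _ _ _ st(2)])
  have b: "quadlin K U V W Y X (act4 U V W Y X F s)" if "s \<in> carrier HHHH" for s using that by blast
  show "klinear K HHHH X (\<lambda>t. act4 U V W Y X F (s \<otimes>\<^bsub>HHHH\<^esub> t) x y z w)"
    by (rule klinear_comp[OF act4_klinear[OF xyz] kalg_right[OF kalg_HHHH st(1) klinear_id]])
  show "klinear K HHHH X (\<lambda>t. act4 U V W Y X (act4 U V W Y X F s) t x y z w)"
    unfolding act4_def[of U V W Y X "act4 U V W Y X F s"] by (intro tlift4_H(1) klinear_id quadlin_act_H b X xyz st)
  fix a b c d assume abc: "a \<in> carrier H" "b \<in> carrier H" "c \<in> carrier H" "d \<in> carrier H"
  have e: "act4 U V W Y X (act4 U V W Y X F s) (h4 a b c d) x y z w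
      = act4 U V W Y X F s (act U a x) (act V b y) (act W c z) (act Y d w)"
    if "s \<in> carrier HHHH" for s
    unfolding act4_def[of U V W Y X "act4 U V W Y X F s"] by (intro tlift4_H(3) quadlin_act_H b X xyz that abc)
  show "act4 U V W Y X F (s \<otimes>\<^bsub>HHHH\<^esub> h4 a b c d) x y z w = act4 U V W Y X (act4 U V W Y X F s) (h4 a b c d) x y z w"
  proof (rule tlift4_H(4)[OF X _ _ _ st(1)])
    show "klinear K HHHH X (\<lambda>s. act4 U V W Y X F (s \<otimes>\<^bsub>HHHH\<^esub> h4 a b c d) x y z w)"
      by (rule klinear_comp[OF act4_klinear[OF xyz] kalg_left[OF kalg_HHHH klinear_id]]) (simp add: abc)
    show "klinear K HHHH X (\<lambda>s. act4 U V W Y X (act4 U V W Y X F s) (h4 a b c d) x y z w)"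
      by (subst klinear_cong[OF e]) (simp_all add: act4_klinear xyz U V W Y abc)
  qed (simp add: abc xyz e tensor_mult_H act4_h4 act_mult U V W Y)
qed

end
end

end

section \<open>Trivial and regular modules, and the action on a tensor product\<close>

lemma module_transfer:
  assumes "module K X" "carrier Y = carrier X" "zero Y = zero X" "add Y = add X" "smult Y = smult X"
  shows "module K Y"
proof -
  interpret X: module K X by fact
  have "abelian_group Y"
    by (rule abelian_groupI) (auto simp: assms X.add.m_ac intro: X.add.m_closed bexI[of _ "\<ominus>\<^bsub>X\<^esub> x" for x] X.l_neg)
  then show ?thesis
    by (intro moduleI) (auto simp: assms X.is_cring X.smult_l_distr X.smult_r_distr X.smult_assoc1)
qed

context hopf_data
begin

definition trivial :: "('k, 'h, 'v, 'p) hmod_scheme \<Rightarrow> bool" where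
  "trivial V \<longleftrightarrow> umodule V \<and> (\<forall>h\<in>carrier H. \<forall>v\<in>carrier V. act V h v = \<epsilon> h \<odot>\<^bsub>V\<^esub> v)"

text \<open>H acting on itself by left multiplication. A formula with variables inside S or next to
  \<alpha> or \<beta> becomes the value at units of a multilinear map with slots in
  \<open>regular\<close>, so that the calculus of actions applies to it. The grading is a
  dummy.\<close>

definition regular :: "('k, 'h, 'h) hmod" where
  "regular = \<lparr>carrier = carrier H, mult = mult H, one = one H, zero = zero H, add = add H,
     smult = smult H, act = mult H, gr = \<lambda>n. {}\<rparr>"

text \<open>The module \<open>X\<close> with H acting through the counit. It is the target that
  turns an invariance property, such as the axiom on \<alpha>, into an equivariance
  statement.\<close>

definition counit_mod :: "('k, 'x, 'p) module_scheme \<Rightarrow> ('k, 'h, 'x) hmod" where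
  "counit_mod X = \<lparr>carrier = carrier X, mult = mult X, one = one X, zero = zero X, add = add X,
     smult = smult X, act = \<lambda>h x. \<epsilon> h \<odot>\<^bsub>X\<^esub> x, gr = \<lambda>n. {}\<rparr>"

lemma htensor_simps [simp]:
  "carrier (V \<boxtimes> W) = carrier (tensor K V W)" "zero (V \<boxtimes> W) = zero (tensor K V W)"
  "add (V \<boxtimes> W) = add (tensor K V W)" "smult (V \<boxtimes> W) = smult (tensor K V W)"
  by (simp_all add: htensor_def Let_def)

lemma klinear_htensor [simp]:
  "klinear K (V \<boxtimes> W) X f = klinear K (tensor K V W) X f" "klinear K X (V \<boxtimes> W) g = klinear K X (tensor K V W) g"
  by (simp_all add: klinear_def)

lemma tlift_htensor [simp]:
  "tlift (V \<boxtimes> W) f t = tlift (tensor K V W) f t" "tlift3 (V \<boxtimes> W) f3 t3 = tlift3 (tensor K V W) f3 t3"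
  by (simp_all add: tlift_def tlift3_def)

lemma act_htensor:
  "act (V \<boxtimes> W) h t = tlift (tensor K V W) (act2 V W (tensor K V W) (pure V W) (\<Delta> h)) t"
  by (simp add: htensor_def Let_def act2_def tlift_def)

lemma bilin_htensor [simp]: "bilin K U V (W \<boxtimes> Y) f = bilin K U V (tensor K W Y) f"
  by (simp add: bilin_def)

lemma act2_htensor [simp]: "act2 U V (W \<boxtimes> Y) f t x y = act2 U V (tensor K W Y) f t x y"
  by (simp add: act2_def)

lemma regular_simps [simp]:
  "carrier regular = carrier H" "zero regular = zero H" "add regular = add H" "smult regular = smult H" "act regular = mult H"
  by (simp_all add: regular_def)

lemma counit_mod_simps [simp]:
  "carrier (counit_mod X) = carrier X" "zero (counit_mod X) = zero X" "add (counit_mod X) = add X"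
  "smult (counit_mod X) = smult X" "act (counit_mod X) = (\<lambda>h x. \<epsilon> h \<odot>\<^bsub>X\<^esub> x)"
  by (simp_all add: counit_mod_def)

lemma unit_obj_simps [simp]:
  "carrier unit_obj = carrier K" "zero unit_obj = zero K" "add unit_obj = add K"
  "smult unit_obj = mult K" "act unit_obj = (\<lambda>h c. \<epsilon> h \<otimes>\<^bsub>K\<^esub> c)"
  by (simp_all add: unit_obj_def)

lemma klinear_regular [simp]:
  "klinear K regular X f = klinear K H X f" "klinear K X regular g = klinear K X H g"
  by (simp_all add: klinear_def)

lemma klinear_counit_mod [simp]:
  "klinear K (counit_mod Y) X f = klinear K Y X f" "klinear K X (counit_mod Y) g = klinear K X Y g"
  by (simp_all add: klinear_def)

lemma trivial_umodule [simp, intro]: "trivial V \<Longrightarrow> umodule V"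
  by (simp add: trivial_def)

lemma tensor_umodule_module [simp, intro]: "umodule V \<Longrightarrow> umodule W \<Longrightarrow> module K (tensor K V W)"
  by (intro tensor_module) auto

lemma pure_closed_h [simp]: "v \<in> carrier V \<Longrightarrow> w \<in> carrier W \<Longrightarrow> pure V W v w \<in> carrier (tensor K V W)"
  by (rule pure_closed)

lemma pure_bilin_h [simp, intro]: "umodule V \<Longrightarrow> umodule W \<Longrightarrow> bilin K V W (tensor K V W) (pure V W)"
  by (intro pure_bilin) auto

lemma tlift_pure_h [simp]:
  "umodule V \<Longrightarrow> umodule W \<Longrightarrow> module K X \<Longrightarrow> bilin K V W X f \<Longrightarrow> v \<in> carrier V \<Longrightarrow> w \<in> carrier W
    \<Longrightarrow> tlift X f (pure V W v w) = f v w"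
  by (intro tlift_pure) auto

lemma klinear_pure_l [lin]:
  "umodule V \<Longrightarrow> umodule W \<Longrightarrow> klinear K U V f \<Longrightarrow> w \<in> carrier W \<Longrightarrow> klinear K U (tensor K V W) (\<lambda>u. pure V W (f u) w)"
  by (rule bilin_left[OF pure_bilin_h])

lemma klinear_pure_r [lin]:
  "umodule V \<Longrightarrow> umodule W \<Longrightarrow> v \<in> carrier V \<Longrightarrow> klinear K U W f \<Longrightarrow> klinear K U (tensor K V W) (\<lambda>u. pure V W v (f u))"
  by (rule bilin_right[OF pure_bilin_h])

end

context quasi_bialgebra
begin

lemma umoduleI:
  assumes "module K V" "bilin K H V V (act V)"
    "\<And>h h' v. h \<in> carrier H \<Longrightarrow> h' \<in> carrier H \<Longrightarrow> v \<in> carrier V \<Longrightarrow> act V (h \<otimes>\<^bsub>H\<^esub> h') v = act V h (act V h' v)"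
    "\<And>v. v \<in> carrier V \<Longrightarrow> act V \<one>\<^bsub>H\<^esub> v = v"
  shows "umodule V"
  using assms unfolding umodule_def by auto

lemma umodule_regular [simp, intro]: "umodule regular"
proof (rule umoduleI)
  show "module K regular" by (rule module_transfer[OF H_modules(1)]) simp_all
  show "bilin K H regular regular (act regular)" by (rule bilinI; simp; intro lin; simp)
qed (simp_all add: H_assoc)

lemma trivial_counit_mod [intro]:
  assumes "module K X" shows "trivial (counit_mod X)"
proof -
  interpret X: module K X by fact
  have "umodule (counit_mod X)"
  proof (rule umoduleI)
    show "module K (counit_mod X)" by (rule module_transfer[OF assms]) simp_all
    show "bilin K H (counit_mod X) (counit_mod X) (act (counit_mod X))"
      by (rule bilinI; simp; intro lin assms; simp)
  qed (simp_all add: counit_mult X.smult_assoc1)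
  then show ?thesis by (simp add: trivial_def)
qed

lemma trivial_unit_obj [simp, intro]: "trivial unit_obj"
proof -
  interpret K: cring K by (fact K_cring)
  have m: "module K unit_obj"
  proof (rule moduleI)
    show "abelian_group unit_obj"
      by (rule abelian_groupI) (auto simp: K.add.m_ac intro: bexI[of _ "\<ominus>\<^bsub>K\<^esub> x" for x] K.l_neg)
  qed (auto simp: K.is_cring K.l_distr K.r_distr K.m_assoc)
  have "umodule unit_obj"
  proof (rule umoduleI[OF m])
    show "bilin K H unit_obj unit_obj (act unit_obj)"
      using klinear_counit[OF m klinear_id] klinear_smult_right[OF m klinear_id counit_closed]
      by (intro bilinI) (simp_all add: klinear_def)
  qed (simp_all add: counit_mult K.m_assoc)
  then show ?thesis by (simp add: trivial_def)
qed

subsection \<open>Merging two tensor factors along an equivariant map\<close>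

text \<open>On pure tensors the action is that of \<Delta>(h) on the map \<open>pure V W\<close>.
  Multiplicativity of \<Delta> together with the right action law then gives compatibility with
  products in H.\<close>

lemma umodule_tensor [simp, intro]:
  assumes V: "umodule V" and W: "umodule W"
  shows "umodule (V \<boxtimes> W)" and pure_equivar [intro]: "equivar V W (V \<boxtimes> W) (pure V W)"
proof -
  let ?T = "tensor K V W"
  have m: "module K ?T" using V W by simp
  have p: "bilin K V W ?T (pure V W)" using V W by blast
  have b2: "bilin K V W ?T (act2 V W ?T (pure V W) t)" if "t \<in> carrier HH" for t
    using that by (intro act2_bilin V W m p)
  have e: "act (V \<boxtimes> W) h (pure V W v w) = act2 V W ?T (pure V W) (\<Delta> h) v w"
    if "h \<in> carrier H" "v \<in> carrier V" "w \<in> carrier W" for h v w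
    using that by (simp add: act_htensor V W m b2)
  have l: "klinear K ?T ?T (\<lambda>t. act (V \<boxtimes> W) h t)" if "h \<in> carrier H" for h
    unfolding act_htensor using that by (intro klinear_tlift[OF umodule_module[OF V] umodule_module[OF W] m b2] klinear_id) auto
  show "umodule (V \<boxtimes> W)"
  proof (rule umoduleI)
    show "module K (V \<boxtimes> W)" by (rule module_transfer[OF m]) simp_all
    show "bilin K H (V \<boxtimes> W) (V \<boxtimes> W) (act (V \<boxtimes> W))"
    proof (rule bilinI)
      fix t assume t: "t \<in> carrier (V \<boxtimes> W)"
      show "klinear K H (V \<boxtimes> W) (\<lambda>h. act (V \<boxtimes> W) h t)"
        unfolding act_htensor using t
        by (simp, intro klinear_tlift_param[OF umodule_module[OF V] umodule_module[OF W] m]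
            klinear_comp[OF act2_klinear[OF V W m p]] comult_linear) auto
    qed (simp add: l)
    fix h h' t assume h: "h \<in> carrier H" "h' \<in> carrier H" and "t \<in> carrier (V \<boxtimes> W)"
    then have t: "t \<in> carrier ?T" by simp
    show "act (V \<boxtimes> W) (h \<otimes>\<^bsub>H\<^esub> h') t = act (V \<boxtimes> W) h (act (V \<boxtimes> W) h' t)"
    proof (rule tensor_ext[OF umodule_module[OF V] umodule_module[OF W] m _ _ _ t])
      show "klinear K ?T ?T (\<lambda>t. act (V \<boxtimes> W) (h \<otimes>\<^bsub>H\<^esub> h') t)" using h by (simp add: l)
      show "klinear K ?T ?T (\<lambda>t. act (V \<boxtimes> W) h (act (V \<boxtimes> W) h' t))"
        by (rule klinear_comp[OF l l]) (use h in auto)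
      fix v w assume vw: "v \<in> carrier V" "w \<in> carrier W"
      have "act (V \<boxtimes> W) h (act (V \<boxtimes> W) h' (pure V W v w))
          = act2 V W ?T (\<lambda>v w. act (V \<boxtimes> W) h (pure V W v w)) (\<Delta> h') v w"
        using h vw by (simp add: e act2_linear[OF V W m p m l])
      also have "\<dots> = act2 V W ?T (act2 V W ?T (pure V W) (\<Delta> h)) (\<Delta> h') v w"
        using h vw by (intro act2_cong[OF V W m]) (simp_all add: e)
      finally show "act (V \<boxtimes> W) (h \<otimes>\<^bsub>H\<^esub> h') (pure V W v w) = act (V \<boxtimes> W) h (act (V \<boxtimes> W) h' (pure V W v w))"
        using h vw by (simp add: e comult_mult act2_mult[OF V W m p])
    qed
  next
    fix t assume "t \<in> carrier (V \<boxtimes> W)"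
    then have t: "t \<in> carrier ?T" by simp
    show "act (V \<boxtimes> W) \<one>\<^bsub>H\<^esub> t = t"
      by (rule tensor_ext[OF umodule_module[OF V] umodule_module[OF W] m _ _ _ t])
        (simp_all add: l klinear_id e comult_one act2_one[OF V W m p])
  qed
  show "equivar V W (V \<boxtimes> W) (pure V W)"
    unfolding equivar_def using p by (simp add: e)
qed

text \<open>If two arguments enter only through an equivariant \<open>B\<close>, the coproduct on
  their legs is absorbed: by equivariance, the two halves acting inside \<open>B\<close> are one
  element acting on its value. The merging lemmas are the means of trading coproducts of legs for
  actions on fewer arguments.\<close>

lemma act3_merge_left:
  assumes U: "umodule U" "umodule V" "umodule W" "umodule M" and X: "module K X"
    and F: "bilin K M W X F" and B: "equivar U V M B" and t: "t \<in> carrier HH"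
    and xyz: "x \<in> carrier U" "y \<in> carrier V" "z \<in> carrier W"
  shows "act3 U V W X (\<lambda>x y z. F (B x y) z) (\<Delta>_id t) x y z = act2 M W X F t (B x y) z"
proof -
  note b = equivar_bilin[OF B]
  note cl = bilin_closed[OF b] bilin_closed[OF F]
  have G: "trilin K U V W X (\<lambda>x y z. F (B x y) z)"
    by (rule trilinI) (intro lin bilin_left[OF F] bilin_right[OF F] bilin_left[OF b] bilin_right[OF b] cl; assumption)+
  have "act3 U V W X (\<lambda>x y z. F (B x y) z) (\<Delta>_id t) x y z
      = tlift X (\<lambda>a c. tlift X (\<lambda>a1 a2. F (B (act U a1 x) (act V a2 y)) (act W c z)) (\<Delta> a)) t"
    using t xyz U by (simp add: act3_tlift[OF U(1-3) X G] act3_h3[OF U(1-3) X G] tlift_H(4) cong: tlift_H(3))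
  also have "\<dots> = act2 M W X F t (B x y) z"
    unfolding act2_def
  proof (rule tlift_H(3)[OF t])
    fix a c assume ac: "a \<in> carrier H" "c \<in> carrier H"
    show "tlift X (\<lambda>a1 a2. F (B (act U a1 x) (act V a2 y)) (act W c z)) (\<Delta> a) = F (act M a (B x y)) (act W c z)"
      using ac xyz U unfolding equivar_act[OF B ac(1) xyz(1,2)] act2_def
      by (intro tlift_H(2)[where g="\<lambda>m. F m (act W c z)", symmetric] bilin_left[OF F] klinear_id X) (auto intro: cl)
  qed
  finally show ?thesis .
qed

lemma act3_merge_right:
  assumes U: "umodule U" "umodule V" "umodule W" "umodule M" and X: "module K X"
    and F: "bilin K U M X F" and B: "equivar V W M B" and t: "t \<in> carrier HH"
    and xyz: "x \<in> carrier U" "y \<in> carrier V" "z \<in> carrier W"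
  shows "act3 U V W X (\<lambda>x y z. F x (B y z)) (id_\<Delta> t) x y z = act2 U M X F t x (B y z)"
proof -
  note b = equivar_bilin[OF B]
  note cl = bilin_closed[OF b] bilin_closed[OF F]
  have G: "trilin K U V W X (\<lambda>x y z. F x (B y z))"
    by (rule trilinI) (intro lin bilin_left[OF F] bilin_right[OF F] bilin_left[OF b] bilin_right[OF b] cl; assumption)+
  have "act3 U V W X (\<lambda>x y z. F x (B y z)) (id_\<Delta> t) x y z
      = tlift X (\<lambda>a b. tlift X (\<lambda>b1 b2. F (act U a x) (B (act V b1 y) (act W b2 z))) (\<Delta> b)) t"
    using t xyz U by (simp add: act3_tlift[OF U(1-3) X G] act3_h3[OF U(1-3) X G] tlift_H(4) cong: tlift_H(3))
  also have "\<dots> = act2 U M X F t x (B y z)"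
    unfolding act2_def
  proof (rule tlift_H(3)[OF t])
    fix a c assume ac: "a \<in> carrier H" "c \<in> carrier H"
    show "tlift X (\<lambda>b1 b2. F (act U a x) (B (act V b1 y) (act W b2 z))) (\<Delta> c) = F (act U a x) (act M c (B y z))"
      using ac xyz U unfolding equivar_act[OF B ac(2) xyz(2,3)] act2_def
      by (intro tlift_H(2)[where g="\<lambda>m. F (act U a x) m", symmetric] bilin_right[OF F] klinear_id X) (auto intro: cl)
  qed
  finally show ?thesis .
qed

lemma legs_closed [simp]:
  "t \<in> carrier HHH \<Longrightarrow> one_tens t \<in> carrier HHHH" "t \<in> carrier HHH \<Longrightarrow> tens_one t \<in> carrier HHHH"
  "t \<in> carrier HHH \<Longrightarrow> \<Delta>_id_id t \<in> carrier HHHH" "t \<in> carrier HHH \<Longrightarrow> id_\<Delta>_id t \<in> carrier HHHH"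
  "t \<in> carrier HHH \<Longrightarrow> id_id_\<Delta> t \<in> carrier HHHH"
  by (auto intro!: tlift3_H(4) tlift_H(4))

context
  fixes U :: "('a, 'b, 'u, 'p) hmod_scheme" and V :: "('a, 'b, 'v, 'q) hmod_scheme" and W :: "('a, 'b, 'w, 'r) hmod_scheme"
    and Y :: "('a, 'b, 'y, 's) hmod_scheme" and X :: "('a, 'x, 'xx) module_scheme"
  assumes U: "umodule U" "umodule V" "umodule W" "umodule Y" and X: "module K X"
begin

lemma act4_cong:
  assumes "\<And>x y z w. x \<in> carrier U \<Longrightarrow> y \<in> carrier V \<Longrightarrow> z \<in> carrier W \<Longrightarrow> w \<in> carrier Y \<Longrightarrow> F x y z w = G x y z w"
    "t \<in> carrier HHHH" "x \<in> carrier U" "y \<in> carrier V" "z \<in> carrier W" "w \<in> carrier Y"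
  shows "act4 U V W Y X F t x y z w = act4 U V W Y X G t x y z w"
  unfolding act4_def tlift4_def using assms U
  by (intro tlift_cong[OF H_modules(1,3)] tlift3_H(3)) auto

lemma act4_one_tens:
  assumes F: "quadlin K U V W Y X F" and t: "t \<in> carrier HHH"
    and xyz: "x \<in> carrier U" "y \<in> carrier V" "z \<in> carrier W" "w \<in> carrier Y"
  shows "act4 U V W Y X F (one_tens t) x y z w = act3 V W Y X (F x) t y z w"
  using assms U by (simp add: act4_tlift3[OF U X F] act4_h4[OF U X F] act3_def cong: tlift3_H(3))

lemma act4_tens_one:
  assumes F: "quadlin K U V W Y X F" and t: "t \<in> carrier HHH"
    and xyz: "x \<in> carrier U" "y \<in> carrier V" "z \<in> carrier W" "w \<in> carrier Y"
  shows "act4 U V W Y X F (tens_one t) x y z w = act3 U V W X (\<lambda>x y z. F x y z w) t x y z"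
  using assms U by (simp add: act4_tlift3[OF U X F] act4_h4[OF U X F] act3_def cong: tlift3_H(3))

text \<open>The pentagon as an identity of operators on \<open>G\<close>. By the right action law
  the leftmost factor of each product becomes the innermost operator.\<close>

lemma act4_pentagon:
  assumes G: "quadlin K U V W Y X G"
    and xyz: "x \<in> carrier U" "y \<in> carrier V" "z \<in> carrier W" "w \<in> carrier Y"
  shows "act4 U V W Y X (act4 U V W Y X (act4 U V W Y X G (one_tens \<phi>)) (id_\<Delta>_id \<phi>)) (tens_one \<phi>) x y z w
    = act4 U V W Y X (act4 U V W Y X G (id_id_\<Delta> \<phi>)) (\<Delta>_id_id \<phi>) x y z w"
proof -
  note p = phi_closed(1)
  note c = legs_closed[OF p]
  have "act4 U V W Y X (act4 U V W Y X (act4 U V W Y X G (one_tens \<phi>)) (id_\<Delta>_id \<phi>)) (tens_one \<phi>) x y z w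
      = act4 U V W Y X (act4 U V W Y X G (one_tens \<phi> \<otimes>\<^bsub>HHHH\<^esub> id_\<Delta>_id \<phi>)) (tens_one \<phi>) x y z w"
    using xyz by (intro act4_cong) (simp_all add: act4_mult[OF U X G c(1,4)] c)
  also have "\<dots> = act4 U V W Y X G (one_tens \<phi> \<otimes>\<^bsub>HHHH\<^esub> id_\<Delta>_id \<phi> \<otimes>\<^bsub>HHHH\<^esub> tens_one \<phi>) x y z w"
    by (rule act4_mult[OF U X G kalg_closed[OF kalg_HHHH c(1,4)] c(2) xyz, symmetric])
  also have "\<dots> = act4 U V W Y X G (id_id_\<Delta> \<phi> \<otimes>\<^bsub>HHHH\<^esub> \<Delta>_id_id \<phi>) x y z w"
    by (simp only: pentagon)
  also have "\<dots> = act4 U V W Y X (act4 U V W Y X G (id_id_\<Delta> \<phi>)) (\<Delta>_id_id \<phi>) x y z w"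
    by (rule act4_mult[OF U X G c(5,3) xyz])
  finally show ?thesis .
qed

end

context
  fixes U :: "('a, 'b, 'u, 'p) hmod_scheme" and V :: "('a, 'b, 'v, 'q) hmod_scheme" and W :: "('a, 'b, 'w, 'r) hmod_scheme"
    and Y :: "('a, 'b, 'y, 's) hmod_scheme" and M :: "('a, 'b, 'm, 't) hmod_scheme" and X :: "('a, 'x, 'xx) module_scheme"
  assumes U: "umodule U" "umodule V" "umodule W" "umodule Y" and M: "umodule M" and X: "module K X"
begin

lemma act4_merge_1:
  assumes F: "trilin K M W Y X F" and B: "equivar U V M B" and t: "t \<in> carrier HHH"
    and xyz: "x \<in> carrier U" "y \<in> carrier V" "z \<in> carrier W" "w \<in> carrier Y"
  shows "act4 U V W Y X (\<lambda>x y z w. F (B x y) z w) (\<Delta>_id_id t) x y z w = act3 M W Y X F t (B x y) z w"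
proof -
  note b = equivar_bilin[OF B]
  note cl = bilin_closed[OF b] trilin_closed[OF F]
  have G: "quadlin K U V W Y X (\<lambda>x y z w. F (B x y) z w)"
    by (rule quadlinI) (intro lin trilin_1[OF F] trilin_2[OF F] trilin_3[OF F] bilin_left[OF b] bilin_right[OF b] cl; assumption)+
  have "act4 U V W Y X (\<lambda>x y z w. F (B x y) z w) (\<Delta>_id_id t) x y z w
      = tlift3 X (\<lambda>a c d. tlift X (\<lambda>a1 a2. F (B (act U a1 x) (act V a2 y)) (act W c z) (act Y d w)) (\<Delta> a)) t"
    using t xyz U by (simp add: act4_tlift3[OF U X G] act4_tlift[OF U X G] act4_h4[OF U X G] tlift_H(4) cong: tlift3_H(3) tlift_H(3))
  also have "\<dots> = act3 M W Y X F t (B x y) z w"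
    unfolding act3_def
  proof (rule tlift3_H(3)[OF t])
    fix a c d assume ac: "a \<in> carrier H" "c \<in> carrier H" "d \<in> carrier H"
    show "tlift X (\<lambda>a1 a2. F (B (act U a1 x) (act V a2 y)) (act W c z) (act Y d w)) (\<Delta> a)
        = F (act M a (B x y)) (act W c z) (act Y d w)"
      using ac xyz U unfolding equivar_act[OF B ac(1) xyz(1,2)] act2_def
      by (intro tlift_H(2)[where g="\<lambda>m. F m (act W c z) (act Y d w)", symmetric] trilin_1[OF F] klinear_id X)
        (auto intro: cl M)
  qed
  finally show ?thesis .
qed

lemma act4_merge_2:
  assumes F: "trilin K U M Y X F" and B: "equivar V W M B" and t: "t \<in> carrier HHH"
    and xyz: "x \<in> carrier U" "y \<in> carrier V" "z \<in> carrier W" "w \<in> carrier Y"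
  shows "act4 U V W Y X (\<lambda>x y z w. F x (B y z) w) (id_\<Delta>_id t) x y z w = act3 U M Y X F t x (B y z) w"
proof -
  note b = equivar_bilin[OF B]
  note cl = bilin_closed[OF b] trilin_closed[OF F]
  have G: "quadlin K U V W Y X (\<lambda>x y z w. F x (B y z) w)"
    by (rule quadlinI) (intro lin trilin_1[OF F] trilin_2[OF F] trilin_3[OF F] bilin_left[OF b] bilin_right[OF b] cl; assumption)+
  have "act4 U V W Y X (\<lambda>x y z w. F x (B y z) w) (id_\<Delta>_id t) x y z w
      = tlift3 X (\<lambda>a c d. tlift X (\<lambda>c1 c2. F (act U a x) (B (act V c1 y) (act W c2 z)) (act Y d w)) (\<Delta> c)) t"
    using t xyz U by (simp add: act4_tlift3[OF U X G] act4_tlift[OF U X G] act4_h4[OF U X G] tlift_H(4) cong: tlift3_H(3) tlift_H(3))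
  also have "\<dots> = act3 U M Y X F t x (B y z) w"
    unfolding act3_def
  proof (rule tlift3_H(3)[OF t])
    fix a c d assume ac: "a \<in> carrier H" "c \<in> carrier H" "d \<in> carrier H"
    show "tlift X (\<lambda>c1 c2. F (act U a x) (B (act V c1 y) (act W c2 z)) (act Y d w)) (\<Delta> c)
        = F (act U a x) (act M c (B y z)) (act Y d w)"
      using ac xyz U unfolding equivar_act[OF B ac(2) xyz(2,3)] act2_def
      by (intro tlift_H(2)[where g="\<lambda>m. F (act U a x) m (act Y d w)", symmetric] trilin_2[OF F] klinear_id X)
        (auto intro: cl M)
  qed
  finally show ?thesis .
qed

lemma act4_merge_3:
  assumes F: "trilin K U V M X F" and B: "equivar W Y M B" and t: "t \<in> carrier HHH"
    and xyz: "x \<in> carrier U" "y \<in> carrier V" "z \<in> carrier W" "w \<in> carrier Y"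
  shows "act4 U V W Y X (\<lambda>x y z w. F x y (B z w)) (id_id_\<Delta> t) x y z w = act3 U V M X F t x y (B z w)"
proof -
  note b = equivar_bilin[OF B]
  note cl = bilin_closed[OF b] trilin_closed[OF F]
  have G: "quadlin K U V W Y X (\<lambda>x y z w. F x y (B z w))"
    by (rule quadlinI) (intro lin trilin_1[OF F] trilin_2[OF F] trilin_3[OF F] bilin_left[OF b] bilin_right[OF b] cl; assumption)+
  have "act4 U V W Y X (\<lambda>x y z w. F x y (B z w)) (id_id_\<Delta> t) x y z w
      = tlift3 X (\<lambda>a c d. tlift X (\<lambda>d1 d2. F (act U a x) (act V c y) (B (act W d1 z) (act Y d2 w))) (\<Delta> d)) t"
    using t xyz U by (simp add: act4_tlift3[OF U X G] act4_tlift[OF U X G] act4_h4[OF U X G] tlift_H(4) cong: tlift3_H(3) tlift_H(3))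
  also have "\<dots> = act3 U V M X F t x y (B z w)"
    unfolding act3_def
  proof (rule tlift3_H(3)[OF t])
    fix a c d assume ac: "a \<in> carrier H" "c \<in> carrier H" "d \<in> carrier H"
    show "tlift X (\<lambda>d1 d2. F (act U a x) (act V c y) (B (act W d1 z) (act Y d2 w))) (\<Delta> d)
        = F (act U a x) (act V c y) (act M d (B z w))"
      using ac xyz U unfolding equivar_act[OF B ac(3) xyz(3,4)] act2_def
      by (intro tlift_H(2)[where g="\<lambda>m. F (act U a x) (act V c y) m", symmetric] trilin_3[OF F] klinear_id X)
        (auto intro: cl M)
  qed
  finally show ?thesis .
qed

end

end

section \<open>Coherence\<close>

context quasi_bialgebra
begin

lemma tlift_tlift3_commute:
  assumes "module K X" "t \<in> carrier HH" "s \<in> carrier HHH"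
    "\<And>a b c d e. \<lbrakk>a \<in> carrier H; b \<in> carrier H; c \<in> carrier H; d \<in> carrier H; e \<in> carrier H\<rbrakk> \<Longrightarrow> f a b c d e \<in> carrier X"
  shows "tlift X (\<lambda>a b. tlift3 X (f a b) s) t = tlift3 X (\<lambda>c d e. tlift X (\<lambda>a b. f a b c d e) t) s"
proof -
  have "tlift X (\<lambda>a b. tlift3 X (f a b) s) t
      = tlift X (\<lambda>c u. tlift X (\<lambda>a b. tlift X (\<lambda>d e. f a b c d e) u) t) s"
    unfolding tlift3_def
    by (rule tlift_commute[OF H_modules(1,1,1,2) assms(1,2,3)]) (auto intro!: tlift_H(4) assms)
  also have "\<dots> = tlift X (\<lambda>c u. tlift X (\<lambda>d e. tlift X (\<lambda>a b. f a b c d e) t) u) s"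
    by (rule tlift_cong[OF H_modules(1,2) assms(3)])
      (auto intro!: tlift_commute[OF H_modules(1,1,1,1) assms(1,2)] assms)
  finally show ?thesis unfolding tlift3_def .
qed

lemma tlift3_commute:
  assumes "module K X" "t \<in> carrier HHH" "s \<in> carrier HHH"
    "\<And>a b c d e g. \<lbrakk>a \<in> carrier H; b \<in> carrier H; c \<in> carrier H; d \<in> carrier H; e \<in> carrier H; g \<in> carrier H\<rbrakk>
      \<Longrightarrow> f a b c d e g \<in> carrier X"
  shows "tlift3 X (\<lambda>a b c. tlift3 X (f a b c) s) t = tlift3 X (\<lambda>d e g. tlift3 X (\<lambda>a b c. f a b c d e g) t) s"
proof -
  have "tlift3 X (\<lambda>a b c. tlift3 X (f a b c) s) t
      = tlift X (\<lambda>a u. tlift X (\<lambda>c v. tlift X (\<lambda>d e. tlift X (\<lambda>b b'. f a b b' c d e) u) v) s) t"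
    unfolding tlift3_def[of X _ t]
    by (rule tlift_cong[OF H_modules(1,2) assms(2)])
      (auto intro!: tlift_tlift3_commute[OF assms(1) _ assms(3), unfolded tlift3_def[of X _ s]] assms simp: tlift3_def[of X _ s])
  also have "\<dots> = tlift X (\<lambda>c v. tlift X (\<lambda>a u. tlift X (\<lambda>d e. tlift X (\<lambda>b b'. f a b b' c d e) u) v) t) s"
    by (rule tlift_commute[OF H_modules(1,2,1,2) assms(1-3)]) (auto intro!: tlift_H(4) assms)
  also have "\<dots> = tlift X (\<lambda>c v. tlift X (\<lambda>d e. tlift X (\<lambda>a u. tlift X (\<lambda>b b'. f a b b' c d e) u) t) v) s"
    by (rule tlift_cong[OF H_modules(1,2) assms(3)])
      (auto intro!: tlift_commute[OF H_modules(1,2,1,1) assms(1,2)] tlift_H(4) assms)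
  finally show ?thesis unfolding tlift3_def .
qed

lemma tlift_H_comult_closed [simp]:
  "t \<in> carrier HH \<Longrightarrow> \<Delta>_id t \<in> carrier HHH" "t \<in> carrier HH \<Longrightarrow> id_\<Delta> t \<in> carrier HHH"
  by (auto intro!: tlift_H(4))

lemma quasi_coassoc_phi:
  assumes "h \<in> carrier H"
  shows "id_\<Delta> (\<Delta> h) \<otimes>\<^bsub>HHH\<^esub> \<phi> = \<phi> \<otimes>\<^bsub>HHH\<^esub> \<Delta>_id (\<Delta> h)"
    and "\<phi>inv \<otimes>\<^bsub>HHH\<^esub> id_\<Delta> (\<Delta> h) = \<Delta>_id (\<Delta> h) \<otimes>\<^bsub>HHH\<^esub> \<phi>inv"
proof -
  interpret M: monoid HHH using kalg_HHH by (simp add: kalg_def)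
  have c: "\<Delta>_id (\<Delta> h) \<in> carrier HHH" using assms by simp
  show "id_\<Delta> (\<Delta> h) \<otimes>\<^bsub>HHH\<^esub> \<phi> = \<phi> \<otimes>\<^bsub>HHH\<^esub> \<Delta>_id (\<Delta> h)"
    using c by (simp add: quasi_coassoc[OF assms] M.m_assoc phi_inv)
  show "\<phi>inv \<otimes>\<^bsub>HHH\<^esub> id_\<Delta> (\<Delta> h) = \<Delta>_id (\<Delta> h) \<otimes>\<^bsub>HHH\<^esub> \<phi>inv"
    using c by (simp add: quasi_coassoc[OF assms] M.m_assoc[symmetric] phi_inv)
qed

context
  fixes U :: "('a, 'b, 'u, 'p) hmod_scheme" and V :: "('a, 'b, 'v, 'q) hmod_scheme" and W :: "('a, 'b, 'w, 'r) hmod_scheme"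
    and X :: "('a, 'x, 'xx) module_scheme" and F
  assumes U: "umodule U" and V: "umodule V" and W: "umodule W" and X: "module K X" and F: "trilin K U V W X F"
begin

lemma act3_phi_inv:
  assumes "x \<in> carrier U" "y \<in> carrier V" "z \<in> carrier W"
  shows "act3 U V W X (act3 U V W X F \<phi>) \<phi>inv x y z = F x y z"
    and "act3 U V W X (act3 U V W X F \<phi>inv) \<phi> x y z = F x y z"
  using assms by (simp_all add: act3_mult[OF U V W X F, symmetric] phi_inv act3_one[OF U V W X F])

lemma act3_coassoc:
  assumes "h \<in> carrier H" "x \<in> carrier U" "y \<in> carrier V" "z \<in> carrier W"
  shows "act3 U V W X (act3 U V W X F (id_\<Delta> (\<Delta> h))) \<phi> x y z = act3 U V W X (act3 U V W X F \<phi>) (\<Delta>_id (\<Delta> h)) x y z"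
    and "act3 U V W X (act3 U V W X F (\<Delta>_id (\<Delta> h))) \<phi>inv x y z = act3 U V W X (act3 U V W X F \<phi>inv) (id_\<Delta> (\<Delta> h)) x y z"
  using assms by (simp_all add: act3_mult[OF U V W X F, symmetric] quasi_coassoc_phi)

text \<open>Only this counit condition on \<phi> is an axiom; those for the outer legs are derived
  from it by means of the pentagon. Invariance is demanded of the single vector \<open>y\<close>,
  not of its module.\<close>

lemma act3_phi_middle:
  assumes y: "\<And>h. h \<in> carrier H \<Longrightarrow> act V h y = \<epsilon> h \<odot>\<^bsub>V\<^esub> y" and xyz: "x \<in> carrier U" "y \<in> carrier V" "z \<in> carrier W"
  shows "act3 U V W X F \<phi> x y z = F x y z"
proof -
  have b: "bilin K H H X (\<lambda>a c. F (act U a x) y (act W c z))"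
    by (rule bilinI) (intro lin trilin_1[OF F] trilin_3[OF F] U W; simp add: U W xyz)+
  interpret HH: module K HH by simp
  have l: "klinear K HH X (tlift X (\<lambda>a c. F (act U a x) y (act W c z)))" by (intro tlift_H(1) klinear_id X b)
  have "act3 U V W X F \<phi> x y z = tlift3 X (\<lambda>a b c. \<epsilon> b \<odot>\<^bsub>X\<^esub> F (act U a x) y (act W c z)) \<phi>"
    unfolding act3_def using xyz y U W
    by (intro tlift3_H(3)) (auto intro!: klinear_smult[OF trilin_2[OF F _ klinear_id]])
  also have "\<dots> = tlift3 X (\<lambda>a b c. tlift X (\<lambda>a c. F (act U a x) y (act W c z)) (\<epsilon> b \<odot>\<^bsub>HH\<^esub> h2 a c)) \<phi>"
    using b X by (intro tlift3_H(3)) (auto simp: klinear_smult[OF l] tlift_H(5))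
  also have "\<dots> = tlift X (\<lambda>a c. F (act U a x) y (act W c z)) (tlift3 HH (\<lambda>a b c. \<epsilon> b \<odot>\<^bsub>HH\<^esub> h2 a c) \<phi>)"
    by (rule tlift3_H(2)[symmetric]) (auto intro!: X l)
  also have "\<dots> = F x y z"
    using xyz U W X b by (simp add: assoc_counit tensor_one_H tlift_H(5))
  finally show ?thesis .
qed

end

text \<open>The counit axioms of the coproduct, for one invariant vector instead of a trivial
  module. In later uses that vector is the unit of some end(W) or lies in a module such as
  \<open>counit_mod\<close>.\<close>

lemma act2_counit:
  assumes U: "umodule U" and V: "umodule V" and X: "module K X" and F: "bilin K U V X F"
    and h: "h \<in> carrier H" and xy: "x \<in> carrier U" "y \<in> carrier V"
  shows "(\<And>h. h \<in> carrier H \<Longrightarrow> act U h x = \<epsilon> h \<odot>\<^bsub>U\<^esub> x) \<Longrightarrow> act2 U V X F (\<Delta> h) x y = F x (act V h y)"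
    and "(\<And>h. h \<in> carrier H \<Longrightarrow> act V h y = \<epsilon> h \<odot>\<^bsub>V\<^esub> y) \<Longrightarrow> act2 U V X F (\<Delta> h) x y = F (act U h x) y"
proof -
  interpret H: module K H by simp
  have l1: "klinear K H X (\<lambda>b. F x (act V b y))" by (intro lin bilin_right[OF F] V xy)
  have l2: "klinear K H X (\<lambda>a. F (act U a x) y)" by (intro lin bilin_left[OF F] U xy)
  show "act2 U V X F (\<Delta> h) x y = F x (act V h y)" if "\<And>h. h \<in> carrier H \<Longrightarrow> act U h x = \<epsilon> h \<odot>\<^bsub>U\<^esub> x"
  proof -
    have "act2 U V X F (\<Delta> h) x y = tlift X (\<lambda>a b. F x (act V (\<epsilon> a \<odot>\<^bsub>H\<^esub> b) y)) (\<Delta> h)"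
      unfolding act2_def using xy that U V h
      by (intro tlift_H(3)) (auto simp: klinear_smult[OF l1] klinear_smult[OF bilin_left[OF F klinear_id]])
    then show ?thesis
      using h by (simp add: tlift_H(2)[OF _ _ _ l1, symmetric] X counit_left)
  qed
  show "act2 U V X F (\<Delta> h) x y = F (act U h x) y" if "\<And>h. h \<in> carrier H \<Longrightarrow> act V h y = \<epsilon> h \<odot>\<^bsub>V\<^esub> y"
  proof -
    have "act2 U V X F (\<Delta> h) x y = tlift X (\<lambda>a b. F (act U (\<epsilon> b \<odot>\<^bsub>H\<^esub> a) x) y) (\<Delta> h)"
      unfolding act2_def using xy that U V h
      by (intro tlift_H(3)) (auto simp: klinear_smult[OF l2] klinear_smult[OF bilin_right[OF F _ klinear_id]])
    then show ?thesis
      using h by (simp add: tlift_H(2)[OF _ _ _ l2, symmetric] X counit_right)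
  qed
qed

lemma equivar_smult_unit:
  assumes V: "umodule V"
  shows "equivar unit_obj V V (\<lambda>c v. c \<odot>\<^bsub>V\<^esub> v)" "equivar V unit_obj V (\<lambda>v c. c \<odot>\<^bsub>V\<^esub> v)"
proof -
  interpret V: module K V using V by simp
  have b: "bilin K unit_obj V V (\<lambda>c v. c \<odot>\<^bsub>V\<^esub> v)"
    using V by (intro bilinI klinear_smult_right klinear_id) (auto intro!: klinearI simp: V.smult_l_distr V.smult_assoc1)
  have b': "bilin K V unit_obj V (\<lambda>v c. c \<odot>\<^bsub>V\<^esub> v)"
    using b by (auto simp: bilin_def)
  have s: "act V h (c \<odot>\<^bsub>V\<^esub> v) = c \<odot>\<^bsub>V\<^esub> act V h v" if "h \<in> carrier H" "c \<in> carrier K" "v \<in> carrier V" for h c v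
    using that V by (intro klinear_smult[OF klinear_act_r[OF V _ klinear_id]])
  show "equivar unit_obj V V (\<lambda>c v. c \<odot>\<^bsub>V\<^esub> v)"
    unfolding equivar_def using b V
    by (auto simp: s act2_counit(1)[OF trivial_umodule[OF trivial_unit_obj] V umodule_module[OF V] b])
  show "equivar V unit_obj V (\<lambda>v c. c \<odot>\<^bsub>V\<^esub> v)"
    unfolding equivar_def using b' V
    by (auto simp: s act2_counit(2)[OF V trivial_umodule[OF trivial_unit_obj] umodule_module[OF V] b'])
qed

text \<open>Writing \<open>T F\<close> for the action of the associator on a map \<open>F\<close> one of whose arguments is the unit
  object, the pentagon gives \<open>T (T F) = T F\<close>; since \<open>T\<close> is invertible, \<open>T F = F\<close>.\<close>

lemma act3_phi_unit_left:
  assumes V: "umodule V" and W: "umodule W" and X: "module K X" and F: "trilin K unit_obj V W X F"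
    and xyz: "c \<in> carrier K" "v \<in> carrier V" "w \<in> carrier W"
  shows "act3 unit_obj V W X F \<phi> c v w = F c v w"
proof -
  interpret K: cring K by (fact K_cring)
  interpret V: module K V using V by simp
  interpret X: module K X by fact
  let ?I = "unit_obj" and ?T = "\<lambda>F. act3 unit_obj V W X F \<phi>"
  have I: "umodule ?I" by blast
  have TF: "trilin K ?I V W X (?T F)" by (intro act3_trilin I V W X F phi_closed)
  have TTF: "trilin K ?I V W X (?T (?T F))" by (intro act3_trilin I V W X TF phi_closed)
  have sc: "P (c \<otimes>\<^bsub>K\<^esub> d) v w = c \<odot>\<^bsub>X\<^esub> P d v w" "P c (d \<odot>\<^bsub>V\<^esub> v) w = d \<odot>\<^bsub>X\<^esub> P c v w"
    if "trilin K ?I V W X P" "c \<in> carrier K" "d \<in> carrier K" "v \<in> carrier V" "w \<in> carrier W" for P c d v w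
    using klinear_smult[OF trilin_1[OF that(1) klinear_id], of v w c d]
      klinear_smult[OF trilin_2[OF that(1) _ klinear_id], of c w d v] that by auto
  note BK = equivar_smult_unit(1)[OF I] note BV = equivar_smult_unit(1)[OF V]
  have bK: "bilin K ?I ?I ?I (\<lambda>c d. c \<otimes>\<^bsub>K\<^esub> d)" using equivar_bilin[OF BK] by simp
  \<comment> \<open>The pentagon is applied to this map of four arguments. Merging the two units by
    the product of \<open>K\<close> makes each of its factors reduce to \<open>?T\<close> or to the
    identity.\<close>
  have G: "quadlin K ?I ?I V W X (\<lambda>c d v w. F (c \<otimes>\<^bsub>K\<^esub> d) v w)"
    by (rule quadlinI) (intro trilin_1[OF F] trilin_2[OF F] trilin_3[OF F] bilin_left[OF bK] bilin_right[OF bK] klinear_id; simp)+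
  have 1: "act4 ?I ?I V W X (\<lambda>c d v w. F (c \<otimes>\<^bsub>K\<^esub> d) v w) (one_tens \<phi>) c d v w = ?T F c (d \<odot>\<^bsub>V\<^esub> v) w"
    if "c \<in> carrier K" "d \<in> carrier K" "v \<in> carrier V" "w \<in> carrier W" for c d v w
  proof -
    have "act4 ?I ?I V W X (\<lambda>c d v w. F (c \<otimes>\<^bsub>K\<^esub> d) v w) (one_tens \<phi>) c d v w
        = act3 ?I V W X (\<lambda>d v w. F (c \<otimes>\<^bsub>K\<^esub> d) v w) \<phi> d v w"
      using that by (simp add: act4_one_tens[OF I I V W X G])
    also have "\<dots> = act3 ?I V W X (\<lambda>d v w. c \<odot>\<^bsub>X\<^esub> F d v w) \<phi> d v w"
      using that by (intro act3_cong[OF I V W X]) (simp_all add: sc[OF F])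
    also have "\<dots> = c \<odot>\<^bsub>X\<^esub> ?T F d v w"
      using that by (subst act3_linear[OF I V W X F X]) (auto intro!: klinear_smult_right klinear_id X)
    also have "\<dots> = ?T F c (d \<odot>\<^bsub>V\<^esub> v) w"
      using that sc[OF TF, of c d v w] sc(1)[OF TF, of d c v w] by (simp add: K.m_comm)
    finally show ?thesis .
  qed
  have 2: "act4 ?I ?I V W X (act4 ?I ?I V W X (\<lambda>c d v w. F (c \<otimes>\<^bsub>K\<^esub> d) v w) (one_tens \<phi>)) (id_\<Delta>_id \<phi>) c d v w
      = ?T (?T F) c (d \<odot>\<^bsub>V\<^esub> v) w"
    if "c \<in> carrier K" "d \<in> carrier K" "v \<in> carrier V" "w \<in> carrier W" for c d v w
  proof -
    have "act4 ?I ?I V W X (act4 ?I ?I V W X (\<lambda>c d v w. F (c \<otimes>\<^bsub>K\<^esub> d) v w) (one_tens \<phi>)) (id_\<Delta>_id \<phi>) c d v w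
      = act4 ?I ?I V W X (\<lambda>c d v w. ?T F c (d \<odot>\<^bsub>V\<^esub> v) w) (id_\<Delta>_id \<phi>) c d v w"
      using that by (intro act4_cong[OF I I V W X]) (simp_all add: 1)
    also have "\<dots> = ?T (?T F) c (d \<odot>\<^bsub>V\<^esub> v) w"
      using that by (intro act4_merge_2[OF I I V W V X TF BV]) auto
    finally show ?thesis .
  qed
  have 3: "act4 ?I ?I V W X (act4 ?I ?I V W X (\<lambda>c d v w. F (c \<otimes>\<^bsub>K\<^esub> d) v w) (id_id_\<Delta> \<phi>)) (\<Delta>_id_id \<phi>) c d v w
      = ?T F (c \<otimes>\<^bsub>K\<^esub> d) v w"
    if "c \<in> carrier K" "d \<in> carrier K" "v \<in> carrier V" "w \<in> carrier W" for c d v w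
  proof -
    have P: "trilin K ?I ?I (V \<boxtimes> W) X (\<lambda>c d s. tlift X (F (c \<otimes>\<^bsub>K\<^esub> d)) s)"
      by (rule trilinI; simp; intro klinear_tlift_param[OF umodule_module[OF V] umodule_module[OF W] X]
          klinear_tlift[OF umodule_module[OF V] umodule_module[OF W] X] trilin_bilin[OF F] trilin_1[OF F]
          bilin_left[OF bK] bilin_right[OF bK] klinear_id; simp)
    have g: "tlift X (F (c \<otimes>\<^bsub>K\<^esub> d)) (pure V W v w) = F (c \<otimes>\<^bsub>K\<^esub> d) v w"
      if "c \<in> carrier K" "d \<in> carrier K" "v \<in> carrier V" "w \<in> carrier W" for c d v w
      using that V W X trilin_bilin[OF F] by simp
    have "act4 ?I ?I V W X (\<lambda>c d v w. F (c \<otimes>\<^bsub>K\<^esub> d) v w) (id_id_\<Delta> \<phi>) c d v w = F (c \<otimes>\<^bsub>K\<^esub> d) v w"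
      if "c \<in> carrier K" "d \<in> carrier K" "v \<in> carrier V" "w \<in> carrier W" for c d v w
    proof -
      have "act4 ?I ?I V W X (\<lambda>c d v w. F (c \<otimes>\<^bsub>K\<^esub> d) v w) (id_id_\<Delta> \<phi>) c d v w
          = act4 ?I ?I V W X (\<lambda>c d v w. tlift X (F (c \<otimes>\<^bsub>K\<^esub> d)) (pure V W v w)) (id_id_\<Delta> \<phi>) c d v w"
        using that by (intro act4_cong[OF I I V W X]) (simp_all add: g)
      also have "\<dots> = act3 ?I ?I (V \<boxtimes> W) X (\<lambda>c d s. tlift X (F (c \<otimes>\<^bsub>K\<^esub> d)) s) \<phi> c d (pure V W v w)"
        using that by (intro act4_merge_3[OF I I V W _ X P]) (auto simp: V W)
      also have "\<dots> = F (c \<otimes>\<^bsub>K\<^esub> d) v w"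
        using that V W by (subst act3_phi_middle[OF I I _ X P]) (auto simp: g)
      finally show ?thesis .
    qed
    then have "act4 ?I ?I V W X (act4 ?I ?I V W X (\<lambda>c d v w. F (c \<otimes>\<^bsub>K\<^esub> d) v w) (id_id_\<Delta> \<phi>)) (\<Delta>_id_id \<phi>) c d v w
      = act4 ?I ?I V W X (\<lambda>c d v w. F (c \<otimes>\<^bsub>K\<^esub> d) v w) (\<Delta>_id_id \<phi>) c d v w"
      using that by (intro act4_cong[OF I I V W X]) simp_all
    also have "\<dots> = ?T F (c \<otimes>\<^bsub>K\<^esub> d) v w"
      using that act4_merge_1[OF I I V W I X F BK phi_closed(1), of c d v w] by simp
    finally show ?thesis .
  qed
  have TT: "?T (?T F) c v w = ?T F c v w" if "c \<in> carrier K" "v \<in> carrier V" "w \<in> carrier W" for c v w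
  proof -
    let ?G2 = "act4 ?I ?I V W X (act4 ?I ?I V W X (\<lambda>c d v w. F (c \<otimes>\<^bsub>K\<^esub> d) v w) (one_tens \<phi>)) (id_\<Delta>_id \<phi>)"
    have q: "quadlin K ?I ?I V W X ?G2"
      by (intro act4_quadlin I V W X G) simp_all
    \<comment> \<open>The second unit occupies the middle leg, so this factor is trivial; setting
      that unit to 1 leaves \<open>?T (?T F)\<close> on this side of the pentagon.\<close>
    have "act4 ?I ?I V W X ?G2 (tens_one \<phi>) c \<one>\<^bsub>K\<^esub> v w = act3 ?I ?I V X (\<lambda>c d v. ?G2 c d v w) \<phi> c \<one>\<^bsub>K\<^esub> v"
      using that by (intro act4_tens_one[OF I I V W X q]) auto
    also have "\<dots> = ?G2 c \<one>\<^bsub>K\<^esub> v w"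
      using that
      by (intro act3_phi_middle[OF I I V X] trilinI)
        (auto intro!: quadlin_1[OF q klinear_id] quadlin_2[OF q _ klinear_id] quadlin_3[OF q _ _ klinear_id])
    finally have "act4 ?I ?I V W X ?G2 (tens_one \<phi>) c \<one>\<^bsub>K\<^esub> v w = ?T (?T F) c v w"
      using that by (simp add: 2)
    then show ?thesis
      using act4_pentagon[OF I I V W X G, of c "\<one>\<^bsub>K\<^esub>" v w] that by (simp add: 3)
  qed
  have "?T F c v w = act3 ?I V W X (?T (?T F)) \<phi>inv c v w"
    using act3_phi_inv(1)[OF I V W X TF] xyz by simp
  also have "\<dots> = act3 ?I V W X (?T F) \<phi>inv c v w"
    by (rule act3_cong[OF I V W X]) (use xyz in \<open>simp_all add: TT\<close>)
  also have "\<dots> = F c v w"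
    using act3_phi_inv(1)[OF I V W X F] xyz by simp
  finally show ?thesis .
qed

lemma act3_phi_unit_right:
  assumes U: "umodule U" and V: "umodule V" and X: "module K X" and F: "trilin K U V unit_obj X F"
    and xyz: "u \<in> carrier U" "v \<in> carrier V" "c \<in> carrier K"
  shows "act3 U V unit_obj X F \<phi> u v c = F u v c"
proof -
  interpret K: cring K by (fact K_cring)
  interpret V: module K V using V by simp
  interpret X: module K X by fact
  let ?I = "unit_obj" and ?T = "\<lambda>F. act3 U V unit_obj X F \<phi>"
  have I: "umodule ?I" by blast
  have TF: "trilin K U V ?I X (?T F)" by (intro act3_trilin I U V X F phi_closed)
  have TTF: "trilin K U V ?I X (?T (?T F))" by (intro act3_trilin I U V X TF phi_closed)
  have sc: "P u v (c \<otimes>\<^bsub>K\<^esub> d) = c \<odot>\<^bsub>X\<^esub> P u v d" "P u (c \<odot>\<^bsub>V\<^esub> v) d = c \<odot>\<^bsub>X\<^esub> P u v d"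
    if "trilin K U V ?I X P" "c \<in> carrier K" "d \<in> carrier K" "v \<in> carrier V" "u \<in> carrier U" for P c d v u
    using klinear_smult[OF trilin_3[OF that(1) _ _ klinear_id], of u v c d]
      klinear_smult[OF trilin_2[OF that(1) _ klinear_id], of u d c v] that by auto
  note BK = equivar_smult_unit(1)[OF I] note BV = equivar_smult_unit(2)[OF V]
  have bK: "bilin K ?I ?I ?I (\<lambda>c d. c \<otimes>\<^bsub>K\<^esub> d)" using equivar_bilin[OF BK] by simp
  \<comment> \<open>Mirror image of the previous argument: the units now stand last, and the trivial
    factors are \<open>one_tens \<phi>\<close> and \<open>\<Delta>_id_id \<phi>\<close>.\<close>
  have G: "quadlin K U V ?I ?I X (\<lambda>u v c d. F u v (c \<otimes>\<^bsub>K\<^esub> d))"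
    by (rule quadlinI) (intro trilin_1[OF F] trilin_2[OF F] trilin_3[OF F] bilin_left[OF bK] bilin_right[OF bK] klinear_id; simp)+
  have 1: "act4 U V ?I ?I X (\<lambda>u v c d. F u v (c \<otimes>\<^bsub>K\<^esub> d)) (one_tens \<phi>) u v c d = F u (c \<odot>\<^bsub>V\<^esub> v) d"
    if "c \<in> carrier K" "d \<in> carrier K" "v \<in> carrier V" "u \<in> carrier U" for c d v u
  proof -
    have "act4 U V ?I ?I X (\<lambda>u v c d. F u v (c \<otimes>\<^bsub>K\<^esub> d)) (one_tens \<phi>) u v c d
        = act3 V ?I ?I X (\<lambda>v c d. F u v (c \<otimes>\<^bsub>K\<^esub> d)) \<phi> v c d"
      using that by (simp add: act4_one_tens[OF U V I I X G])
    also have "\<dots> = F u v (c \<otimes>\<^bsub>K\<^esub> d)"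
      using that
      by (intro act3_phi_middle[OF V I I X] quadlin_trilin[OF G]) auto
    finally show ?thesis using that by (simp add: sc[OF F])
  qed
  have 2: "act4 U V ?I ?I X (act4 U V ?I ?I X (\<lambda>u v c d. F u v (c \<otimes>\<^bsub>K\<^esub> d)) (one_tens \<phi>)) (id_\<Delta>_id \<phi>) u v c d
      = ?T F u (c \<odot>\<^bsub>V\<^esub> v) d"
    if "c \<in> carrier K" "d \<in> carrier K" "v \<in> carrier V" "u \<in> carrier U" for c d v u
  proof -
    have "act4 U V ?I ?I X (act4 U V ?I ?I X (\<lambda>u v c d. F u v (c \<otimes>\<^bsub>K\<^esub> d)) (one_tens \<phi>)) (id_\<Delta>_id \<phi>) u v c d
      = act4 U V ?I ?I X (\<lambda>u v c d. F u (c \<odot>\<^bsub>V\<^esub> v) d) (id_\<Delta>_id \<phi>) u v c d"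
      using that by (intro act4_cong[OF U V I I X]) (simp_all add: 1)
    also have "\<dots> = ?T F u (c \<odot>\<^bsub>V\<^esub> v) d"
      using that by (intro act4_merge_2[OF U V I I V X F BV]) auto
    finally show ?thesis .
  qed
  have 3: "act4 U V ?I ?I X (act4 U V ?I ?I X (\<lambda>u v c d. F u v (c \<otimes>\<^bsub>K\<^esub> d)) (id_id_\<Delta> \<phi>)) (\<Delta>_id_id \<phi>) u v c d
      = ?T F u v (c \<otimes>\<^bsub>K\<^esub> d)"
    if uvcd: "c \<in> carrier K" "d \<in> carrier K" "v \<in> carrier V" "u \<in> carrier U" for c d v u
  proof -
    have P: "trilin K (U \<boxtimes> V) ?I ?I X (\<lambda>s c d. tlift X (\<lambda>u v. ?T F u v (c \<otimes>\<^bsub>K\<^esub> d)) s)"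
      by (rule trilinI; simp; intro klinear_tlift_param[OF umodule_module[OF U] umodule_module[OF V] X]
          klinear_tlift[OF umodule_module[OF U] umodule_module[OF V] X] bilinI trilin_1[OF TF] trilin_2[OF TF] trilin_3[OF TF]
          bilin_left[OF bK] bilin_right[OF bK] klinear_id; simp)
    have g: "tlift X (\<lambda>u v. ?T F u v (c \<otimes>\<^bsub>K\<^esub> d)) (pure U V u v) = ?T F u v (c \<otimes>\<^bsub>K\<^esub> d)"
      if "c \<in> carrier K" "d \<in> carrier K" "v \<in> carrier V" "u \<in> carrier U" for c d v u
      using that U V X by (intro tlift_pure_h bilinI trilin_1[OF TF] trilin_2[OF TF] klinear_id; simp)
    have e: "act4 U V ?I ?I X (\<lambda>u v c d. F u v (c \<otimes>\<^bsub>K\<^esub> d)) (id_id_\<Delta> \<phi>) u v c d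
        = tlift X (\<lambda>u v. ?T F u v (c \<otimes>\<^bsub>K\<^esub> d)) (pure U V u v)"
      if "c \<in> carrier K" "d \<in> carrier K" "v \<in> carrier V" "u \<in> carrier U" for c d v u
      using that act4_merge_3[OF U V I I I X F BK phi_closed(1), of u v c d] by (simp add: g)
    have "act4 U V ?I ?I X (act4 U V ?I ?I X (\<lambda>u v c d. F u v (c \<otimes>\<^bsub>K\<^esub> d)) (id_id_\<Delta> \<phi>)) (\<Delta>_id_id \<phi>) u v c d
      = act4 U V ?I ?I X (\<lambda>u v c d. tlift X (\<lambda>u v. ?T F u v (c \<otimes>\<^bsub>K\<^esub> d)) (pure U V u v)) (\<Delta>_id_id \<phi>) u v c d"
      using uvcd by (intro act4_cong[OF U V I I X]) (simp_all add: e)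
    also have "\<dots> = act3 (U \<boxtimes> V) ?I ?I X (\<lambda>s c d. tlift X (\<lambda>u v. ?T F u v (c \<otimes>\<^bsub>K\<^esub> d)) s) \<phi> (pure U V u v) c d"
      using uvcd by (intro act4_merge_1[OF U V I I _ X P]) (auto simp: U V)
    also have "\<dots> = ?T F u v (c \<otimes>\<^bsub>K\<^esub> d)"
      using uvcd U V by (subst act3_phi_middle[OF _ I I X P]) (auto simp: g)
    finally show ?thesis .
  qed
  have TT: "?T (?T F) u v c = ?T F u v c" if "c \<in> carrier K" "v \<in> carrier V" "u \<in> carrier U" for c v u
  proof -
    let ?G2 = "act4 U V ?I ?I X (act4 U V ?I ?I X (\<lambda>u v c d. F u v (c \<otimes>\<^bsub>K\<^esub> d)) (one_tens \<phi>)) (id_\<Delta>_id \<phi>)"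
    have q: "quadlin K U V ?I ?I X ?G2"
      by (intro act4_quadlin I U V X G) simp_all
    have "act4 U V ?I ?I X ?G2 (tens_one \<phi>) u v c \<one>\<^bsub>K\<^esub> = act3 U V ?I X (\<lambda>u v c. ?G2 u v c \<one>\<^bsub>K\<^esub>) \<phi> u v c"
      using that by (intro act4_tens_one[OF U V I I X q]) auto
    also have "\<dots> = ?T (?T F) u v c"
      using that sc[OF TF] by (intro act3_cong[OF U V I X]) (auto simp: 2 simp flip: sc(1)[OF TF])
    finally show ?thesis
      using act4_pentagon[OF U V I I X G, of u v c "\<one>\<^bsub>K\<^esub>"] that by (simp add: 3)
  qed
  have "?T F u v c = act3 U V ?I X (?T (?T F)) \<phi>inv u v c"
    using act3_phi_inv(1)[OF U V I X TF] xyz by simp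
  also have "\<dots> = act3 U V ?I X (?T F) \<phi>inv u v c"
    by (rule act3_cong[OF U V I X]) (use xyz in \<open>simp_all add: TT\<close>)
  also have "\<dots> = F u v c"
    using act3_phi_inv(1)[OF U V I X F] xyz by simp
  finally show ?thesis .
qed

text \<open>An invariant vector \<open>x\<close> is the value at 1 of the map c \<mapsto> c x from
  the unit object, which reduces the claim to \<open>unit_obj\<close>.\<close>

lemma act3_phi_left:
  assumes U: "umodule U" and V: "umodule V" and W: "umodule W" and X: "module K X" and F: "trilin K U V W X F"
    and x: "\<And>h. h \<in> carrier H \<Longrightarrow> act U h x = \<epsilon> h \<odot>\<^bsub>U\<^esub> x" and xyz: "x \<in> carrier U" "y \<in> carrier V" "z \<in> carrier W"
  shows "act3 U V W X F \<phi> x y z = F x y z"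
proof -
  interpret K: cring K by (fact K_cring)
  interpret U: module K U using U by simp
  have b: "bilin K unit_obj U U (\<lambda>c v. c \<odot>\<^bsub>U\<^esub> v)" by (rule equivar_bilin[OF equivar_smult_unit(1)[OF U]])
  have P: "trilin K unit_obj V W X (\<lambda>c. F (c \<odot>\<^bsub>U\<^esub> x))"
    by (rule trilinI) (intro trilin_1[OF F] trilin_2[OF F] trilin_3[OF F] bilin_left[OF b] klinear_id; simp add: xyz)+
  have "act3 U V W X F \<phi> x y z = act3 unit_obj V W X (\<lambda>c. F (c \<odot>\<^bsub>U\<^esub> x)) \<phi> \<one>\<^bsub>K\<^esub> y z"
    unfolding act3_def using xyz x by (intro tlift3_H(3)) auto
  then show ?thesis using xyz by (simp add: act3_phi_unit_left[OF V W X P])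
qed

lemma act3_phi_right:
  assumes U: "umodule U" and V: "umodule V" and W: "umodule W" and X: "module K X" and F: "trilin K U V W X F"
    and z: "\<And>h. h \<in> carrier H \<Longrightarrow> act W h z = \<epsilon> h \<odot>\<^bsub>W\<^esub> z" and xyz: "x \<in> carrier U" "y \<in> carrier V" "z \<in> carrier W"
  shows "act3 U V W X F \<phi> x y z = F x y z"
proof -
  interpret K: cring K by (fact K_cring)
  interpret W: module K W using W by simp
  have b: "bilin K unit_obj W W (\<lambda>c v. c \<odot>\<^bsub>W\<^esub> v)" by (rule equivar_bilin[OF equivar_smult_unit(1)[OF W]])
  have P: "trilin K U V unit_obj X (\<lambda>x y c. F x y (c \<odot>\<^bsub>W\<^esub> z))"
    by (rule trilinI) (intro trilin_1[OF F] trilin_2[OF F] trilin_3[OF F] bilin_left[OF b] klinear_id; simp add: xyz)+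
  have "act3 U V W X F \<phi> x y z = act3 U V unit_obj X (\<lambda>x y c. F x y (c \<odot>\<^bsub>W\<^esub> z)) \<phi> x y \<one>\<^bsub>K\<^esub>"
    unfolding act3_def using xyz z by (intro tlift3_H(3)) auto
  then show ?thesis using xyz by (simp add: act3_phi_unit_right[OF U V X P])
qed

end

section \<open>Coproducts on the first leg, expanded and cancelled\<close>

context quasi_bialgebra
begin

lemma act3_comult_1:
  assumes U: "umodule U" "umodule V" "umodule W" and X: "module K X" and F: "trilin K U V W X F" and t: "t \<in> carrier HH"
    and xyz: "x \<in> carrier U" "y \<in> carrier V" "z \<in> carrier W"
  shows "act3 U V W X F (\<Delta>_id t) x y z = tlift X (\<lambda>p q. act2 U V X (\<lambda>x y. F x y (act W q z)) (\<Delta> p) x y) t"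
  using t xyz U by (simp add: act3_tlift[OF U X F] act3_h3[OF U X F] tlift_H(4) act2_def cong: tlift_H(3))

lemma act4_comult_1:
  assumes U: "umodule U" "umodule V" "umodule W" "umodule Y" and X: "module K X" and F: "quadlin K U V W Y X F" and t: "t \<in> carrier HHH"
    and xyz: "x \<in> carrier U" "y \<in> carrier V" "z \<in> carrier W" "w \<in> carrier Y"
  shows "act4 U V W Y X F (\<Delta>_id_id t) x y z w
    = tlift3 X (\<lambda>p q r. act2 U V X (\<lambda>x y. F x y (act W q z) (act Y r w)) (\<Delta> p) x y) t"
  using t xyz U
  by (simp add: act4_tlift3[OF U X F] act4_tlift[OF U X F] act4_h4[OF U X F] tlift_H(4) act2_def cong: tlift3_H(3) tlift_H(3))

text \<open>Rather than proving that \<open>\<Delta>_id_id\<close> is multiplicative, the first two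
  arguments of \<open>F\<close> are combined into one argument in \<open>U \<boxtimes> V\<close>.
  There the two elements act as \<phi> and \<open>\<phi>inv\<close> themselves and cancel.\<close>

lemma act4_cancel_1:
  assumes U: "umodule U" "umodule V" "umodule W" "umodule Y" and X: "module K X" and F: "quadlin K U V W Y X F"
    and xyz: "x \<in> carrier U" "y \<in> carrier V" "z \<in> carrier W" "w \<in> carrier Y"
  shows "act4 U V W Y X (act4 U V W Y X F (\<Delta>_id_id \<phi>)) (\<Delta>_id_id \<phi>inv) x y z w = F x y z w"
proof -
  let ?P = "\<lambda>s z w. tlift X (\<lambda>x y. F x y z w) s"
  note m = umodule_module[OF U(1)] umodule_module[OF U(2)]
  have P: "trilin K (U \<boxtimes> V) W Y X ?P"
    using U X by (intro trilinI; simp; intro klinear_tlift_param[OF m] klinear_tlift[OF m] bilinI klinear_id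
        quadlin_1[OF F] quadlin_2[OF F] quadlin_3[OF F] quadlin_4[OF F]; simp)
  have e: "?P (pure U V x y) z w = F x y z w"
    if "x \<in> carrier U" "y \<in> carrier V" "z \<in> carrier W" "w \<in> carrier Y" for x y z w
    using that U X by (intro tlift_pure_h bilinI quadlin_1[OF F] quadlin_2[OF F] klinear_id; simp)
  have UV: "umodule (U \<boxtimes> V)" and eq: "equivar U V (U \<boxtimes> V) (pure U V)" using U by blast+
  have aP: "trilin K (U \<boxtimes> V) W Y X (act3 (U \<boxtimes> V) W Y X ?P \<phi>)" by (rule act3_trilin[OF UV U(3,4) X P]) simp
  have 1: "act4 U V W Y X F (\<Delta>_id_id \<phi>) x y z w = act3 (U \<boxtimes> V) W Y X ?P \<phi> (pure U V x y) z w"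
    if "x \<in> carrier U" "y \<in> carrier V" "z \<in> carrier W" "w \<in> carrier Y" for x y z w
  proof -
    have "act4 U V W Y X F (\<Delta>_id_id \<phi>) x y z w = act4 U V W Y X (\<lambda>x y z w. ?P (pure U V x y) z w) (\<Delta>_id_id \<phi>) x y z w"
      using that by (intro act4_cong[OF U X]) (simp_all only: e legs_closed phi_closed)
    also have "\<dots> = act3 (U \<boxtimes> V) W Y X ?P \<phi> (pure U V x y) z w"
      by (rule act4_merge_1[OF U UV X P eq phi_closed(1) that])
    finally show ?thesis .
  qed
  have "act4 U V W Y X (act4 U V W Y X F (\<Delta>_id_id \<phi>)) (\<Delta>_id_id \<phi>inv) x y z w
      = act4 U V W Y X (\<lambda>x y z w. act3 (U \<boxtimes> V) W Y X ?P \<phi> (pure U V x y) z w) (\<Delta>_id_id \<phi>inv) x y z w"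
    using xyz by (intro act4_cong[OF U X]) (simp_all only: 1 legs_closed phi_closed)
  also have "\<dots> = act3 (U \<boxtimes> V) W Y X (act3 (U \<boxtimes> V) W Y X ?P \<phi>) \<phi>inv (pure U V x y) z w"
    by (rule act4_merge_1[OF U UV X aP eq phi_closed(2) xyz])
  also have "\<dots> = F x y z w"
    using xyz by (simp add: act3_phi_inv(1)[OF UV U(3,4) X P] e)
  finally show ?thesis .
qed

end

section \<open>Internal homs\<close>

context hopf_data
begin

definition beta_op :: "('k, 'h, 'v, 'p) hmod_scheme \<Rightarrow> 'v \<Rightarrow> 'v" where
  "beta_op V = (\<lambda>v\<in>carrier V. act V \<beta> v)"

text \<open>The bilinear form of \<open>ev\<close>. Computing with it and with
  \<open>curry_h\<close>, instead of with \<open>ev\<close> and \<open>zeta\<close>, keeps tensor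
  products of the arguments out of the formulas.\<close>

definition ap :: "('k, 'h, 'v, 'p) hmod_scheme \<Rightarrow> ('k, 'h, 'w, 'q) hmod_scheme \<Rightarrow> ('v \<Rightarrow> 'w) \<Rightarrow> 'v \<Rightarrow> 'w" where
  "ap V W L v = tlift3 W (\<lambda>a b c. act W a (L (act V (S b \<otimes>\<^bsub>H\<^esub> \<alpha> \<otimes>\<^bsub>H\<^esub> c) v))) \<phi>"

definition curry_h :: "('k, 'h, 'v, 'p) hmod_scheme \<Rightarrow> ('k, 'h, 'w, 'q) hmod_scheme \<Rightarrow> ('k, 'h, 'x, 'r) hmod_scheme
    \<Rightarrow> ('v \<Rightarrow> 'w \<Rightarrow> 'x) \<Rightarrow> 'v \<Rightarrow> 'w \<Rightarrow> 'x" where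
  "curry_h V W X F v = (\<lambda>w\<in>carrier W. tlift3 X (\<lambda>a b c. F (act V a v) (act W (b \<otimes>\<^bsub>H\<^esub> \<beta> \<otimes>\<^bsub>H\<^esub> S c) w)) \<phi>inv)"

lemma zeta_curry_h: "zeta V W X f = curry_h V W X (\<lambda>v w. f (pure V W v w))"
  by (simp add: fun_eq_iff zeta_def curry_h_def)

lemma ev_ap: "ev V W = tlift W (ap V W)"
  by (simp add: fun_eq_iff ev_def zeta_inv_def ap_def tlift_def)

lemma ihom_simps:
  "carrier (ihom V W) = {L. klinear K V W L \<and> L \<in> extensional (carrier V)}"
  "zero (ihom V W) = (\<lambda>v\<in>carrier V. \<zero>\<^bsub>W\<^esub>)"
  "add (ihom V W) = (\<lambda>L L'. \<lambda>v\<in>carrier V. L v \<oplus>\<^bsub>W\<^esub> L' v)"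
  "smult (ihom V W) = (\<lambda>c L. \<lambda>v\<in>carrier V. c \<odot>\<^bsub>W\<^esub> L v)"
  "act (ihom V W) = (\<lambda>h L. \<lambda>v\<in>carrier V. tlift W (\<lambda>a b. act W a (L (act V (S b) v))) (\<Delta> h))"
  by (simp_all add: ihom_def Let_def)

lemma ihom_klinear: "L \<in> carrier (ihom V W) \<Longrightarrow> klinear K V W L"
  by (simp add: ihom_simps)

lemma ihom_closed [simp]: "L \<in> carrier (ihom V W) \<Longrightarrow> v \<in> carrier V \<Longrightarrow> L v \<in> carrier W"
  by (rule klinear_closed[OF ihom_klinear])

lemma ihom_ext:
  "L \<in> carrier (ihom V W) \<Longrightarrow> L' \<in> carrier (ihom V W) \<Longrightarrow> (\<And>v. v \<in> carrier V \<Longrightarrow> L v = L' v) \<Longrightarrow> L = L'"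
  by (auto simp: ihom_simps intro: extensionalityI)

lemma restrict_ihom:
  assumes "module K V" "klinear K V W f" shows "(\<lambda>v\<in>carrier V. f v) \<in> carrier (ihom V W)"
  using assms klinear_cong[of V "\<lambda>v\<in>carrier V. f v" f K W] by (simp add: ihom_simps)

lemma ihom_module:
  assumes V: "module K V" and W: "module K W"
  shows "module K (ihom V W)"
proof -
  interpret V: module K V by fact
  interpret W: module K W by fact
  have c: "(\<lambda>v\<in>carrier V. f v) \<in> carrier (ihom V W)" if "klinear K V W f" for f by (rule restrict_ihom[OF V that])
  note L = ihom_klinear[where V=V and W=W]
  have ag: "abelian_group (ihom V W)"
  proof (rule abelian_groupI)
    fix x assume x: "x \<in> carrier (ihom V W)"
    show "\<exists>y\<in>carrier (ihom V W). y \<oplus>\<^bsub>ihom V W\<^esub> x = \<zero>\<^bsub>ihom V W\<^esub>"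
      using x by (intro bexI[of _ "\<lambda>v\<in>carrier V. \<ominus>\<^bsub>W\<^esub> x v"] c klinear_uminus W L)
        (auto simp: ihom_simps(2-) restrict_def fun_eq_iff W.l_neg)
    show "\<zero>\<^bsub>ihom V W\<^esub> \<oplus>\<^bsub>ihom V W\<^esub> x = x"
      using ihom_closed[OF x] x by (intro extensionalityI[of _ "carrier V"]) (auto simp: ihom_simps)
  next
    fix x y z assume xyz: "x \<in> carrier (ihom V W)" "y \<in> carrier (ihom V W)" "z \<in> carrier (ihom V W)"
    show "x \<oplus>\<^bsub>ihom V W\<^esub> y \<oplus>\<^bsub>ihom V W\<^esub> z = x \<oplus>\<^bsub>ihom V W\<^esub> (y \<oplus>\<^bsub>ihom V W\<^esub> z)"
      using xyz by (auto simp: ihom_simps(2-) fun_eq_iff restrict_def W.add.m_assoc)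
  next
    fix x y assume xyz: "x \<in> carrier (ihom V W)" "y \<in> carrier (ihom V W)"
    show "x \<oplus>\<^bsub>ihom V W\<^esub> y = y \<oplus>\<^bsub>ihom V W\<^esub> x"
      using xyz by (auto simp: ihom_simps(2-) fun_eq_iff restrict_def W.add.m_comm)
    show "x \<oplus>\<^bsub>ihom V W\<^esub> y \<in> carrier (ihom V W)"
      unfolding ihom_simps(3) by (intro c klinear_plus W L xyz)
  next
    show "\<zero>\<^bsub>ihom V W\<^esub> \<in> carrier (ihom V W)" unfolding ihom_simps(2) by (intro c klinear_const_zero W)
  qed
  show ?thesis
  proof (rule moduleI[OF V.is_cring ag])
    fix a x assume a: "a \<in> carrier K" "x \<in> carrier (ihom V W)"
    show "a \<odot>\<^bsub>ihom V W\<^esub> x \<in> carrier (ihom V W)"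
      unfolding ihom_simps(4) by (intro c klinear_smult_right W L a)
    fix b assume b: "b \<in> carrier K"
    show "(a \<oplus>\<^bsub>K\<^esub> b) \<odot>\<^bsub>ihom V W\<^esub> x = a \<odot>\<^bsub>ihom V W\<^esub> x \<oplus>\<^bsub>ihom V W\<^esub> b \<odot>\<^bsub>ihom V W\<^esub> x"
      and "(a \<otimes>\<^bsub>K\<^esub> b) \<odot>\<^bsub>ihom V W\<^esub> x = a \<odot>\<^bsub>ihom V W\<^esub> (b \<odot>\<^bsub>ihom V W\<^esub> x)"
      using a b by (auto simp: ihom_simps(2-) fun_eq_iff restrict_def W.smult_l_distr W.smult_assoc1)
  next
    fix a x y assume "a \<in> carrier K" "x \<in> carrier (ihom V W)" "y \<in> carrier (ihom V W)"
    then show "a \<odot>\<^bsub>ihom V W\<^esub> (x \<oplus>\<^bsub>ihom V W\<^esub> y) = a \<odot>\<^bsub>ihom V W\<^esub> x \<oplus>\<^bsub>ihom V W\<^esub> a \<odot>\<^bsub>ihom V W\<^esub> y"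
      by (auto simp: ihom_simps(2-) fun_eq_iff restrict_def W.smult_r_distr)
  next
    fix x assume x: "x \<in> carrier (ihom V W)"
    show "\<one>\<^bsub>K\<^esub> \<odot>\<^bsub>ihom V W\<^esub> x = x"
      using ihom_closed[OF x] x by (intro extensionalityI[of _ "carrier V"]) (auto simp: ihom_simps)
  qed
qed

lemma klinear_eval [lin]: "v \<in> carrier V \<Longrightarrow> klinear K (ihom V W) W (\<lambda>L. L v)"
  by (rule klinearI) (auto simp: ihom_simps(2-))

lemma klinear_ihom_app: "L \<in> carrier (ihom V W) \<Longrightarrow> klinear K U V f \<Longrightarrow> klinear K U W (\<lambda>u. L (f u))"
  by (rule klinear_comp[OF ihom_klinear])

lemma klinear_ihomI:
  assumes "module K U" "\<And>u. u \<in> carrier U \<Longrightarrow> f u \<in> carrier (ihom V W)"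
    and "\<And>v. v \<in> carrier V \<Longrightarrow> klinear K U W (\<lambda>u. f u v)" "module K V" "module K W"
  shows "klinear K U (ihom V W) f"
proof -
  interpret U: module K U by fact
  interpret E: module K "ihom V W" by (rule ihom_module) fact+
  show ?thesis
    by (rule klinearI) (auto intro!: ihom_ext[of _ V W] assms(2)
      simp: klinear_add[OF assms(3)] klinear_smult[OF assms(3)] klinear_add[OF klinear_eval[of _ V W]] klinear_smult[OF klinear_eval[of _ V W]] assms(2))
qed

lemma beta_op_closed [simp]:
  "umodule V \<Longrightarrow> \<beta> \<in> carrier H \<Longrightarrow> beta_op V \<in> carrier (ihom V V)"
  unfolding beta_op_def by (intro restrict_ihom lin) auto

end

context quasi_hopf_algebra
begin

lemma S_closed [simp]: "h \<in> carrier H \<Longrightarrow> S h \<in> carrier H"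
  by (rule klinear_closed[OF antip_linear])

lemmas klinear_S [lin] = klinear_comp[OF antip_linear]

declare alpha_closed [simp] beta_closed [simp] antip_one [simp]

lemma bilin_act_S:
  "umodule V \<Longrightarrow> umodule W \<Longrightarrow> L \<in> carrier (ihom V W) \<Longrightarrow> v \<in> carrier V \<Longrightarrow>
    bilin K regular regular W (\<lambda>x y. act W x (L (act V (S y) v)))"
  by (rule bilinI; simp; intro lin klinear_ihom_app[where V=V and W=W]; simp)

lemma act_ihom:
  "v \<in> carrier V \<Longrightarrow> act (ihom V W) h L v = tlift W (\<lambda>a b. act W a (L (act V (S b) v))) (\<Delta> h)"
  by (simp add: ihom_simps)

lemma act_ihom_closed:
  assumes "umodule V" "umodule W" "L \<in> carrier (ihom V W)" "h \<in> carrier H"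
  shows "act (ihom V W) h L \<in> carrier (ihom V W)"
  unfolding ihom_simps(5) using assms
  by (intro restrict_ihom lin klinear_ihom_app[OF assms(3)]) auto

lemma umodule_ihom [simp, intro]:
  assumes V: "umodule V" and W: "umodule W"
  shows "umodule (ihom V W)"
proof (rule umoduleI)
  let ?E = "ihom V W"
  note m = umodule_module[OF V] umodule_module[OF W]
  show E: "module K ?E" by (intro ihom_module m)
  show "bilin K H ?E ?E (act ?E)"
  proof (intro bilinI klinear_ihomI m E H_modules act_ihom_closed V W; assumption?)
    fix L v assume L: "L \<in> carrier ?E" and v: "v \<in> carrier V"
    show "klinear K H W (\<lambda>h. act ?E h L v)"
      unfolding act_ihom[OF v] using bilin_act_S[OF V W L v]
      by (intro klinear_tlift[OF H_modules(1,1) m(2)] comult_linear) (simp add: bilin_def)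
  next
    fix h v assume h: "h \<in> carrier H" and v: "v \<in> carrier V"
    show "klinear K ?E W (\<lambda>L. act ?E h L v)"
      unfolding act_ihom[OF v] using h v V by (intro lin W m) auto
  qed
  fix L assume L: "L \<in> carrier ?E"
  show "act ?E \<one>\<^bsub>H\<^esub> L = L"
  proof (rule ihom_ext[OF act_ihom_closed[OF V W L H_one_closed] L])
    fix v assume v: "v \<in> carrier V"
    have b: "bilin K H H W (\<lambda>x y. act W x (L (act V (S y) v)))"
      using bilin_act_S[OF V W L v] by (simp add: bilin_def)
    show "act ?E \<one>\<^bsub>H\<^esub> L v = L v"
      using b v L V W by (simp add: act_ihom comult_one tensor_one_H tlift_H(5) m)
  qed
  fix h h' assume h: "h \<in> carrier H" "h' \<in> carrier H"
  show "act ?E (h \<otimes>\<^bsub>H\<^esub> h') L = act ?E h (act ?E h' L)"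
  proof (rule ihom_ext[of _ V W])
    show "act ?E (h \<otimes>\<^bsub>H\<^esub> h') L \<in> carrier ?E" "act ?E h (act ?E h' L) \<in> carrier ?E"
      using h L by (auto intro!: act_ihom_closed V W)
    fix v assume v: "v \<in> carrier V"
    let ?Q = "\<lambda>x y. act W x (L (act V (S y) v))"
    note b = bilin_act_S[OF V W L v]
    \<comment> \<open>The adjoint action is an action of \<Delta>(h) on two slots in
      \<open>regular\<close>, evaluated at units, so the right action law applies. The antipode
      reverses products, which is what places the legs of h' inside those of h.\<close>
    have "act ?E (h \<otimes>\<^bsub>H\<^esub> h') L v = act2 regular regular W ?Q (\<Delta> h \<otimes>\<^bsub>HH\<^esub> \<Delta> h') \<one>\<^bsub>H\<^esub> \<one>\<^bsub>H\<^esub>"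
      unfolding act2_def using h v kalg_closed[OF kalg_HH, of "\<Delta> h" "\<Delta> h'"]
      by (auto simp: act_ihom comult_mult intro!: tlift_H(3))
    also have "\<dots> = act2 regular regular W (act2 regular regular W ?Q (\<Delta> h)) (\<Delta> h') \<one>\<^bsub>H\<^esub> \<one>\<^bsub>H\<^esub>"
      using h by (intro act2_mult[OF umodule_regular umodule_regular m(2) b]) auto
    also have "\<dots> = tlift W (\<lambda>a' b'. tlift W (\<lambda>a b. ?Q (a \<otimes>\<^bsub>H\<^esub> a') (b \<otimes>\<^bsub>H\<^esub> b')) (\<Delta> h)) (\<Delta> h')"
      unfolding act2_def using h by (auto intro!: tlift_H(3))
    also have "\<dots> = tlift W (\<lambda>a b. tlift W (\<lambda>a' b'. ?Q (a \<otimes>\<^bsub>H\<^esub> a') (b \<otimes>\<^bsub>H\<^esub> b')) (\<Delta> h')) (\<Delta> h)"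
      using h v L V W by (intro tlift_commute[OF H_modules(1,1,1,1) m(2)]) auto
    also have "\<dots> = tlift W (\<lambda>a b. act W a (act ?E h' L (act V (S b) v))) (\<Delta> h)"
    proof (rule tlift_H(3))
      fix a b assume ab: "a \<in> carrier H" "b \<in> carrier H"
      show "tlift W (\<lambda>a' b'. ?Q (a \<otimes>\<^bsub>H\<^esub> a') (b \<otimes>\<^bsub>H\<^esub> b')) (\<Delta> h') = act W a (act ?E h' L (act V (S b) v))"
        using ab h v L V W
        by (simp add: act_ihom tlift_H(2)[OF m(2) m(2) _ klinear_act_r[OF W ab(1) klinear_id]] antip_mult act_mult cong: tlift_H(3))
    qed (use h in simp)
    also have "\<dots> = act ?E h (act ?E h' L) v" using v by (simp add: act_ihom)
    finally show "act ?E (h \<otimes>\<^bsub>H\<^esub> h') L v = act ?E h (act ?E h' L) v" .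
  qed
qed

lemma tlift_ihom:
  assumes "module K V" "module K W" "t \<in> carrier HH" "v \<in> carrier V"
    "\<And>a b. a \<in> carrier H \<Longrightarrow> b \<in> carrier H \<Longrightarrow> f a b \<in> carrier (ihom V W)"
  shows "tlift (ihom V W) f t v = tlift W (\<lambda>a b. f a b v) t"
  by (rule tlift_H(2)[where g="\<lambda>L. L v"]) (auto intro!: ihom_module klinear_eval assms)

text \<open>The axiom on \<alpha> read as invariance: acting by \<Delta>(h) on y and v inserts S(h1)
  \<alpha> h2 between S(y) and v, and this equals \<epsilon>(h) \<alpha>.\<close>

lemma equivar_alpha:
  assumes V: "umodule V"
  shows "equivar regular V (counit_mod V) (\<lambda>y v. act V (S y \<otimes>\<^bsub>H\<^esub> \<alpha>) v)"
  unfolding equivar_def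
proof (intro conjI ballI)
  show "bilin K regular V (counit_mod V) (\<lambda>y v. act V (S y \<otimes>\<^bsub>H\<^esub> \<alpha>) v)"
    by (rule bilinI; simp; intro lin V; simp)
  fix h y v assume h: "h \<in> carrier H" and "y \<in> carrier regular" and v: "v \<in> carrier V"
  then have y: "y \<in> carrier H" by simp
  have l: "klinear K H V (\<lambda>m. act V (S y \<otimes>\<^bsub>H\<^esub> m) v)" using y v by (intro lin V) auto
  have "act2 regular V (counit_mod V) (\<lambda>y v. act V (S y \<otimes>\<^bsub>H\<^esub> \<alpha>) v) (\<Delta> h) y v
      = tlift V (\<lambda>a b. act V (S y \<otimes>\<^bsub>H\<^esub> (S a \<otimes>\<^bsub>H\<^esub> \<alpha> \<otimes>\<^bsub>H\<^esub> b)) v) (\<Delta> h)"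
    unfolding act2_def using h y v V
    by (auto simp: tlift_def[of "counit_mod V"] tlift_def[symmetric] antip_mult act_mult H_assoc intro!: tlift_H(3))
  also have "\<dots> = act V (S y \<otimes>\<^bsub>H\<^esub> (\<epsilon> h \<odot>\<^bsub>H\<^esub> \<alpha>)) v"
    using h V by (simp add: tlift_H(2)[OF _ _ _ l, symmetric] antip_alpha)
  also have "\<dots> = \<epsilon> h \<odot>\<^bsub>V\<^esub> act V (S y \<otimes>\<^bsub>H\<^esub> \<alpha>) v"
    using h by (simp add: klinear_smult[OF l])
  finally show "act (counit_mod V) h (act V (S y \<otimes>\<^bsub>H\<^esub> \<alpha>) v)
      = act2 regular V (counit_mod V) (\<lambda>y v. act V (S y \<otimes>\<^bsub>H\<^esub> \<alpha>) v) (\<Delta> h) y v" by simp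
qed

text \<open>The operators through which the second and third legs of \<open>\<phi>inv\<close> enter
  a curried map. As y and z vary they form an equivariant family over two copies of
  \<open>regular\<close>, with \<beta> at the units.\<close>

definition bop where
  "bop W y z = (\<lambda>w\<in>carrier W. act W (y \<otimes>\<^bsub>H\<^esub> \<beta> \<otimes>\<^bsub>H\<^esub> S z) w)"

lemma bop_closed [simp]:
  "umodule W \<Longrightarrow> y \<in> carrier H \<Longrightarrow> z \<in> carrier H \<Longrightarrow> bop W y z \<in> carrier (ihom W W)"
  unfolding bop_def by (intro restrict_ihom lin) auto

lemma bop_one: "bop W \<one>\<^bsub>H\<^esub> \<one>\<^bsub>H\<^esub> = beta_op W"
  by (simp add: bop_def beta_op_def)

lemma bop_apply: "w \<in> carrier W \<Longrightarrow> bop W y z w = act W (y \<otimes>\<^bsub>H\<^esub> \<beta> \<otimes>\<^bsub>H\<^esub> S z) w"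
  by (simp add: bop_def)

lemma equivar_bop:
  assumes W: "umodule W"
  shows "equivar regular regular (ihom W W) (bop W)"
  unfolding equivar_def
proof (intro conjI ballI)
  note m = umodule_module[OF W]
  show "bilin K regular regular (ihom W W) (bop W)"
    using W by (intro bilinI; simp; intro klinear_ihomI m bop_closed; simp add: bop_apply; intro lin; simp)
  fix h y z assume h: "h \<in> carrier H" and "y \<in> carrier regular" "z \<in> carrier regular"
  then have yz: "y \<in> carrier H" "z \<in> carrier H" by simp_all
  have t: "tlift (ihom W W) (\<lambda>a b. bop W (a \<otimes>\<^bsub>H\<^esub> y) (b \<otimes>\<^bsub>H\<^esub> z)) (\<Delta> h) \<in> carrier (ihom W W)"
    using h yz W by (intro tlift_H(4) ihom_module m) auto
  show "act (ihom W W) h (bop W y z) = act2 regular regular (ihom W W) (bop W) (\<Delta> h) y z"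
    unfolding act2_def regular_simps
  proof (rule ihom_ext[OF act_ihom_closed[OF W W bop_closed[OF W yz] h] t])
    fix w assume w: "w \<in> carrier W"
    show "act (ihom W W) h (bop W y z) w = tlift (ihom W W) (\<lambda>a b. bop W (a \<otimes>\<^bsub>H\<^esub> y) (b \<otimes>\<^bsub>H\<^esub> z)) (\<Delta> h) w"
      using h yz w W
      by (subst tlift_ihom[OF m m]) (auto simp: act_ihom bop_apply antip_mult act_mult H_assoc intro!: tlift_H(3))
  qed
qed

text \<open>This is the axiom on \<beta>, read in the adjoint action. Being invariant, the unit of
  end(W) can be passed by \<phi> and by R.\<close>

lemma beta_op_invariant:
  assumes W: "umodule W" and h: "h \<in> carrier H"
  shows "act (ihom W W) h (beta_op W) = \<epsilon> h \<odot>\<^bsub>ihom W W\<^esub> beta_op W"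
proof -
  interpret E: module K "ihom W W" using W by simp
  have b: "beta_op W \<in> carrier (ihom W W)" using W by simp
  show ?thesis
  proof (rule ihom_ext[OF act_ihom_closed[OF W W b h]])
    show "\<epsilon> h \<odot>\<^bsub>ihom W W\<^esub> beta_op W \<in> carrier (ihom W W)" using b h by simp
    fix w assume w: "w \<in> carrier W"
    have l: "klinear K H W (\<lambda>m. act W m w)" by (intro lin W w)
    have "act (ihom W W) h (beta_op W) w = tlift W (\<lambda>a b. act W (a \<otimes>\<^bsub>H\<^esub> \<beta> \<otimes>\<^bsub>H\<^esub> S b) w) (\<Delta> h)"
      using w h W by (auto simp: act_ihom beta_op_def act_mult intro!: tlift_H(3))
    also have "\<dots> = act W (\<epsilon> h \<odot>\<^bsub>H\<^esub> \<beta>) w"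
      using h W by (simp add: tlift_H(2)[OF _ _ _ l, symmetric] antip_beta)
    finally show "act (ihom W W) h (beta_op W) w = (\<epsilon> h \<odot>\<^bsub>ihom W W\<^esub> beta_op W) w"
      using w h by (simp add: klinear_smult[OF l] ihom_simps(4) beta_op_def)
  qed
qed

subsection \<open>Evaluation\<close>

text \<open>The integrand of evaluation before \<phi> has acted: its first two legs become slots in
  \<open>regular\<close>, its third leg acts on \<open>v\<close>. Evaluation is recovered by letting
  \<phi> act and inserting units.\<close>

definition apF where
  "apF V W L x y v = act W x (L (act V (S y \<otimes>\<^bsub>H\<^esub> \<alpha>) v))"

lemma apF_trilin:
  assumes "umodule V" "umodule W" "L \<in> carrier (ihom V W)"
  shows "trilin K regular regular V W (apF V W L)"
  unfolding apF_def using assms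
  by (intro trilinI; simp; intro lin klinear_ihom_app[OF assms(3)]; simp)

lemma ap_act3:
  assumes "umodule V" "umodule W" "L \<in> carrier (ihom V W)" "v \<in> carrier V"
  shows "ap V W L v = act3 regular regular V W (apF V W L) \<phi> \<one>\<^bsub>H\<^esub> \<one>\<^bsub>H\<^esub> v"
  unfolding ap_def act3_def apF_def using assms by (intro tlift3_H(3)) (auto simp: act_mult)

lemma bilin_ap: 
  assumes V: "umodule V" and W: "umodule W"
  shows "bilin K (ihom V W) V W (ap V W)"
  unfolding ap_def
  by (intro bilinI; intro lin V W klinear_ihom_app[where V=V and W=W]; simp add: V W)

lemmas ap_closed = bilin_closed[OF bilin_ap]

text \<open>The adjoint action puts the legs of \<Delta>(h) next to the first two legs of \<phi>,
  that is, on the two slots in \<open>regular\<close>. This exposes the expression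
  \<open>\<Delta>_id (\<Delta> h)\<close> to which quasi-coassociativity applies.\<close>

lemma ap_act:
  assumes V: "umodule V" and W: "umodule W" and L: "L \<in> carrier (ihom V W)" and v: "v \<in> carrier V" and h: "h \<in> carrier H"
  shows "ap V W (act (ihom V W) h L) v
    = act2 regular regular W (\<lambda>x y. act3 regular regular V W (apF V W L) \<phi> x y v) (\<Delta> h) \<one>\<^bsub>H\<^esub> \<one>\<^bsub>H\<^esub>"
proof -
  have "ap V W (act (ihom V W) h L) v
      = tlift3 W (\<lambda>a b c. tlift W (\<lambda>p q. apF V W L (a \<otimes>\<^bsub>H\<^esub> p) (b \<otimes>\<^bsub>H\<^esub> q) (act V c v)) (\<Delta> h)) \<phi>"
    unfolding ap_def
  proof (rule tlift3_H(3)[OF phi_closed(1)])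
    fix a b c assume abc: "a \<in> carrier H" "b \<in> carrier H" "c \<in> carrier H"
    show "act W a (act (ihom V W) h L (act V (S b \<otimes>\<^bsub>H\<^esub> \<alpha> \<otimes>\<^bsub>H\<^esub> c) v))
        = tlift W (\<lambda>p q. apF V W L (a \<otimes>\<^bsub>H\<^esub> p) (b \<otimes>\<^bsub>H\<^esub> q) (act V c v)) (\<Delta> h)"
      using abc h v V W L
      by (simp add: act_ihom apF_def tlift_H(2)[OF _ _ _ klinear_act_r[OF W abc(1) klinear_id]] antip_mult act_mult H_assoc cong: tlift_H(3))
  qed
  also have "\<dots> = tlift W (\<lambda>p q. tlift3 W (\<lambda>a b c. apF V W L (a \<otimes>\<^bsub>H\<^esub> p) (b \<otimes>\<^bsub>H\<^esub> q) (act V c v)) \<phi>) (\<Delta> h)"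
    using h v V W L by (intro tlift_tlift3_commute[symmetric]) (auto simp: apF_def)
  also have "\<dots> = act2 regular regular W (\<lambda>x y. act3 regular regular V W (apF V W L) \<phi> x y v) (\<Delta> h) \<one>\<^bsub>H\<^esub> \<one>\<^bsub>H\<^esub>"
    unfolding act2_def act3_def using h v V W by (intro tlift_H(3)) auto
  finally show ?thesis .
qed

text \<open>Quasi-coassociativity moves \<Delta>(h) across \<phi>. On the other side its last two
  legs meet around \<alpha> and disappear by the counit, which leaves \<open>h\<close> acting on the
  result.\<close>

lemma equivar_ap [intro]:
  assumes V: "umodule V" and W: "umodule W"
  shows "equivar (ihom V W) V W (ap V W)"
  unfolding equivar_def
proof (intro conjI ballI)
  show "bilin K (ihom V W) V W (ap V W)" by (rule bilin_ap[OF V W])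
  note m = umodule_module[OF V] umodule_module[OF W]
  fix h L v assume h: "h \<in> carrier H" and L: "L \<in> carrier (ihom V W)" and v: "v \<in> carrier V"
  let ?F = "apF V W L" and ?R = regular
  note R = umodule_regular
  note F = apF_trilin[OF V W L]
  have aF: "trilin K ?R ?R V W (act3 ?R ?R V W ?F \<phi>)" by (rule act3_trilin[OF R R V m(2) F phi_closed(1)])
  have "act2 (ihom V W) V W (ap V W) (\<Delta> h) L v
      = tlift W (\<lambda>a b. act2 ?R ?R W (\<lambda>x y. act3 ?R ?R V W ?F \<phi> x y (act V b v)) (\<Delta> a) \<one>\<^bsub>H\<^esub> \<one>\<^bsub>H\<^esub>) (\<Delta> h)"
    unfolding act2_def[of "ihom V W"] using h v L V W by (intro tlift_H(3)) (auto simp: ap_act)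
  also have "\<dots> = act3 ?R ?R V W (act3 ?R ?R V W ?F \<phi>) (\<Delta>_id (\<Delta> h)) \<one>\<^bsub>H\<^esub> \<one>\<^bsub>H\<^esub> v"
    using h v by (intro act3_comult_1[OF R R V m(2) aF, symmetric]) auto
  also have "\<dots> = act3 ?R ?R V W (act3 ?R ?R V W ?F (id_\<Delta> (\<Delta> h))) \<phi> \<one>\<^bsub>H\<^esub> \<one>\<^bsub>H\<^esub> v"
    using h v by (intro act3_coassoc(1)[OF R R V m(2) F, symmetric]) auto
  also have "\<dots> = act3 ?R ?R V W (\<lambda>x y v. act W h (?F x y v)) \<phi> \<one>\<^bsub>H\<^esub> \<one>\<^bsub>H\<^esub> v"
  proof (rule act3_cong[OF R R V m(2)])
    fix x y v assume "x \<in> carrier ?R" "y \<in> carrier ?R" and v: "v \<in> carrier V"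
    then have xy: "x \<in> carrier H" "y \<in> carrier H" by simp_all
    have t: "trivial (counit_mod V)" using m by blast
    have G: "bilin K ?R (counit_mod V) W (\<lambda>x m. act W x (L m))"
      using V W L by (intro bilinI; simp; intro lin klinear_ihom_app[OF L]; simp)
    \<comment> \<open>The slots y and v enter only through S(y) \<alpha> v, which is invariant;
      hence only the first slot feels \<open>h\<close>.\<close>
    have "act3 ?R ?R V W ?F (id_\<Delta> (\<Delta> h)) x y v = act2 ?R (counit_mod V) W (\<lambda>x m. act W x (L m)) (\<Delta> h) x (act V (S y \<otimes>\<^bsub>H\<^esub> \<alpha>) v)"
      using act3_merge_right[OF R R V trivial_umodule[OF t] m(2) G equivar_alpha[OF V], of "\<Delta> h" x y v] xy v h
      unfolding apF_def by simp
    also have "\<dots> = act W (h \<otimes>\<^bsub>H\<^esub> x) (L (act V (S y \<otimes>\<^bsub>H\<^esub> \<alpha>) v))"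
      using xy v h V by (subst act2_counit(2)[OF R trivial_umodule[OF t] m(2) G]) auto
    finally show "act3 ?R ?R V W ?F (id_\<Delta> (\<Delta> h)) x y v = act W h (?F x y v)"
      using xy v h V W L by (simp add: apF_def act_mult)
  qed (use v in auto)
  also have "\<dots> = act W h (act3 ?R ?R V W ?F \<phi> \<one>\<^bsub>H\<^esub> \<one>\<^bsub>H\<^esub> v)"
    using h v W by (intro act3_linear[OF R R V m(2) F m(2), symmetric] klinear_act_r klinear_id) auto
  finally show "act W h (ap V W L v) = act2 (ihom V W) V W (ap V W) (\<Delta> h) L v"
    using L v V W by (simp add: ap_act3)
qed

text \<open>Evaluating the unit assembles exactly the expression of the axiom
  \<open>antip_assoc\<close>, which is 1.\<close>

lemma ap_beta_op:
  assumes V: "umodule V" and v: "v \<in> carrier V"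
  shows "ap V V (beta_op V) v = v"
proof -
  have l: "klinear K H V (\<lambda>m. act V m v)" by (intro lin V v)
  have "ap V V (beta_op V) v = tlift3 V (\<lambda>a b c. act V (a \<otimes>\<^bsub>H\<^esub> \<beta> \<otimes>\<^bsub>H\<^esub> S b \<otimes>\<^bsub>H\<^esub> \<alpha> \<otimes>\<^bsub>H\<^esub> c) v) \<phi>"
    unfolding ap_def using v V by (intro tlift3_H(3)) (auto simp: beta_op_def act_mult H_assoc)
  also have "\<dots> = v"
    using V v by (simp add: tlift3_H(2)[OF _ _ _ l, symmetric] antip_assoc)
  finally show ?thesis .
qed

end

context quasi_hopf_algebra
begin

subsection \<open>Currying\<close>

lemma klinear_curry_arg:
  assumes V: "umodule V" and W: "umodule W" and X: "module K X" and F: "bilin K V W X F" and v: "v \<in> carrier V"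
  shows "klinear K W X (\<lambda>w. tlift3 X (\<lambda>a b c. F (act V a v) (act W (b \<otimes>\<^bsub>H\<^esub> \<beta> \<otimes>\<^bsub>H\<^esub> S c) w)) \<phi>inv)"
  by (intro lin bilin_right[OF F] X V W; simp add: V W v)

lemma curry_h_closed:
  assumes V: "umodule V" and W: "umodule W" and X: "module K X" and F: "bilin K V W X F" and v: "v \<in> carrier V"
  shows "curry_h V W X F v \<in> carrier (ihom W X)"
  unfolding curry_h_def by (intro restrict_ihom klinear_curry_arg[OF assms] umodule_module W)

lemma klinear_curry_h:
  assumes V: "umodule V" and W: "umodule W" and X: "module K X" and F: "bilin K V W X F"
  shows "klinear K V (ihom W X) (curry_h V W X F)"
proof (intro klinear_ihomI umodule_module[OF V] umodule_module[OF W] V W X curry_h_closed F; assumption?)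
  fix w assume w: "w \<in> carrier W"
  show "klinear K V X (\<lambda>v. curry_h V W X F v w)"
    unfolding curry_h_def using w by (simp, intro lin bilin_left[OF F] X V W; simp add: V W)
qed

text \<open>Equivariance of \<open>F\<close> collects the legs of h into
  \<open>\<Delta>_id (\<Delta> h)\<close>, acting before \<open>\<phi>inv\<close>.
  Quasi-coassociativity turns this into \<open>id_\<Delta> (\<Delta> h)\<close> acting after it,
  where invariance of \<beta> removes all but the action on \<open>v\<close>.\<close>

lemma curry_h_act:
  assumes V: "umodule V" and W: "umodule W" and X: "umodule X" and F: "equivar V W X F"
    and v: "v \<in> carrier V" and h: "h \<in> carrier H"
  shows "curry_h V W X F (act V h v) = act (ihom W X) h (curry_h V W X F v)"
proof (rule ihom_ext[of _ W X])
  note m = umodule_module[OF V] umodule_module[OF W] umodule_module[OF X]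
  note bF = equivar_bilin[OF F]
  note R = umodule_regular
  let ?R = regular
  show "curry_h V W X F (act V h v) \<in> carrier (ihom W X)"
    using h v V by (intro curry_h_closed V W m bF) auto
  show "act (ihom W X) h (curry_h V W X F v) \<in> carrier (ihom W X)"
    by (intro act_ihom_closed curry_h_closed V W X m bF v h)
  fix w assume w: "w \<in> carrier W"
  let ?Q = "\<lambda>x y z. F x (act W (y \<otimes>\<^bsub>H\<^esub> \<beta> \<otimes>\<^bsub>H\<^esub> S z) w)"
  have Q: "trilin K V ?R ?R X ?Q"
    by (rule trilinI; simp; intro bilin_left[OF bF] bilin_right[OF bF] lin W; simp add: W w)
  have aQ: "trilin K V ?R ?R X (act3 V ?R ?R X ?Q \<phi>inv)"
    by (rule act3_trilin[OF V R R m(3) Q phi_closed(2)])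
  \<comment> \<open>After \<open>\<phi>inv\<close> has acted, y and z occur only in the operator
    \<open>bop W y z\<close>. This factorisation is what permits merging the last two slots.\<close>
  let ?P = "\<lambda>x m. tlift3 X (\<lambda>a b c. F (act V a x) (act W b (m (act W (S c) w)))) \<phi>inv"
  have P: "bilin K V (ihom W W) X ?P"
    by (rule bilinI; intro lin bilin_left[OF bF] bilin_right[OF bF] V W m(3); simp add: V W w)
  have e: "act3 V ?R ?R X ?Q \<phi>inv x y z = ?P x (bop W y z)" if "x \<in> carrier V" "y \<in> carrier H" "z \<in> carrier H" for x y z
    unfolding act3_def using that w W by (intro tlift3_H(3)) (auto simp: bop_apply act_mult antip_mult H_assoc)
  have "act (ihom W X) h (curry_h V W X F v) w
      = tlift X (\<lambda>p q. tlift3 X (\<lambda>a b c. act X p (F (act V a v) (act W (b \<otimes>\<^bsub>H\<^esub> \<beta> \<otimes>\<^bsub>H\<^esub> S c) (act W (S q) w)))) \<phi>inv) (\<Delta> h)"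
    unfolding act_ihom[OF w]
  proof (rule tlift_H(3))
    fix p q assume pq: "p \<in> carrier H" "q \<in> carrier H"
    show "act X p (curry_h V W X F v (act W (S q) w))
      = tlift3 X (\<lambda>a b c. act X p (F (act V a v) (act W (b \<otimes>\<^bsub>H\<^esub> \<beta> \<otimes>\<^bsub>H\<^esub> S c) (act W (S q) w)))) \<phi>inv"
      unfolding curry_h_def using pq v w V W X
      by (simp, intro tlift3_H(2)[OF m(3) m(3)] klinear_act_r[OF X pq(1) klinear_id] bilin_closed[OF bF]) auto
  qed (use h in simp)
  also have "\<dots> = tlift3 X (\<lambda>a b c. tlift X (\<lambda>p q. act X p (F (act V a v) (act W (b \<otimes>\<^bsub>H\<^esub> \<beta> \<otimes>\<^bsub>H\<^esub> S c) (act W (S q) w)))) (\<Delta> h)) \<phi>inv"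
    using h v w V W X by (intro tlift_tlift3_commute m) (auto intro!: act_closed bilin_closed[OF bF])
  also have "\<dots> = act3 V ?R ?R X (act3 V ?R ?R X ?Q (\<Delta>_id (\<Delta> h))) \<phi>inv v \<one>\<^bsub>H\<^esub> \<one>\<^bsub>H\<^esub>"
    unfolding act3_def[of V ?R ?R X "act3 V ?R ?R X ?Q (\<Delta>_id (\<Delta> h))"]
  proof (rule tlift3_H(3)[OF phi_closed(2)])
    fix a b c assume abc: "a \<in> carrier H" "b \<in> carrier H" "c \<in> carrier H"
    have "act3 V ?R ?R X ?Q (\<Delta>_id (\<Delta> h)) (act V a v) b c
        = tlift X (\<lambda>p q. act2 V ?R X (\<lambda>x y. ?Q x y (q \<otimes>\<^bsub>H\<^esub> c)) (\<Delta> p) (act V a v) b) (\<Delta> h)"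
      using abc h v V by (subst act3_comult_1[OF V R R m(3) Q]) auto
    also have "\<dots> = tlift X (\<lambda>p q. act X p (F (act V a v) (act W (b \<otimes>\<^bsub>H\<^esub> \<beta> \<otimes>\<^bsub>H\<^esub> S c) (act W (S q) w)))) (\<Delta> h)"
    proof (rule tlift_H(3))
      fix p q assume pq: "p \<in> carrier H" "q \<in> carrier H"
      show "act2 V ?R X (\<lambda>x y. ?Q x y (q \<otimes>\<^bsub>H\<^esub> c)) (\<Delta> p) (act V a v) b
        = act X p (F (act V a v) (act W (b \<otimes>\<^bsub>H\<^esub> \<beta> \<otimes>\<^bsub>H\<^esub> S c) (act W (S q) w)))"
        using pq abc v w V W by (subst equivar_act[OF F]) (auto simp: act2_def act_mult antip_mult H_assoc intro!: tlift_H(3))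
    qed (use h in simp)
    finally show "tlift X (\<lambda>p q. act X p (F (act V a v) (act W (b \<otimes>\<^bsub>H\<^esub> \<beta> \<otimes>\<^bsub>H\<^esub> S c) (act W (S q) w)))) (\<Delta> h)
        = act3 V ?R ?R X ?Q (\<Delta>_id (\<Delta> h)) (act V a v) (act ?R b \<one>\<^bsub>H\<^esub>) (act ?R c \<one>\<^bsub>H\<^esub>)"
      using abc by simp
  qed
  also have "\<dots> = act3 V ?R ?R X (act3 V ?R ?R X ?Q \<phi>inv) (id_\<Delta> (\<Delta> h)) v \<one>\<^bsub>H\<^esub> \<one>\<^bsub>H\<^esub>"
    using h v by (intro act3_coassoc(2)[OF V R R m(3) Q]) auto
  also have "\<dots> = act3 V ?R ?R X (\<lambda>x y z. ?P x (bop W y z)) (id_\<Delta> (\<Delta> h)) v \<one>\<^bsub>H\<^esub> \<one>\<^bsub>H\<^esub>"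
    using h v by (intro act3_cong[OF V R R m(3)]) (auto simp: e)
  also have "\<dots> = act2 V (ihom W W) X ?P (\<Delta> h) v (bop W \<one>\<^bsub>H\<^esub> \<one>\<^bsub>H\<^esub>)"
    using h v W by (intro act3_merge_right[OF V R R _ m(3) P equivar_bop[OF W]]) auto
  also have "\<dots> = ?P (act V h v) (beta_op W)"
    unfolding bop_one using h v W by (intro act2_counit(2)[OF V _ m(3) P]) (auto simp: beta_op_invariant)
  also have "\<dots> = curry_h V W X F (act V h v) w"
    unfolding curry_h_def using w h v V W by (auto simp: beta_op_def act_mult intro!: tlift3_H(3))
  finally show "curry_h V W X F (act V h v) w = act (ihom W X) h (curry_h V W X F v) w" by simp
qed

text \<open>Uncurrying after currying is the identity. Of the five factors of the pentagon on
  \<open>?G\<close>, one is trivial by invariance of \<alpha>, one becomes an evaluation, and one is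
  trivial on the slots of \<beta> once units are inserted. The remaining relation between
  \<open>\<Delta>_id_id \<phi>\<close> and \<open>tens_one \<phi>\<close> is the claim, after a
  cancellation of \<phi> against the \<open>\<phi>inv\<close> of \<open>curry_h\<close>.\<close>

lemma ap_curry_h:
  assumes V: "umodule V" and W: "umodule W" and X: "umodule X" and F: "equivar V W X F"
    and v: "v \<in> carrier V" and w: "w \<in> carrier W"
  shows "ap W X (curry_h V W X F v) w = F v w"
proof -
  note m = umodule_module[OF V] umodule_module[OF W] umodule_module[OF X]
  note bF = equivar_bilin[OF F]
  note R = umodule_regular
  note cl = bilin_closed[OF bF] ap_closed[OF W W]
  let ?R = regular and ?M = "counit_mod W"
  have t: "trivial ?M" using m by blast
  \<comment> \<open>The slots a, b, c take the legs of \<open>\<phi>inv\<close>, and the legs of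
    \<phi> act on all four arguments.\<close>
  let ?G = "\<lambda>a b c w. F (act V a v) (act W (b \<otimes>\<^bsub>H\<^esub> \<beta>) (act W (S c \<otimes>\<^bsub>H\<^esub> \<alpha>) w))"
  have G: "quadlin K ?R ?R ?R W X ?G"
    by (rule quadlinI; simp; intro bilin_left[OF bF] bilin_right[OF bF] lin V W; simp add: V W v)
  let ?P = "\<lambda>a b m. F (act V a v) (act W (b \<otimes>\<^bsub>H\<^esub> \<beta>) m)"
  have P: "trilin K ?R ?R ?M X ?P"
    by (rule trilinI; simp; intro bilin_left[OF bF] bilin_right[OF bF] lin V W; simp add: V W v)
  have 1: "act4 ?R ?R ?R W X ?G (id_id_\<Delta> \<phi>) a b c w = ?G a b c w"
    if "a \<in> carrier H" "b \<in> carrier H" "c \<in> carrier H" "w \<in> carrier W" for a b c w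
  proof -
    have "act4 ?R ?R ?R W X ?G (id_id_\<Delta> \<phi>) a b c w = act3 ?R ?R ?M X ?P \<phi> a b (act W (S c \<otimes>\<^bsub>H\<^esub> \<alpha>) w)"
      using that act4_merge_3[OF R R R W trivial_umodule[OF t] m(3) P equivar_alpha[OF W] phi_closed(1), of a b c w] by simp
    also have "\<dots> = ?G a b c w"
      using that W by (intro act3_phi_right[OF R R _ m(3) P]) (auto simp: t)
    finally show ?thesis .
  qed
  let ?N = "\<lambda>a m w. F (act V a v) (ap W W m w)"
  have N: "trilin K ?R (ihom W W) W X ?N"
    by (rule trilinI; simp; intro bilin_left[OF bF] bilin_right[OF bF] bilin_left[OF bilin_ap[OF W W]]
        bilin_right[OF bilin_ap[OF W W]] lin V W cl; simp add: V W v)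
  have 2: "act4 ?R ?R ?R W X ?G (one_tens \<phi>) a b c w = ?N a (bop W b c) w"
    if "a \<in> carrier H" "b \<in> carrier H" "c \<in> carrier H" "w \<in> carrier W" for a b c w
  proof -
    have l: "klinear K W X (F (act V a v))" using that V v by (intro bilin_right[OF bF _ klinear_id]) auto
    have "act4 ?R ?R ?R W X ?G (one_tens \<phi>) a b c w = act3 ?R ?R W X (?G a) \<phi> b c w"
      using that by (intro act4_one_tens[OF R R R W m(3) G]) auto
    also have "\<dots> = tlift3 X (\<lambda>p q r. F (act V a v) (act W p (bop W b c (act W (S q \<otimes>\<^bsub>H\<^esub> \<alpha> \<otimes>\<^bsub>H\<^esub> r) w)))) \<phi>"
      unfolding act3_def using that W by (intro tlift3_H(3)) (auto simp: bop_apply act_mult antip_mult)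
    also have "\<dots> = ?N a (bop W b c) w"
      unfolding ap_def using that W by (intro tlift3_H(2)[OF m(2,3) _ l, symmetric]) (auto simp: bop_apply)
    finally show ?thesis .
  qed
  let ?G2 = "act4 ?R ?R ?R W X (act4 ?R ?R ?R W X ?G (one_tens \<phi>)) (id_\<Delta>_id \<phi>)"
  have G2: "quadlin K ?R ?R ?R W X ?G2" by (intro act4_quadlin R W m G) simp_all
  have G2': "trilin K ?R ?R ?R X (\<lambda>a b c. ?G2 a b c w)"
    using w by (intro trilinI quadlin_1[OF G2 klinear_id] quadlin_2[OF G2 _ klinear_id] quadlin_3[OF G2 _ _ klinear_id])
  \<comment> \<open>Merging b and c into \<open>bop\<close> puts \<beta> on the middle leg of
    \<phi>, where its invariance makes it transparent. The axiom \<open>antip_assoc\<close>, in the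
    form of \<open>ap_beta_op\<close>, does the rest.\<close>
  have 3: "?G2 \<one>\<^bsub>H\<^esub> \<one>\<^bsub>H\<^esub> \<one>\<^bsub>H\<^esub> w = F v w"
  proof -
    have "?G2 \<one>\<^bsub>H\<^esub> \<one>\<^bsub>H\<^esub> \<one>\<^bsub>H\<^esub> w = act4 ?R ?R ?R W X (\<lambda>a b c w. ?N a (bop W b c) w) (id_\<Delta>_id \<phi>) \<one>\<^bsub>H\<^esub> \<one>\<^bsub>H\<^esub> \<one>\<^bsub>H\<^esub> w"
      using w by (intro act4_cong[OF R R R W m(3)]) (simp_all add: 2)
    also have "\<dots> = act3 ?R (ihom W W) W X ?N \<phi> \<one>\<^bsub>H\<^esub> (bop W \<one>\<^bsub>H\<^esub> \<one>\<^bsub>H\<^esub>) w"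
      using w W by (intro act4_merge_2[OF R R R W _ m(3) N equivar_bop[OF W]]) auto
    also have "\<dots> = ?N \<one>\<^bsub>H\<^esub> (beta_op W) w"
      unfolding bop_one using w W by (intro act3_phi_middle[OF R _ W m(3) N]) (auto simp: beta_op_invariant)
    also have "\<dots> = F v w" using v w V W by (simp add: ap_beta_op)
    finally show ?thesis .
  qed
  \<comment> \<open>Inserting the trivial factor \<open>id_id_\<Delta> \<phi>\<close> completes one
    side of the pentagon; on the other side only \<open>tens_one \<phi>\<close> is left outside
    \<open>?G2\<close>.\<close>
  have 4: "act4 ?R ?R ?R W X ?G (\<Delta>_id_id \<phi>) a b c w = act3 ?R ?R ?R X (\<lambda>a b c. ?G2 a b c w) \<phi> a b c"
    if "a \<in> carrier H" "b \<in> carrier H" "c \<in> carrier H" for a b c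
  proof -
    have "act4 ?R ?R ?R W X ?G (\<Delta>_id_id \<phi>) a b c w = act4 ?R ?R ?R W X (act4 ?R ?R ?R W X ?G (id_id_\<Delta> \<phi>)) (\<Delta>_id_id \<phi>) a b c w"
      using that w by (intro act4_cong[OF R R R W m(3)]) (simp_all add: 1)
    also have "\<dots> = act4 ?R ?R ?R W X ?G2 (tens_one \<phi>) a b c w"
      using that w by (intro act4_pentagon[OF R R R W m(3) G, symmetric]) auto
    also have "\<dots> = act3 ?R ?R ?R X (\<lambda>a b c. ?G2 a b c w) \<phi> a b c"
      using that w by (intro act4_tens_one[OF R R R W m(3) G2]) auto
    finally show ?thesis .
  qed
  \<comment> \<open>The coproduct of the first leg acts jointly on both arguments of
    \<open>F\<close>, so equivariance pulls it out as an action on the value. This produces the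
    integrand of evaluation applied to a curried map.\<close>
  have 5: "act4 ?R ?R ?R W X ?G (\<Delta>_id_id \<phi>) a b c w
      = tlift3 X (\<lambda>p q r. act X p (F (act V a v) (act W (b \<otimes>\<^bsub>H\<^esub> \<beta> \<otimes>\<^bsub>H\<^esub> S c) (act W (S q \<otimes>\<^bsub>H\<^esub> \<alpha> \<otimes>\<^bsub>H\<^esub> r) w)))) \<phi>"
    if "a \<in> carrier H" "b \<in> carrier H" "c \<in> carrier H" for a b c
  proof -
    have "act4 ?R ?R ?R W X ?G (\<Delta>_id_id \<phi>) a b c w
        = tlift3 X (\<lambda>p q r. act2 ?R ?R X (\<lambda>x y. ?G x y (q \<otimes>\<^bsub>H\<^esub> c) (act W r w)) (\<Delta> p) a b) \<phi>"
      using that w by (subst act4_comult_1[OF R R R W m(3) G]) auto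
    also have "\<dots> = tlift3 X (\<lambda>p q r. act X p (F (act V a v) (act W (b \<otimes>\<^bsub>H\<^esub> \<beta> \<otimes>\<^bsub>H\<^esub> S c) (act W (S q \<otimes>\<^bsub>H\<^esub> \<alpha> \<otimes>\<^bsub>H\<^esub> r) w)))) \<phi>"
    proof (rule tlift3_H(3)[OF phi_closed(1)])
      fix p q r assume pqr: "p \<in> carrier H" "q \<in> carrier H" "r \<in> carrier H"
      show "act2 ?R ?R X (\<lambda>x y. ?G x y (q \<otimes>\<^bsub>H\<^esub> c) (act W r w)) (\<Delta> p) a b
          = act X p (F (act V a v) (act W (b \<otimes>\<^bsub>H\<^esub> \<beta> \<otimes>\<^bsub>H\<^esub> S c) (act W (S q \<otimes>\<^bsub>H\<^esub> \<alpha> \<otimes>\<^bsub>H\<^esub> r) w)))"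
        using pqr that v w V W
        by (subst equivar_act[OF F]) (auto simp: act2_def act_mult antip_mult H_assoc intro!: tlift_H(3))
    qed
    finally show ?thesis .
  qed
  have "F v w = act3 ?R ?R ?R X (act3 ?R ?R ?R X (\<lambda>a b c. ?G2 a b c w) \<phi>) \<phi>inv \<one>\<^bsub>H\<^esub> \<one>\<^bsub>H\<^esub> \<one>\<^bsub>H\<^esub>"
    using act3_phi_inv(1)[OF R R R m(3) G2', of "\<one>\<^bsub>H\<^esub>" "\<one>\<^bsub>H\<^esub>" "\<one>\<^bsub>H\<^esub>"] 3 by simp
  also have "\<dots> = tlift3 X (\<lambda>a b c. tlift3 X (\<lambda>p q r. act X p (F (act V a v) (act W (b \<otimes>\<^bsub>H\<^esub> \<beta> \<otimes>\<^bsub>H\<^esub> S c) (act W (S q \<otimes>\<^bsub>H\<^esub> \<alpha> \<otimes>\<^bsub>H\<^esub> r) w)))) \<phi>) \<phi>inv"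
    unfolding act3_def[of ?R ?R ?R X "act3 ?R ?R ?R X (\<lambda>a b c. ?G2 a b c w) \<phi>"]
    by (intro tlift3_H(3)) (simp_all add: 4[symmetric] 5)
  also have "\<dots> = tlift3 X (\<lambda>p q r. tlift3 X (\<lambda>a b c. act X p (F (act V a v) (act W (b \<otimes>\<^bsub>H\<^esub> \<beta> \<otimes>\<^bsub>H\<^esub> S c) (act W (S q \<otimes>\<^bsub>H\<^esub> \<alpha> \<otimes>\<^bsub>H\<^esub> r) w)))) \<phi>inv) \<phi>"
    using v w V W X by (intro tlift3_commute m) (auto intro!: act_closed cl)
  also have "\<dots> = ap W X (curry_h V W X F v) w"
    unfolding ap_def
  proof (rule tlift3_H(3)[OF phi_closed(1)])
    fix p q r assume pqr: "p \<in> carrier H" "q \<in> carrier H" "r \<in> carrier H"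
    show "tlift3 X (\<lambda>a b c. act X p (F (act V a v) (act W (b \<otimes>\<^bsub>H\<^esub> \<beta> \<otimes>\<^bsub>H\<^esub> S c) (act W (S q \<otimes>\<^bsub>H\<^esub> \<alpha> \<otimes>\<^bsub>H\<^esub> r) w)))) \<phi>inv
        = act X p (curry_h V W X F v (act W (S q \<otimes>\<^bsub>H\<^esub> \<alpha> \<otimes>\<^bsub>H\<^esub> r) w))"
      unfolding curry_h_def using pqr v w V W X
      by (simp, intro tlift3_H(2)[OF m(3) m(3), symmetric] klinear_act_r[OF X pqr(1) klinear_id] cl) auto
  qed
  finally show ?thesis by simp
qed

text \<open>Currying after uncurrying is the identity. Again the pentagon is decisive, with S(b)
  \<alpha> c in the middle; at the end \<open>\<Delta>_id_id \<phi>\<close> cancels against the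
  \<open>\<Delta>_id_id \<phi>inv\<close> that currying contributes, and the second antipode axiom
  on \<phi> yields \<open>L v\<close>.\<close>

lemma curry_h_ap:
  assumes V: "umodule V" and W: "umodule W" and L: "L \<in> carrier (ihom V W)"
  shows "curry_h (ihom V W) V W (ap V W) L = L"
proof (rule ihom_ext[of _ V W])
  note m = umodule_module[OF V] umodule_module[OF W]
  note R = umodule_regular
  let ?R = regular and ?M = "counit_mod regular"
  have t: "trivial ?M" using R by blast
  show "curry_h (ihom V W) V W (ap V W) L \<in> carrier (ihom V W)"
    by (intro curry_h_closed umodule_ihom V W m bilin_ap L)
  show "L \<in> carrier (ihom V W)" by fact
  fix v assume v: "v \<in> carrier V"
  let ?G = "\<lambda>a b c d. act W a (L (act V (S b \<otimes>\<^bsub>H\<^esub> \<alpha> \<otimes>\<^bsub>H\<^esub> c) (act V (\<beta> \<otimes>\<^bsub>H\<^esub> S d) v)))"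
  have G: "quadlin K ?R ?R ?R ?R W ?G"
    by (rule quadlinI; simp; intro klinear_ihom_app[OF L] lin V W; simp add: V W v ihom_closed[OF L])
  let ?P1 = "\<lambda>a m d. act W a (L (act V m (act V (\<beta> \<otimes>\<^bsub>H\<^esub> S d) v)))"
  have P1: "trilin K ?R ?M ?R W ?P1"
    by (rule trilinI; simp; intro klinear_ihom_app[OF L] lin V W; simp add: V W v ihom_closed[OF L])
  have 1: "act4 ?R ?R ?R ?R W ?G (id_\<Delta>_id \<phi>) a b c d = ?G a b c d"
    if "a \<in> carrier H" "b \<in> carrier H" "c \<in> carrier H" "d \<in> carrier H" for a b c d
  proof -
    have "act4 ?R ?R ?R ?R W ?G (id_\<Delta>_id \<phi>) a b c d = act3 ?R ?M ?R W ?P1 \<phi> a (S b \<otimes>\<^bsub>H\<^esub> \<alpha> \<otimes>\<^bsub>H\<^esub> c) d"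
      using that act4_merge_2[OF R R R R trivial_umodule[OF t] m(2) P1 equivar_alpha[OF R, unfolded regular_simps] phi_closed(1), of a b c d] by simp
    also have "\<dots> = ?G a b c d"
      using that by (intro act3_phi_middle[OF R _ R m(2) P1]) auto
    finally show ?thesis .
  qed
  \<comment> \<open>One side of the pentagon begins with \<open>one_tens \<phi>\<close>. Starting
    from \<open>?G\<close> acted on by the inverse makes this factor disappear.\<close>
  let ?G' = "act4 ?R ?R ?R ?R W ?G (one_tens \<phi>inv)"
  have G': "quadlin K ?R ?R ?R ?R W ?G'" by (intro act4_quadlin R m G) simp
  let ?G'' = "act4 ?R ?R ?R ?R W ?G' (id_id_\<Delta> \<phi>)"
  have G'': "quadlin K ?R ?R ?R ?R W ?G''" by (intro act4_quadlin R m G') simp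
  have 2: "act4 ?R ?R ?R ?R W ?G' (one_tens \<phi>) a b c d = ?G a b c d"
    if "a \<in> carrier H" "b \<in> carrier H" "c \<in> carrier H" "d \<in> carrier H" for a b c d
  proof -
    have tG: "trilin K ?R ?R ?R W (?G a)" using that by (intro quadlin_trilin[OF G]) auto
    have "act4 ?R ?R ?R ?R W ?G' (one_tens \<phi>) a b c d = act3 ?R ?R ?R W (?G' a) \<phi> b c d"
      using that by (intro act4_one_tens[OF R R R R m(2) G']) auto
    also have "\<dots> = act3 ?R ?R ?R W (act3 ?R ?R ?R W (?G a) \<phi>inv) \<phi> b c d"
    proof (rule act3_cong[OF R R R m(2)])
      fix x y z assume "x \<in> carrier ?R" "y \<in> carrier ?R" "z \<in> carrier ?R"
      then show "?G' a x y z = act3 ?R ?R ?R W (?G a) \<phi>inv x y z"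
        using that by (intro act4_one_tens[OF R R R R m(2) G]) auto
    qed (use that in auto)
    also have "\<dots> = ?G a b c d"
      using that act3_phi_inv(2)[OF R R R m(2) tG, of b c d] by simp
    finally show ?thesis .
  qed
  have 3: "act4 ?R ?R ?R ?R W ?G (tens_one \<phi>) a b c d = act4 ?R ?R ?R ?R W ?G'' (\<Delta>_id_id \<phi>) a b c d"
    if "a \<in> carrier H" "b \<in> carrier H" "c \<in> carrier H" "d \<in> carrier H" for a b c d
  proof -
    have e: "act4 ?R ?R ?R ?R W (act4 ?R ?R ?R ?R W ?G' (one_tens \<phi>)) (id_\<Delta>_id \<phi>) a b c d = ?G a b c d"
      if "a \<in> carrier H" "b \<in> carrier H" "c \<in> carrier H" "d \<in> carrier H" for a b c d
    proof -
      have "act4 ?R ?R ?R ?R W (act4 ?R ?R ?R ?R W ?G' (one_tens \<phi>)) (id_\<Delta>_id \<phi>) a b c d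
          = act4 ?R ?R ?R ?R W ?G (id_\<Delta>_id \<phi>) a b c d"
        using that by (intro act4_cong[OF R R R R m(2)]) (simp_all add: 2)
      then show ?thesis using that by (simp add: 1)
    qed
    have "act4 ?R ?R ?R ?R W ?G (tens_one \<phi>) a b c d
        = act4 ?R ?R ?R ?R W (act4 ?R ?R ?R ?R W (act4 ?R ?R ?R ?R W ?G' (one_tens \<phi>)) (id_\<Delta>_id \<phi>)) (tens_one \<phi>) a b c d"
      using that by (intro act4_cong[OF R R R R m(2)]) (simp_all add: e)
    also have "\<dots> = act4 ?R ?R ?R ?R W ?G'' (\<Delta>_id_id \<phi>) a b c d"
      using that by (intro act4_pentagon[OF R R R R m(2) G']) auto
    finally show ?thesis .
  qed
  \<comment> \<open>Once \<open>\<phi>inv\<close> has acted on the last three slots, c and d occur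
    only in \<open>bop V c d\<close>, so the coproduct on them can be merged.\<close>
  let ?P = "\<lambda>a b m. tlift3 W (\<lambda>s t u. act W a (L (act V (S (s \<otimes>\<^bsub>H\<^esub> b) \<otimes>\<^bsub>H\<^esub> \<alpha> \<otimes>\<^bsub>H\<^esub> t) (m (act V (S u) v))))) \<phi>inv"
  have P: "trilin K ?R ?R (ihom V V) W ?P"
    by (rule trilinI; simp; intro klinear_ihom_app[OF L] lin V W m(2); simp add: V W v ihom_closed[OF L])
  have 4: "?G' a b c d = ?P a b (bop V c d)"
    if "a \<in> carrier H" "b \<in> carrier H" "c \<in> carrier H" "d \<in> carrier H" for a b c d
  proof -
    have "?G' a b c d = act3 ?R ?R ?R W (?G a) \<phi>inv b c d"
      using that by (intro act4_one_tens[OF R R R R m(2) G]) auto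
    also have "\<dots> = ?P a b (bop V c d)"
      unfolding act3_def using that v V
      by (intro tlift3_H(3)) (auto simp: bop_apply act_mult antip_mult H_assoc)
    finally show ?thesis .
  qed
  have l: "klinear K H W (\<lambda>m. L (act V m v))" by (intro klinear_ihom_app[OF L] lin V v)
  \<comment> \<open>\<beta> is invariant, so \<phi> acts trivially; what is left is the expression
    of \<open>antip_assoc_inv\<close> inside the argument of \<open>L\<close>.\<close>
  have 5: "?G'' \<one>\<^bsub>H\<^esub> \<one>\<^bsub>H\<^esub> \<one>\<^bsub>H\<^esub> \<one>\<^bsub>H\<^esub> = L v"
  proof -
    have "?G'' \<one>\<^bsub>H\<^esub> \<one>\<^bsub>H\<^esub> \<one>\<^bsub>H\<^esub> \<one>\<^bsub>H\<^esub>
        = act4 ?R ?R ?R ?R W (\<lambda>a b c d. ?P a b (bop V c d)) (id_id_\<Delta> \<phi>) \<one>\<^bsub>H\<^esub> \<one>\<^bsub>H\<^esub> \<one>\<^bsub>H\<^esub> \<one>\<^bsub>H\<^esub>"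
      by (intro act4_cong[OF R R R R m(2)]) (simp_all add: 4)
    also have "\<dots> = act3 ?R ?R (ihom V V) W ?P \<phi> \<one>\<^bsub>H\<^esub> \<one>\<^bsub>H\<^esub> (bop V \<one>\<^bsub>H\<^esub> \<one>\<^bsub>H\<^esub>)"
      using V by (intro act4_merge_3[OF R R R R _ m(2) P equivar_bop[OF V]]) auto
    also have "\<dots> = ?P \<one>\<^bsub>H\<^esub> \<one>\<^bsub>H\<^esub> (beta_op V)"
      unfolding bop_one using V by (intro act3_phi_right[OF R R _ m(2) P]) (auto simp: beta_op_invariant)
    also have "\<dots> = tlift3 W (\<lambda>s t u. L (act V (S s \<otimes>\<^bsub>H\<^esub> \<alpha> \<otimes>\<^bsub>H\<^esub> t \<otimes>\<^bsub>H\<^esub> \<beta> \<otimes>\<^bsub>H\<^esub> S u) v)) \<phi>inv"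
      using v V W L by (intro tlift3_H(3)) (auto simp: beta_op_def act_mult)
    also have "\<dots> = L v"
      using v V m by (simp add: tlift3_H(2)[OF _ _ _ l, symmetric] antip_assoc_inv)
    finally show ?thesis .
  qed
  have tG4: "quadlin K ?R ?R ?R ?R W (act4 ?R ?R ?R ?R W ?G (tens_one \<phi>))" by (intro act4_quadlin R m G) simp
  have "curry_h (ihom V W) V W (ap V W) L v
      = tlift3 W (\<lambda>p q r. ap V W (act (ihom V W) p L) (act V (q \<otimes>\<^bsub>H\<^esub> \<beta> \<otimes>\<^bsub>H\<^esub> S r) v)) \<phi>inv"
    using v by (simp add: curry_h_def)
  also have "\<dots> = tlift3 W (\<lambda>p q r. act2 ?R ?R W (\<lambda>x y. act4 ?R ?R ?R ?R W ?G (tens_one \<phi>) x y q r) (\<Delta> p) \<one>\<^bsub>H\<^esub> \<one>\<^bsub>H\<^esub>) \<phi>inv"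
  proof (rule tlift3_H(3)[OF phi_closed(2)])
    fix p q r assume pqr: "p \<in> carrier H" "q \<in> carrier H" "r \<in> carrier H"
    have qv: "act V (q \<otimes>\<^bsub>H\<^esub> \<beta> \<otimes>\<^bsub>H\<^esub> S r) v \<in> carrier V" using pqr v V by simp
    show "ap V W (act (ihom V W) p L) (act V (q \<otimes>\<^bsub>H\<^esub> \<beta> \<otimes>\<^bsub>H\<^esub> S r) v)
        = act2 ?R ?R W (\<lambda>x y. act4 ?R ?R ?R ?R W ?G (tens_one \<phi>) x y q r) (\<Delta> p) \<one>\<^bsub>H\<^esub> \<one>\<^bsub>H\<^esub>"
      unfolding ap_act[OF V W L qv pqr(1)]
    proof (rule act2_cong[OF R R m(2)])
      fix x y assume "x \<in> carrier ?R" "y \<in> carrier ?R"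
      then have xy: "x \<in> carrier H" "y \<in> carrier H" by simp_all
      have "act4 ?R ?R ?R ?R W ?G (tens_one \<phi>) x y q r = act3 ?R ?R ?R W (\<lambda>x y q. ?G x y q r) \<phi> x y q"
        using xy pqr by (intro act4_tens_one[OF R R R R m(2) G]) auto
      then show "act3 ?R ?R V W (apF V W L) \<phi> x y (act V (q \<otimes>\<^bsub>H\<^esub> \<beta> \<otimes>\<^bsub>H\<^esub> S r) v)
          = act4 ?R ?R ?R ?R W ?G (tens_one \<phi>) x y q r"
        unfolding act3_def using xy pqr v V
        by (auto simp: apF_def act_mult H_assoc intro!: tlift3_H(3))
    qed (use pqr in auto)
  qed
  also have "\<dots> = act4 ?R ?R ?R ?R W (act4 ?R ?R ?R ?R W ?G (tens_one \<phi>)) (\<Delta>_id_id \<phi>inv) \<one>\<^bsub>H\<^esub> \<one>\<^bsub>H\<^esub> \<one>\<^bsub>H\<^esub> \<one>\<^bsub>H\<^esub>"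
    by (subst act4_comult_1[OF R R R R m(2) tG4]) (auto intro!: tlift3_H(3) act2_cong[OF R R m(2)])
  also have "\<dots> = act4 ?R ?R ?R ?R W (act4 ?R ?R ?R ?R W ?G'' (\<Delta>_id_id \<phi>)) (\<Delta>_id_id \<phi>inv) \<one>\<^bsub>H\<^esub> \<one>\<^bsub>H\<^esub> \<one>\<^bsub>H\<^esub> \<one>\<^bsub>H\<^esub>"
    by (intro act4_cong[OF R R R R m(2)]) (simp_all add: 3)
  \<comment> \<open>The coproduct of \<phi> produced by the pentagon meets the coproduct of
    \<open>\<phi>inv\<close> produced by \<open>curry_h\<close>.\<close>
  also have "\<dots> = L v"
    by (subst act4_cancel_1[OF R R R R m(2) G'']) (simp_all add: 5)
  finally show "curry_h (ihom V W) V W (ap V W) L v = L v" .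
qed

text \<open>By \<open>curry_h_ap\<close>, \<open>L\<close> is a sum of evaluations of elements of
  its orbit: the first leg of \<open>\<phi>inv\<close> acts on \<open>L\<close>. This is why the
  hypothesis ranges over all \<open>h\<close>.\<close>

lemma ihom_zeroI:
  assumes V: "umodule V" and W: "umodule W" and L: "L \<in> carrier (ihom V W)"
    and z: "\<And>h v. h \<in> carrier H \<Longrightarrow> v \<in> carrier V \<Longrightarrow> ap V W (act (ihom V W) h L) v = \<zero>\<^bsub>W\<^esub>"
  shows "L = \<zero>\<^bsub>ihom V W\<^esub>"
proof -
  interpret W: module K W using W by simp
  interpret E: module K "ihom V W" using V W by simp
  show ?thesis
  proof (rule ihom_ext[OF L E.zero_closed])
    fix v assume v: "v \<in> carrier V"
    have "L v = curry_h (ihom V W) V W (ap V W) L v" by (simp add: curry_h_ap[OF V W L])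
    also have "\<dots> = tlift3 W (\<lambda>a b c. \<zero>\<^bsub>W\<^esub>) \<phi>inv"
      unfolding curry_h_def using v V by (auto simp: z intro!: tlift3_H(3))
    also have "\<dots> = \<zero>\<^bsub>W\<^esub>"
      using tlift3_H(2)[OF umodule_module[OF W] umodule_module[OF W] phi_closed(2) klinear_const_zero[OF umodule_module[OF W]], of "\<lambda>a b c. \<zero>\<^bsub>W\<^esub>"] by simp
    finally show "L v = \<zero>\<^bsub>ihom V W\<^esub> v" using v by (simp add: ihom_simps)
  qed
qed

end

section \<open>The algebra of internal endomorphisms\<close>

context quasi_bialgebra
begin

lemma tmap_pure:
  assumes U: "umodule U" "umodule X" "umodule V" "umodule W" and f: "klinear K U V f" and g: "klinear K X W g"
  shows "u \<in> carrier U \<Longrightarrow> x \<in> carrier X \<Longrightarrow> tmap V W f g (pure U X u x) = pure V W (f u) (g x)"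
    and "klinear K (tensor K U X) (tensor K V W) (tmap V W f g)"
proof -
  have b: "bilin K U X (tensor K V W) (\<lambda>u x. pure V W (f u) (g x))"
    using f g by (intro bilinI lin U klinear_closed[OF f] klinear_closed[OF g])
  then show "u \<in> carrier U \<Longrightarrow> x \<in> carrier X \<Longrightarrow> tmap V W f g (pure U X u x) = pure V W (f u) (g x)"
    using U by (simp add: tmap_def)
  show "klinear K (tensor K U X) (tensor K V W) (tmap V W f g)"
    unfolding tmap_def tlift_htensor
    by (rule klinear_tlift[OF _ _ _ b klinear_id]) (use U in auto)
qed

context
  fixes U :: "('a, 'b, 'u, 'p) hmod_scheme" and V :: "('a, 'b, 'v, 'q) hmod_scheme" and W :: "('a, 'b, 'w, 'r) hmod_scheme"
  assumes U: "umodule U" and V: "umodule V" and W: "umodule W"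
begin

lemma associator_pure:
  shows "u \<in> carrier U \<Longrightarrow> v \<in> carrier V \<Longrightarrow> w \<in> carrier W \<Longrightarrow>
      associator U V W (pure (U \<boxtimes> V) W (pure U V u v) w)
      = act3 U V W (tensor K U (V \<boxtimes> W)) (\<lambda>u v w. pure U (V \<boxtimes> W) u (pure V W v w)) \<phi> u v w"
    and "klinear K (tensor K (U \<boxtimes> V) W) (tensor K U (V \<boxtimes> W)) (associator U V W)"
proof -
  let ?T = "tensor K U (V \<boxtimes> W)"
  have m: "module K ?T" using U V W by simp
  let ?F = "\<lambda>u v w. pure U (V \<boxtimes> W) u (pure V W v w)"
  have F: "trilin K U V W ?T ?F"
    using U V W by (intro trilinI lin; simp; intro lin; simp)
  have aF: "trilin K U V W ?T (act3 U V W ?T ?F \<phi>)" by (intro act3_trilin U V W m F phi_closed)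
  let ?G = "\<lambda>s w. tlift ?T (\<lambda>u v. act3 U V W ?T ?F \<phi> u v w) s"
  have b: "bilin K U V ?T (\<lambda>u v. act3 U V W ?T ?F \<phi> u v w)" if "w \<in> carrier W" for w
    using that by (intro bilinI trilin_1[OF aF] trilin_2[OF aF] klinear_id)
  have G: "bilin K (U \<boxtimes> V) W ?T ?G"
    using U V W by (intro bilinI; simp; intro klinear_tlift[OF _ _ m b] klinear_tlift_param[OF _ _ m] klinear_id trilin_3[OF aF]; simp)
  have e: "associator U V W = tlift ?T ?G"
    by (simp add: fun_eq_iff associator_def act3_def)
  show "u \<in> carrier U \<Longrightarrow> v \<in> carrier V \<Longrightarrow> w \<in> carrier W \<Longrightarrow>
      associator U V W (pure (U \<boxtimes> V) W (pure U V u v) w) = act3 U V W ?T ?F \<phi> u v w"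
    unfolding e using U V W G m b by simp
  show "klinear K (tensor K (U \<boxtimes> V) W) ?T (associator U V W)"
    unfolding e by (rule klinear_tlift[OF _ _ m G klinear_id]) (use U V W in auto)
qed

lemma associator_inv_pure:
  shows "u \<in> carrier U \<Longrightarrow> v \<in> carrier V \<Longrightarrow> w \<in> carrier W \<Longrightarrow>
      associator_inv U V W (pure U (V \<boxtimes> W) u (pure V W v w))
      = act3 U V W (tensor K (U \<boxtimes> V) W) (\<lambda>u v w. pure (U \<boxtimes> V) W (pure U V u v) w) \<phi>inv u v w"
    and "klinear K (tensor K U (V \<boxtimes> W)) (tensor K (U \<boxtimes> V) W) (associator_inv U V W)"
proof -
  let ?T = "tensor K (U \<boxtimes> V) W"
  have m: "module K ?T" using U V W by simp
  let ?F = "\<lambda>u v w. pure (U \<boxtimes> V) W (pure U V u v) w"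
  have F: "trilin K U V W ?T ?F"
    using U V W by (intro trilinI lin; simp; intro lin; simp)
  have aF: "trilin K U V W ?T (act3 U V W ?T ?F \<phi>inv)" by (intro act3_trilin U V W m F phi_closed)
  let ?G = "\<lambda>u s. tlift ?T (\<lambda>v w. act3 U V W ?T ?F \<phi>inv u v w) s"
  have b: "bilin K V W ?T (\<lambda>v w. act3 U V W ?T ?F \<phi>inv u v w)" if "u \<in> carrier U" for u
    using that by (intro bilinI trilin_3[OF aF] trilin_2[OF aF] klinear_id)
  have G: "bilin K U (V \<boxtimes> W) ?T ?G"
    using U V W by (intro bilinI; simp; intro klinear_tlift[OF _ _ m b] klinear_tlift_param[OF _ _ m] klinear_id trilin_1[OF aF]; simp)
  \<comment> \<open>Only the outer of the two nested \<open>tlift3\<close> is unfolded; the inner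
    one is the action of \<open>\<phi>inv\<close>.\<close>
  have e: "associator_inv U V W = tlift ?T ?G"
    by (simp add: fun_eq_iff associator_inv_def act3_def tlift3_def[of _ "\<lambda>u v w. tlift3 (A u v w) (B u v w) (C u v w)" for A B C])
  show "u \<in> carrier U \<Longrightarrow> v \<in> carrier V \<Longrightarrow> w \<in> carrier W \<Longrightarrow>
      associator_inv U V W (pure U (V \<boxtimes> W) u (pure V W v w)) = act3 U V W ?T ?F \<phi>inv u v w"
    unfolding e using U V W G m b by simp
  show "klinear K (tensor K U (V \<boxtimes> W)) ?T (associator_inv U V W)"
    unfolding e by (rule klinear_tlift[OF _ _ m G klinear_id]) (use U V W in auto)
qed

end

end

section \<open>Comparing internal homs by the evaluations of their orbits\<close>

context quasi_hopf_algebra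
begin

lemma curry_h_cong:
  assumes "umodule V" "umodule W" "v \<in> carrier V" "\<And>v w. v \<in> carrier V \<Longrightarrow> w \<in> carrier W \<Longrightarrow> F v w = G v w"
  shows "curry_h V W X F v = curry_h V W X G v"
  unfolding curry_h_def using assms by (intro restrict_ext tlift3_H(3)) auto

lemma klinear_ev:
  assumes "umodule V" "umodule W" shows "klinear K (tensor K (ihom V W) V) W (ev V W)"
  unfolding ev_ap using assms by (intro klinear_tlift[OF _ _ _ bilin_ap klinear_id]) auto

lemma ev_pure:
  assumes "umodule V" "umodule W" "L \<in> carrier (ihom V W)" "v \<in> carrier V"
  shows "ev V W (pure (ihom V W) V L v) = ap V W L v"
  unfolding ev_ap using assms by (simp add: bilin_ap)

lemma ihom_eqI:
  assumes V: "umodule V" and W: "umodule W" and L: "L \<in> carrier (ihom V W)" "L' \<in> carrier (ihom V W)"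
    and z: "\<And>h v. h \<in> carrier H \<Longrightarrow> v \<in> carrier V \<Longrightarrow> ap V W (act (ihom V W) h L) v = ap V W (act (ihom V W) h L') v"
  shows "L = L'"
proof -
  interpret W: module K W using W by simp
  interpret E: module K "ihom V W" using V W by simp
  have "L \<ominus>\<^bsub>ihom V W\<^esub> L' = \<zero>\<^bsub>ihom V W\<^esub>"
  proof (rule ihom_zeroI[OF V W E.minus_closed[OF L]])
    fix h v assume h: "h \<in> carrier H" and v: "v \<in> carrier V"
    have l: "klinear K (ihom V W) W (\<lambda>L. ap V W (act (ihom V W) h L) v)"
      using h v V W by (intro bilin_left[OF bilin_ap[OF V W]] lin) auto
    have c: "ap V W (act (ihom V W) h M) v \<in> carrier W" if "M \<in> carrier (ihom V W)" for M
      using klinear_closed[OF l that] .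
    show "ap V W (act (ihom V W) h (L \<ominus>\<^bsub>ihom V W\<^esub> L')) v = \<zero>\<^bsub>W\<^esub>"
      using L V W c z[OF h v]
      by (simp add: a_minus_def klinear_add[OF l] klinear_minus[OF _ _ l] W.r_neg)
  qed
  then show ?thesis using L E.minus_equality[of L "\<ominus>\<^bsub>ihom V W\<^esub> L'"] by (simp add: a_minus_def)
qed

end

section \<open>Product and unit of end(V)\<close>

locale endomorphisms = quasi_hopf_algebra +
  fixes V :: "('a, 'b, 'v, 'p) hmod_scheme"
  assumes V: "umodule V"
begin

abbreviation "E \<equiv> ihom V V"
abbreviation "cmp L L' \<equiv> icomp V V V (pure E E L L')"
abbreviation "app \<equiv> ap V V"

lemma E [simp, intro]: "umodule E" "module K E"
  using V by auto

lemma mV [simp, intro]: "module K V"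
  using V by auto

lemmas bilin_app = bilin_ap[OF V V]
lemmas app_closed [simp] = ap_closed[OF V V]
lemmas klinear_app [lin] = bilin_left[OF bilin_app] bilin_right[OF bilin_app]
lemmas equivar_app = equivar_ap[OF V V]

abbreviation "app2 \<equiv> \<lambda>L L' v. app L (app L' v)"

lemma app2: "trilin K E E V V app2"
  by (intro trilinI lin; simp; intro lin; simp)

text \<open>The composite of associator and two evaluations whose currying is the product \<bullet>.
  It takes the tensor \<open>s\<close> as one argument, because currying lets H act on
  \<open>s\<close> as a whole.\<close>

definition compF where
  "compF s v = tlift V (\<lambda>L L'. act3 E E V V app2 \<phi> L L' v) s"

lemma trilin_compF: "trilin K E E V V (act3 E E V V app2 \<phi>)"
  by (intro act3_trilin E V mV app2 phi_closed)

lemma compF_pure: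
  "L \<in> carrier E \<Longrightarrow> L' \<in> carrier E \<Longrightarrow> v \<in> carrier V \<Longrightarrow> compF (pure E E L L') v = act3 E E V V app2 \<phi> L L' v"
  unfolding compF_def by (simp add: tlift_pure_h bilinI trilin_1[OF trilin_compF klinear_id] trilin_2[OF trilin_compF _ klinear_id])

lemma bilin_compF: "bilin K (E \<boxtimes> E) V V compF"
  unfolding compF_def
  by (intro bilinI; simp; intro klinear_tlift[OF E(2) E(2) mV] klinear_tlift_param[OF E(2) E(2) mV] bilinI
      trilin_1[OF trilin_compF] trilin_2[OF trilin_compF] trilin_3[OF trilin_compF] klinear_id; simp)

lemma act3_app2:
  assumes h: "h \<in> carrier H" and L: "L \<in> carrier E" "L' \<in> carrier E" "v \<in> carrier V"
  shows "act3 E E V V app2 (id_\<Delta> (\<Delta> h)) L L' v = act V h (app2 L L' v)"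
  using act3_merge_right[OF E(1) E(1) V V mV bilin_app equivar_app, of "\<Delta> h" L L' v] assms
  by (simp add: equivar_act[OF equivar_app])

text \<open>Both evaluations are equivariant, and quasi-coassociativity carries the coproducts from
  one bracketing of the three arguments to the other.\<close>

lemma equivar_compF: "equivar (E \<boxtimes> E) V V compF"
  unfolding equivar_def
proof (intro conjI ballI bilin_compF)
  fix h s v assume h: "h \<in> carrier H" and "s \<in> carrier (E \<boxtimes> E)" and v: "v \<in> carrier V"
  then have s: "s \<in> carrier (tensor K E E)" by simp
  have EE: "umodule (E \<boxtimes> E)" by blast
  show "act V h (compF s v) = act2 (E \<boxtimes> E) V V compF (\<Delta> h) s v"
  proof (rule tensor_ext[OF E(2) E(2) mV _ _ _ s])
    show "klinear K (tensor K E E) V (\<lambda>s. act V h (compF s v))"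
      using bilin_left[OF bilin_compF klinear_id v] by (intro lin V h) simp
    show "klinear K (tensor K E E) V (\<lambda>s. act2 (E \<boxtimes> E) V V compF (\<Delta> h) s v)"
      using bilin_left[OF act2_bilin[OF EE V mV bilin_compF] klinear_id v] h by simp
    fix L L' assume L: "L \<in> carrier E" "L' \<in> carrier E"
    have "act V h (compF (pure E E L L') v) = act3 E E V V (\<lambda>L L' v. act V h (app2 L L' v)) \<phi> L L' v"
      using L v h by (simp add: compF_pure act3_linear[OF E(1) E(1) V mV app2 mV] klinear_act_r[OF V _ klinear_id])
    also have "\<dots> = act3 E E V V (act3 E E V V app2 (id_\<Delta> (\<Delta> h))) \<phi> L L' v"
      using L v h by (intro act3_cong[OF E(1) E(1) V mV]) (simp_all add: act3_app2)
    also have "\<dots> = act3 E E V V (act3 E E V V app2 \<phi>) (\<Delta>_id (\<Delta> h)) L L' v"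
      using L v h by (intro act3_coassoc(1)[OF E(1) E(1) V mV app2])
    also have "\<dots> = act3 E E V V (\<lambda>L L' v. compF (pure E E L L') v) (\<Delta>_id (\<Delta> h)) L L' v"
      using L v h by (intro act3_cong[OF E(1) E(1) V mV]) (simp_all add: compF_pure)
    also have "\<dots> = act2 (E \<boxtimes> E) V V compF (\<Delta> h) (pure E E L L') v"
      using L v h by (intro act3_merge_left[OF E(1) E(1) V EE mV bilin_compF]) auto
    finally show "act V h (compF (pure E E L L') v) = act2 (E \<boxtimes> E) V V compF (\<Delta> h) (pure E E L L') v" .
  qed
qed

lemma icomp_curry:
  assumes s: "s \<in> carrier (tensor K E E)"
  shows "icomp V V V s = curry_h (E \<boxtimes> E) V V compF s"
proof -
  let ?f = "ev V V \<circ> tmap E V (\<lambda>L. L) (ev V V) \<circ> associator E E V"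
  have EE: "umodule (E \<boxtimes> E)" "umodule (E \<boxtimes> V)" using V by blast+
  note ass = associator_pure[OF E(1) E(1) V]
  note tm = tmap_pure[OF E(1) EE(2) E(1) V klinear_id, of "ev V V", simplified klinear_htensor, OF klinear_ev[OF V V]]
  have l: "klinear K (tensor K (E \<boxtimes> E) V) V ?f"
    unfolding comp_def by (rule klinear_comp[OF klinear_ev[OF V V] klinear_comp[OF tm(2) ass(2)]])
  have e: "?f (pure (E \<boxtimes> E) V s v) = compF s v" if "s \<in> carrier (tensor K E E)" and v: "v \<in> carrier V" for s v
  proof (rule tensor_ext[OF E(2) E(2) mV _ _ _ that(1)])
    show "klinear K (tensor K E E) V (\<lambda>s. ?f (pure (E \<boxtimes> E) V s v))"
      using v V by (intro klinear_comp[OF l] lin) (auto simp: klinear_id)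
    show "klinear K (tensor K E E) V (\<lambda>s. compF s v)"
      using bilin_left[OF bilin_compF klinear_id v] by simp
    fix L L' assume L: "L \<in> carrier E" "L' \<in> carrier E"
    let ?T = "tensor K E (E \<boxtimes> V)"
    have T: "module K ?T" using V by simp
    have F: "trilin K E E V ?T (\<lambda>L L' v. pure E (E \<boxtimes> V) L (pure E V L' v))"
      using V by (intro trilinI lin; simp; intro lin; simp)
    have "?f (pure (E \<boxtimes> E) V (pure E E L L') v)
        = act3 E E V V (\<lambda>L L' v. ev V V (tmap E V (\<lambda>L. L) (ev V V) (pure E (E \<boxtimes> V) L (pure E V L' v)))) \<phi> L L' v"
      unfolding comp_def ass(1)[OF L v]
      by (rule act3_linear[OF E(1) E(1) V T F mV klinear_comp[OF klinear_ev[OF V V] tm(2)] phi_closed(1) L v])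
    also have "\<dots> = act3 E E V V app2 \<phi> L L' v"
      by (rule act3_cong[OF E(1) E(1) V mV]) (use L v V in \<open>simp_all add: tm(1) ev_pure\<close>)
    finally show "?f (pure (E \<boxtimes> E) V (pure E E L L') v) = compF (pure E E L L') v"
      using L v by (simp add: compF_pure)
  qed
  show ?thesis
    unfolding icomp_def zeta_curry_h
    by (rule curry_h_cong[OF EE(1) V]) (use s e in auto)
qed

lemma klinear_icomp: "klinear K (tensor K E E) E (icomp V V V)"
proof -
  have "klinear K (tensor K E E) E (curry_h (E \<boxtimes> E) V V compF)"
    using klinear_curry_h[OF _ V mV bilin_compF] by auto
  then show ?thesis by (subst klinear_cong[OF icomp_curry]) auto
qed

lemma icomp_act:
  assumes "s \<in> carrier (tensor K E E)" "h \<in> carrier H"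
  shows "icomp V V V (act (E \<boxtimes> E) h s) = act E h (icomp V V V s)"
proof -
  have EE: "umodule (E \<boxtimes> E)" by blast
  then have "act (E \<boxtimes> E) h s \<in> carrier (tensor K E E)" using assms act_closed[OF EE] by simp
  then show ?thesis
    using curry_h_act[OF EE V V equivar_compF, of s h] assms by (simp add: icomp_curry)
qed

lemma equivar_cmp: "equivar E E E (\<lambda>L L'. cmp L L')"
  unfolding equivar_def
proof (intro conjI ballI)
  show b: "bilin K E E E (\<lambda>L L'. cmp L L')"
    by (intro bilinI klinear_comp[OF klinear_icomp] lin E)
  fix h L L' assume h: "h \<in> carrier H" and L: "L \<in> carrier E" "L' \<in> carrier E"
  have "act E h (cmp L L') = icomp V V V (act (E \<boxtimes> E) h (pure E E L L'))" using h L by (simp add: icomp_act)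
  also have "act (E \<boxtimes> E) h (pure E E L L') = act2 E E (tensor K E E) (pure E E) (\<Delta> h) L L'"
    using equivar_act[OF pure_equivar[OF E(1) E(1)] h L] by simp
  also have "icomp V V V \<dots> = act2 E E E (\<lambda>L L'. cmp L L') (\<Delta> h) L L'"
    using h L by (intro act2_linear[OF E(1) E(1) _ _ E(2) klinear_icomp]) auto
  finally show "act E h (cmp L L') = act2 E E E (\<lambda>L L'. cmp L L') (\<Delta> h) L L'" .
qed

lemmas bilin_cmp = equivar_bilin[OF equivar_cmp]
lemmas cmp_closed [simp] = bilin_closed[OF bilin_cmp]
lemmas klinear_cmp [lin] = bilin_left[OF bilin_cmp] bilin_right[OF bilin_cmp]

text \<open>Evaluating a curried map gives the map back. Together with \<open>ihom_eqI\<close> this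
  is the working description of the product, in place of its definition by
  \<open>zeta\<close>.\<close>

lemma app_cmp:
  assumes "L \<in> carrier E" "L' \<in> carrier E" "v \<in> carrier V"
  shows "app (cmp L L') v = act3 E E V V app2 \<phi> L L' v"
proof -
  have EE: "umodule (E \<boxtimes> E)" by blast
  show ?thesis
    using assms ap_curry_h[OF EE V V equivar_compF, of "pure E E L L'" v] by (simp add: icomp_curry compF_pure)
qed

lemma trilin_cmp: "trilin K E E E E (\<lambda>x y z. cmp (cmp x y) z)" "trilin K E E E E (\<lambda>x y z. cmp x (cmp y z))"
  by (intro trilinI lin; simp; intro lin; simp)+

text \<open>Unfolding the products by \<open>app_cmp\<close>, the evaluations of the two bracketings
  become the two sides of the pentagon acting on threefold application. The step from evaluations to
  the operators themselves requires the whole orbit.\<close>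

lemma cmp_assoc:
  assumes xyz: "x \<in> carrier E" "y \<in> carrier E" "z \<in> carrier E"
  shows "cmp (cmp x y) z = act3 E E E E (\<lambda>x y z. cmp x (cmp y z)) \<phi> x y z"
proof -
  let ?P1 = "\<lambda>x y z. cmp (cmp x y) z" and ?P2 = "\<lambda>x y z. cmp x (cmp y z)"
  let ?T = "\<lambda>x y z v. app2 x y (app z v)"
  have T: "quadlin K E E E V V ?T" by (intro quadlinI lin; simp; intro lin; simp)
  have aP2: "trilin K E E E E (act3 E E E E ?P2 \<phi>)" by (intro act3_trilin E trilin_cmp phi_closed)
  have q1: "quadlin K E E E V V (\<lambda>x y z v. app (?P2 x y z) v)"
    by (intro quadlinI lin; simp; intro lin; simp)
  have 1: "app (?P1 x y z) v = act4 E E E V V (act4 E E E V V ?T (id_id_\<Delta> \<phi>)) (\<Delta>_id_id \<phi>) x y z v"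
    if "x \<in> carrier E" "y \<in> carrier E" "z \<in> carrier E" "v \<in> carrier V" for x y z v
  proof -
    have "app (?P1 x y z) v = act3 E E V V app2 \<phi> (cmp x y) z v" using that by (simp add: app_cmp)
    also have "\<dots> = act4 E E E V V (\<lambda>x y z v. app2 (cmp x y) z v) (\<Delta>_id_id \<phi>) x y z v"
      using that by (intro act4_merge_1[OF E(1) E(1) E(1) V E(1) mV app2 equivar_cmp, symmetric]) auto
    also have "\<dots> = act4 E E E V V (act4 E E E V V ?T (id_id_\<Delta> \<phi>)) (\<Delta>_id_id \<phi>) x y z v"
    proof (rule act4_cong[OF E(1) E(1) E(1) V mV])
      fix x y z v assume xyz: "x \<in> carrier E" "y \<in> carrier E" "z \<in> carrier E" "v \<in> carrier V"
      then have "act4 E E E V V ?T (id_id_\<Delta> \<phi>) x y z v = act3 E E V V app2 \<phi> x y (app z v)"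
        by (intro act4_merge_3[OF E(1) E(1) E(1) V V mV app2 equivar_app]) auto
      then show "app2 (cmp x y) z v = act4 E E E V V ?T (id_id_\<Delta> \<phi>) x y z v"
        using xyz by (simp add: app_cmp)
    qed (use that in auto)
    finally show ?thesis .
  qed
  have 2: "app (?P2 x y z) v = act4 E E E V V (act4 E E E V V ?T (one_tens \<phi>)) (id_\<Delta>_id \<phi>) x y z v"
    if "x \<in> carrier E" "y \<in> carrier E" "z \<in> carrier E" "v \<in> carrier V" for x y z v
  proof -
    have "app (?P2 x y z) v = act3 E E V V app2 \<phi> x (cmp y z) v" using that by (simp add: app_cmp)
    also have "\<dots> = act4 E E E V V (\<lambda>x y z v. app2 x (cmp y z) v) (id_\<Delta>_id \<phi>) x y z v"
      using that by (intro act4_merge_2[OF E(1) E(1) E(1) V E(1) mV app2 equivar_cmp, symmetric]) auto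
    also have "\<dots> = act4 E E E V V (act4 E E E V V ?T (one_tens \<phi>)) (id_\<Delta>_id \<phi>) x y z v"
    proof (rule act4_cong[OF E(1) E(1) E(1) V mV])
      fix x y z v assume xyz: "x \<in> carrier E" "y \<in> carrier E" "z \<in> carrier E" "v \<in> carrier V"
      then have "act4 E E E V V ?T (one_tens \<phi>) x y z v = act3 E E V V (?T x) \<phi> y z v"
        by (intro act4_one_tens[OF E(1) E(1) E(1) V mV T]) auto
      also have "\<dots> = app x (act3 E E V V app2 \<phi> y z v)"
        using xyz by (intro act3_linear[OF E(1) E(1) V mV app2 mV, symmetric] lin) auto
      finally show "app2 x (cmp y z) v = act4 E E E V V ?T (one_tens \<phi>) x y z v"
        using xyz by (simp add: app_cmp)
    qed (use that in auto)
    finally show ?thesis .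
  qed
  \<comment> \<open>The \<phi> of the right hand side does not touch \<open>v\<close>, so it acts as
    \<open>tens_one \<phi>\<close> and supplies the last factor of the pentagon.\<close>
  have 3: "app (act3 E E E E ?P2 \<phi> x y z) v = app (?P1 x y z) v"
    if "x \<in> carrier E" "y \<in> carrier E" "z \<in> carrier E" "v \<in> carrier V" for x y z v
  proof -
    have "app (act3 E E E E ?P2 \<phi> x y z) v = act3 E E E V (\<lambda>x y z. app (?P2 x y z) v) \<phi> x y z"
      using that by (intro act3_linear[where g="\<lambda>m. app m v", OF E(1) E(1) E(1) E(2) trilin_cmp(2) mV] lin) auto
    also have "\<dots> = act4 E E E V V (\<lambda>x y z v. app (?P2 x y z) v) (tens_one \<phi>) x y z v"
      using that by (intro act4_tens_one[OF E(1) E(1) E(1) V mV q1, symmetric]) auto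
    also have "\<dots> = act4 E E E V V (act4 E E E V V (act4 E E E V V ?T (one_tens \<phi>)) (id_\<Delta>_id \<phi>)) (tens_one \<phi>) x y z v"
      using that by (intro act4_cong[OF E(1) E(1) E(1) V mV]) (simp_all add: 2)
    also have "\<dots> = app (?P1 x y z) v"
      using that by (simp add: act4_pentagon[OF E(1) E(1) E(1) V mV T] 1)
    finally show ?thesis .
  qed
  have c: "act3 E E E E ?P2 \<phi> x y z \<in> carrier E" using xyz by (intro trilin_closed[OF aP2])
  \<comment> \<open>To pass to orbits, equivariance pulls \<open>h\<close> inside the left
    bracketing as \<open>\<Delta>_id (\<Delta> h)\<close>, quasi-coassociativity moves it across
    \<phi>, and equivariance of the right bracketing pulls it out again.\<close>
  show ?thesis
  proof (rule ihom_eqI[OF V V _ c])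
    show "?P1 x y z \<in> carrier E" using xyz by simp
    fix h v assume h: "h \<in> carrier H" and v: "v \<in> carrier V"
    have "act E h (?P1 x y z) = act3 E E E E ?P1 (\<Delta>_id (\<Delta> h)) x y z"
      using xyz h by (simp add: equivar_act[OF equivar_cmp] act3_merge_left[OF E(1) E(1) E(1) E(1) E(2) bilin_cmp equivar_cmp])
    then have "app (act E h (?P1 x y z)) v = act3 E E E V (\<lambda>x y z. app (?P1 x y z) v) (\<Delta>_id (\<Delta> h)) x y z"
      using xyz h v by (simp, intro act3_linear[where g="\<lambda>m. app m v", OF E(1) E(1) E(1) E(2) trilin_cmp(1) mV] lin) auto
    also have "\<dots> = act3 E E E V (\<lambda>x y z. app (act3 E E E E ?P2 \<phi> x y z) v) (\<Delta>_id (\<Delta> h)) x y z"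
      using xyz h v by (intro act3_cong[OF E(1) E(1) E(1) mV]) (simp_all add: 3)
    also have "\<dots> = app (act3 E E E E (act3 E E E E ?P2 \<phi>) (\<Delta>_id (\<Delta> h)) x y z) v"
      using xyz h v by (intro act3_linear[where g="\<lambda>m. app m v", OF E(1) E(1) E(1) E(2) aP2 mV, symmetric] lin) auto
    also have "act3 E E E E (act3 E E E E ?P2 \<phi>) (\<Delta>_id (\<Delta> h)) x y z = act3 E E E E (act3 E E E E ?P2 (id_\<Delta> (\<Delta> h))) \<phi> x y z"
      using xyz h by (intro act3_coassoc(1)[OF E(1) E(1) E(1) E(2) trilin_cmp(2), symmetric])
    also have "\<dots> = act3 E E E E (\<lambda>x y z. act E h (?P2 x y z)) \<phi> x y z"
      using xyz h
      by (intro act3_cong[OF E(1) E(1) E(1) E(2)])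
        (simp_all add: equivar_act[OF equivar_cmp] act3_merge_right[OF E(1) E(1) E(1) E(1) E(2) bilin_cmp equivar_cmp])
    also have "\<dots> = act E h (act3 E E E E ?P2 \<phi> x y z)"
      using xyz h by (intro act3_linear[OF E(1) E(1) E(1) E(2) trilin_cmp(2) E(2), symmetric] lin) auto
    finally show "app (act E h (?P1 x y z)) v = app (act E h (act3 E E E E ?P2 \<phi> x y z)) v" .
  qed
qed

abbreviation "idE \<equiv> beta_op V"

lemma idE_closed [simp]: "idE \<in> carrier E"
  using V by simp

lemmas idE_invariant = beta_op_invariant[OF V]

lemma app_idE [simp]: "v \<in> carrier V \<Longrightarrow> app idE v = v"
  by (rule ap_beta_op[OF V])

text \<open>The unit is invariant, so the \<phi> in \<open>app_cmp\<close> acts trivially whether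
  the unit is the left or the middle argument, and evaluation at the unit is the identity.\<close>

lemma cmp_idE:
  assumes L: "L \<in> carrier E" shows "cmp idE L = L" "cmp L idE = L"
proof -
  have 1: "app (cmp idE M) v = app M v" "app (cmp M idE) v = app M v" if "M \<in> carrier E" "v \<in> carrier V" for M v
    using that idE_invariant
    by (simp_all add: app_cmp act3_phi_left[OF E(1) E(1) V mV app2] act3_phi_middle[OF E(1) E(1) V mV app2])
  show "cmp idE L = L" "cmp L idE = L"
  proof (rule_tac [1-2] ihom_eqI[OF V V])
    fix h v assume h: "h \<in> carrier H" and v: "v \<in> carrier V"
    show "app (act E h (cmp idE L)) v = app (act E h L) v" "app (act E h (cmp L idE)) v = app (act E h L) v"
      using h v L idE_invariant
      by (simp_all add: equivar_act[OF equivar_cmp] act2_counit[OF E(1) E(1) E(2) bilin_cmp] 1)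
  qed (use L in auto)
qed

end

section \<open>The R-matrix\<close>

context quasitriangular_quasi_hopf_algebra
begin

abbreviation "\<R>inv \<equiv> inv\<^bsub>HH\<^esub> \<R>"

lemma rmat_closed [simp]: "\<R> \<in> carrier HH" "\<R>inv \<in> carrier HH"
  and rmat_inv: "\<R> \<otimes>\<^bsub>HH\<^esub> \<R>inv = \<one>\<^bsub>HH\<^esub>" "\<R>inv \<otimes>\<^bsub>HH\<^esub> \<R> = \<one>\<^bsub>HH\<^esub>"
proof -
  interpret M: monoid HH using kalg_HH by (simp add: kalg_def)
  show "\<R> \<in> carrier HH" "\<R>inv \<in> carrier HH"
    and "\<R> \<otimes>\<^bsub>HH\<^esub> \<R>inv = \<one>\<^bsub>HH\<^esub>" "\<R>inv \<otimes>\<^bsub>HH\<^esub> \<R> = \<one>\<^bsub>HH\<^esub>"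
    using rmat_unit by (simp_all add: M.Units_closed)
qed

lemma rmat_comult:
  assumes "h \<in> carrier H"
  shows "tlift HH (\<lambda>a b. h2 b a) (\<Delta> h) \<otimes>\<^bsub>HH\<^esub> \<R> = \<R> \<otimes>\<^bsub>HH\<^esub> \<Delta> h"
proof -
  interpret M: monoid HH using kalg_HH by (simp add: kalg_def)
  show ?thesis using assms by (simp add: rmat_op M.m_assoc rmat_inv)
qed

text \<open>\<open>F1\<close>, \<open>F2\<close>, \<open>F3\<close>, \<open>F4\<close> and the final \<open>\<phi>\<close> let the five factors on the right hand side of the second
  hexagon identity act on \<open>F\<close> one at a time, from left to right.\<close>

lemma act3_hexagon:
  fixes U :: "('a, 'b, 'u, 'p) hmod_scheme" and V :: "('a, 'b, 'v, 'q) hmod_scheme" and W :: "('a, 'b, 'w, 'r) hmod_scheme"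
  assumes U: "umodule U" and V: "umodule V" and W: "umodule W" and X: "module K X" and F: "trilin K U V W X F"
    and xyz: "x \<in> carrier U" "y \<in> carrier V" "z \<in> carrier W"
  defines "F1 \<equiv> \<lambda>x y z. act3 W U V X (\<lambda>z x y. F x y z) \<phi> z x y"
  defines "F2 \<equiv> \<lambda>x y z. act2 U W X (\<lambda>x z. F1 x y z) \<R> x z"
  defines "F3 \<equiv> \<lambda>x y z. act3 U W V X (\<lambda>x z y. F2 x y z) \<phi>inv x z y"
  defines "F4 \<equiv> \<lambda>x y z. act2 V W X (F3 x) \<R> y z"
  shows "act3 U V W X F (\<Delta>_id \<R>) x y z = act3 U V W X F4 \<phi> x y z"
proof -
  let ?P1 = "tlift3 HHH (\<lambda>p q r. h3 q r p) \<phi>" and ?P2 = "tlift HHH (\<lambda>a b. h3 a \<one>\<^bsub>H\<^esub> b) \<R>"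
    and ?P3 = "tlift3 HHH (\<lambda>p q r. h3 p r q) \<phi>inv" and ?P4 = "tlift HHH (\<lambda>a b. h3 \<one>\<^bsub>H\<^esub> a b) \<R>"
  have P: "?P1 \<in> carrier HHH" "?P2 \<in> carrier HHH" "?P3 \<in> carrier HHH" "?P4 \<in> carrier HHH"
    by (auto intro!: tlift3_H(4) tlift_H(4))
  note m = kalg_closed[OF kalg_HHH]
  let ?A = "act3 U V W X"
  \<comment> \<open>The permuted legs only record which argument each leg of \<phi> acts on: here p,
    q, r act on z, x, y. The same reading gives \<open>F3\<close>, with the legs on x, z, y.\<close>
  have F1: "?A F ?P1 x y z = F1 x y z" if "x \<in> carrier U" "y \<in> carrier V" "z \<in> carrier W" for x y z
    using that by (simp add: act3_tlift3[OF U V W X F] act3_h3[OF U V W X F] F1_def cong: tlift3_H(3)) (simp add: act3_def)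
  have tF1: "trilin K U V W X F1"
    unfolding F1_def using act3_trilin[OF W U V X, of "\<lambda>z x y. F x y z" \<phi>]
    by (auto intro!: trilinI trilin_1[OF F klinear_id] trilin_2[OF F _ klinear_id] trilin_3[OF F _ _ klinear_id]
        intro: trilin_1[OF _ klinear_id] trilin_2[OF _ _ klinear_id] trilin_3[OF _ _ _ klinear_id])
  have F2: "?A F1 ?P2 x y z = F2 x y z" if "x \<in> carrier U" "y \<in> carrier V" "z \<in> carrier W" for x y z
    using that U V W by (simp add: act3_tlift[OF U V W X tF1] act3_h3[OF U V W X tF1] F2_def act2_def cong: tlift_H(3))
  have tF2: "trilin K U V W X F2"
    unfolding F2_def act2_def using U V W X
    by (intro trilinI lin trilin_1[OF tF1] trilin_2[OF tF1] trilin_3[OF tF1]; simp)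
  have F3: "?A F2 ?P3 x y z = F3 x y z" if "x \<in> carrier U" "y \<in> carrier V" "z \<in> carrier W" for x y z
    using that by (simp add: act3_tlift3[OF U V W X tF2] act3_h3[OF U V W X tF2] F3_def cong: tlift3_H(3)) (simp add: act3_def)
  have tF3: "trilin K U V W X F3"
    unfolding F3_def act3_def using U V W X
    by (intro trilinI lin trilin_1[OF tF2] trilin_2[OF tF2] trilin_3[OF tF2]; simp)
  have F4: "?A F3 ?P4 x y z = F4 x y z" if "x \<in> carrier U" "y \<in> carrier V" "z \<in> carrier W" for x y z
    using that U V W by (simp add: act3_tlift[OF U V W X tF3] act3_h3[OF U V W X tF3] F4_def act2_def cong: tlift_H(3))
  have 1: "?A F (?P1 \<otimes>\<^bsub>HHH\<^esub> ?P2) x y z = F2 x y z" if "x \<in> carrier U" "y \<in> carrier V" "z \<in> carrier W" for x y z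
  proof -
    have "?A (?A F ?P1) ?P2 x y z = ?A F1 ?P2 x y z"
      by (rule act3_cong[OF U V W X F1 P(2) that])
    then show ?thesis by (simp add: act3_mult[OF U V W X F P(1,2) that] F2[OF that])
  qed
  have 2: "?A F (?P1 \<otimes>\<^bsub>HHH\<^esub> ?P2 \<otimes>\<^bsub>HHH\<^esub> ?P3) x y z = F3 x y z" if "x \<in> carrier U" "y \<in> carrier V" "z \<in> carrier W" for x y z
  proof -
    have "?A (?A F (?P1 \<otimes>\<^bsub>HHH\<^esub> ?P2)) ?P3 x y z = ?A F2 ?P3 x y z"
      by (rule act3_cong[OF U V W X 1 P(3) that])
    then show ?thesis by (simp add: act3_mult[OF U V W X F m[OF P(1,2)] P(3) that] F3[OF that])
  qed
  have 3: "?A F (?P1 \<otimes>\<^bsub>HHH\<^esub> ?P2 \<otimes>\<^bsub>HHH\<^esub> ?P3 \<otimes>\<^bsub>HHH\<^esub> ?P4) x y z = F4 x y z"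
    if "x \<in> carrier U" "y \<in> carrier V" "z \<in> carrier W" for x y z
  proof -
    have "?A (?A F (?P1 \<otimes>\<^bsub>HHH\<^esub> ?P2 \<otimes>\<^bsub>HHH\<^esub> ?P3)) ?P4 x y z = ?A F3 ?P4 x y z"
      by (rule act3_cong[OF U V W X 2 P(4) that])
    then show ?thesis by (simp add: act3_mult[OF U V W X F m[OF m[OF P(1,2)] P(3)] P(4) that] F4[OF that])
  qed
  have "?A F (\<Delta>_id \<R>) x y z = ?A F (?P1 \<otimes>\<^bsub>HHH\<^esub> ?P2 \<otimes>\<^bsub>HHH\<^esub> ?P3 \<otimes>\<^bsub>HHH\<^esub> ?P4 \<otimes>\<^bsub>HHH\<^esub> \<phi>) x y z"
    by (simp only: hexagon2)
  also have "\<dots> = ?A (?A F (?P1 \<otimes>\<^bsub>HHH\<^esub> ?P2 \<otimes>\<^bsub>HHH\<^esub> ?P3 \<otimes>\<^bsub>HHH\<^esub> ?P4)) \<phi> x y z"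
    by (rule act3_mult[OF U V W X F m[OF m[OF m[OF P(1,2)] P(3)] P(4)] phi_closed(1) xyz])
  also have "\<dots> = ?A F4 \<phi> x y z"
    by (rule act3_cong[OF U V W X 3 phi_closed(1) xyz])
  finally show ?thesis .
qed

text \<open>The counit condition (\<epsilon> \<otimes> id)(R) = 1. With the first argument in the
  unit object all associators of the hexagon are trivial, and it says that R acting on
  \<open>G\<close> equals R acting on \<open>?T\<close>, the map whose equality with
  \<open>G\<close> is claimed. Invertibility of R then cancels.\<close>

lemma act2_rmat_counit_unit:
  assumes Y: "umodule Y" and W: "umodule W" and X: "module K X" and G: "bilin K Y W X G"
    and yw: "y \<in> carrier Y" "w \<in> carrier W"
  shows "act2 unit_obj W X (\<lambda>c w. G (c \<odot>\<^bsub>Y\<^esub> y) w) \<R> \<one>\<^bsub>K\<^esub> w = G y w"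
proof -
  interpret K: cring K by (fact K_cring)
  interpret Y: module K Y using Y by simp
  interpret X: module K X by fact
  let ?I = unit_obj
  have t: "trivial ?I" and I: "umodule ?I" by blast+
  note B = equivar_smult_unit(1)[OF Y] note b = equivar_bilin[OF B]
  let ?F = "\<lambda>c y w. G (c \<odot>\<^bsub>Y\<^esub> y) w"
  have F: "trilin K ?I Y W X ?F"
    by (rule trilinI) (intro bilin_left[OF G] bilin_right[OF G] bilin_left[OF b] bilin_right[OF b] klinear_id; simp)+
  have F': "trilin K W ?I Y X (\<lambda>z c y. ?F c y z)"
    by (intro trilinI trilin_1[OF F klinear_id] trilin_2[OF F _ klinear_id] trilin_3[OF F _ _ klinear_id])
  let ?F2 = "\<lambda>c y w. act2 ?I W X (\<lambda>c w. ?F c y w) \<R> c w"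
  have F2: "trilin K ?I W Y X (\<lambda>c w y. ?F2 c y w)"
    unfolding act2_def using Y W X
    by (intro trilinI lin trilin_1[OF F] trilin_2[OF F] trilin_3[OF F] I; simp)
  \<comment> \<open>For \<open>\<phi>inv\<close> the triviality on the unit object is inherited from
    \<phi> by cancellation.\<close>
  have inv: "act3 ?I W Y X P \<phi>inv c z y = P c z y"
    if P: "trilin K ?I W Y X P" and "c \<in> carrier K" "z \<in> carrier W" "y \<in> carrier Y" for P c z y
  proof -
    have "act3 ?I W Y X P \<phi>inv c z y = act3 ?I W Y X (act3 ?I W Y X P \<phi>) \<phi>inv c z y"
      using that by (intro act3_cong[OF I W Y X]) (auto simp: act3_phi_left[OF I W Y X P])
    then show ?thesis using that by (simp add: act3_phi_inv(1)[OF I W Y X P])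
  qed
  let ?T = "\<lambda>y w. act2 ?I W X (\<lambda>c w. ?F c y w) \<R> \<one>\<^bsub>K\<^esub> w"
  have T: "bilin K Y W X ?T"
    using trilin_bilin[OF F2, of "\<one>\<^bsub>K\<^esub>"] by (auto simp: bilin_def)
  have F1: "act3 W ?I Y X (\<lambda>z c y. ?F c y z) \<phi> z c y = ?F c y z"
    if "c \<in> carrier K" "z \<in> carrier W" "y \<in> carrier Y" for c z y
    using that by (intro act3_phi_middle[OF W I Y X F']) auto
  have F2': "act2 ?I W X (\<lambda>c z. act3 W ?I Y X (\<lambda>z c y. ?F c y z) \<phi> z c y) \<R> c w = ?F2 c y w"
    if "c \<in> carrier K" "w \<in> carrier W" "y \<in> carrier Y" for c w y
    by (rule act2_cong[OF I W X]) (use that in \<open>auto simp: F1\<close>)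
  have F3: "act3 ?I W Y X (\<lambda>c z y. act2 ?I W X (\<lambda>c z. act3 W ?I Y X (\<lambda>z c y. ?F c y z) \<phi> z c y) \<R> c z) \<phi>inv c z y
      = ?F2 c y z" if "c \<in> carrier K" "z \<in> carrier W" "y \<in> carrier Y" for c z y
  proof -
    have "act3 ?I W Y X (\<lambda>c z y. act2 ?I W X (\<lambda>c z. act3 W ?I Y X (\<lambda>z c y. ?F c y z) \<phi> z c y) \<R> c z) \<phi>inv c z y
        = act3 ?I W Y X (\<lambda>c z y. ?F2 c y z) \<phi>inv c z y"
      by (rule act3_cong[OF I W Y X]) (use that in \<open>auto simp: F2'\<close>)
    then show ?thesis using that by (simp add: inv[OF F2])
  qed
  have F4: "act2 Y W X (\<lambda>y z. act3 ?I W Y X (\<lambda>c z y. act2 ?I W X (\<lambda>c z. act3 W ?I Y X (\<lambda>z c y. ?F c y z) \<phi> z c y) \<R> c z) \<phi>inv c z y) \<R> y z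
      = act2 Y W X (?F2 c) \<R> y z" if "c \<in> carrier K" "z \<in> carrier W" "y \<in> carrier Y" for c z y
    by (rule act2_cong[OF Y W X]) (use that in \<open>auto simp: F3\<close>)
  have tF4: "trilin K ?I Y W X (\<lambda>c. act2 Y W X (?F2 c) \<R>)"
  proof (rule trilinI)
    show "klinear K ?I X (\<lambda>c. act2 Y W X (?F2 c) \<R> v w)" if "v \<in> carrier Y" "w \<in> carrier W" for v w
      unfolding act2_def[of Y] using that Y W X by (intro lin trilin_1[OF F2] I) auto
    have b2: "bilin K Y W X (?F2 c)" if "c \<in> carrier ?I" for c
      using trilin_bilin[OF F2 that] by (auto simp: bilin_def)
    show "klinear K Y X (\<lambda>v. act2 Y W X (?F2 c) \<R> v w)" if "c \<in> carrier ?I" "w \<in> carrier W" for c w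
      by (rule bilin_left[OF act2_bilin[OF Y W X b2] klinear_id]) (use that in auto)
    show "klinear K W X (\<lambda>w. act2 Y W X (?F2 c) \<R> v w)" if "c \<in> carrier ?I" "v \<in> carrier Y" for c v
      by (rule bilin_right[OF act2_bilin[OF Y W X b2] _ klinear_id]) (use that in auto)
  qed
  \<comment> \<open>The left side merges the unit into \<open>y\<close>, so that
    \<open>\<Delta>_id \<R>\<close> becomes \<R>; the right side is the hexagon after removal of its
    three associators.\<close>
  have main: "act2 Y W X G \<R> y w = act2 Y W X ?T \<R> y w" if "w \<in> carrier W" "y \<in> carrier Y" for w y
  proof -
    have "act2 Y W X G \<R> y w = act3 ?I Y W X ?F (\<Delta>_id \<R>) \<one>\<^bsub>K\<^esub> y w"
      using that act3_merge_left[OF I Y W Y X G B, of \<R> "\<one>\<^bsub>K\<^esub>" y w] by simp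
    also have "\<dots> = act3 ?I Y W X (\<lambda>c. act2 Y W X (?F2 c) \<R>) \<phi> \<one>\<^bsub>K\<^esub> y w"
      using that by (subst act3_hexagon[OF I Y W X F]) (auto simp: F4 intro!: act3_cong[OF I Y W X])
    also have "\<dots> = act2 Y W X (?F2 \<one>\<^bsub>K\<^esub>) \<R> y w"
      using that by (intro act3_phi_left[OF I Y W X tF4]) auto
    finally show ?thesis .
  qed
  have i: "act2 Y W X (act2 Y W X P \<R>) \<R>inv y w = P y w" if P: "bilin K Y W X P" for P
    using yw by (simp add: act2_mult[OF Y W X P, symmetric] rmat_inv act2_one[OF Y W X P])
  have "?T y w = act2 Y W X (act2 Y W X ?T \<R>) \<R>inv y w" by (rule i[OF T, symmetric])
  also have "\<dots> = act2 Y W X (act2 Y W X G \<R>) \<R>inv y w"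
    by (rule act2_cong[OF Y W X]) (use yw in \<open>auto simp: main\<close>)
  also have "\<dots> = G y w" by (rule i[OF G])
  finally show ?thesis .
qed

lemma act2_rmat_counit:
  assumes Y: "umodule Y" and W: "umodule W" and X: "module K X" and G: "bilin K Y W X G"
    and yw: "y \<in> carrier Y" "w \<in> carrier W" and y: "\<And>h. h \<in> carrier H \<Longrightarrow> act Y h y = \<epsilon> h \<odot>\<^bsub>Y\<^esub> y"
  shows "act2 Y W X G \<R> y w = G y w"
proof -
  interpret K: cring K by (fact K_cring)
  interpret Y: module K Y using Y by simp
  have "act2 Y W X G \<R> y w = act2 unit_obj W X (\<lambda>c w. G (c \<odot>\<^bsub>Y\<^esub> y) w) \<R> \<one>\<^bsub>K\<^esub> w"
    unfolding act2_def using yw y by (intro tlift_H(3)) auto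
  then show ?thesis by (simp add: act2_rmat_counit_unit[OF Y W X G yw])
qed

end

section \<open>Gradings\<close>

lemma submodule_closed:
  assumes "module K X" "submodule N K X"
  shows "x \<in> N \<Longrightarrow> x \<in> carrier X" "\<zero>\<^bsub>X\<^esub> \<in> N"
    "x \<in> N \<Longrightarrow> y \<in> N \<Longrightarrow> x \<oplus>\<^bsub>X\<^esub> y \<in> N" "x \<in> N \<Longrightarrow> \<ominus>\<^bsub>X\<^esub> x \<in> N"
    "x \<in> N \<Longrightarrow> y \<in> N \<Longrightarrow> x \<ominus>\<^bsub>X\<^esub> y \<in> N" "c \<in> carrier K \<Longrightarrow> x \<in> N \<Longrightarrow> c \<odot>\<^bsub>X\<^esub> x \<in> N"
proof -
  interpret X: module K X by fact
  note e = X.submoduleE[OF assms(2)]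
  show "x \<in> N \<Longrightarrow> x \<in> carrier X" "x \<in> N \<Longrightarrow> y \<in> N \<Longrightarrow> x \<oplus>\<^bsub>X\<^esub> y \<in> N" "x \<in> N \<Longrightarrow> \<ominus>\<^bsub>X\<^esub> x \<in> N"
    "x \<in> N \<Longrightarrow> y \<in> N \<Longrightarrow> x \<ominus>\<^bsub>X\<^esub> y \<in> N" "c \<in> carrier K \<Longrightarrow> x \<in> N \<Longrightarrow> c \<odot>\<^bsub>X\<^esub> x \<in> N"
    using e by (auto simp: a_minus_def)
  obtain x where x: "x \<in> N" using e(2) by blast
  then have "x \<oplus>\<^bsub>X\<^esub> \<ominus>\<^bsub>X\<^esub> x \<in> N" using e by blast
  then show "\<zero>\<^bsub>X\<^esub> \<in> N" using x e(1) by (simp add: X.r_neg subsetD)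
qed

lemma submodule_finsum:
  assumes "module K X" "submodule N K X" "\<And>i. i \<in> A \<Longrightarrow> g i \<in> N"
  shows "finsum X g A \<in> N"
proof -
  interpret X: module K X by fact
  note c = submodule_closed[OF assms(1,2)]
  show ?thesis
  proof (cases "finite A")
    case True
    then show ?thesis using assms(3)
    proof (induct A)
      case empty
      then show ?case by (simp add: c)
    next
      case (insert i A)
      have "finsum X g (insert i A) = g i \<oplus>\<^bsub>X\<^esub> finsum X g A"
        using insert c(1) by (intro X.finsum_insert) auto
      then show ?case using insert c by auto
    qed
  qed (simp add: c X.finsum_infinite)
qed

lemma klinear_finsum:
  assumes "module K V" "module K W" "klinear K V W f" "\<And>i. i \<in> A \<Longrightarrow> g i \<in> carrier V"
  shows "f (finsum V g A) = finsum W (\<lambda>i. f (g i)) A"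
proof -
  interpret V: module K V by fact
  interpret W: module K W by fact
  note z = klinear_zero[OF assms(1-3)]
  note c = klinear_closed[OF assms(3)]
  show ?thesis
  proof (cases "finite A")
    case True
    then show ?thesis using assms(4)
    proof (induct A)
      case (insert i A)
      have "finsum V g (insert i A) = g i \<oplus>\<^bsub>V\<^esub> finsum V g A"
        using insert by (intro V.finsum_insert) auto
      moreover have "finsum W (\<lambda>i. f (g i)) (insert i A) = f (g i) \<oplus>\<^bsub>W\<^esub> finsum W (\<lambda>i. f (g i)) A"
        using insert c by (intro W.finsum_insert) auto
      moreover have "finsum V g A \<in> carrier V" using insert by (intro V.finsum_closed) auto
      ultimately show ?case using insert klinear_add[OF assms(3)] by simp
    qed (simp add: z)
  qed (simp add: z V.finsum_infinite W.finsum_infinite)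
qed

lemma klinear_finsum_param:
  assumes "module K W" "finite A" "\<And>i. i \<in> A \<Longrightarrow> klinear K U W (\<lambda>u. f u i)"
  shows "klinear K U W (\<lambda>u. finsum W (f u) A)"
proof -
  interpret W: module K W by fact
  have c: "f u i \<in> carrier W" if "i \<in> A" "u \<in> carrier U" for u i using klinear_closed[OF assms(3)] that by blast
  show ?thesis
  proof (rule klinearI)
    fix x y assume xy: "x \<in> carrier U" "y \<in> carrier U"
    show "finsum W (f x) A \<in> carrier W" using c xy by (intro W.finsum_closed) auto
    have "finsum W (f (x \<oplus>\<^bsub>U\<^esub> y)) A = finsum W (\<lambda>i. f x i \<oplus>\<^bsub>W\<^esub> f y i) A"
      using c xy klinear_add[OF assms(3)] by (intro W.finsum_cong') auto
    then show "finsum W (f (x \<oplus>\<^bsub>U\<^esub> y)) A = finsum W (f x) A \<oplus>\<^bsub>W\<^esub> finsum W (f y) A"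
      using c xy by (simp add: W.finsum_addf Pi_iff)
  next
    fix a x assume a: "a \<in> carrier K" "x \<in> carrier U"
    have "finsum W (f (a \<odot>\<^bsub>U\<^esub> x)) A = finsum W (\<lambda>i. a \<odot>\<^bsub>W\<^esub> f x i) A"
      using c a klinear_smult[OF assms(3)] by (intro W.finsum_cong') auto
    then show "finsum W (f (a \<odot>\<^bsub>U\<^esub> x)) A = a \<odot>\<^bsub>W\<^esub> finsum W (f x) A"
      using c a by (simp add: klinear_finsum[OF assms(1,1) klinear_smult_right[OF assms(1) klinear_id a(1)]])
  qed
qed

lemma lsum_submodule:
  assumes "module K X" "submodule N K X" "\<And>v w. (v, w) \<in> set xs \<Longrightarrow> f v w \<in> N"
  shows "lsum X f xs \<in> N"
  using assms(3) submodule_closed[OF assms(1,2)] by (induct xs) auto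

lemma tlift_submodule:
  assumes "module K V" "module K W" "t \<in> carrier (tensor K V W)" "module K X" "submodule N K X"
    "\<And>v w. v \<in> carrier V \<Longrightarrow> w \<in> carrier W \<Longrightarrow> f v w \<in> N"
  shows "tlift X f t \<in> N"
  unfolding tlift_lsum using tensor_rep[OF assms(3,1,2)] assms(6) by (intro lsum_submodule[OF assms(4,5)]) auto

lemma tlift3_submodule:
  assumes "module K U" "module K V" "module K W" "t \<in> carrier (tensor K U (tensor K V W))" "module K X" "submodule N K X"
    "\<And>u v w. u \<in> carrier U \<Longrightarrow> v \<in> carrier V \<Longrightarrow> w \<in> carrier W \<Longrightarrow> f u v w \<in> N"
  shows "tlift3 X f t \<in> N"
  unfolding tlift3_def
  by (rule tlift_submodule[OF assms(1) tensor_module[OF assms(2,3)] assms(4-6)])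
    (rule tlift_submodule[OF assms(2,3) _ assms(5,6)], auto intro: assms(7))

text \<open>A criterion for a bounded grading: linear projections \<open>p n\<close> onto the
  homogeneous parts that sum to the identity. They provide a decomposition, and applied to any other
  one they force its components.\<close>

lemma decomposes_unique:
  assumes X: "module K X" and sub: "\<And>n. submodule (gr X n) K X" and N: "finite N" "degrees X \<subseteq> N"
    and p: "\<And>n. klinear K X X (p n)" "\<And>n x. x \<in> carrier X \<Longrightarrow> p n x \<in> gr X n"
    and s: "\<And>x. x \<in> carrier X \<Longrightarrow> x = (\<Oplus>\<^bsub>X\<^esub>n\<in>N. p n x)"
    and h: "\<And>n m x. x \<in> gr X m \<Longrightarrow> p n x = (if n = m then x else \<zero>\<^bsub>X\<^esub>)"
    and x: "x \<in> carrier X"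
  shows "\<exists>!c. decomposes X x c"
proof -
  interpret X: module K X by fact
  note c = submodule_closed[OF X sub]
  have fin: "{n. c n \<noteq> \<zero>\<^bsub>X\<^esub>} \<subseteq> N" if "\<And>n. c n \<in> gr X n" for c
  proof
    fix n assume "n \<in> {n. c n \<noteq> \<zero>\<^bsub>X\<^esub>}"
    then have "n \<in> degrees X" unfolding degrees_def using that[of n] by auto
    then show "n \<in> N" using N by auto
  qed
  \<comment> \<open>The support in the definition varies with the decomposition; the fixed finite
    set \<open>N\<close> contains every such support, so all sums can be taken over it.\<close>
  have sum: "(\<Oplus>\<^bsub>X\<^esub>n\<in>{n. c n \<noteq> \<zero>\<^bsub>X\<^esub>}. c n) = (\<Oplus>\<^bsub>X\<^esub>n\<in>N. c n)" if "\<And>n. c n \<in> gr X n" for c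
    by (rule X.add.finprod_mono_neutral_cong_left) (use N fin[OF that] c(1)[OF that] in auto)
  show ?thesis
  proof (rule ex1I[of _ "\<lambda>n. p n x"])
    show "decomposes X x (\<lambda>n. p n x)"
      unfolding decomposes_def using p(2)[OF x] s[OF x] sum[of "\<lambda>n. p n x"] fin[of "\<lambda>n. p n x"] N(1) finite_subset by auto
    fix d assume "decomposes X x d"
    then have d: "\<And>n. d n \<in> gr X n" and xd: "x = (\<Oplus>\<^bsub>X\<^esub>n\<in>N. d n)"
      unfolding decomposes_def using sum[of d] by auto
    have "d m = p m x" for m
    proof -
      \<comment> \<open>Applying \<open>p m\<close> to an arbitrary decomposition annihilates every
        component except the one of degree m.\<close>
      have "p m x = (\<Oplus>\<^bsub>X\<^esub>n\<in>N. p m (d n))"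
        unfolding xd by (rule klinear_finsum[OF X X p(1) c(1)[OF d]])
      also have "\<dots> = (\<Oplus>\<^bsub>X\<^esub>n\<in>N. if m = n then d n else \<zero>\<^bsub>X\<^esub>)"
        using c(1)[OF d] h[OF d] by (intro X.finsum_cong') auto
      also have "\<dots> = d m"
      proof (cases "m \<in> N")
        case True
        then show ?thesis using c(1)[OF d] N by (intro X.finsum_singleton) auto
      next
        case False
        then have "d m = \<zero>\<^bsub>X\<^esub>" using fin[of d] d by auto
        moreover have "(\<Oplus>\<^bsub>X\<^esub>n\<in>N. if m = n then d n else \<zero>\<^bsub>X\<^esub>) = (\<Oplus>\<^bsub>X\<^esub>n\<in>N. \<zero>\<^bsub>X\<^esub>)"
          using False by (intro X.finsum_cong') auto
        ultimately show ?thesis by (simp add: X.finsum_zero)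
      qed
      finally show ?thesis by simp
    qed
    then show "d = (\<lambda>n. p n x)" by auto
  qed
qed

context hopf_data
begin

context
  fixes V :: "('k, 'h, 'v, 'p) hmod_scheme"
  assumes V: "hmodule V"
begin

lemma hmodule_facts:
  shows hmodule_module: "module K V" and gr_submodule: "submodule (gr V n) K V" and finite_degrees: "finite (degrees V)"
    and gr_act: "h \<in> carrier H \<Longrightarrow> v \<in> gr V n \<Longrightarrow> act V h v \<in> gr V n"
    and ex1_decomposes: "v \<in> carrier V \<Longrightarrow> \<exists>!c. decomposes V v c"
  using V unfolding hmodule_def by auto

interpretation V: module K V by (rule hmodule_module)

lemmas gr_closed = submodule_closed[OF hmodule_module gr_submodule]

lemma gr_degrees: "v \<in> gr V n \<Longrightarrow> n \<notin> degrees V \<Longrightarrow> v = \<zero>\<^bsub>V\<^esub>"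
  by (auto simp: degrees_def)

lemma decomposes_iff:
  assumes "\<And>n. c n \<in> gr V n"
  shows "decomposes V v c \<longleftrightarrow> v = (\<Oplus>\<^bsub>V\<^esub>n\<in>degrees V. c n)"
proof -
  have sub: "{n. c n \<noteq> \<zero>\<^bsub>V\<^esub>} \<subseteq> degrees V" using assms gr_degrees by blast
  have "(\<Oplus>\<^bsub>V\<^esub>n\<in>{n. c n \<noteq> \<zero>\<^bsub>V\<^esub>}. c n) = (\<Oplus>\<^bsub>V\<^esub>n\<in>degrees V. c n)"
    by (rule V.add.finprod_mono_neutral_cong_left) (use sub gr_closed(1)[OF assms] finite_degrees in auto)
  then show ?thesis
    using assms finite_subset[OF sub finite_degrees] by (auto simp: decomposes_def)
qed

lemma hcomp_decomposes: "v \<in> carrier V \<Longrightarrow> decomposes V v (hcomp V v)"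
  unfolding hcomp_def by (rule theI'[OF ex1_decomposes])

lemma hcomp_gr: "v \<in> carrier V \<Longrightarrow> hcomp V v n \<in> gr V n"
  using hcomp_decomposes by (simp add: decomposes_def)

lemma hcomp_closed: "v \<in> carrier V \<Longrightarrow> hcomp V v n \<in> carrier V"
  using gr_closed(1)[OF hcomp_gr] .

lemma hcomp_sum: "v \<in> carrier V \<Longrightarrow> v = (\<Oplus>\<^bsub>V\<^esub>n\<in>degrees V. hcomp V v n)"
  by (rule iffD1[OF decomposes_iff[OF hcomp_gr] hcomp_decomposes])

lemma hcomp_eqI:
  assumes "v \<in> carrier V" "\<And>n. c n \<in> gr V n" "v = (\<Oplus>\<^bsub>V\<^esub>n\<in>degrees V. c n)"
  shows "hcomp V v n = c n"
proof -
  have "decomposes V v c" by (rule iffD2[OF decomposes_iff[OF assms(2)] assms(3)])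
  then show ?thesis unfolding hcomp_def using the1_equality[OF ex1_decomposes[OF assms(1)]] by simp
qed

lemma klinear_hcomp: "klinear K V V (\<lambda>v. hcomp V v n)"
proof (rule klinearI)
  fix v w assume v: "v \<in> carrier V" and w: "w \<in> carrier V"
  show "hcomp V v n \<in> carrier V" by (rule hcomp_closed[OF v])
  show "hcomp V (v \<oplus>\<^bsub>V\<^esub> w) n = hcomp V v n \<oplus>\<^bsub>V\<^esub> hcomp V w n"
  proof (rule hcomp_eqI)
    have "v \<oplus>\<^bsub>V\<^esub> w = (\<Oplus>\<^bsub>V\<^esub>n\<in>degrees V. hcomp V v n) \<oplus>\<^bsub>V\<^esub> (\<Oplus>\<^bsub>V\<^esub>n\<in>degrees V. hcomp V w n)"
      using hcomp_sum[OF v] hcomp_sum[OF w] by simp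
    also have "\<dots> = (\<Oplus>\<^bsub>V\<^esub>n\<in>degrees V. hcomp V v n \<oplus>\<^bsub>V\<^esub> hcomp V w n)"
      by (rule V.finsum_addf[symmetric]) (auto simp: hcomp_closed v w)
    finally show "v \<oplus>\<^bsub>V\<^esub> w = (\<Oplus>\<^bsub>V\<^esub>n\<in>degrees V. hcomp V v n \<oplus>\<^bsub>V\<^esub> hcomp V w n)" .
  qed (auto intro!: gr_closed(3) hcomp_gr v w)
next
  fix a v assume a: "a \<in> carrier K" and v: "v \<in> carrier V"
  show "hcomp V (a \<odot>\<^bsub>V\<^esub> v) n = a \<odot>\<^bsub>V\<^esub> hcomp V v n"
  proof (rule hcomp_eqI)
    have "a \<odot>\<^bsub>V\<^esub> v = a \<odot>\<^bsub>V\<^esub> (\<Oplus>\<^bsub>V\<^esub>n\<in>degrees V. hcomp V v n)"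
      using hcomp_sum[OF v] by simp
    also have "\<dots> = (\<Oplus>\<^bsub>V\<^esub>n\<in>degrees V. a \<odot>\<^bsub>V\<^esub> hcomp V v n)"
      by (rule klinear_finsum[OF hmodule_module hmodule_module klinear_smult_right[OF hmodule_module klinear_id a]])
        (rule hcomp_closed[OF v])
    finally show "a \<odot>\<^bsub>V\<^esub> v = (\<Oplus>\<^bsub>V\<^esub>n\<in>degrees V. a \<odot>\<^bsub>V\<^esub> hcomp V v n)" .
  qed (auto intro!: gr_closed(6) hcomp_gr a v)
qed

lemma hcomp_homogeneous:
  assumes "v \<in> gr V m"
  shows "hcomp V v n = (if n = m then v else \<zero>\<^bsub>V\<^esub>)"
proof (rule hcomp_eqI)
  show "v \<in> carrier V" using assms by (rule gr_closed(1))
  show "(if n = m then v else \<zero>\<^bsub>V\<^esub>) \<in> gr V n" for n using assms gr_closed(2) by simp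
  show "v = (\<Oplus>\<^bsub>V\<^esub>n\<in>degrees V. if n = m then v else \<zero>\<^bsub>V\<^esub>)"
  proof (cases "m \<in> degrees V")
    case True
    then show ?thesis
      using V.add.finprod_singleton_swap[OF True finite_degrees, of "\<lambda>_. v"] gr_closed(1)[OF assms] by simp
  next
    case False
    then have "(\<Oplus>\<^bsub>V\<^esub>n\<in>degrees V. if n = m then v else \<zero>\<^bsub>V\<^esub>) = (\<Oplus>\<^bsub>V\<^esub>n\<in>degrees V. \<zero>\<^bsub>V\<^esub>)"
      by (intro V.finsum_cong') auto
    then show ?thesis using gr_degrees[OF assms False] by (simp add: V.finsum_zero)
  qed
qed

text \<open>Signs are explicit only on homogeneous elements. Linearity and the decomposition into
  components extend identities from there.\<close>

lemma graded_ext: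
  assumes X: "module K X" and f: "klinear K V X f" and g: "klinear K V X g"
    and e: "\<And>n v. v \<in> gr V n \<Longrightarrow> f v = g v" and v: "v \<in> carrier V"
  shows "f v = g v"
proof -
  interpret X: module K X by fact
  have "f (\<Oplus>\<^bsub>V\<^esub>n\<in>degrees V. hcomp V v n) = (\<Oplus>\<^bsub>X\<^esub>n\<in>degrees V. f (hcomp V v n))"
    by (rule klinear_finsum[OF hmodule_module X f hcomp_closed[OF v]])
  also have "\<dots> = (\<Oplus>\<^bsub>X\<^esub>n\<in>degrees V. g (hcomp V v n))"
    using e[OF hcomp_gr[OF v]] klinear_closed[OF g hcomp_closed[OF v]] by (intro X.finsum_cong') auto
  also have "\<dots> = g (\<Oplus>\<^bsub>V\<^esub>n\<in>degrees V. hcomp V v n)"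
    by (rule klinear_finsum[OF hmodule_module X g hcomp_closed[OF v], symmetric])
  finally show ?thesis using hcomp_sum[OF v] by simp
qed

lemma graded_submodule:
  assumes X: "module K X" and f: "klinear K V X f" and N: "submodule N K X"
    and e: "\<And>n v. v \<in> gr V n \<Longrightarrow> f v \<in> N" and v: "v \<in> carrier V"
  shows "f v \<in> N"
proof -
  have "f (\<Oplus>\<^bsub>V\<^esub>n\<in>degrees V. hcomp V v n) = (\<Oplus>\<^bsub>X\<^esub>n\<in>degrees V. f (hcomp V v n))"
    by (rule klinear_finsum[OF hmodule_module X f hcomp_closed[OF v]])
  also have "\<dots> \<in> N" by (rule submodule_finsum[OF X N e[OF hcomp_gr[OF v]]])
  finally show ?thesis using hcomp_sum[OF v] by simp
qed

end

text \<open>With j = 0 this makes the action of H commute with taking components; with j the degree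
  of \<open>a\<close> it does the same for the bracket with \<open>a\<close>.\<close>

lemma hcomp_shift:
  assumes V: "hmodule V" and W: "hmodule W" and f: "klinear K V W f" and d: "\<And>n v. v \<in> gr V n \<Longrightarrow> f v \<in> gr W (n + j)"
    and v: "v \<in> carrier V"
  shows "hcomp W (f v) (k + j) = f (hcomp V v k)"
proof (rule graded_ext[OF V hmodule_module[OF W] klinear_comp[OF klinear_hcomp[OF W] f] klinear_comp[OF f klinear_hcomp[OF V]] _ v])
  fix n v assume v: "v \<in> gr V n"
  show "hcomp W (f v) (k + j) = f (hcomp V v k)"
    using hcomp_homogeneous[OF W d[OF v]] hcomp_homogeneous[OF V v]
      klinear_zero[OF hmodule_module[OF V] hmodule_module[OF W] f] by auto
qed

end

section \<open>Graded internal homs\<close>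

context quasi_hopf_algebra
begin

lemma ihom_gr: "gr (ihom V W) n = {L \<in> carrier (ihom V W). \<forall>m. \<forall>v\<in>gr V m. L v \<in> gr W (m + n)}"
  by (simp add: ihom_def Let_def)

lemma ihom_grI: "L \<in> carrier (ihom V W) \<Longrightarrow> (\<And>m v. v \<in> gr V m \<Longrightarrow> L v \<in> gr W (m + n)) \<Longrightarrow> L \<in> gr (ihom V W) n"
  by (simp add: ihom_gr)

lemma ihom_grD: "L \<in> gr (ihom V W) n \<Longrightarrow> v \<in> gr V m \<Longrightarrow> L v \<in> gr W (m + n)"
  by (simp add: ihom_gr)

text \<open>Boundedness of both gradings is what makes every linear map a finite sum of homogeneous
  ones. The projections onto the parts are built from the components in the source and in the
  target.\<close>

lemma hmodule_ihom:
  assumes V: "hmodule V" and W: "hmodule W"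
  shows "hmodule (ihom V W)"
proof -
  let ?E = "ihom V W"
  note u = hmodule_umodule[OF V] hmodule_umodule[OF W]
  note m = hmodule_module[OF V] hmodule_module[OF W]
  have uE: "umodule ?E" and mE: "module K ?E" using u by auto
  interpret V: module K V by (rule m)
  interpret W: module K W by (rule m)
  interpret E: module K ?E by (rule mE)
  note gV = gr_closed[OF V] and gW = gr_closed[OF W]
  note z = klinear_zero[OF m ihom_klinear[where V=V and W=W]]
  have sub: "submodule (gr ?E n) K ?E" for n
  proof (rule E.submoduleI)
    show "gr ?E n \<subseteq> carrier ?E" by (auto simp: ihom_gr)
    show "\<zero>\<^bsub>?E\<^esub> \<in> gr ?E n"
      by (rule ihom_grI[OF E.zero_closed]) (simp_all add: ihom_simps(2) gV(1) gW(2))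
    fix L assume L: "L \<in> gr ?E n"
    then have Lc: "L \<in> carrier ?E" by (simp add: ihom_gr)
    show "\<ominus>\<^bsub>?E\<^esub> L \<in> gr ?E n"
      using Lc L
      by (intro ihom_grI) (simp_all add: klinear_minus[OF mE m(2) klinear_eval] gV(1) gW(4) ihom_grD)
    show "c \<odot>\<^bsub>?E\<^esub> L \<in> gr ?E n" if "c \<in> carrier K" for c
      using Lc L that
      by (intro ihom_grI) (simp_all add: klinear_smult[OF klinear_eval] gV(1) gW(6) ihom_grD)
    fix L' assume L': "L' \<in> gr ?E n"
    then have Lc': "L' \<in> carrier ?E" by (simp add: ihom_gr)
    show "L \<oplus>\<^bsub>?E\<^esub> L' \<in> gr ?E n"
      using Lc L L' Lc'
      by (intro ihom_grI) (simp_all add: klinear_add[OF klinear_eval] gV(1) gW(3) ihom_grD)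
  qed
  \<comment> \<open>A nonzero homogeneous map sends some degree of \<open>V\<close> to some degree
    of \<open>W\<close>, so its degree is a difference of two such degrees.\<close>
  define N where "N = (\<lambda>(i, j). j - i) ` (degrees V \<times> degrees W)"
  have N: "finite N" unfolding N_def using finite_degrees[OF V] finite_degrees[OF W] by auto
  have zero_gr: "L = \<zero>\<^bsub>?E\<^esub>" if L: "L \<in> gr ?E n" and n: "n \<notin> N" for L n
  proof -
    have Lc: "L \<in> carrier ?E" using L by (simp add: ihom_gr)
    show ?thesis
    proof (rule ihom_ext[OF Lc E.zero_closed])
      fix v assume v: "v \<in> carrier V"
      have "L v = (\<lambda>v. \<zero>\<^bsub>W\<^esub>) v"
      proof (rule graded_ext[OF V m(2) ihom_klinear[OF Lc] klinear_const_zero[OF m(2)] _ v])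
        fix i v assume v: "v \<in> gr V i"
        show "L v = \<zero>\<^bsub>W\<^esub>"
        proof (cases "i \<in> degrees V")
          case True
          then have "i + n \<notin> degrees W" using n unfolding N_def by force
          then show ?thesis using gr_degrees[OF W ihom_grD[OF L v]] by blast
        next
          case False
          then show ?thesis using gr_degrees[OF V v] z[OF Lc] by blast
        qed
      qed
      then show "L v = \<zero>\<^bsub>?E\<^esub> v" using v by (simp add: ihom_simps)
    qed
  qed
  have degE: "degrees ?E \<subseteq> N"
  proof
    fix n assume "n \<in> degrees ?E"
    then obtain L where "L \<in> gr ?E n" "L \<noteq> \<zero>\<^bsub>?E\<^esub>"
      unfolding degrees_def using submodule_closed(2)[OF mE sub] by auto
    then show "n \<in> N" using zero_gr by blast
  qed
  \<comment> \<open>The part of degree n: on elements of degree i it keeps the component of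
    \<open>L\<close> in degree i + n.\<close>
  define p where "p n L = (\<lambda>v\<in>carrier V. \<Oplus>\<^bsub>W\<^esub>i\<in>degrees V. hcomp W (L (hcomp V v i)) (i + n))" for n L
  have pc: "p n L \<in> carrier ?E" if "L \<in> carrier ?E" for n L
    unfolding p_def
    by (intro restrict_ihom m klinear_finsum_param finite_degrees[OF V] klinear_comp[OF klinear_hcomp[OF W]]
        klinear_ihom_app[OF that] klinear_hcomp[OF V])
  have ph: "p n L v = hcomp W (L v) (j + n)" if L: "L \<in> carrier ?E" and v: "v \<in> gr V j" for n L v j
  proof -
    have Lv: "L v \<in> carrier W" using L gV(1)[OF v] by simp
    have z0: "hcomp W \<zero>\<^bsub>W\<^esub> i = \<zero>\<^bsub>W\<^esub>" for i by (rule klinear_zero[OF m(2,2) klinear_hcomp[OF W]])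
    have "p n L v = (\<Oplus>\<^bsub>W\<^esub>i\<in>degrees V. if i = j then hcomp W (L v) (j + n) else \<zero>\<^bsub>W\<^esub>)"
      unfolding p_def using gV(1)[OF v] hcomp_homogeneous[OF V v] z[OF L] z0 hcomp_closed[OF W Lv]
      by (auto intro!: W.finsum_cong')
    also have "\<dots> = hcomp W (L v) (j + n)"
    proof (cases "j \<in> degrees V")
      case True
      then show ?thesis
        using W.add.finprod_singleton_swap[OF True finite_degrees[OF V], of "\<lambda>_. hcomp W (L v) (j + n)"] hcomp_closed[OF W Lv] by simp
    next
      case False
      then have "L v = \<zero>\<^bsub>W\<^esub>" using gr_degrees[OF V v] z[OF L] by simp
      moreover have "(\<Oplus>\<^bsub>W\<^esub>i\<in>degrees V. if i = j then hcomp W (L v) (j + n) else \<zero>\<^bsub>W\<^esub>) = (\<Oplus>\<^bsub>W\<^esub>i\<in>degrees V. \<zero>\<^bsub>W\<^esub>)"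
        using False by (intro W.finsum_cong') auto
      ultimately show ?thesis using z0 by (simp add: W.finsum_zero)
    qed
    finally show ?thesis .
  qed
  have ex1: "\<exists>!c. decomposes ?E L c" if L: "L \<in> carrier ?E" for L
  proof (rule decomposes_unique[OF mE sub N degE, of p])
    show "klinear K ?E ?E (p n)" for n
    proof (intro klinear_ihomI mE m pc; assumption?)
      fix v assume v: "v \<in> carrier V"
      show "klinear K ?E W (\<lambda>L. p n L v)"
        unfolding p_def using v
        by (simp, intro klinear_finsum_param m finite_degrees[OF V] klinear_comp[OF klinear_hcomp[OF W]] klinear_eval hcomp_closed[OF V])
    qed
    show "p n L \<in> gr ?E n" if "L \<in> carrier ?E" for n L
      using that by (intro ihom_grI pc) (simp_all add: ph hcomp_gr[OF W] gV(1))
    show "p n L = (if n = k then L else \<zero>\<^bsub>?E\<^esub>)" if L: "L \<in> gr ?E k" for n k L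
    proof -
      have Lc: "L \<in> carrier ?E" using L by (simp add: ihom_gr)
      have c: "(if n = k then L else \<zero>\<^bsub>?E\<^esub>) \<in> carrier ?E" using Lc by simp
      show ?thesis
      proof (rule ihom_ext[OF pc[OF Lc] c])
        fix v assume v: "v \<in> carrier V"
        show "p n L v = (if n = k then L else \<zero>\<^bsub>?E\<^esub>) v"
        proof (rule graded_ext[OF V m(2) ihom_klinear[OF pc[OF Lc]] ihom_klinear[OF c] _ v])
          fix i v assume v: "v \<in> gr V i"
          show "p n L v = (if n = k then L else \<zero>\<^bsub>?E\<^esub>) v"
            using hcomp_homogeneous[OF W ihom_grD[OF L v], of "i + n"] gV(1)[OF v]
            by (simp add: ph[OF Lc v] ihom_simps(2))
        qed
      qed
    qed
    fix L assume L: "L \<in> carrier ?E"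
    have c: "(\<Oplus>\<^bsub>?E\<^esub>n\<in>N. p n L) \<in> carrier ?E" using pc[OF L] by (intro E.finsum_closed) auto
    show "L = (\<Oplus>\<^bsub>?E\<^esub>n\<in>N. p n L)"
    proof (rule ihom_ext[OF L c])
      fix v assume v: "v \<in> carrier V"
      show "L v = (\<Oplus>\<^bsub>?E\<^esub>n\<in>N. p n L) v"
      proof (rule graded_ext[OF V m(2) ihom_klinear[OF L] ihom_klinear[OF c] _ v])
        fix i v assume v: "v \<in> gr V i"
        have vc: "v \<in> carrier V" and Lv: "L v \<in> carrier W" using gV(1)[OF v] L by auto
        have "(\<Oplus>\<^bsub>?E\<^esub>n\<in>N. p n L) v = (\<Oplus>\<^bsub>W\<^esub>n\<in>N. p n L v)"
          by (rule klinear_finsum[OF mE m(2) klinear_eval[OF vc] pc[OF L]])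
        also have "\<dots> = (\<Oplus>\<^bsub>W\<^esub>n\<in>N. hcomp W (L v) (i + n))" by (simp add: ph[OF L v])
        also have "\<dots> = L v"
        proof (cases "i \<in> degrees V")
          case True
          \<comment> \<open>Translating \<open>N\<close> by i covers all degrees of \<open>W\<close>
            and possibly more; in the surplus degrees the components vanish.\<close>
          have sb: "degrees W \<subseteq> (+) i ` N"
          proof
            fix j assume "j \<in> degrees W"
            then have "j - i \<in> N" using True unfolding N_def by force
            then show "j \<in> (+) i ` N" by (intro image_eqI[of _ _ "j - i"]) auto
          qed
          have "(\<Oplus>\<^bsub>W\<^esub>n\<in>N. hcomp W (L v) (i + n)) = (\<Oplus>\<^bsub>W\<^esub>n\<in>(+) i ` N. hcomp W (L v) n)"
            using hcomp_closed[OF W Lv] by (subst W.add.finprod_reindex) auto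
          also have "\<dots> = (\<Oplus>\<^bsub>W\<^esub>n\<in>degrees W. hcomp W (L v) n)"
            by (rule W.add.finprod_mono_neutral_cong_right)
              (use N sb hcomp_closed[OF W Lv] gr_degrees[OF W hcomp_gr[OF W Lv]] in auto)
          also have "\<dots> = L v" by (rule hcomp_sum[OF W Lv, symmetric])
          finally show ?thesis .
        next
          case False
          then have "L v = \<zero>\<^bsub>W\<^esub>" using gr_degrees[OF V v] z[OF L] by simp
          then show ?thesis
            using klinear_zero[OF m(2,2) klinear_hcomp[OF W]] by (simp add: W.finsum_zero)
        qed
        finally show "L v = (\<Oplus>\<^bsub>?E\<^esub>n\<in>N. p n L) v" by simp
      qed
    qed
  qed (rule L)
  have ag: "act ?E h L \<in> gr ?E n" if h: "h \<in> carrier H" and L: "L \<in> gr ?E n" for h L n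
  proof -
    have Lc: "L \<in> carrier ?E" using L by (simp add: ihom_gr)
    show ?thesis
    proof (rule ihom_grI[OF act_ihom_closed[OF u Lc h]])
      fix i v assume v: "v \<in> gr V i"
      show "act ?E h L v \<in> gr W (i + n)"
        unfolding act_ihom[OF gV(1)[OF v]]
        by (rule tlift_submodule[OF H_modules(1,1) comult_closed[OF h] m(2) gr_submodule[OF W]])
          (intro gr_act[OF W] ihom_grD[OF L] gr_act[OF V] v S_closed)
    qed
  qed
  have b: "bilin K H ?E ?E (act ?E)" by (rule conjunct1[OF conjunct2[OF uE[unfolded umodule_def]]])
  show ?thesis
    unfolding hmodule_def
  proof (intro conjI ballI allI)
    show "finite (degrees ?E)" by (rule finite_subset[OF degE N])
    show "klinear K ?E ?E (act ?E h)" if "h \<in> carrier H" for h using b that by (simp add: bilin_def)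
    show "klinear K H ?E (\<lambda>h. act ?E h v)" if "v \<in> carrier ?E" for v using b that by (simp add: bilin_def)
    show "act ?E (h \<otimes>\<^bsub>H\<^esub> h') v = act ?E h (act ?E h' v)" if "h \<in> carrier H" "h' \<in> carrier H" "v \<in> carrier ?E" for h h' v
      using uE that by (rule act_mult)
    show "act ?E \<one>\<^bsub>H\<^esub> v = v" if "v \<in> carrier ?E" for v using uE that by (rule act_one)
    show "module K ?E" by (rule mE)
    show "submodule (gr ?E n) K ?E" for n by (rule sub)
    show "\<exists>!c. decomposes ?E v c" if "v \<in> carrier ?E" for v by (rule ex1[OF that])
    show "act ?E h v \<in> gr ?E n" if "h \<in> carrier H" "v \<in> gr ?E n" for h n v by (rule ag[OF that])
  qed
qed

lemma ap_gr:
  assumes V: "hmodule V" and W: "hmodule W" and L: "L \<in> gr (ihom V W) i" and v: "v \<in> gr V j"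
  shows "ap V W L v \<in> gr W (j + i)"
  unfolding ap_def
  by (rule tlift3_submodule[OF H_modules(1,1,1) phi_closed(1) hmodule_module[OF W] gr_submodule[OF W]])
    (intro gr_act[OF W] ihom_grD[OF L] gr_act[OF V] v; simp)

text \<open>The degree condition is imposed on the orbit of \<open>v\<close>, because the first leg
  of \<open>\<phi>inv\<close> acts on \<open>v\<close> before \<open>F\<close> is applied.\<close>

lemma curry_h_gr:
  assumes V: "umodule V" and W: "hmodule W" and X: "hmodule X" and F: "bilin K V W X F" and v: "v \<in> carrier V"
    and d: "\<And>h j w. h \<in> carrier H \<Longrightarrow> w \<in> gr W j \<Longrightarrow> F (act V h v) w \<in> gr X (j + i)"
  shows "curry_h V W X F v \<in> gr (ihom W X) i"
proof (rule ihom_grI[OF curry_h_closed[OF V hmodule_umodule[OF W] hmodule_module[OF X] F v]])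
  fix j w assume w: "w \<in> gr W j"
  show "curry_h V W X F v w \<in> gr X (j + i)"
    unfolding curry_h_def using gr_closed(1)[OF W w]
    by (simp, intro tlift3_submodule[OF H_modules(1,1,1) phi_closed(2) hmodule_module[OF X] gr_submodule[OF X]])
      (intro d gr_act[OF W] w; simp)
qed

end

section \<open>Passing between records that share their module structure\<close>

lemma submodule_iff:
  assumes "module K X"
  shows "submodule N K X \<longleftrightarrow> N \<subseteq> carrier X \<and> \<zero>\<^bsub>X\<^esub> \<in> N \<and> (\<forall>x\<in>N. \<forall>y\<in>N. x \<oplus>\<^bsub>X\<^esub> y \<in> N) \<and>
    (\<forall>c\<in>carrier K. \<forall>x\<in>N. c \<odot>\<^bsub>X\<^esub> x \<in> N)"
    (is "_ \<longleftrightarrow> ?R")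
proof
  show ?R if "submodule N K X"
    using submodule_closed(1-3,6)[OF assms that] by auto
next
  interpret X: module K X by fact
  assume R: ?R
  show "submodule N K X"
  proof (rule X.submoduleI)
    fix x assume "x \<in> N"
    \<comment> \<open>Closure under negation comes from scalar multiplication by -1.\<close>
    then have "\<ominus>\<^bsub>X\<^esub> x = (\<ominus>\<^bsub>K\<^esub> \<one>\<^bsub>K\<^esub>) \<odot>\<^bsub>X\<^esub> x" "(\<ominus>\<^bsub>K\<^esub> \<one>\<^bsub>K\<^esub>) \<odot>\<^bsub>X\<^esub> x \<in> N"
      using R X.smult_l_minus[OF X.one_closed] by (auto simp: subsetD)
    then show "\<ominus>\<^bsub>X\<^esub> x \<in> N" by simp
  qed (use R in auto)
qed

lemma tens_eq_mono:
  assumes "tens_eq K V W xs ys"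
    and "carrier V \<subseteq> carrier V'" "zero V' = zero V" "add V' = add V" "smult V' = smult V"
    and "carrier W \<subseteq> carrier W'" "zero W' = zero W" "add W' = add W" "smult W' = smult W"
  shows "tens_eq K V' W' xs ys"
  using assms(1)
proof induct
  case (refl xs)
  then show ?case using assms by (intro tens_eq.refl) auto
next
  case (zero w)
  then show ?case using assms tens_eq.zero[of w W' K V'] by auto
next
  case (add_left v v' w)
  then show ?case using assms tens_eq.add_left[of v V' v' w W' K] by auto
next
  case (add_right v w w')
  then show ?case using assms tens_eq.add_right[of v V' w W' w' K] by auto
next
  case (smult c v w)
  then show ?case using assms tens_eq.smult[of c K v V' w W'] by auto
next
  case (swap v w v' w')
  then show ?case using assms by (intro tens_eq.swap) auto
next
  case (sym xs ys)
  show ?case using sym(2) by (rule tens_eq.sym)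
next
  case (trans xs ys zs)
  show ?case using trans(2,4) by (rule tens_eq.trans)
next
  case (append xs ys us vs)
  show ?case using append(2,4) by (rule tens_eq.append)
qed

text \<open>The classes depend only on carriers, zeros, sums and scalar multiples. This identifies
  tensors over the record \<open>end_alg V\<close> with tensors over
  \<open>ihom V V\<close>.\<close>

lemma tclass_transfer:
  assumes "carrier V' = carrier V" "zero V' = zero V" "add V' = add V" "smult V' = smult V"
    and "carrier W' = carrier W" "zero W' = zero W" "add W' = add W" "smult W' = smult W"
  shows "tclass K V' W' = tclass K V W"
proof -
  have "tens_eq K V' W' xs ys = tens_eq K V W xs ys" for xs ys
    using tens_eq_mono[of K V W xs ys V' W'] tens_eq_mono[of K V' W' xs ys V W] assms by auto
  then show ?thesis by (simp add: fun_eq_iff tclass_def)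
qed

context hopf_data
begin

lemma end_alg_simps [simp]:
  "carrier (end_alg V) = carrier (ihom V V)" "zero (end_alg V) = zero (ihom V V)" "add (end_alg V) = add (ihom V V)"
  "smult (end_alg V) = smult (ihom V V)" "act (end_alg V) = act (ihom V V)" "gr (end_alg V) = gr (ihom V V)"
  "mult (end_alg V) = mult (ihom V V)" "one (end_alg V) = one (ihom V V)"
  "mu (end_alg V) = icomp V V V" "eta (end_alg V) = (\<lambda>c. c \<odot>\<^bsub>ihom V V\<^esub> beta_op V)"
  by (simp_all add: end_alg_def hmod.defs halg.defs beta_op_def)

lemma tclass_end_alg [simp]: "tclass K (end_alg V) (end_alg V) = tclass K (ihom V V) (ihom V V)"
  by (rule tclass_transfer) simp_all

lemma htensor_end_alg [simp]: "end_alg V \<boxtimes> end_alg V = ihom V V \<boxtimes> ihom V V"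
proof -
  have "tensor K (end_alg V) (end_alg V) = tensor K (ihom V V) (ihom V V)" by (simp add: tensor_def)
  then show ?thesis by (simp add: htensor_def)
qed

lemma klinear_end_alg [simp]:
  "klinear K X (end_alg V) f = klinear K X (ihom V V) f"
  by (simp add: klinear_def)

lemma tlift_end_alg [simp]: "tlift3 (end_alg V) f t = tlift3 (ihom V V) f t"
  by (simp add: tlift3_def tlift_def)

lemma hmodule_transfer:
  assumes X: "hmodule X" and e: "carrier Y = carrier X" "zero Y = zero X" "add Y = add X" "smult Y = smult X" "act Y = act X" "gr Y = gr X"
  shows "hmodule Y"
proof -
  have m: "module K Y" by (rule module_transfer[OF hmodule_module[OF X]]) (simp_all add: e)
  have s: "submodule N K Y = submodule N K X" for N
    by (simp add: submodule_iff[OF m] submodule_iff[OF hmodule_module[OF X]] e)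
  have d: "decomposes Y = decomposes X"
    by (simp add: fun_eq_iff decomposes_def finsum_def finprod_def e)
  have k: "klinear K Y Y f = klinear K X X f" "klinear K H Y g = klinear K H X g" for f g by (simp_all add: klinear_def e)
  show ?thesis using X m unfolding hmodule_def by (simp add: s d k e degrees_def)
qed

lemma gr_htensor: "gr (V \<boxtimes> W) n = tclass K V W ` {xs. \<forall>(v, w)\<in>set xs. \<exists>m. v \<in> gr V m \<and> w \<in> gr W (n - m)}"
  by (simp add: htensor_def Let_def)

text \<open>Elements of degree n of a tensor product are represented by sums of homogeneous pairs of
  total degree n, so degree conditions need checking only on such pairs.\<close>

lemma gr_htensor_submodule:
  assumes V: "hmodule V" and W: "hmodule W" and X: "module K X" and f: "klinear K (tensor K V W) X f"
    and N: "submodule N K X" and t: "t \<in> gr (V \<boxtimes> W) n"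
    and h: "\<And>m v w. v \<in> gr V m \<Longrightarrow> w \<in> gr W (n - m) \<Longrightarrow> f (pure V W v w) \<in> N"
  shows "f t \<in> N"
proof -
  note m = hmodule_module[OF V] hmodule_module[OF W]
  obtain xs where xs: "\<forall>(v, w)\<in>set xs. \<exists>m. v \<in> gr V m \<and> w \<in> gr W (n - m)" and t: "t = tclass K V W xs"
    using t by (auto simp: gr_htensor)
  have c: "set xs \<subseteq> carrier V \<times> carrier W" using xs gr_closed(1)[OF V] gr_closed(1)[OF W] by fastforce
  have "f t = lsum X (\<lambda>v w. f (pure V W v w)) xs"
    unfolding t lsum_pure[OF c m, symmetric]
    by (rule lsum_linear[OF tensor_module[OF m] X f]) (use c in \<open>auto intro: pure_closed\<close>)
  also have "\<dots> \<in> N" by (rule lsum_submodule[OF X N]) (use xs h in blast)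
  finally show ?thesis .
qed

lemma klinear_unit_obj:
  assumes "module K X" "x \<in> carrier X" shows "klinear K unit_obj X (\<lambda>c. c \<odot>\<^bsub>X\<^esub> x)"
proof -
  interpret X: module K X by fact
  show ?thesis using assms(2) by (intro klinearI) (auto simp: X.smult_l_distr X.smult_assoc1)
qed

end

section \<open>The grading of the product and end(V) as an algebra\<close>

locale graded_endomorphisms = endomorphisms +
  assumes hV: "hmodule V"
begin

lemmas hE = hmodule_ihom[OF hV hV]
lemmas grE = gr_closed[OF hE]

lemma cmp_gr:
  assumes L: "L \<in> gr E i" and L': "L' \<in> gr E j"
  shows "cmp L L' \<in> gr E (i + j)"
proof -
  have c: "L \<in> carrier E" "L' \<in> carrier E" using L L' by (auto intro: grE)
  have EE: "umodule (E \<boxtimes> E)" by blast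
  have "curry_h (E \<boxtimes> E) V V compF (pure E E L L') \<in> gr E (i + j)"
  proof (rule curry_h_gr[OF EE hV hV bilin_compF])
    show "pure E E L L' \<in> carrier (E \<boxtimes> E)" using c by simp
    fix h k v assume h: "h \<in> carrier H" and v: "v \<in> gr V k"
    have vc: "v \<in> carrier V" using gr_closed(1)[OF hV v] .
    have "act (E \<boxtimes> E) h (pure E E L L') = act2 E E (tensor K E E) (pure E E) (\<Delta> h) L L'"
      using equivar_act[OF pure_equivar[OF E(1) E(1)] h c] by simp
    then have "compF (act (E \<boxtimes> E) h (pure E E L L')) v = act2 E E V (\<lambda>L L'. compF (pure E E L L') v) (\<Delta> h) L L'"
      using h c vc bilin_left[OF bilin_compF klinear_id vc]
      by (simp, intro act2_linear[where g="\<lambda>s. compF s v", OF E(1) E(1)]) auto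
    also have "\<dots> \<in> gr V (k + (i + j))"
      unfolding act2_def
    proof (rule tlift_submodule[OF H_modules(1,1) comult_closed[OF h] mV gr_submodule[OF hV]])
      fix a b assume ab: "a \<in> carrier H" "b \<in> carrier H"
      have "act3 E E V V app2 \<phi> (act E a L) (act E b L') v \<in> gr V (k + (i + j))"
        unfolding act3_def
      proof (rule tlift3_submodule[OF H_modules(1,1,1) phi_closed(1) mV gr_submodule[OF hV]])
        fix p q r assume pqr: "p \<in> carrier H" "q \<in> carrier H" "r \<in> carrier H"
        have "app2 (act E p (act E a L)) (act E q (act E b L')) (act V r v) \<in> gr V ((k + j) + i)"
          using ab pqr by (intro ap_gr[OF hV hV] gr_act[OF hE] gr_act[OF hV] L L' v)
        then show "app2 (act E p (act E a L)) (act E q (act E b L')) (act V r v) \<in> gr V (k + (i + j))"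
          by (simp add: add.assoc add.commute add.left_commute)
      qed
      then show "compF (pure E E (act E a L) (act E b L')) v \<in> gr V (k + (i + j))"
        using ab c vc by (simp add: compF_pure)
    qed
    finally show "compF (act (E \<boxtimes> E) h (pure E E L L')) v \<in> gr V (k + (i + j))" .
  qed
  then show ?thesis using c by (simp add: icomp_curry)
qed

lemma idE_gr: "idE \<in> gr E 0"
  by (rule ihom_grI[OF idE_closed]) (auto simp: beta_op_def gr_closed(1)[OF hV] gr_act[OF hV])

lemma halgebra_end_alg: "halgebra (end_alg V)"
proof -
  interpret K: cring K by (fact K_cring)
  interpret E: module K E by simp
  have 1: "hmorphism (E \<boxtimes> E) (end_alg V) (icomp V V V)"
    unfolding hmorphism_def
  proof (intro conjI ballI allI)
    show "klinear K (E \<boxtimes> E) (end_alg V) (icomp V V V)" by (simp add: klinear_icomp)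
    fix n t assume t: "t \<in> gr (E \<boxtimes> E) n"
    have "icomp V V V t \<in> gr E n"
    proof (rule gr_htensor_submodule[OF hE hE E(2) klinear_icomp gr_submodule[OF hE] t])
      fix m L L' assume "L \<in> gr E m" "L' \<in> gr E (n - m)"
      then show "cmp L L' \<in> gr E n" using cmp_gr[of L m L' "n - m"] by simp
    qed
    then show "icomp V V V t \<in> gr (end_alg V) n" by simp
  qed (simp add: icomp_act)
  have 2: "hmorphism unit_obj (end_alg V) (eta (end_alg V))"
    unfolding hmorphism_def
  proof (intro conjI ballI allI)
    show "klinear K unit_obj (end_alg V) (eta (end_alg V))" by (simp add: klinear_unit_obj)
    show "eta (end_alg V) (act unit_obj h c) = act (end_alg V) h (eta (end_alg V) c)" if "h \<in> carrier H" "c \<in> carrier unit_obj" for h c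
      using that klinear_smult[OF klinear_act_r[OF E(1) _ klinear_id], of h c idE]
      by (simp add: idE_invariant E.smult_assoc1[symmetric] K.m_comm)
    show "eta (end_alg V) c \<in> gr (end_alg V) n" if "c \<in> gr unit_obj n" for c n
      using that grE idE_gr by (auto simp: unit_obj_def split: if_splits)
  qed
  have 3: "hmodule (end_alg V)" by (rule hmodule_transfer[OF hE]) simp_all
  show ?thesis
    unfolding halgebra_def using 1 2 3
    by (simp add: cmp_assoc[unfolded act3_def] cmp_idE)
qed

end

section \<open>Subalgebras\<close>

lemma submodule_carrier_module:
  assumes X: "module K X" and N: "submodule N K X"
    and e: "carrier Y = N" "zero Y = zero X" "add Y = add X" "smult Y = smult X"
  shows "module K Y"
proof -
  interpret X: module K X by fact
  note c = submodule_closed[OF X N]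
  have "abelian_group Y"
  proof (rule abelian_groupI)
    show "\<exists>y\<in>carrier Y. y \<oplus>\<^bsub>Y\<^esub> x = \<zero>\<^bsub>Y\<^esub>" if "x \<in> carrier Y" for x
      using that c by (intro bexI[of _ "\<ominus>\<^bsub>X\<^esub> x"]) (auto simp: e X.l_neg)
  qed (auto simp: e c X.add.m_ac dest: c(1))
  then show ?thesis
    by (intro moduleI) (auto simp: e c X.is_cring X.smult_l_distr X.smult_r_distr X.smult_assoc1 dest: c(1))
qed

lemma tensor_submodule:
  assumes "module K V" "module K W" "module K X" "klinear K (tensor K V W) X f" "submodule N K X"
    "\<And>v w. v \<in> carrier V \<Longrightarrow> w \<in> carrier W \<Longrightarrow> f (tclass K V W [(v, w)]) \<in> N" "t \<in> carrier (tensor K V W)"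
  shows "f t \<in> N"
proof -
  have "f (tlift (tensor K V W) (\<lambda>v w. tclass K V W [(v, w)]) t) = tlift X (\<lambda>v w. f (tclass K V W [(v, w)])) t"
    by (rule tlift_linear[OF assms(1,2) tensor_module[OF assms(1,2)] assms(3,7,4) pure_closed])
  also have "\<dots> \<in> N" by (rule tlift_submodule[OF assms(1,2,7,3,5,6)])
  finally show ?thesis by (simp add: tlift_self[OF assms(1,2,7)])
qed

context hopf_data
begin

lemma restrict_alg_simps [simp]:
  "carrier (restrict_alg B D) = D" "zero (restrict_alg B D) = zero B" "add (restrict_alg B D) = add B"
  "smult (restrict_alg B D) = smult B" "act (restrict_alg B D) = act B" "gr (restrict_alg B D) n = gr B n \<inter> D"
  "mu (restrict_alg B D) = (\<lambda>t. mu B (tmap B B (\<lambda>x. x) (\<lambda>x. x) t))" "eta (restrict_alg B D) = eta B"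
  by (simp_all add: restrict_alg_def)

lemma tlift3_restrict_alg: "tlift3 (restrict_alg B D) f t = tlift3 B f t"
  by (simp add: tlift3_def tlift_def)

end

context quasi_bialgebra
begin

text \<open>A subalgebra in the category must be a module, H-stable and graded. Gradedness is the
  hypothesis that \<open>D\<close> contains the homogeneous components of its elements; the algebra
  laws are then inherited through the inclusion.\<close>

lemma alg_subobject_restrict:
  assumes B: "halgebra B" and D: "submodule D K B"
    and act: "\<And>h x. h \<in> carrier H \<Longrightarrow> x \<in> D \<Longrightarrow> act B h x \<in> D"
    and comp: "\<And>x n. x \<in> D \<Longrightarrow> hcomp B x n \<in> D"
    and mult: "\<And>x y. x \<in> D \<Longrightarrow> y \<in> D \<Longrightarrow> mu B (pure B B x y) \<in> D"
    and one: "eta B \<one>\<^bsub>K\<^esub> \<in> D"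
  shows "alg_subobject (restrict_alg B D) B"
proof -
  let ?R = "restrict_alg B D"
  interpret K: cring K by (fact K_cring)
  have hB: "hmodule B" and mB: "hmorphism (B \<boxtimes> B) B (mu B)" and eB: "hmorphism unit_obj B (eta B)"
    using B by (auto simp: halgebra_def)
  note m = hmodule_module[OF hB]
  note uB = hmodule_umodule[OF hB]
  interpret B: module K B by (rule m)
  note c = submodule_closed[OF m D]
  have mR: "module K ?R" by (rule submodule_carrier_module[OF m D]) simp_all
  interpret R: module K ?R by (rule mR)
  have inc: "klinear K ?R B (\<lambda>x. x)" using c(1) by (intro klinearI) simp_all
  have toR: "klinear K U ?R f" if "klinear K U B f" "\<And>u. u \<in> carrier U \<Longrightarrow> f u \<in> D" for U :: "('a, 'u, 'q) module_scheme" and f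
    using that unfolding klinear_def by auto
  have uB': "klinear K B B (act B h)" "klinear K H B (\<lambda>h. act B h x)" if "h \<in> carrier H" "x \<in> D" for h x
    using hB that c(1) by (auto simp: hmodule_def)
  have sub: "submodule (gr ?R n) K ?R" for n
    unfolding submodule_iff[OF mR] using gr_closed[OF hB] c by auto
  have dR: "degrees ?R \<subseteq> degrees B"
    using gr_closed(2)[OF hB] c(2) by (auto simp: degrees_def)
  have hR: "hmodule ?R"
    unfolding hmodule_def
  proof (intro conjI ballI allI)
    show "klinear K ?R ?R (act ?R h)" if "h \<in> carrier H" for h
      using that act uB(1) klinear_comp[OF klinear_act_r[OF uB that klinear_id] inc] by (intro toR) auto
    show "klinear K H ?R (\<lambda>h. act ?R h v)" if "v \<in> carrier ?R" for v
      using that act c(1) klinear_act_l[OF uB klinear_id] by (intro toR) auto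
    show "act ?R (h \<otimes>\<^bsub>H\<^esub> h') v = act ?R h (act ?R h' v)" if "h \<in> carrier H" "h' \<in> carrier H" "v \<in> carrier ?R" for h h' v
      using that c(1) by (simp add: act_mult[OF uB])
    show "act ?R \<one>\<^bsub>H\<^esub> v = v" if "v \<in> carrier ?R" for v
      using that c(1) by (simp add: act_one[OF uB])
    show "finite (degrees ?R)" by (rule finite_subset[OF dR finite_degrees[OF hB]])
    show "act ?R h v \<in> gr ?R n" if "h \<in> carrier H" "v \<in> gr ?R n" for h n v
      using that act gr_act[OF hB] by auto
    show "\<exists>!d. decomposes ?R x d" if x: "x \<in> carrier ?R" for x
    proof (rule decomposes_unique[OF mR sub finite_degrees[OF hB] dR, of "\<lambda>n x. hcomp B x n"])
      show "klinear K ?R ?R (\<lambda>x. hcomp B x n)" for n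
        using klinear_comp[OF klinear_hcomp[OF hB] inc] comp by (intro toR) auto
      show "hcomp B x n \<in> gr ?R n" if "x \<in> carrier ?R" for n x
        using that comp hcomp_gr[OF hB] c(1) by auto
      show "x = (\<Oplus>\<^bsub>?R\<^esub>n\<in>degrees B. hcomp B x n)" if x: "x \<in> carrier ?R" for x
        using klinear_finsum[OF mR m inc, of "degrees B" "hcomp B x"] x comp hcomp_sum[OF hB c(1), of x] by simp
      show "hcomp B x n = (if n = k then x else \<zero>\<^bsub>?R\<^esub>)" if "x \<in> gr ?R k" for n k x
        using that hcomp_homogeneous[OF hB, of x k n] by simp
    qed (rule x)
    show "module K ?R" by (rule mR)
    show "submodule (gr ?R n) K ?R" for n by (rule sub)
  qed
  note uR = hmodule_umodule[OF hR]
  \<comment> \<open>The map from D \<otimes> D to B \<otimes> B need not be injective. Classes over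
    \<open>D\<close> and classes over \<open>B\<close> are therefore kept apart and compared only
    through this map.\<close>
  let ?i = "tmap B B (\<lambda>x. x) (\<lambda>x. x)"
  note ti = tmap_pure[OF uR uR uB uB inc inc]
  have kB: "klinear K (tensor K B B) B (mu B)" using mB by (simp add: hmorphism_def)
  have km: "klinear K (tensor K ?R ?R) B (\<lambda>t. mu B (?i t))" by (rule klinear_comp[OF kB ti(2)])
  have mD: "mu B (?i t) \<in> D" if "t \<in> carrier (tensor K ?R ?R)" for t
    by (rule tensor_submodule[OF mR mR m km D _ that]) (simp add: ti(1) mult)
  have mact: "mu B (?i (act (?R \<boxtimes> ?R) h t)) = act B h (mu B (?i t))"
    if h: "h \<in> carrier H" and t: "t \<in> carrier (tensor K ?R ?R)" for h t
  proof (rule tensor_ext[OF mR mR m _ _ _ t])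
    have uRR: "umodule (?R \<boxtimes> ?R)" using uR by blast
    show "klinear K (tensor K ?R ?R) B (\<lambda>t. mu B (?i (act (?R \<boxtimes> ?R) h t)))"
      using klinear_comp[OF km] klinear_act_r[OF uRR h klinear_id] by simp
    show "klinear K (tensor K ?R ?R) B (\<lambda>t. act B h (mu B (?i t)))"
      by (rule klinear_act_r[OF uB h km])
    fix x y assume xy: "x \<in> carrier ?R" "y \<in> carrier ?R"
    have "act (?R \<boxtimes> ?R) h (pure ?R ?R x y) = act2 ?R ?R (tensor K ?R ?R) (pure ?R ?R) (\<Delta> h) x y"
      using equivar_act[OF pure_equivar[OF uR uR] h xy] by simp
    then have "?i (act (?R \<boxtimes> ?R) h (pure ?R ?R x y)) = act2 ?R ?R (tensor K B B) (\<lambda>x y. ?i (pure ?R ?R x y)) (\<Delta> h) x y"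
      using act2_linear[OF uR uR _ pure_bilin_h[OF uR uR] _ ti(2) comult_closed[OF h] xy] uR uB by simp
    also have "\<dots> = act2 ?R ?R (tensor K B B) (pure B B) (\<Delta> h) x y"
      by (rule act2_cong[OF uR uR]) (use xy h uB in \<open>auto simp: ti(1)\<close>)
    also have "\<dots> = act (B \<boxtimes> B) h (pure B B x y)"
      using equivar_act[OF pure_equivar[OF uB uB] h] xy c(1) by (simp add: act2_def)
    finally show "mu B (?i (act (?R \<boxtimes> ?R) h (pure ?R ?R x y))) = act B h (mu B (?i (pure ?R ?R x y)))"
      using mB h xy c(1) by (simp add: hmorphism_def ti(1))
  qed
  have mor_mu: "hmorphism (?R \<boxtimes> ?R) ?R (mu ?R)"
    unfolding hmorphism_def
  proof (intro conjI ballI allI)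
    show "klinear K (?R \<boxtimes> ?R) ?R (mu ?R)" using km mD unfolding klinear_htensor by (intro toR) auto
    show "mu ?R (act (?R \<boxtimes> ?R) h t) = act ?R h (mu ?R t)" if "h \<in> carrier H" "t \<in> carrier (?R \<boxtimes> ?R)" for h t
      using that by (simp add: mact)
    fix n t assume t: "t \<in> gr (?R \<boxtimes> ?R) n"
    have "mu B (?i t) \<in> gr B n"
    proof (rule gr_htensor_submodule[OF hR hR m km gr_submodule[OF hB] t])
      fix k x y assume xy: "x \<in> gr ?R k" "y \<in> gr ?R (n - k)"
      then have "pure B B x y \<in> gr (B \<boxtimes> B) n" unfolding gr_htensor by (intro imageI) auto
      then show "mu B (?i (pure ?R ?R x y)) \<in> gr B n" using mB xy by (simp add: hmorphism_def ti(1))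
    qed
    moreover have "t \<in> carrier (tensor K ?R ?R)"
    proof -
      obtain xs where xs: "\<forall>(v, w)\<in>set xs. \<exists>k. v \<in> gr ?R k \<and> w \<in> gr ?R (n - k)" "t = tclass K ?R ?R xs"
        using t unfolding gr_htensor by auto
      then have "set xs \<subseteq> carrier ?R \<times> carrier ?R" by fastforce
      then show ?thesis using xs(2) by (auto simp: tensor_carrier)
    qed
    ultimately show "mu ?R t \<in> gr ?R n" using mD by simp
  qed
  have eD: "eta B a \<in> D" if "a \<in> carrier K" for a
  proof -
    have "eta B (a \<odot>\<^bsub>unit_obj\<^esub> \<one>\<^bsub>K\<^esub>) = a \<odot>\<^bsub>B\<^esub> eta B \<one>\<^bsub>K\<^esub>"
      using eB that by (intro klinear_smult[of K unit_obj]) (auto simp: hmorphism_def)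
    then show ?thesis using that c(6) one by simp
  qed
  have mor_eta: "hmorphism unit_obj ?R (eta ?R)"
    using eB eD c unfolding hmorphism_def by (auto simp: klinear_def unit_obj_def split: if_splits)
  have pm: "mu B (?i (pure ?R ?R x y)) = mu B (pure B B x y)" if "x \<in> D" "y \<in> D" for x y
    using that by (simp add: ti(1))
  have R: "halgebra ?R"
    unfolding halgebra_def
  proof (intro conjI ballI hR mor_mu mor_eta)
    fix x y z assume xyz: "x \<in> carrier ?R" "y \<in> carrier ?R" "z \<in> carrier ?R"
    have "mu ?R (pure ?R ?R (mu ?R (pure ?R ?R x y)) z) = mu B (pure B B (mu B (pure B B x y)) z)"
      using xyz mult by (simp add: pm)
    also have "\<dots> = tlift3 B (\<lambda>a b d. mu B (pure B B (act B a x) (mu B (pure B B (act B b y) (act B d z))))) \<phi>"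
      using B xyz c(1) by (simp add: halgebra_def)
    also have "\<dots> = tlift3 B (\<lambda>a b d. mu ?R (pure ?R ?R (act ?R a x) (mu ?R (pure ?R ?R (act ?R b y) (act ?R d z))))) \<phi>"
      using xyz mult act by (intro tlift3_H(3)) (auto simp: pm)
    finally show "mu ?R (pure ?R ?R (mu ?R (pure ?R ?R x y)) z)
        = tlift3 ?R (\<lambda>a b d. mu ?R (pure ?R ?R (act ?R a x) (mu ?R (pure ?R ?R (act ?R b y) (act ?R d z))))) \<phi>"
      by (simp add: tlift3_restrict_alg)
  next
    fix x assume x: "x \<in> carrier ?R"
    show "mu ?R (pure ?R ?R (eta ?R \<one>\<^bsub>K\<^esub>) x) = x" "mu ?R (pure ?R ?R x (eta ?R \<one>\<^bsub>K\<^esub>)) = x"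
      using B x c(1) one by (simp_all add: pm halgebra_def)
  qed
  have "hmorphism ?R B (\<lambda>x. x)" unfolding hmorphism_def using inc by simp
  then show ?thesis
    unfolding alg_subobject_def halg_morphism_def using B R c(1) by auto
qed

end

section \<open>Braided commutators\<close>

lemma tlift_add:
  assumes "module K V" "module K W" "module K X" "t \<in> carrier (tensor K V W)"
    "\<And>v w. v \<in> carrier V \<Longrightarrow> w \<in> carrier W \<Longrightarrow> f v w \<in> carrier X \<and> g v w \<in> carrier X"
  shows "tlift X (\<lambda>v w. f v w \<oplus>\<^bsub>X\<^esub> g v w) t = tlift X f t \<oplus>\<^bsub>X\<^esub> tlift X g t"
  unfolding tlift_lsum using tensor_rep[OF assms(4,1,2)] assms(5)
  by (intro lsum_add[OF module_abelian_monoid[OF assms(3)]]) auto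

context quasi_bialgebra
begin

lemma equivar_uminus:
  assumes U: "umodule U" "umodule V" "umodule M" and F: "equivar U V M F"
  shows "equivar U V M (\<lambda>x y. \<ominus>\<^bsub>M\<^esub> F x y)"
  unfolding equivar_def
proof (intro conjI ballI)
  note m = umodule_module[OF U(3)]
  note b = equivar_bilin[OF F]
  note n = klinear_uminus[OF m klinear_id]
  show "bilin K U V M (\<lambda>x y. \<ominus>\<^bsub>M\<^esub> F x y)"
    by (intro bilinI klinear_uminus m bilin_left[OF b klinear_id] bilin_right[OF b _ klinear_id])
  fix h x y assume h: "h \<in> carrier H" and xy: "x \<in> carrier U" "y \<in> carrier V"
  have "act2 U V M (\<lambda>x y. \<ominus>\<^bsub>M\<^esub> F x y) (\<Delta> h) x y = \<ominus>\<^bsub>M\<^esub> act2 U V M F (\<Delta> h) x y"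
    by (rule act2_linear[OF U(1,2) m b m n comult_closed[OF h] xy, symmetric])
  then show "act M h (\<ominus>\<^bsub>M\<^esub> F x y) = act2 U V M (\<lambda>x y. \<ominus>\<^bsub>M\<^esub> F x y) (\<Delta> h) x y"
    using klinear_minus[OF m m klinear_act_r[OF U(3) h klinear_id] bilin_closed[OF b xy]]
    by (simp add: equivar_act[OF F h xy])
qed

lemma equivar_add:
  assumes U: "umodule U" "umodule V" "umodule M" and F: "equivar U V M F" and G: "equivar U V M G"
  shows "equivar U V M (\<lambda>x y. F x y \<oplus>\<^bsub>M\<^esub> G x y)"
  unfolding equivar_def
proof (intro conjI ballI)
  note m = umodule_module[OF U(3)]
  note b = equivar_bilin[OF F] equivar_bilin[OF G]
  note cl = bilin_closed[OF b(1)] bilin_closed[OF b(2)]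
  show "bilin K U V M (\<lambda>x y. F x y \<oplus>\<^bsub>M\<^esub> G x y)"
    by (intro bilinI klinear_plus m bilin_left[OF b(1) klinear_id] bilin_right[OF b(1) _ klinear_id]
        bilin_left[OF b(2) klinear_id] bilin_right[OF b(2) _ klinear_id])
  fix h x y assume h: "h \<in> carrier H" and xy: "x \<in> carrier U" "y \<in> carrier V"
  have "act2 U V M (\<lambda>x y. F x y \<oplus>\<^bsub>M\<^esub> G x y) (\<Delta> h) x y = act2 U V M F (\<Delta> h) x y \<oplus>\<^bsub>M\<^esub> act2 U V M G (\<Delta> h) x y"
    unfolding act2_def by (rule tlift_add) (use h xy U in \<open>auto intro: cl\<close>)
  then show "act M h (F x y \<oplus>\<^bsub>M\<^esub> G x y) = act2 U V M (\<lambda>x y. F x y \<oplus>\<^bsub>M\<^esub> G x y) (\<Delta> h) x y"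
    using klinear_add[OF klinear_act_r[OF U(3) h klinear_id] cl(1)[OF xy] cl(2)[OF xy]]
    by (simp add: equivar_act[OF F h xy] equivar_act[OF G h xy])
qed

end

locale braided_endomorphisms = graded_endomorphisms K H V + quasitriangular_quasi_hopf_algebra K H
  for K :: "'a ring" and H :: "('a, 'b) quasi_hopf" and V :: "('a, 'b, 'v, 'p) hmod_scheme"
begin

definition sgn_op :: "int \<Rightarrow> ('v \<Rightarrow> 'v) \<Rightarrow> 'v \<Rightarrow> 'v" where
  "sgn_op n L = (if even n then L else \<ominus>\<^bsub>E\<^esub> L)"

text \<open>The second term of the commutator without its sign. The formula does not refer to
  degrees, so its equivariance can be proved on all of end(V) at once.\<close>

definition swap where
  "swap x y = act2 E E E (\<lambda>x y. cmp y x) \<R> x y"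

lemma bilin_cmp_flip: "bilin K E E E (\<lambda>x y. cmp y x)"
  by (intro bilinI lin)

lemma bilin_swap: "bilin K E E E swap"
  unfolding swap_def by (rule act2_bilin[OF E(1) E(1) E(2) bilin_cmp_flip rmat_closed(1)])

lemma klinear_sgn_op: "klinear K U E f \<Longrightarrow> klinear K U E (\<lambda>u. sgn_op n (f u))"
  unfolding sgn_op_def by (cases "even n") (simp_all add: klinear_uminus)

lemma sgn_op_closed [simp]: "L \<in> carrier E \<Longrightarrow> sgn_op n L \<in> carrier E"
  by (rule klinear_closed[OF klinear_sgn_op[OF klinear_id]])

text \<open>The flipped product is equivariant for the opposite coproduct, and R intertwines the
  opposite coproduct with \<Delta>.\<close>

lemma equivar_swap: "equivar E E E swap"
  unfolding equivar_def
proof (intro conjI ballI bilin_swap)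
  let ?P = "\<lambda>x y. cmp y x" and ?fl = "\<lambda>h. tlift HH (\<lambda>a b. h2 b a) (\<Delta> h)"
  fix h x y assume h: "h \<in> carrier H" and xy: "x \<in> carrier E" "y \<in> carrier E"
  have f: "?fl h \<in> carrier HH" using h by (intro tlift_H(4)) auto
  note aP = act2_klinear[OF E(1) E(1) E(2) bilin_cmp_flip]
  have e: "act E h (?P x y) = act2 E E E ?P (?fl h) x y" if "x \<in> carrier E" "y \<in> carrier E" for x y
  proof -
    have "act2 E E E ?P (?fl h) x y = tlift E (\<lambda>a b. act2 E E E ?P (h2 b a) x y) (\<Delta> h)"
      by (rule tlift_H(2)[OF _ _ _ aP]) (use h that in auto)
    also have "\<dots> = tlift E (\<lambda>a b. cmp (act E a y) (act E b x)) (\<Delta> h)"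
      using h that by (intro tlift_H(3)) (auto simp: act2_h2[OF E(1) E(1) E(2) bilin_cmp_flip])
    finally show ?thesis using that h by (simp add: equivar_act[OF equivar_cmp] act2_def)
  qed
  have "act E h (swap x y) = act2 E E E (\<lambda>x y. act E h (?P x y)) \<R> x y"
    unfolding swap_def
    by (rule act2_linear[OF E(1) E(1) E(2) bilin_cmp_flip E(2) klinear_act_r[OF E(1) h klinear_id] rmat_closed(1) xy])
  also have "\<dots> = act2 E E E (act2 E E E ?P (?fl h)) \<R> x y"
    by (rule act2_cong[OF E(1) E(1) E(2)]) (use xy e in auto)
  also have "\<dots> = act2 E E E ?P (\<R> \<otimes>\<^bsub>HH\<^esub> \<Delta> h) x y"
    using act2_mult[OF E(1) E(1) E(2) bilin_cmp_flip f rmat_closed(1) xy] by (simp add: rmat_comult[OF h])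
  also have "\<dots> = act2 E E E (act2 E E E ?P \<R>) (\<Delta> h) x y"
    by (rule act2_mult[OF E(1) E(1) E(2) bilin_cmp_flip rmat_closed(1) comult_closed[OF h] xy])
  finally show "act E h (swap x y) = act2 E E E swap (\<Delta> h) x y" by (simp add: swap_def act2_def)
qed

abbreviation "com L L' \<equiv> commutator V (pure E E L L')"

text \<open>The summand of the braiding that belongs to the pair \<open>p\<close> of degrees, before
  the sign is attached.\<close>

definition "brterm v w p = tlift (E \<boxtimes> E) (\<lambda>a b. pure E E (act E b (hcomp E w (snd p))) (act E a (hcomp E v (fst p)))) \<R>"

definition "brsum v w = finsum (E \<boxtimes> E) (\<lambda>p. if even (fst p * snd p) then brterm v w p else \<ominus>\<^bsub>E \<boxtimes> E\<^esub> brterm v w p) (degrees E \<times> degrees E)"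

lemma braiding_brsum: "braiding E E t = tlift (E \<boxtimes> E) brsum t"
  by (simp add: braiding_def Let_def brsum_def[abs_def] brterm_def cong del: if_weak_cong)

lemma EE: "umodule (E \<boxtimes> E)" "module K (E \<boxtimes> E)"
  using umodule_tensor(1)[OF E(1) E(1)] by auto

lemma bilin_brterm: "bilin K E E (E \<boxtimes> E) (\<lambda>v w. brterm v w p)"
  unfolding brterm_def tlift_htensor bilin_htensor
  by (rule bilinI; intro lin E klinear_hcomp[OF hE]; simp add: hcomp_closed[OF hE])

lemma bilin_brsum: "bilin K E E (E \<boxtimes> E) brsum"
proof -
  have "bilin K E E (E \<boxtimes> E) (\<lambda>v w. if even (fst p * snd p) then brterm v w p else \<ominus>\<^bsub>E \<boxtimes> E\<^esub> brterm v w p)" for p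
    by (cases "even (fst p * snd p)"; simp only: if_True if_False; intro bilinI klinear_uminus[OF EE(2)]
        bilin_left[OF bilin_brterm klinear_id] bilin_right[OF bilin_brterm _ klinear_id])
  then show ?thesis
    unfolding brsum_def bilin_def
    using finite_degrees[OF hE] by (intro conjI ballI klinear_finsum_param EE) auto
qed

lemma klinear_commutator: "klinear K (tensor K E E) E (commutator V)"
proof -
  have "klinear K (tensor K E E) (E \<boxtimes> E) (braiding E E)"
    unfolding braiding_brsum[abs_def] by (rule klinear_tlift[OF E(2) E(2) EE(2) bilin_brsum klinear_id])
  then have "klinear K (tensor K E E) E (\<lambda>t. icomp V V V (braiding E E t))"
    unfolding klinear_htensor by (rule klinear_comp[OF klinear_icomp])
  then show ?thesis
    unfolding commutator_def[abs_def] by (intro klinear_minus2 klinear_icomp E)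
qed

lemma bilin_com: "bilin K E E E (\<lambda>L L'. com L L')"
  by (intro bilinI klinear_comp[OF klinear_commutator] lin E)

text \<open>The braiding sums over all pairs of degrees. For homogeneous arguments only the
  components of degrees i and j survive, so one sign remains.\<close>

lemma com_homogeneous:
  assumes x: "x \<in> gr E i" and y: "y \<in> gr E j"
  shows "com x y = cmp x y \<ominus>\<^bsub>E\<^esub> sgn_op (i * j) (swap x y)"
proof -
  interpret E: module K E by simp
  have xy: "x \<in> carrier E" "y \<in> carrier E" using x y by (auto intro: grE)
  have ki: "klinear K (E \<boxtimes> E) E (icomp V V V)" by (simp add: klinear_icomp)
  have T: "module K (tensor K E E)" by simp
  have z: "swap u \<zero>\<^bsub>E\<^esub> = \<zero>\<^bsub>E\<^esub>" "swap \<zero>\<^bsub>E\<^esub> u = \<zero>\<^bsub>E\<^esub>" if "u \<in> carrier E" for u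
    using klinear_zero[OF E(2) E(2) bilin_right[OF bilin_swap that klinear_id]]
      klinear_zero[OF E(2) E(2) bilin_left[OF bilin_swap klinear_id that]] by auto
  have bt: "icomp V V V (brterm x y p) = swap (hcomp E x (fst p)) (hcomp E y (snd p))" for p
  proof -
    have "icomp V V V (brterm x y p)
        = tlift E (\<lambda>a b. cmp (act E b (hcomp E y (snd p))) (act E a (hcomp E x (fst p)))) \<R>"
      unfolding brterm_def tlift_htensor
      by (rule tlift_H(2)[OF T E(2) rmat_closed(1) klinear_icomp]) (simp add: hcomp_closed[OF hE] xy)
    then show ?thesis by (simp add: swap_def act2_def)
  qed
  have c: "brterm x y p \<in> carrier (E \<boxtimes> E)" for p using bilin_closed[OF bilin_brterm xy] .
  interpret EE: module K "E \<boxtimes> E" by (rule EE)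
  have sc: "swap (hcomp E x a) (hcomp E y b) \<in> carrier E" for a b
    by (intro bilin_closed[OF bilin_swap] hcomp_closed[OF hE] xy)
  have "icomp V V V (brsum x y) = (\<Oplus>\<^bsub>E\<^esub>p\<in>degrees E \<times> degrees E.
      icomp V V V (if even (fst p * snd p) then brterm x y p else \<ominus>\<^bsub>E \<boxtimes> E\<^esub> brterm x y p))"
    unfolding brsum_def
  proof (rule klinear_finsum[OF EE(2) E(2) ki])
    show "(if even (fst p * snd p) then brterm x y p else \<ominus>\<^bsub>E \<boxtimes> E\<^esub> brterm x y p) \<in> carrier (E \<boxtimes> E)" for p
      by (cases "even (fst p * snd p)"; simp only: if_True if_False; intro EE.a_inv_closed c)
  qed
  also have "\<dots> = (\<Oplus>\<^bsub>E\<^esub>p\<in>degrees E \<times> degrees E. if p = (i, j) then sgn_op (i * j) (swap x y) else \<zero>\<^bsub>E\<^esub>)"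
  proof (rule E.finsum_cong')
    show "(\<lambda>p. if p = (i, j) then sgn_op (i * j) (swap x y) else \<zero>\<^bsub>E\<^esub>) \<in> degrees E \<times> degrees E \<rightarrow> carrier E"
      using bilin_closed[OF bilin_swap xy] by auto
    fix p assume p: "p \<in> degrees E \<times> degrees E"
    have "icomp V V V (if even (fst p * snd p) then brterm x y p else \<ominus>\<^bsub>E \<boxtimes> E\<^esub> brterm x y p)
        = sgn_op (fst p * snd p) (swap (hcomp E x (fst p)) (hcomp E y (snd p)))"
      using klinear_minus[OF EE(2) E(2) ki c] by (simp add: sgn_op_def bt)
    also have "\<dots> = (if p = (i, j) then sgn_op (i * j) (swap x y) else \<zero>\<^bsub>E\<^esub>)"
      using hcomp_homogeneous[OF hE x] hcomp_homogeneous[OF hE y] z xy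
      by (cases p) (auto simp: sgn_op_def)
    finally show "icomp V V V (if even (fst p * snd p) then brterm x y p else \<ominus>\<^bsub>E \<boxtimes> E\<^esub> brterm x y p)
        = (if p = (i, j) then sgn_op (i * j) (swap x y) else \<zero>\<^bsub>E\<^esub>)" .
  qed simp
  also have "\<dots> = sgn_op (i * j) (swap x y)"
  proof (cases "(i, j) \<in> degrees E \<times> degrees E")
    case True
    then show ?thesis
      using E.add.finprod_singleton_swap[OF True, of "\<lambda>_. sgn_op (i * j) (swap x y)"] finite_degrees[OF hE]
        bilin_closed[OF bilin_swap xy] by simp
  next
    \<comment> \<open>If (i, j) does not occur in the sum, one of the arguments is zero, and both
      sides vanish.\<close>
    case False
    then have "x = \<zero>\<^bsub>E\<^esub> \<or> y = \<zero>\<^bsub>E\<^esub>" using gr_degrees[OF hE x] gr_degrees[OF hE y] by auto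
    then have "swap x y = \<zero>\<^bsub>E\<^esub>" using z xy by auto
    then have s: "sgn_op (i * j) (swap x y) = \<zero>\<^bsub>E\<^esub>" by (simp add: sgn_op_def)
    have "(\<Oplus>\<^bsub>E\<^esub>p\<in>degrees E \<times> degrees E. if p = (i, j) then sgn_op (i * j) (swap x y) else \<zero>\<^bsub>E\<^esub>)
        = (\<Oplus>\<^bsub>E\<^esub>p\<in>degrees E \<times> degrees E. \<zero>\<^bsub>E\<^esub>)"
      using s by (intro E.finsum_cong') auto
    then show ?thesis using s by (simp add: E.finsum_zero)
  qed
  finally have "icomp V V V (brsum x y) = sgn_op (i * j) (swap x y)" .
  moreover have "braiding E E (pure E E x y) = brsum x y"
    unfolding braiding_brsum by (rule tlift_pure_h[OF E(1) E(1) EE(2) bilin_brsum xy])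
  ultimately show ?thesis by (simp add: commutator_def)
qed

lemma swap_gr:
  assumes x: "x \<in> gr E i" and y: "y \<in> gr E j"
  shows "swap x y \<in> gr E (i + j)"
  unfolding swap_def act2_def
proof (rule tlift_submodule[OF H_modules(1,1) rmat_closed(1) E(2) gr_submodule[OF hE]])
  fix a b assume "a \<in> carrier H" "b \<in> carrier H"
  then have "cmp (act E b y) (act E a x) \<in> gr E (j + i)" by (intro cmp_gr gr_act[OF hE] x y)
  then show "cmp (act E b y) (act E a x) \<in> gr E (i + j)" by (simp add: add.commute)
qed

lemma com_gr:
  assumes x: "x \<in> gr E i" and y: "y \<in> gr E j"
  shows "com x y \<in> gr E (i + j)"
  unfolding com_homogeneous[OF assms] sgn_op_def
  using cmp_gr[OF assms] swap_gr[OF assms] grE by auto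

text \<open>The commutator with a prescribed sign. With the sign decoupled from the degrees it is a
  fixed combination of equivariant maps, and it agrees with the true commutator on homogeneous
  elements whose degrees have product n.\<close>

definition "hcom n x y = cmp x y \<ominus>\<^bsub>E\<^esub> sgn_op n (swap x y)"

lemma equivar_hcom: "equivar E E E (hcom n)"
proof -
  have "equivar E E E (\<lambda>x y. sgn_op n (swap x y))"
    unfolding sgn_op_def by (cases "even n") (simp_all add: equivar_swap equivar_uminus)
  from equivar_add[OF E(1) E(1) E(1) equivar_cmp equivar_uminus[OF E(1) E(1) E(1) this]]
  show ?thesis by (simp add: hcom_def[abs_def] a_minus_def)
qed

end

text \<open>Congruence modulo \<open>N\<close> passes through Sweedler sums. The memberships in the
  carrier are repeated in the conclusion so that the rule can be applied to nested sums.\<close>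

lemma tlift_diff_submodule:
  assumes "module K V" "module K W" "t \<in> carrier (tensor K V W)" "module K X" "submodule N K X"
    "\<And>v w. v \<in> carrier V \<Longrightarrow> w \<in> carrier W \<Longrightarrow> f v w \<in> carrier X \<and> g v w \<in> carrier X \<and> f v w \<ominus>\<^bsub>X\<^esub> g v w \<in> N"
  shows "tlift X f t \<in> carrier X \<and> tlift X g t \<in> carrier X \<and> tlift X f t \<ominus>\<^bsub>X\<^esub> tlift X g t \<in> N"
proof -
  interpret X: module K X by fact
  have c: "tlift X f t \<in> carrier X" "tlift X g t \<in> carrier X"
    using assms(6) by (auto intro!: tlift_closed[OF assms(1,2,4,3)])
  have d: "tlift X (\<lambda>v w. f v w \<ominus>\<^bsub>X\<^esub> g v w) t \<in> N"
    by (rule tlift_submodule[OF assms(1-5)]) (simp add: assms(6))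
  then have dc: "tlift X (\<lambda>v w. f v w \<ominus>\<^bsub>X\<^esub> g v w) t \<in> carrier X" by (rule submodule_closed(1)[OF assms(4,5)])
  have "tlift X f t = tlift X (\<lambda>v w. (f v w \<ominus>\<^bsub>X\<^esub> g v w) \<oplus>\<^bsub>X\<^esub> g v w) t"
    using assms(6) by (intro tlift_cong[OF assms(1-3)]) (auto simp: a_minus_def X.a_assoc X.l_neg)
  also have "\<dots> = tlift X (\<lambda>v w. f v w \<ominus>\<^bsub>X\<^esub> g v w) t \<oplus>\<^bsub>X\<^esub> tlift X g t"
    using assms(6) by (intro tlift_add[OF assms(1,2,4,3)]) auto
  finally have "tlift X f t \<ominus>\<^bsub>X\<^esub> tlift X g t = tlift X (\<lambda>v w. f v w \<ominus>\<^bsub>X\<^esub> g v w) t"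
    using c dc by (simp add: a_minus_def X.a_assoc X.r_neg)
  then show ?thesis using c d by simp
qed

locale diff_operators = braided_endomorphisms K H V
  for K :: "'a ring" and H :: "('a, 'b) quasi_hopf" and V :: "('a, 'b, 'c, 'v, 'q) hbimod_scheme" +
  fixes A :: "('a, 'b, 'c, 'p) halg_scheme"
  assumes hA: "hmodule A" and lact: "hmorphism (A \<boxtimes> V) V (lact V)"
begin

section \<open>Differential operators\<close>

abbreviation "hat \<equiv> zeta A V V (lact V)"

lemma uA [simp, intro]: "umodule A"
  by (rule hmodule_umodule[OF hA])

lemma mA [simp, intro]: "module K A"
  by (rule hmodule_module[OF hA])

lemma equivar_lact: "equivar A V V (\<lambda>a v. lact V (pure A V a v))"
  unfolding equivar_def
proof (intro conjI ballI)
  have k: "klinear K (tensor K A V) V (lact V)" using lact by (simp add: hmorphism_def)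
  show "bilin K A V V (\<lambda>a v. lact V (pure A V a v))"
    by (intro bilinI klinear_comp[OF k] lin uA V)
  fix h a v assume h: "h \<in> carrier H" and av: "a \<in> carrier A" "v \<in> carrier V"
  have "act V h (lact V (pure A V a v)) = lact V (act (A \<boxtimes> V) h (pure A V a v))"
    using lact h av by (simp add: hmorphism_def)
  also have "act (A \<boxtimes> V) h (pure A V a v) = act2 A V (tensor K A V) (pure A V) (\<Delta> h) a v"
    using equivar_act[OF pure_equivar[OF uA V] h av] by simp
  also have "lact V \<dots> = act2 A V V (\<lambda>a v. lact V (pure A V a v)) (\<Delta> h) a v"
    using h av V by (intro act2_linear[OF uA V _ _ mV k]) auto
  finally show "act V h (lact V (pure A V a v)) = act2 A V V (\<lambda>a v. lact V (pure A V a v)) (\<Delta> h) a v" .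
qed

lemma klinear_hat: "klinear K A E hat"
  unfolding zeta_curry_h by (rule klinear_curry_h[OF uA V mV equivar_bilin[OF equivar_lact]])

lemmas hat_closed [simp] = klinear_closed[OF klinear_hat]
lemmas klinear_hat_comp [lin] = klinear_comp[OF klinear_hat]

lemma hat_act: "h \<in> carrier H \<Longrightarrow> a \<in> carrier A \<Longrightarrow> hat (act A h a) = act E h (hat a)"
  unfolding zeta_curry_h by (rule curry_h_act[OF uA V V equivar_lact])

lemma hat_gr:
  assumes "a \<in> gr A i" shows "hat a \<in> gr E i"
  unfolding zeta_curry_h
proof (rule curry_h_gr[OF uA hV hV equivar_bilin[OF equivar_lact] gr_closed(1)[OF hA assms]])
  fix h j w assume h: "h \<in> carrier H" and w: "w \<in> gr V j"
  have "act A h a \<in> gr A i" using gr_act[OF hA h assms] .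
  then have "pure A V (act A h a) w \<in> gr (A \<boxtimes> V) (j + i)"
    unfolding gr_htensor using w by (intro imageI) auto
  then show "lact V (pure A V (act A h a) w) \<in> gr V (j + i)" using lact by (simp add: hmorphism_def)
qed

definition "brk L a = com L (hat a)"

lemma bilin_brk: "bilin K E A E brk"
  unfolding brk_def
  by (intro bilinI bilin_left[OF bilin_com] bilin_right[OF bilin_com] klinear_hat klinear_id hat_closed)

lemma commutator_alg_pure:
  "L \<in> carrier E \<Longrightarrow> a \<in> carrier A \<Longrightarrow> commutator_alg A V (pure E A L a) = brk L a"
  by (simp add: commutator_alg_def brk_def tmap_pure(1)[OF E(1) uA E(1) E(1) klinear_id klinear_hat])

lemma klinear_commutator_alg: "klinear K (tensor K E A) E (commutator_alg A V)"
  unfolding commutator_alg_def comp_def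
  by (rule klinear_comp[OF klinear_commutator tmap_pure(2)[OF E(1) uA E(1) E(1) klinear_id klinear_hat]])

lemma brk_homogeneous:
  "L \<in> gr E i \<Longrightarrow> a \<in> gr A k \<Longrightarrow> brk L a = cmp L (hat a) \<ominus>\<^bsub>E\<^esub> sgn_op (i * k) (swap L (hat a))"
  unfolding brk_def by (rule com_homogeneous[OF _ hat_gr])

lemma brk_gr: "L \<in> gr E i \<Longrightarrow> a \<in> gr A k \<Longrightarrow> brk L a \<in> gr E (i + k)"
  unfolding brk_def by (rule com_gr[OF _ hat_gr])

text \<open>H preserves degrees, so for homogeneous arguments one sign serves the whole orbit and
  \<open>hcom\<close> applies. Linearity extends the identity first in \<open>L\<close>, then in
  \<open>a\<close>.\<close>

lemma equivar_brk: "equivar E A E brk"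
  unfolding equivar_def
proof (intro conjI ballI bilin_brk)
  fix h L a assume h: "h \<in> carrier H" and L: "L \<in> carrier E" and a: "a \<in> carrier A"
  have b2: "bilin K E A E (act2 E A E brk (\<Delta> h))"
    by (rule act2_bilin[OF E(1) uA E(2) bilin_brk comult_closed[OF h]])
  have b1: "bilin K E A E (\<lambda>L a. act E h (brk L a))"
    by (intro bilinI klinear_act_r[OF E(1) h] bilin_left[OF bilin_brk klinear_id] bilin_right[OF bilin_brk _ klinear_id])
  have hom: "act E h (brk L a) = act2 E A E brk (\<Delta> h) L a" if L: "L \<in> gr E i" and a: "a \<in> gr A k" for L a i k
  proof -
    have c: "L \<in> carrier E" "a \<in> carrier A" using L a grE gr_closed(1)[OF hA] by auto
    have "act E h (brk L a) = act2 E E E (hcom (i * k)) (\<Delta> h) L (hat a)"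
      using equivar_act[OF equivar_hcom h, of L "hat a" "i * k"] c brk_homogeneous[OF L a] by (simp add: hcom_def)
    also have "\<dots> = act2 E A E brk (\<Delta> h) L a"
      unfolding act2_def
    proof (rule tlift_H(3)[OF comult_closed[OF h]])
      fix p q assume pq: "p \<in> carrier H" "q \<in> carrier H"
      show "hcom (i * k) (act E p L) (act E q (hat a)) = brk (act E p L) (act A q a)"
        unfolding brk_homogeneous[OF gr_act[OF hE pq(1) L] gr_act[OF hA pq(2) a]] hcom_def
        by (simp add: hat_act pq c)
    qed
    finally show ?thesis .
  qed
  have 1: "act E h (brk L a) = act2 E A E brk (\<Delta> h) L a" if a: "a \<in> gr A k" for a k
    by (rule graded_ext[OF hE E(2) bilin_left[OF b1 klinear_id] bilin_left[OF b2 klinear_id] hom[OF _ a] L])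
      (use gr_closed(1)[OF hA a] in auto)
  show "act E h (brk L a) = act2 E A E brk (\<Delta> h) L a"
    by (rule graded_ext[OF hA E(2) bilin_right[OF b1 L klinear_id] bilin_right[OF b2 L klinear_id] 1 a])
qed

text \<open>\<open>dd (n + 1)\<close> will turn out to be \<open>diff\<^sup>n(V)\<close>, with \<open>dd 0 = 0\<close> in the role of \<open>diff\<^sup>-\<^sup>1(V)\<close>.\<close>

primrec dd :: "nat \<Rightarrow> ('v \<Rightarrow> 'v) set" where
  "dd 0 = {\<zero>\<^bsub>E\<^esub>}"
| "dd (Suc n) = {L \<in> carrier E. \<forall>h\<in>carrier H. \<forall>a\<in>carrier A. brk (act E h L) a \<in> dd n}"

lemma klinear_brk_act: "h \<in> carrier H \<Longrightarrow> a \<in> carrier A \<Longrightarrow> klinear K E E (\<lambda>L. brk (act E h L) a)"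
  by (rule bilin_left[OF bilin_brk klinear_act_r[OF E(1) _ klinear_id]])

lemma dd_submodule: "submodule (dd n) K E"
proof (induct n)
  interpret E: module K E by simp
  case 0
  show ?case unfolding submodule_iff[OF E(2)] by simp
next
  interpret E: module K E by simp
  case (Suc n)
  note c = submodule_closed[OF E(2) Suc]
  note l = klinear_brk_act
  show ?case unfolding submodule_iff[OF E(2)]
    by (auto simp: klinear_zero[OF E(2) E(2) l] klinear_add[OF l] klinear_smult[OF l] c)
qed

lemmas dd_closed = submodule_closed[OF E(2) dd_submodule]

lemma dd_act: "h \<in> carrier H \<Longrightarrow> L \<in> dd n \<Longrightarrow> act E h L \<in> dd n"
proof (cases n)
  case 0
  assume "h \<in> carrier H" "L \<in> dd n"
  then show ?thesis using 0 klinear_zero[OF E(2) E(2) klinear_act_r[OF E(1) _ klinear_id]] by simp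
next
  case (Suc m)
  assume "h \<in> carrier H" "L \<in> dd n"
  then show ?thesis using Suc by (auto simp: act_mult[OF E(1), symmetric])
qed

lemma dd_Suc: "dd n \<subseteq> dd (Suc n)"
proof (induct n)
  interpret E: module K E by simp
  case 0
  then show ?case by (auto simp: klinear_zero[OF E(2) E(2) klinear_brk_act])
qed auto

lemma dd_brk: "L \<in> dd (Suc n) \<Longrightarrow> a \<in> carrier A \<Longrightarrow> brk L a \<in> dd n"
  by (drule dd.simps(2)[THEN equalityD1, THEN subsetD], clarify, drule bspec[OF _ H_one_closed]) (simp add: act_one[OF E(1)])

lemma hcomp_act:
  assumes h: "h \<in> carrier H" and L: "L \<in> carrier E"
  shows "hcomp E (act E h L) k = act E h (hcomp E L k)"
  using hcomp_shift[OF hE hE klinear_act_r[OF E(1) h klinear_id], of 0 L k] gr_act[OF hE h] L by simp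

text \<open>The bracket with a homogeneous \<open>a\<close> shifts degrees uniformly. Hence the
  bracket of a component of \<open>L\<close> is a component of the bracket of \<open>L\<close>, and
  the induction applies to it.\<close>

lemma dd_hcomp: "L \<in> dd n \<Longrightarrow> hcomp E L k \<in> dd n"
proof (induct n arbitrary: L k)
  case 0
  then show ?case using klinear_zero[OF E(2) E(2) klinear_hcomp[OF hE]] by simp
next
  case (Suc n)
  have L: "L \<in> carrier E" using Suc(2) by simp
  have "brk (act E h (hcomp E L k)) a \<in> dd n" if h: "h \<in> carrier H" and a: "a \<in> carrier A" for h a
  proof (rule graded_submodule[OF hA E(2) bilin_right[OF bilin_brk _ klinear_id] dd_submodule _ a])
    have hL: "act E h L \<in> carrier E" using h L by simp
    show "act E h (hcomp E L k) \<in> carrier E" using h hcomp_closed[OF hE L] by simp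
    fix j a assume a: "a \<in> gr A j"
    have ac: "a \<in> carrier A" by (rule gr_closed(1)[OF hA a])
    have "hcomp E (brk (act E h L) a) (k + j) = brk (hcomp E (act E h L) k) a"
      by (rule hcomp_shift[OF hE hE bilin_left[OF bilin_brk klinear_id ac] brk_gr[OF _ a] hL])
    then have "brk (act E h (hcomp E L k)) a = hcomp E (brk (act E h L) a) (k + j)"
      using h L by (simp add: hcomp_act)
    also have "\<dots> \<in> dd n" by (rule Suc(1)) (use Suc(2) h ac in auto)
    finally show "brk (act E h (hcomp E L k)) a \<in> dd n" .
  qed
  then show ?case using hcomp_closed[OF hE L] by simp
qed

lemma swap_idE:
  assumes "L \<in> carrier E" shows "swap idE L = L"
  unfolding swap_def using assms idE_invariant
  by (simp add: act2_rmat_counit[OF E(1) E(1) E(2) bilin_cmp_flip] cmp_idE)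

text \<open>The unit is invariant, so R acts trivially on it, and it has degree 0, so no sign
  appears; both terms of the bracket are \<open>hat a\<close>.\<close>

lemma brk_idE:
  assumes a: "a \<in> carrier A" shows "brk idE a = \<zero>\<^bsub>E\<^esub>"
proof (rule graded_ext[OF hA E(2) bilin_right[OF bilin_brk idE_closed klinear_id] klinear_const_zero[OF E(2)] _ a])
  interpret E: module K E by simp
  fix k a assume a: "a \<in> gr A k"
  then show "brk idE a = \<zero>\<^bsub>E\<^esub>"
    using gr_closed(1)[OF hA a] brk_homogeneous[OF idE_gr a]
    by (simp add: cmp_idE swap_idE sgn_op_def a_minus_def E.r_neg)
qed

text \<open>In the numbering of \<open>dd\<close> the operators of order zero form
  \<open>dd 1\<close>. The orbit of the unit consists of its multiples by values of the counit, so
  one bracket suffices.\<close>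

lemma idE_dd: "idE \<in> dd 1"
proof -
  interpret E: module K E by simp
  have "brk (act E h idE) a = \<zero>\<^bsub>E\<^esub>" if "h \<in> carrier H" "a \<in> carrier A" for h a
    using that klinear_smult[OF bilin_left[OF bilin_brk klinear_id that(2)], of "\<epsilon> h" idE]
    by (simp add: idE_invariant brk_idE)
  then show ?thesis by simp
qed

subsection \<open>The derivation property\<close>

lemma sgn_op_add: "L \<in> carrier E \<Longrightarrow> sgn_op m (sgn_op n L) = sgn_op (m + n) L"
proof -
  interpret E: module K E by simp
  show "L \<in> carrier E \<Longrightarrow> ?thesis" by (auto simp: sgn_op_def)
qed

lemma sgn_op_linear:
  assumes "klinear K E E f" "L \<in> carrier E" shows "f (sgn_op n L) = sgn_op n (f L)"
  using klinear_minus[OF E(2) E(2) assms] by (simp add: sgn_op_def)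

lemma cmp_assoc_inv:
  assumes xyz: "x \<in> carrier E" "y \<in> carrier E" "z \<in> carrier E"
  shows "act3 E E E E (\<lambda>x y z. cmp (cmp x y) z) \<phi>inv x y z = cmp x (cmp y z)"
proof -
  have "act3 E E E E (\<lambda>x y z. cmp (cmp x y) z) \<phi>inv x y z
      = act3 E E E E (act3 E E E E (\<lambda>x y z. cmp x (cmp y z)) \<phi>) \<phi>inv x y z"
    by (rule act3_cong[OF E(1) E(1) E(1) E(2) cmp_assoc phi_closed(2) xyz])
  then show ?thesis using act3_phi_inv(1)[OF E(1) E(1) E(1) E(2) trilin_cmp(2) xyz] by simp
qed

text \<open>Modulo \<open>N\<close>, the elements of \<open>M\<^sub>1\<close> and of \<open>M\<^sub>2\<close> braided-commute with those of \<open>A\<close>, in every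
  product of three factors. Moving \<open>a\<close> to the left through \<open>x y\<close> one factor at a time therefore changes
  nothing but the sign, and by the hexagon identity the result is the braiding of \<open>a\<close> with \<open>x y\<close>.\<close>

lemma brk_cmp_mod:
  assumes N: "submodule N K E"
    and M: "M1 \<subseteq> carrier E" "M2 \<subseteq> carrier E" "\<And>h x. h \<in> carrier H \<Longrightarrow> x \<in> M1 \<Longrightarrow> act E h x \<in> M1"
      "\<And>h x. h \<in> carrier H \<Longrightarrow> x \<in> M2 \<Longrightarrow> act E h x \<in> M2"
    and NM: "\<And>x y a. x \<in> M1 \<Longrightarrow> y \<in> M2 \<Longrightarrow> a \<in> carrier A \<Longrightarrow> cmp x (brk y a) \<in> N"
      "\<And>x y a. x \<in> M1 \<Longrightarrow> y \<in> M2 \<Longrightarrow> a \<in> carrier A \<Longrightarrow> cmp (brk x a) y \<in> N"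
    and x: "x \<in> M1" "x \<in> gr E i" and y: "y \<in> M2" "y \<in> gr E j" and a: "a \<in> gr A k"
  shows "brk (cmp x y) a \<in> N"
proof -
  interpret E: module K E by simp
  note c = submodule_closed[OF E(2) N]
  \<comment> \<open>Congruence modulo \<open>N\<close>, with membership in the carrier built in so
    that the rules for chaining congruences carry no side conditions.\<close>
  define eqm where "eqm u v \<longleftrightarrow> u \<in> carrier E \<and> v \<in> carrier E \<and> u \<ominus>\<^bsub>E\<^esub> v \<in> N" for u v
  have eq_refl: "eqm u u" if "u \<in> carrier E" for u
    using that c(2) by (simp add: eqm_def a_minus_def E.r_neg)
  have eq_sym: "eqm v u" if "eqm u v" for u v
  proof -
    have "v \<ominus>\<^bsub>E\<^esub> u = \<ominus>\<^bsub>E\<^esub> (u \<ominus>\<^bsub>E\<^esub> v)"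
      using that by (simp add: eqm_def a_minus_def E.minus_add E.a_comm)
    then show ?thesis using that c(4) by (simp add: eqm_def)
  qed
  have eq_trans: "eqm u w" if "eqm u v" "eqm v w" for u v w
  proof -
    have uvw: "u \<in> carrier E" "v \<in> carrier E" "w \<in> carrier E" using that by (simp_all add: eqm_def)
    have "u \<ominus>\<^bsub>E\<^esub> w = (u \<ominus>\<^bsub>E\<^esub> v) \<oplus>\<^bsub>E\<^esub> (v \<ominus>\<^bsub>E\<^esub> w)"
      using uvw E.l_neg[of v] E.a_assoc[of "\<ominus>\<^bsub>E\<^esub> v" v "\<ominus>\<^bsub>E\<^esub> w"]
      by (simp add: a_minus_def E.a_assoc)
    then show ?thesis using that c(3) by (simp add: eqm_def)
  qed
  have eq_sgn: "eqm (sgn_op n u) (sgn_op n v)" if "eqm u v" for n u v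
  proof -
    have uv: "u \<in> carrier E" "v \<in> carrier E" using that by (simp_all add: eqm_def)
    have "sgn_op n u \<ominus>\<^bsub>E\<^esub> sgn_op n v = sgn_op n (u \<ominus>\<^bsub>E\<^esub> v)"
      using uv by (simp add: sgn_op_def a_minus_def E.minus_add)
    then show ?thesis using that uv c(4) by (simp add: eqm_def sgn_op_def)
  qed
  have eq2: "eqm (tlift E f t) (tlift E g t)"
    if "t \<in> carrier HH" "\<And>p q. p \<in> carrier H \<Longrightarrow> q \<in> carrier H \<Longrightarrow> eqm (f p q) (g p q)" for f g t
    using tlift_diff_submodule[OF H_modules(1,1) that(1) E(2) N, of f g] that(2) by (simp add: eqm_def)
  have eq3: "eqm (tlift3 E f t) (tlift3 E g t)"
    if "t \<in> carrier HHH" "\<And>p q r. p \<in> carrier H \<Longrightarrow> q \<in> carrier H \<Longrightarrow> r \<in> carrier H \<Longrightarrow> eqm (f p q r) (g p q r)" for f g t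
    unfolding tlift3_def eqm_def
    by (rule tlift_diff_submodule[OF H_modules(1,2) that(1) E(2) N], fold eqm_def) (intro eq2 that(2))
  \<comment> \<open>This condition is stable under the action of H on all three entries. The degrees
    i, j, k thus stay fixed inside the Sweedler sums, and the signs can be taken out.\<close>
  define good where "good x y a \<longleftrightarrow> x \<in> M1 \<and> x \<in> gr E i \<and> y \<in> M2 \<and> y \<in> gr E j \<and> a \<in> gr A k" for x y a
  have goodc: "x \<in> carrier E" "y \<in> carrier E" "a \<in> carrier A" if "good x y a" for x y a
    using that M(1,2) gr_closed(1)[OF hA] by (auto simp: good_def)
  have good_act: "good (act E p x) (act E q y) (act A r a)"
    if "good x y a" "p \<in> carrier H" "q \<in> carrier H" "r \<in> carrier H" for x y a p q r
    using that M(3,4) gr_act[OF hE] gr_act[OF hA] by (auto simp: good_def)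
  have good_act': "good x (act E q y) (act A r a)" "good (act E q x) y (act A r a)"
    if "good x y a" "q \<in> carrier H" "r \<in> carrier H" for x y a q r
    using that M(3,4) gr_act[OF hE] gr_act[OF hA] by (auto simp: good_def)
  \<comment> \<open>The order after \<open>a\<close> has passed both factors. The hexagon expresses
    \<open>swap (cmp x y) (hat a)\<close> through this map by way of \<open>F1\<close> to
    \<open>F4\<close>; \<open>F1\<close> and the start of \<open>F2\<close> are exact, congruences
    enter with the first exchange.\<close>
  let ?F = "\<lambda>x y a. cmp (hat a) (cmp x y)"
  have F: "trilin K E E A E ?F" by (intro trilinI lin; simp; intro lin; simp)
  define F1 where "F1 = (\<lambda>x y z. act3 A E E E (\<lambda>z x y. ?F x y z) \<phi> z x y)"
  define F2 where "F2 = (\<lambda>x y z. act2 E A E (\<lambda>x z. F1 x y z) \<R> x z)"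
  define F3 where "F3 = (\<lambda>x y z. act3 E A E E (\<lambda>x z y. F2 x y z) \<phi>inv x z y)"
  define F4 where "F4 = (\<lambda>x y z. act2 E A E (F3 x) \<R> y z)"
  have sw: "tlift E (\<lambda>p q. cmp (hat (act A q a)) (act E p x)) \<R> = swap x (hat a)"
    if "x \<in> carrier E" "a \<in> carrier A" for x a
    unfolding swap_def act2_def using that by (intro tlift_H(3)) (auto simp: hat_act)
  have 1: "F1 x y z = cmp (cmp (hat z) x) y" if "x \<in> carrier E" "y \<in> carrier E" "z \<in> carrier A" for x y z
    using that unfolding F1_def
    by (subst cmp_assoc) (auto simp: act3_def hat_act intro!: tlift3_H(3))
  have 2: "F2 x y z = cmp (swap x (hat z)) y" if "x \<in> carrier E" "y \<in> carrier E" "z \<in> carrier A" for x y z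
  proof -
    have l: "klinear K E E (\<lambda>s. cmp s y)" by (intro lin that)
    have "F2 x y z = tlift E (\<lambda>p q. cmp (cmp (hat (act A q z)) (act E p x)) y) \<R>"
      unfolding F2_def act2_def using that by (intro tlift_H(3)) (auto simp: 1)
    also have "\<dots> = cmp (swap x (hat z)) y"
      unfolding sw[OF that(1,3), symmetric] using that by (intro tlift_H(2)[OF _ _ _ l, symmetric]) auto
    finally show ?thesis .
  qed
  \<comment> \<open>One exchange of neighbouring factors. \<open>f\<close> multiplies by the third
    factor, from either side, and a bracket killed modulo \<open>N\<close> means that the braided
    exchange differs from the plain product by a sign only.\<close>
  have sg: "eqm (f (swap x (hat z))) (sgn_op (n * k) (f (cmp x (hat z))))"
    if "x \<in> gr E n" "z \<in> gr A k" and f: "klinear K E E f" and fN: "f (brk x z) \<in> N" for f n x z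
  proof -
    have xz: "x \<in> carrier E" "z \<in> carrier A" using that grE gr_closed(1)[OF hA] by auto
    have s: "swap x (hat z) \<in> carrier E" using bilin_closed[OF bilin_swap] xz by simp
    note fc = klinear_closed[OF f]
    have "f (brk x z) = f (cmp x (hat z)) \<ominus>\<^bsub>E\<^esub> sgn_op (n * k) (f (swap x (hat z)))"
      unfolding brk_homogeneous[OF that(1,2)] a_minus_def using xz s
      by (simp add: klinear_add[OF f] klinear_minus[OF E(2) E(2) f] sgn_op_linear[OF f])
    then have "eqm (f (cmp x (hat z))) (sgn_op (n * k) (f (swap x (hat z))))"
      using fN xz s fc by (simp add: eqm_def)
    from eq_sym[OF eq_sgn[OF this, of "n * k"]] show ?thesis
      using fc[OF s] by (simp add: sgn_op_add) (simp add: sgn_op_def)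
  qed
  have F2m: "eqm (F2 x y z) (sgn_op (i * k) (cmp (cmp x (hat z)) y))" if g: "good x y z" for x y z
    using sg[of x i z "\<lambda>s. cmp s y"] g goodc[OF g] NM(2) by (simp add: 2 good_def bilin_left[OF bilin_cmp klinear_id])
  have 3: "eqm (F3 x y z) (sgn_op (i * k) (cmp x (cmp (hat z) y)))" if g: "good x y z" for x y z
  proof -
    note gc = goodc[OF g]
    have "eqm (F3 x y z) (tlift3 E (\<lambda>p q r. sgn_op (i * k) (cmp (cmp (act E p x) (hat (act A q z))) (act E r y))) \<phi>inv)"
      unfolding F3_def act3_def by (intro eq3 F2m good_act g) auto
    also have "tlift3 E (\<lambda>p q r. sgn_op (i * k) (cmp (cmp (act E p x) (hat (act A q z))) (act E r y))) \<phi>inv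
        = act3 E E E E (\<lambda>x y z. sgn_op (i * k) (cmp (cmp x y) z)) \<phi>inv x (hat z) y"
      unfolding act3_def using gc by (intro tlift3_H(3)) (auto simp: hat_act)
    also have "\<dots> = sgn_op (i * k) (act3 E E E E (\<lambda>x y z. cmp (cmp x y) z) \<phi>inv x (hat z) y)"
      by (rule act3_linear[OF E(1) E(1) E(1) E(2) trilin_cmp(1) E(2) klinear_sgn_op[OF klinear_id] phi_closed(2), symmetric])
        (use gc in auto)
    also have "\<dots> = sgn_op (i * k) (cmp x (cmp (hat z) y))" using gc by (simp add: cmp_assoc_inv)
    finally show ?thesis .
  qed
  have 4: "eqm (F4 x y z) (sgn_op (i * k + j * k) (cmp x (cmp y (hat z))))" if g: "good x y z" for x y z
  proof -
    note gc = goodc[OF g]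
    have l: "klinear K E E (\<lambda>s. cmp x s)" by (intro lin gc)
    have "eqm (F4 x y z) (tlift E (\<lambda>p q. sgn_op (i * k) (cmp x (cmp (hat (act A q z)) (act E p y)))) \<R>)"
      unfolding F4_def act2_def by (intro eq2 3 good_act' g) auto
    also have "tlift E (\<lambda>p q. sgn_op (i * k) (cmp x (cmp (hat (act A q z)) (act E p y)))) \<R> = sgn_op (i * k) (cmp x (swap y (hat z)))"
      unfolding sw[OF gc(2,3), symmetric] using gc
      by (intro tlift_H(2)[OF E(2) E(2) _ klinear_sgn_op[OF l], symmetric]) auto
    finally have *: "eqm (F4 x y z) (sgn_op (i * k) (cmp x (swap y (hat z))))" .
    have "eqm (cmp x (swap y (hat z))) (sgn_op (j * k) (cmp x (cmp y (hat z))))"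
      using sg[of y j z "\<lambda>s. cmp x s"] g gc NM(1) l by (simp add: good_def)
    from eq_trans[OF * eq_sgn[OF this]] show ?thesis using gc by (simp add: sgn_op_add)
  qed
  have g: "good x y a" using x y a by (simp add: good_def)
  note gc = goodc[OF g]
  have "swap (cmp x y) (hat a) = act3 E E A E ?F (\<Delta>_id \<R>) x y a"
  proof -
    have b: "bilin K E A E (\<lambda>s a. cmp (hat a) s)" by (intro bilinI lin; simp)
    have "act3 E E A E ?F (\<Delta>_id \<R>) x y a = act2 E A E (\<lambda>s a. cmp (hat a) s) \<R> (cmp x y) a"
      using gc by (intro act3_merge_left[OF E(1) E(1) uA E(1) E(2) b equivar_cmp]) auto
    then show ?thesis using gc by (simp add: sw act2_def)
  qed
  also have "\<dots> = act3 E E A E F4 \<phi> x y a"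
    unfolding F4_def F3_def F2_def F1_def by (rule act3_hexagon[OF E(1) E(1) uA E(2) F gc])
  finally have 5: "swap (cmp x y) (hat a) = act3 E E A E F4 \<phi> x y a" .
  have "eqm (act3 E E A E F4 \<phi> x y a)
      (tlift3 E (\<lambda>p q r. sgn_op (i * k + j * k) (cmp (act E p x) (cmp (act E q y) (hat (act A r a))))) \<phi>)"
    unfolding act3_def by (intro eq3 4 good_act g) auto
  also have "tlift3 E (\<lambda>p q r. sgn_op (i * k + j * k) (cmp (act E p x) (cmp (act E q y) (hat (act A r a))))) \<phi>
      = act3 E E E E (\<lambda>x y z. sgn_op (i * k + j * k) (cmp x (cmp y z))) \<phi> x y (hat a)"
    unfolding act3_def using gc by (intro tlift3_H(3)) (auto simp: hat_act)
  also have "\<dots> = sgn_op (i * k + j * k) (act3 E E E E (\<lambda>x y z. cmp x (cmp y z)) \<phi> x y (hat a))"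
    by (rule act3_linear[OF E(1) E(1) E(1) E(2) trilin_cmp(2) E(2) klinear_sgn_op[OF klinear_id] phi_closed(1), symmetric])
      (use gc in auto)
  also have "\<dots> = sgn_op (i * k + j * k) (cmp (cmp x y) (hat a))" using gc by (simp add: cmp_assoc)
  finally have "eqm (swap (cmp x y) (hat a)) (sgn_op (i * k + j * k) (cmp (cmp x y) (hat a)))" by (simp add: 5)
  \<comment> \<open>Multiplying by the total sign once more moves it to the other side, since it
    squares to 1.\<close>
  from eq_sym[OF eq_sgn[OF this, of "(i + j) * k"]]
  have "eqm (cmp (cmp x y) (hat a)) (sgn_op ((i + j) * k) (swap (cmp x y) (hat a)))"
    using gc by (simp add: sgn_op_add) (simp add: sgn_op_def distrib_right)
  then show ?thesis
    unfolding brk_homogeneous[OF cmp_gr[OF x(2) y(2)] a] by (simp add: eqm_def)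
qed

lemma hcomp_submodule:
  assumes f: "klinear K E E f" and N: "submodule N K E" and L: "L \<in> carrier E" and h: "\<And>n. f (hcomp E L n) \<in> N"
  shows "f L \<in> N"
proof -
  have "f (\<Oplus>\<^bsub>E\<^esub>n\<in>degrees E. hcomp E L n) = (\<Oplus>\<^bsub>E\<^esub>n\<in>degrees E. f (hcomp E L n))"
    by (rule klinear_finsum[OF E(2) E(2) f hcomp_closed[OF hE L]])
  also have "\<dots> \<in> N" by (rule submodule_finsum[OF E(2) N h])
  finally show ?thesis using hcomp_sum[OF hE L] by simp
qed

text \<open>Induction on the total order n + m. Both x [y, a] and [x, a] y have smaller total order,
  so by induction they lie in \<open>dd (n + m)\<close>; modulo this submodule
  \<open>brk_cmp_mod\<close> shows that the bracket of the product vanishes.\<close>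

lemma dd_cmp: "x \<in> dd (Suc n) \<Longrightarrow> y \<in> dd (Suc m) \<Longrightarrow> cmp x y \<in> dd (Suc (n + m))"
proof (induct "n + m" arbitrary: n m x y rule: less_induct)
  case less
  interpret E: module K E by simp
  have sub: "dd (Suc l) \<subseteq> carrier E" for l by auto
  note z = klinear_zero[OF E(2) E(2)]
  \<comment> \<open>An operator of order 0 has zero bracket, which starts the induction. Otherwise
    the order of y drops by one and the induction hypothesis gives exactly the level n + m of
    \<open>dd\<close>.\<close>
  have N1: "cmp x (brk y a) \<in> dd (n + m)" if "x \<in> dd (Suc n)" "y \<in> dd (Suc m)" "a \<in> carrier A" for x y a
  proof (cases m)
    case 0
    then have "brk y a = \<zero>\<^bsub>E\<^esub>" using dd_brk[OF that(2,3)] by simp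
    then show ?thesis using z[OF bilin_right[OF bilin_cmp _ klinear_id], of x] that(1) dd_closed(2) by simp
  next
    case (Suc l)
    then have "brk y a \<in> dd (Suc l)" using dd_brk[OF that(2,3)] by simp
    then show ?thesis using less(1)[of n l x "brk y a"] that(1) Suc by simp
  qed
  have N2: "cmp (brk x a) y \<in> dd (n + m)" if "x \<in> dd (Suc n)" "y \<in> dd (Suc m)" "a \<in> carrier A" for x y a
  proof (cases n)
    case 0
    then have "brk x a = \<zero>\<^bsub>E\<^esub>" using dd_brk[OF that(1,3)] by simp
    then show ?thesis using z[OF bilin_left[OF bilin_cmp klinear_id], of y] that(2) dd_closed(2) by simp
  next
    case (Suc l)
    then have "brk x a \<in> dd (Suc l)" using dd_brk[OF that(1,3)] by simp
    then show ?thesis using less(1)[of l m "brk x a" y] that(2) Suc by simp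
  qed
  have main: "brk (cmp x y) a \<in> dd (n + m)" if x: "x \<in> dd (Suc n)" and y: "y \<in> dd (Suc m)" and a: "a \<in> carrier A" for x y a
  proof -
    have c: "x \<in> carrier E" "y \<in> carrier E" using x y by auto
    note hc = hcomp_closed[OF hE]
    have 1: "brk (cmp (hcomp E x i) (hcomp E y j)) a \<in> dd (n + m)" for i j
    proof (rule graded_submodule[OF hA E(2) bilin_right[OF bilin_brk _ klinear_id] dd_submodule _ a])
      show "cmp (hcomp E x i) (hcomp E y j) \<in> carrier E" using c hc by simp
      fix k a assume a: "a \<in> gr A k"
      show "brk (cmp (hcomp E x i) (hcomp E y j)) a \<in> dd (n + m)"
        by (rule brk_cmp_mod[OF dd_submodule sub sub dd_act dd_act N1 N2 dd_hcomp[OF x] hcomp_gr[OF hE c(1)]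
              dd_hcomp[OF y] hcomp_gr[OF hE c(2)] a])
    qed
    have 2: "brk (cmp (hcomp E x i) y) a \<in> dd (n + m)" for i
      by (rule hcomp_submodule[OF bilin_left[OF bilin_brk bilin_right[OF bilin_cmp _ klinear_id] a] dd_submodule c(2) 1])
        (simp add: c hc)
    show ?thesis
      by (rule hcomp_submodule[OF bilin_left[OF bilin_brk bilin_left[OF bilin_cmp klinear_id c(2)] a] dd_submodule c(1) 2])
  qed
  have c: "x \<in> carrier E" "y \<in> carrier E" using less(2,3) by auto
  \<comment> \<open>Membership concerns the whole orbit of the product. The coproduct distributes
    \<open>h\<close> over the two factors, and each level of \<open>dd\<close> is H-stable.\<close>
  have "brk (act E h (cmp x y)) a \<in> dd (n + m)" if h: "h \<in> carrier H" and a: "a \<in> carrier A" for h a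
  proof -
    have l: "klinear K E E (\<lambda>s. brk s a)" by (rule bilin_left[OF bilin_brk klinear_id a])
    have "brk (act E h (cmp x y)) a = tlift E (\<lambda>p q. brk (cmp (act E p x) (act E q y)) a) (\<Delta> h)"
      using equivar_act[OF equivar_cmp h c] tlift_H(2)[OF E(2) E(2) comult_closed[OF h] l] c by (simp add: act2_def)
    also have "\<dots> \<in> dd (n + m)"
      by (rule tlift_submodule[OF H_modules(1,1) comult_closed[OF h] E(2) dd_submodule])
        (intro main dd_act less(2,3) a; assumption)
    finally show ?thesis .
  qed
  then show ?case using c by simp
qed

end

section \<open>Rebracketing\<close>

text \<open>Two classes with the same chosen representative coincide. This justifies storing a list
  in the datatype in place of the class, which as a set of lists could not occur there
  recursively.\<close>

lemma inj_on_lnode: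
  assumes "module K V" "module K W"
  shows "inj_on lnode (carrier (tensor K V W))"
proof (rule inj_onI)
  fix s t assume st: "s \<in> carrier (tensor K V W)" "t \<in> carrier (tensor K V W)" and "lnode s = lnode t"
  then have "trep s = trep t" by (simp add: lnode_def)
  then have "tclass K V W (trep s) = tclass K V W (trep t)" by (rule arg_cong)
  then show "s = t" by (simp only: tensor_rep(2)[OF st(1) assms] tensor_rep(2)[OF st(2) assms])
qed

lemma inj_on_rnode:
  assumes "module K V" "module K W"
  shows "inj_on rnode (carrier (tensor K V W))"
proof (rule inj_onI)
  fix s t assume st: "s \<in> carrier (tensor K V W)" "t \<in> carrier (tensor K V W)" and "rnode s = rnode t"
  then have "trep s = trep t" by (simp add: rnode_def)
  then have "tclass K V W (trep s) = tclass K V W (trep t)" by (rule arg_cong)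
  then show "s = t" by (simp only: tensor_rep(2)[OF st(1) assms] tensor_rep(2)[OF st(2) assms])
qed

context quasi_bialgebra
begin

lemma umodule_relabel:
  assumes V: "umodule V" and c: "inj_on c (carrier V)"
  shows "umodule (relabel c V)" and "klinear K V (relabel c V) c"
    and "klinear K (relabel c V) V (inv_into (carrier V) c)"
    and "h \<in> carrier H \<Longrightarrow> v \<in> carrier V \<Longrightarrow> act (relabel c V) h (c v) = c (act V h v)"
proof -
  interpret V: module K V using V by simp
  let ?R = "relabel c V"
  note d = inv_into_f_f[OF c]
  have e: "carrier ?R = c ` carrier V" "zero ?R = c \<zero>\<^bsub>V\<^esub>"
    "x \<in> carrier V \<Longrightarrow> y \<in> carrier V \<Longrightarrow> c x \<oplus>\<^bsub>?R\<^esub> c y = c (x \<oplus>\<^bsub>V\<^esub> y)"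
    "x \<in> carrier V \<Longrightarrow> a \<odot>\<^bsub>?R\<^esub> c x = c (a \<odot>\<^bsub>V\<^esub> x)"
    "x \<in> carrier V \<Longrightarrow> act ?R h (c x) = c (act V h x)" for x y a h
    by (simp_all add: relabel_def Let_def d)
  show l1: "klinear K V ?R c" by (rule klinearI) (auto simp: e)
  show l2: "klinear K ?R V (inv_into (carrier V) c)" by (rule klinearI) (auto simp: e d)
  show "h \<in> carrier H \<Longrightarrow> v \<in> carrier V \<Longrightarrow> act ?R h (c v) = c (act V h v)" by (simp add: e)
  have ag: "abelian_group ?R"
  proof (rule abelian_groupI)
    show "\<exists>y\<in>carrier ?R. y \<oplus>\<^bsub>?R\<^esub> x = \<zero>\<^bsub>?R\<^esub>" if "x \<in> carrier ?R" for x
    proof -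
      obtain v where v: "v \<in> carrier V" "x = c v" using \<open>x \<in> carrier ?R\<close> by (auto simp: e)
      then show ?thesis by (intro bexI[of _ "c (\<ominus>\<^bsub>V\<^esub> v)"]) (auto simp: e V.l_neg)
    qed
  qed (auto simp: e V.add.m_ac)
  have m: "module K ?R"
    by (rule moduleI[OF V.is_cring ag]) (auto simp: e V.smult_l_distr V.smult_r_distr V.smult_assoc1)
  show "umodule ?R"
  proof (rule umoduleI[OF m])
    show "bilin K H ?R ?R (act ?R)"
    proof (rule bilinI)
      fix x assume "x \<in> carrier ?R"
      then obtain v where v: "v \<in> carrier V" "x = c v" by (auto simp: e)
      show "klinear K H ?R (\<lambda>h. act ?R h x)"
        using klinear_comp[OF l1 klinear_act_l[OF V klinear_id v(1)]] v by (simp add: e)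
    next
      fix h assume h: "h \<in> carrier H"
      have "klinear K ?R ?R (\<lambda>x. c (act V h (inv_into (carrier V) c x)))"
        by (rule klinear_comp[OF l1 klinear_act_r[OF V h l2]])
      then show "klinear K ?R ?R (act ?R h)"
        by (subst klinear_cong[OF _ m, of _ "\<lambda>x. c (act V h (inv_into (carrier V) c x))"]) (auto simp: e d)
    qed
  qed (auto simp: e act_mult[OF V] V)
qed

lemma equivar_relabel:
  assumes V: "umodule V" and W: "umodule W" and c: "inj_on c (carrier (tensor K V W))"
  shows "equivar V W (relabel c (V \<boxtimes> W)) (\<lambda>v w. c (pure V W v w))"
  unfolding equivar_def
proof (intro conjI ballI)
  have VW: "umodule (V \<boxtimes> W)" using V W by blast
  have c': "inj_on c (carrier (V \<boxtimes> W))" using c by simp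
  note r = umodule_relabel[OF VW c']
  have k: "klinear K (tensor K V W) (relabel c (V \<boxtimes> W)) c" using r(2) by simp
  show "bilin K V W (relabel c (V \<boxtimes> W)) (\<lambda>v w. c (pure V W v w))"
    by (intro bilinI klinear_comp[OF k] lin V W)
  fix h v w assume h: "h \<in> carrier H" and vw: "v \<in> carrier V" "w \<in> carrier W"
  have "act (relabel c (V \<boxtimes> W)) h (c (pure V W v w)) = c (act2 V W (tensor K V W) (pure V W) (\<Delta> h) v w)"
    using h vw equivar_act[OF pure_equivar[OF V W] h vw] by (simp add: r(4))
  also have "\<dots> = act2 V W (relabel c (V \<boxtimes> W)) (\<lambda>v w. c (pure V W v w)) (\<Delta> h) v w"
    using h vw V W by (intro act2_linear[OF V W _ _ umodule_module[OF r(1)] k]) auto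
  finally show "act (relabel c (V \<boxtimes> W)) h (c (pure V W v w)) = act2 V W (relabel c (V \<boxtimes> W)) (\<lambda>v w. c (pure V W v w)) (\<Delta> h) v w" .
qed

end

context diff_operators
begin

abbreviation "lten \<equiv> ltensor E A"
abbreviation "rten \<equiv> rtensor A"
abbreviation "iter \<equiv> iter_commutator A V"
abbreviation "rebr \<equiv> rebracket E A"

lemma inj_on_leaf: "inj_on LLeaf B" "inj_on RLeaf C"
  by (auto intro: inj_onI)

lemma umodule_lten [simp, intro]: "umodule (lten n)"
proof (induct n)
  case 0
  show ?case by (simp add: umodule_relabel(1)[OF E(1) inj_on_leaf(1)])
next
  case (Suc n)
  have "umodule (lten n \<boxtimes> A)" using Suc by blast
  then show ?case
    using inj_on_lnode[OF umodule_module[OF Suc] mA] by (simp add: umodule_relabel(1))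
qed

lemma umodule_rten [simp, intro]: "umodule (rten n)"
proof (induct n)
  case 0
  show ?case by (simp add: umodule_relabel(1)[OF uA inj_on_leaf(2)])
next
  case (Suc n)
  have "umodule (A \<boxtimes> rten n)" using Suc by blast
  then show ?case
    using inj_on_rnode[OF mA umodule_module[OF Suc]] by (simp add: umodule_relabel(1))
qed

lemma lnode_inj: "inj_on lnode (carrier (lten n \<boxtimes> A))"
  using inj_on_lnode[OF umodule_module[OF umodule_lten] mA] by simp

lemma rnode_inj: "inj_on rnode (carrier (A \<boxtimes> rten n))"
  using inj_on_rnode[OF mA umodule_module[OF umodule_rten]] by simp

lemma lten_A: "umodule (lten n \<boxtimes> A)" and A_rten: "umodule (A \<boxtimes> rten n)"
  by auto

lemmas lten_Suc = umodule_relabel[OF lten_A lnode_inj, folded ltensor.simps(2)]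
lemmas rten_Suc = umodule_relabel[OF A_rten rnode_inj, folded rtensor.simps(2)]

lemma equivar_lnode: "equivar (lten n) A (lten (Suc n)) (\<lambda>x a. lnode (pure (lten n) A x a))"
  unfolding ltensor.simps(2) using lnode_inj by (intro equivar_relabel umodule_lten uA) simp

lemma equivar_rnode: "equivar A (rten n) (rten (Suc n)) (\<lambda>a w. rnode (pure A (rten n) a w))"
  unfolding rtensor.simps(2) using rnode_inj by (intro equivar_relabel umodule_rten uA) simp

lemma klinear_iter: "klinear K (lten n) E (iter n)"
proof (induct n)
  case 0
  show ?case using umodule_relabel(3)[OF E(1) inj_on_leaf(1)] by simp
next
  case (Suc n)
  have "klinear K (lten (Suc n)) (tensor K (lten n) A) (inv_into (carrier (lten n \<boxtimes> A)) lnode)"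
    using lten_Suc(3) unfolding klinear_htensor .
  then show ?case
    unfolding iter_commutator.simps comp_def
    by (rule klinear_comp[OF klinear_commutator_alg klinear_comp[OF tmap_pure(2)[OF umodule_lten uA E(1) uA Suc klinear_id]]])
qed

lemmas iter_closed [simp] = klinear_closed[OF klinear_iter]

lemma iter_lnode:
  "x \<in> carrier (lten n) \<Longrightarrow> a \<in> carrier A \<Longrightarrow> iter (Suc n) (lnode (pure (lten n) A x a)) = brk (iter n x) a"
  by (simp add: inv_into_f_f[OF lnode_inj, simplified] tmap_pure(1)[OF umodule_lten uA E(1) uA klinear_iter klinear_id]
      commutator_alg_pure)

lemma lten_ext:
  assumes X: "module K X" and f: "klinear K (lten (Suc n)) X f" and g: "klinear K (lten (Suc n)) X g"
    and e: "\<And>x a. x \<in> carrier (lten n) \<Longrightarrow> a \<in> carrier A \<Longrightarrow> f (lnode (pure (lten n) A x a)) = g (lnode (pure (lten n) A x a))"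
    and y: "y \<in> carrier (lten (Suc n))"
  shows "f y = g y"
proof -
  have k: "klinear K (tensor K (lten n) A) (lten (Suc n)) lnode" using lten_Suc(2) unfolding klinear_htensor .
  obtain t where t: "t \<in> carrier (tensor K (lten n) A)" "y = lnode t" using y by (auto simp: relabel_def Let_def)
  have "f (lnode t) = g (lnode t)"
    by (rule tensor_ext[OF umodule_module[OF umodule_lten] mA X klinear_comp[OF f k] klinear_comp[OF g k] e t(1)])
  then show ?thesis using t by simp
qed

lemma rten_ext:
  assumes X: "module K X" and f: "klinear K (rten (Suc n)) X f" and g: "klinear K (rten (Suc n)) X g"
    and e: "\<And>a w. a \<in> carrier A \<Longrightarrow> w \<in> carrier (rten n) \<Longrightarrow> f (rnode (pure A (rten n) a w)) = g (rnode (pure A (rten n) a w))"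
    and y: "y \<in> carrier (rten (Suc n))"
  shows "f y = g y"
proof -
  have k: "klinear K (tensor K A (rten n)) (rten (Suc n)) rnode" using rten_Suc(2) unfolding klinear_htensor .
  obtain t where t: "t \<in> carrier (tensor K A (rten n))" "y = rnode t" using y by (auto simp: relabel_def Let_def)
  have "f (rnode t) = g (rnode t)"
    by (rule tensor_ext[OF mA umodule_module[OF umodule_rten] X klinear_comp[OF f k] klinear_comp[OF g k] e t(1)])
  then show ?thesis using t by simp
qed

lemma iter_act:
  "h \<in> carrier H \<Longrightarrow> x \<in> carrier (lten n) \<Longrightarrow> iter n (act (lten n) h x) = act E h (iter n x)"
proof (induct n arbitrary: h x)
  case 0
  note h = 0(1)
  from 0 obtain L where L: "L \<in> carrier E" "x = LLeaf L" by (auto simp: relabel_def Let_def)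
  then show ?case
    using h by (simp add: umodule_relabel(4)[OF E(1) inj_on_leaf(1)] inv_into_f_f[OF inj_on_leaf(1)])
next
  case (Suc n)
  note h = Suc(2)
  show ?case
  proof (rule lten_ext[OF E(2) _ _ _ Suc(3)])
    show "klinear K (lten (Suc n)) E (\<lambda>x. iter (Suc n) (act (lten (Suc n)) h x))"
      by (rule klinear_comp[OF klinear_iter klinear_act_r[OF umodule_lten h klinear_id]])
    show "klinear K (lten (Suc n)) E (\<lambda>x. act E h (iter (Suc n) x))"
      by (rule klinear_act_r[OF E(1) h klinear_iter])
    fix x a assume x: "x \<in> carrier (lten n)" and a: "a \<in> carrier A"
    have "iter (Suc n) (act (lten (Suc n)) h (lnode (pure (lten n) A x a)))
        = act2 (lten n) A E (\<lambda>x a. iter (Suc n) (lnode (pure (lten n) A x a))) (\<Delta> h) x a"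
      unfolding equivar_act[OF equivar_lnode h x a]
      by (rule act2_linear[OF umodule_lten uA umodule_module[OF umodule_lten] equivar_bilin[OF equivar_lnode] E(2) klinear_iter comult_closed[OF h] x a])
    also have "\<dots> = act2 E A E brk (\<Delta> h) (iter n x) a"
      unfolding act2_def using h x a by (intro tlift_H(3)) (auto simp: iter_lnode Suc(1) simp del: iter_commutator.simps)
    also have "\<dots> = act E h (iter (Suc n) (lnode (pure (lten n) A x a)))"
      using equivar_act[OF equivar_brk h, of "iter n x" a] x a by (simp add: iter_lnode del: iter_commutator.simps)
    finally show "iter (Suc n) (act (lten (Suc n)) h (lnode (pure (lten n) A x a)))
      = act E h (iter (Suc n) (lnode (pure (lten n) A x a)))" .
  qed
qed

lemma klinear_rebr: "klinear K (tensor K (lten j) (rten n)) (lten (Suc (j + n))) (rebr n j)"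
proof (induct n arbitrary: j)
  case 0
  have "klinear K (rten 0) A (inv_into (carrier A) RLeaf)"
    using umodule_relabel(3)[OF uA inj_on_leaf(2)] by simp
  from tmap_pure(2)[OF umodule_lten umodule_rten umodule_lten uA klinear_id this]
  have "klinear K (tensor K (lten j) (rten 0)) (tensor K (lten j) A) (tmap (lten j) A (\<lambda>x. x) (inv_into (carrier A) RLeaf))" .
  from klinear_comp[OF lten_Suc(2)[unfolded klinear_htensor] this] show ?case
    by (simp add: comp_def del: ltensor.simps rtensor.simps)
next
  case (Suc n)
  note 1 = tmap_pure(2)[OF umodule_lten umodule_rten umodule_lten A_rten klinear_id rten_Suc(3)]
  note 2 = tmap_pure(2)[OF lten_A umodule_rten umodule_lten umodule_rten lten_Suc(2) klinear_id]
  have "klinear K (tensor K (lten j) (rten (Suc n))) (lten (Suc (Suc j + n))) (rebr (Suc n) j)"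
    unfolding rebracket.simps comp_def
    by (rule klinear_comp[OF Suc klinear_comp[OF 2 klinear_comp[OF associator_inv_pure(2)[OF umodule_lten uA umodule_rten] 1]]])
  then show ?case by (simp del: rebracket.simps ltensor.simps rtensor.simps)
qed

text \<open>The iterated bracket after rebracketing, as a bilinear map: \<open>x\<close> holds the
  operator with j factors already bracketed to the left, \<open>w\<close> the n + 1 factors still
  bracketed to the right.\<close>

definition "rc n j x w = iter (Suc (j + n)) (rebr n j (pure (lten j) (rten n) x w))"

lemma bilin_rc: "bilin K (lten j) (rten n) E (rc n j)"
  unfolding rc_def
  by (intro bilinI klinear_comp[OF klinear_iter] klinear_comp[OF klinear_rebr] lin umodule_lten umodule_rten)

lemma rc_0:
  assumes "x \<in> carrier (lten j)" "a \<in> carrier A"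
  shows "rc 0 j x (RLeaf a) = brk (iter j x) a"
proof -
  have l: "klinear K (rten 0) A (inv_into (carrier A) RLeaf)"
    using umodule_relabel(3)[OF uA inj_on_leaf(2)] by simp
  have r: "RLeaf a \<in> carrier (rten 0)" using assms by (simp add: relabel_def Let_def)
  have "rebr 0 j (pure (lten j) (rten 0) x (RLeaf a)) = lnode (pure (lten j) A x a)"
    using tmap_pure(1)[OF umodule_lten umodule_rten umodule_lten uA klinear_id l assms(1) r] assms
    by (simp add: inv_into_f_f[OF inj_on_leaf(2)] del: rtensor.simps ltensor.simps)
  then show ?thesis using assms by (simp add: rc_def iter_lnode del: iter_commutator.simps rebracket.simps)
qed

abbreviation "rcn n j x a w \<equiv> rc n (Suc j) (lnode (pure (lten j) A x a)) w"

lemma trilin_rcn: "trilin K (lten j) A (rten n) E (rcn n j)"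
  by (intro trilinI bilin_left[OF bilin_rc] bilin_right[OF bilin_rc] bilin_left[OF equivar_bilin[OF equivar_lnode]]
      bilin_right[OF equivar_bilin[OF equivar_lnode]] bilin_closed[OF equivar_bilin[OF equivar_lnode]] klinear_id)

text \<open>One rebracketing step detaches the first factor \<open>a\<close> from the right tensor
  and attaches it to \<open>x\<close>; its only cost is the action of \<open>\<phi>inv\<close> on
  the three arguments.\<close>

lemma rc_Suc:
  assumes "x \<in> carrier (lten j)" "a \<in> carrier A" "w \<in> carrier (rten n)"
  shows "rc (Suc n) j x (rnode (pure A (rten n) a w)) = act3 (lten j) A (rten n) E (rcn n j) \<phi>inv x a w"
proof -
  let ?T = "tensor K (lten j \<boxtimes> A) (rten n)"
  have m: "module K ?T" using lten_A by simp
  have r: "rnode (pure A (rten n) a w) \<in> carrier (rten (Suc n))"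
    using assms by (intro bilin_closed[OF equivar_bilin[OF equivar_rnode]])
  have i: "inv_into (carrier (A \<boxtimes> rten n)) rnode (rnode (pure A (rten n) a w)) = pure A (rten n) a w"
    using assms by (intro inv_into_f_f[OF rnode_inj]) simp
  note t1 = tmap_pure(1)[OF umodule_lten umodule_rten umodule_lten A_rten klinear_id rten_Suc(3) assms(1) r, unfolded i]
  note t2 = tmap_pure[OF lten_A umodule_rten umodule_lten umodule_rten lten_Suc(2) klinear_id]
  let ?F = "\<lambda>x a w. pure (lten j \<boxtimes> A) (rten n) (pure (lten j) A x a) w"
  have F: "trilin K (lten j) A (rten n) ?T ?F"
    using lten_A by (intro trilinI lin; simp; intro lin; simp)
  let ?g = "\<lambda>t. iter (Suc (Suc j + n)) (rebr n (Suc j) (tmap (lten (Suc j)) (rten n) lnode (\<lambda>y. y) t))"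
  have g: "klinear K ?T E ?g"
    by (rule klinear_comp[OF klinear_iter klinear_comp[OF klinear_rebr t2(2)]])
  have "rc (Suc n) j x (rnode (pure A (rten n) a w)) = ?g (act3 (lten j) A (rten n) ?T ?F \<phi>inv x a w)"
    unfolding rc_def rebracket.simps comp_def t1 associator_inv_pure(1)[OF umodule_lten uA umodule_rten assms] by simp
  also have "\<dots> = act3 (lten j) A (rten n) E (\<lambda>x a w. ?g (?F x a w)) \<phi>inv x a w"
    by (rule act3_linear[OF umodule_lten uA umodule_rten m F E(2) g phi_closed(2) assms])
  also have "\<dots> = act3 (lten j) A (rten n) E (rcn n j) \<phi>inv x a w"
  proof (rule act3_cong[OF umodule_lten uA umodule_rten E(2) _ phi_closed(2) assms])
    fix x a w assume c: "x \<in> carrier (lten j)" "a \<in> carrier A" "w \<in> carrier (rten n)"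
    have "pure (lten j) A x a \<in> carrier (lten j \<boxtimes> A)" using c by simp
    then show "?g (?F x a w) = rcn n j x a w" using c by (simp only: rc_def t2(1))
  qed
  finally show ?thesis .
qed

text \<open>Each step is equivariant because quasi-coassociativity moves
  \<open>\<Delta>_id (\<Delta> h)\<close> across \<open>\<phi>inv\<close> as
  \<open>id_\<Delta> (\<Delta> h)\<close>; \<open>lnode\<close> and \<open>rnode\<close> absorb the
  coproduct on either side.\<close>

lemma equivar_rc: "equivar (lten j) (rten n) E (rc n j)"
proof (induct n arbitrary: j)
  case 0
  show ?case
    unfolding equivar_def
  proof (intro conjI ballI bilin_rc)
    fix h x y assume h: "h \<in> carrier H" and x: "x \<in> carrier (lten j)" and "y \<in> carrier (rten 0)"
    then obtain a where a: "a \<in> carrier A" "y = RLeaf a" by (auto simp: relabel_def Let_def)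
    have r: "act (rten 0) q (RLeaf a) = RLeaf (act A q a)" if "q \<in> carrier H" for q
      using that a umodule_relabel(4)[OF uA inj_on_leaf(2)] by simp
    have "act E h (rc 0 j x y) = act2 E A E brk (\<Delta> h) (iter j x) a"
      using h x a equivar_act[OF equivar_brk h, of "iter j x" a] by (simp add: rc_0)
    also have "\<dots> = act2 (lten j) (rten 0) E (rc 0 j) (\<Delta> h) x y"
      unfolding act2_def a(2) using h x a
      by (intro tlift_H(3)) (auto simp: r rc_0 iter_act simp del: rtensor.simps)
    finally show "act E h (rc 0 j x y) = act2 (lten j) (rten 0) E (rc 0 j) (\<Delta> h) x y" .
  qed
next
  case (Suc n)
  let ?R = "rten (Suc n)"
  note u = umodule_lten[of j] uA umodule_rten[of n]
  show ?case
    unfolding equivar_def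
  proof (intro conjI ballI bilin_rc)
    fix h x y assume h: "h \<in> carrier H" and x: "x \<in> carrier (lten j)" and y: "y \<in> carrier ?R"
    have b2: "bilin K (lten j) ?R E (act2 (lten j) ?R E (rc (Suc n) j) (\<Delta> h))"
      by (rule act2_bilin[OF umodule_lten umodule_rten E(2) bilin_rc comult_closed[OF h]])
    show "act E h (rc (Suc n) j x y) = act2 (lten j) ?R E (rc (Suc n) j) (\<Delta> h) x y"
    proof (rule rten_ext[OF E(2) _ _ _ y])
      show "klinear K ?R E (\<lambda>y. act E h (rc (Suc n) j x y))"
        by (rule klinear_act_r[OF E(1) h bilin_right[OF bilin_rc x klinear_id]])
      show "klinear K ?R E (\<lambda>y. act2 (lten j) ?R E (rc (Suc n) j) (\<Delta> h) x y)"
        by (rule bilin_right[OF b2 x klinear_id])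
      fix a w assume aw: "a \<in> carrier A" "w \<in> carrier (rten n)"
      let ?Q = "rcn n j"
      have "act E h (rc (Suc n) j x (rnode (pure A (rten n) a w))) = act3 (lten j) A (rten n) E (\<lambda>x a w. act E h (?Q x a w)) \<phi>inv x a w"
        unfolding rc_Suc[OF x aw]
        by (rule act3_linear[OF u E(2) trilin_rcn E(2) klinear_act_r[OF E(1) h klinear_id] phi_closed(2) x aw])
      also have "\<dots> = act3 (lten j) A (rten n) E (act3 (lten j) A (rten n) E ?Q (\<Delta>_id (\<Delta> h))) \<phi>inv x a w"
      proof (rule act3_cong[OF u E(2) _ phi_closed(2) x aw])
        fix x a w assume c: "x \<in> carrier (lten j)" "a \<in> carrier A" "w \<in> carrier (rten n)"
        have "act E h (?Q x a w) = act2 (lten (Suc j)) (rten n) E (rc n (Suc j)) (\<Delta> h) (lnode (pure (lten j) A x a)) w"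
          by (rule equivar_act[OF Suc h bilin_closed[OF equivar_bilin[OF equivar_lnode] c(1,2)] c(3)])
        also have "\<dots> = act3 (lten j) A (rten n) E ?Q (\<Delta>_id (\<Delta> h)) x a w"
          by (rule act3_merge_left[OF u umodule_lten E(2) bilin_rc equivar_lnode comult_closed[OF h] c, symmetric])
        finally show "act E h (?Q x a w) = act3 (lten j) A (rten n) E ?Q (\<Delta>_id (\<Delta> h)) x a w" .
      qed
      also have "\<dots> = act3 (lten j) A (rten n) E (act3 (lten j) A (rten n) E ?Q \<phi>inv) (id_\<Delta> (\<Delta> h)) x a w"
        by (rule act3_coassoc(2)[OF u E(2) trilin_rcn h x aw])
      also have "\<dots> = act3 (lten j) A (rten n) E (\<lambda>x a w. rc (Suc n) j x (rnode (pure A (rten n) a w))) (id_\<Delta> (\<Delta> h)) x a w"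
        by (rule act3_cong[OF u E(2) _ _ x aw]) (use h in \<open>auto simp: rc_Suc\<close>)
      also have "\<dots> = act2 (lten j) ?R E (rc (Suc n) j) (\<Delta> h) x (rnode (pure A (rten n) a w))"
        by (rule act3_merge_right[OF u umodule_rten E(2) bilin_rc equivar_rnode comult_closed[OF h] x aw])
      finally show "act E h (rc (Suc n) j x (rnode (pure A (rten n) a w)))
        = act2 (lten j) ?R E (rc (Suc n) j) (\<Delta> h) x (rnode (pure A (rten n) a w))" .
    qed
  qed
qed

lemma rc_zero_iff:
  assumes "x \<in> carrier (lten j)"
  shows "(\<forall>h\<in>carrier H. \<forall>w\<in>carrier (rten n). rc n j (act (lten j) h x) w = \<zero>\<^bsub>E\<^esub>) \<longleftrightarrow> iter j x \<in> dd (Suc n)"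
  using assms
proof (induct n arbitrary: j x)
  case 0
  have r: "carrier (rten 0) = RLeaf ` carrier A" by (simp add: relabel_def Let_def)
  show ?case using 0 by (simp add: r rc_0 iter_act del: rtensor.simps)
next
  case (Suc n)
  let ?T = "lten j" and ?Q = "rcn n j"
  note x = Suc(2)
  note u = umodule_lten[of j] uA umodule_rten[of n]
  \<comment> \<open>\<open>dd 0\<close> is the zero submodule, so these instances say that a
    Sweedler sum of zeros is zero.\<close>
  note z3 = tlift3_submodule[OF H_modules(1,1,1) _ E(2) dd_submodule[of 0], simplified]
    and z2 = tlift_submodule[OF H_modules(1,1) _ E(2) dd_submodule[of 0], simplified]
  \<comment> \<open>The same vanishing statement without the outermost \<open>\<phi>inv\<close>. It
    is shown equivalent to each side of the claim.\<close>
  let ?Z = "\<forall>h\<in>carrier H. \<forall>a\<in>carrier A. \<forall>w\<in>carrier (rten n). ?Q (act ?T h x) a w = \<zero>\<^bsub>E\<^esub>"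
  have lc: "lnode (pure ?T A y a) \<in> carrier (lten (Suc j))" if "y \<in> carrier ?T" "a \<in> carrier A" for y a
    by (rule bilin_closed[OF equivar_bilin[OF equivar_lnode] that])
  have 1: "?Z" if L: "\<forall>h\<in>carrier H. \<forall>w\<in>carrier (rten (Suc n)). rc (Suc n) j (act ?T h x) w = \<zero>\<^bsub>E\<^esub>"
  proof (intro ballI)
    fix h a w assume h: "h \<in> carrier H" and aw: "a \<in> carrier A" "w \<in> carrier (rten n)"
    have hx: "act ?T h x \<in> carrier ?T" using h x by simp
    \<comment> \<open>Inserting \<open>\<phi>inv\<close> followed by \<phi> writes the plain value
      as a sum of rebracketed values on the orbit.\<close>
    have "?Q (act ?T h x) a w = act3 ?T A (rten n) E (act3 ?T A (rten n) E ?Q \<phi>inv) \<phi> (act ?T h x) a w"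
      by (rule act3_phi_inv(2)[OF u E(2) trilin_rcn hx aw, symmetric])
    also have "\<dots> = \<zero>\<^bsub>E\<^esub>"
      unfolding act3_def[of ?T A "rten n" E "act3 ?T A (rten n) E ?Q \<phi>inv"]
    proof (rule z3[OF phi_closed(1)])
      fix p q r assume pqr: "p \<in> carrier H" "q \<in> carrier H" "r \<in> carrier H"
      have c: "act ?T p (act ?T h x) \<in> carrier ?T" "act A q a \<in> carrier A" "act (rten n) r w \<in> carrier (rten n)"
        using pqr h x aw by auto
      have "rnode (pure A (rten n) (act A q a) (act (rten n) r w)) \<in> carrier (rten (Suc n))"
        by (rule bilin_closed[OF equivar_bilin[OF equivar_rnode] c(2,3)])
      moreover have "act ?T p (act ?T h x) = act ?T (p \<otimes>\<^bsub>H\<^esub> h) x" using pqr h x by (simp add: act_mult)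
      ultimately show "act3 ?T A (rten n) E ?Q \<phi>inv (act ?T p (act ?T h x)) (act A q a) (act (rten n) r w) = \<zero>\<^bsub>E\<^esub>"
        unfolding rc_Suc[OF c, symmetric] using L pqr h by (simp del: rtensor.simps)
    qed
    finally show "?Q (act ?T h x) a w = \<zero>\<^bsub>E\<^esub>" .
  qed
  have 2: "rc (Suc n) j (act ?T h x) y = \<zero>\<^bsub>E\<^esub>" if Z: ?Z and h: "h \<in> carrier H" and y: "y \<in> carrier (rten (Suc n))" for h y
  proof (rule rten_ext[OF E(2) bilin_right[OF bilin_rc _ klinear_id] klinear_const_zero[OF E(2)] _ y])
    show hx: "act ?T h x \<in> carrier ?T" using h x by simp
    fix a w assume aw: "a \<in> carrier A" "w \<in> carrier (rten n)"
    show "rc (Suc n) j (act ?T h x) (rnode (pure A (rten n) a w)) = \<zero>\<^bsub>E\<^esub>"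
      unfolding rc_Suc[OF hx aw] act3_def
    proof (rule z3[OF phi_closed(2)])
      fix p q r assume pqr: "p \<in> carrier H" "q \<in> carrier H" "r \<in> carrier H"
      have "act ?T p (act ?T h x) = act ?T (p \<otimes>\<^bsub>H\<^esub> h) x" using pqr h x by (simp add: act_mult)
      then show "?Q (act ?T p (act ?T h x)) (act A q a) (act (rten n) r w) = \<zero>\<^bsub>E\<^esub>"
        using Z pqr h aw by simp
    qed
  qed
  \<comment> \<open>The induction hypothesis speaks about the orbit of the node formed by
    \<open>x\<close> and \<open>a\<close>, on which H acts through \<Delta>. In one direction the
    coproduct is expanded and \<open>?Z\<close> covers each term; in the other the orbit is
    evaluated at 1.\<close>
  have 3: "?Z \<longleftrightarrow> (\<forall>h\<in>carrier H. \<forall>a\<in>carrier A. brk (act E h (iter j x)) a \<in> dd (Suc n))"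
  proof
    assume Z: ?Z
    show "\<forall>h\<in>carrier H. \<forall>a\<in>carrier A. brk (act E h (iter j x)) a \<in> dd (Suc n)"
    proof (intro ballI)
      fix h a assume h: "h \<in> carrier H" and a: "a \<in> carrier A"
      have hx: "act ?T h x \<in> carrier ?T" using h x by simp
      have "\<forall>h'\<in>carrier H. \<forall>w\<in>carrier (rten n). rc n (Suc j) (act (lten (Suc j)) h' (lnode (pure ?T A (act ?T h x) a))) w = \<zero>\<^bsub>E\<^esub>"
      proof (intro ballI)
        fix h' w assume h': "h' \<in> carrier H" and w: "w \<in> carrier (rten n)"
        have "rc n (Suc j) (act (lten (Suc j)) h' (lnode (pure ?T A (act ?T h x) a))) w = act2 ?T A E (\<lambda>x a. ?Q x a w) (\<Delta> h') (act ?T h x) a"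
          unfolding equivar_act[OF equivar_lnode h' hx a]
          by (rule act2_linear[where g="\<lambda>m. rc n (Suc j) m w", OF u(1,2) umodule_module[OF umodule_lten]
                equivar_bilin[OF equivar_lnode] E(2) bilin_left[OF bilin_rc klinear_id w] comult_closed[OF h'] hx a])
        also have "\<dots> = \<zero>\<^bsub>E\<^esub>"
          unfolding act2_def
        proof (rule z2[OF comult_closed[OF h']])
          fix p q assume pq: "p \<in> carrier H" "q \<in> carrier H"
          have "act ?T p (act ?T h x) = act ?T (p \<otimes>\<^bsub>H\<^esub> h) x" using pq h x by (simp add: act_mult)
          then show "?Q (act ?T p (act ?T h x)) (act A q a) w = \<zero>\<^bsub>E\<^esub>"
            using Z pq h a w by simp
        qed
        finally show "rc n (Suc j) (act (lten (Suc j)) h' (lnode (pure ?T A (act ?T h x) a))) w = \<zero>\<^bsub>E\<^esub>" .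
      qed
      then have "iter (Suc j) (lnode (pure ?T A (act ?T h x) a)) \<in> dd (Suc n)"
        using Suc(1)[OF lc[OF hx a]] by blast
      then show "brk (act E h (iter j x)) a \<in> dd (Suc n)"
        unfolding iter_lnode[OF hx a] iter_act[OF h x] .
    qed
  next
    assume D: "\<forall>h\<in>carrier H. \<forall>a\<in>carrier A. brk (act E h (iter j x)) a \<in> dd (Suc n)"
    show ?Z
    proof (intro ballI)
      fix h a w assume h: "h \<in> carrier H" and a: "a \<in> carrier A" and w: "w \<in> carrier (rten n)"
      have hx: "act ?T h x \<in> carrier ?T" using h x by simp
      have "iter (Suc j) (lnode (pure ?T A (act ?T h x) a)) \<in> dd (Suc n)"
        unfolding iter_lnode[OF hx a] iter_act[OF h x] using D h a by blast
      then have "rc n (Suc j) (act (lten (Suc j)) \<one>\<^bsub>H\<^esub> (lnode (pure ?T A (act ?T h x) a))) w = \<zero>\<^bsub>E\<^esub>"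
        using Suc(1)[OF lc[OF hx a]] w H_one_closed by blast
      then show "?Q (act ?T h x) a w = \<zero>\<^bsub>E\<^esub>"
        unfolding act_one[OF umodule_lten lc[OF hx a]] .
    qed
  qed
  have ic: "iter j x \<in> carrier E" using x by simp
  have "(\<forall>h\<in>carrier H. \<forall>w\<in>carrier (rten (Suc n)). rc (Suc n) j (act ?T h x) w = \<zero>\<^bsub>E\<^esub>) \<longleftrightarrow> ?Z"
    using 1 2 by blast
  then show ?case using 3 ic by (simp only: dd.simps(2)[of "Suc n"] mem_Collect_eq simp_thms)
qed

text \<open>The kernel of the curried map consists of those \<open>L\<close> whose whole orbit is
  killed by the uncurried map, to which \<open>rc_zero_iff\<close> applies with j = 0. The index is
  shifted because n + 1 factors of \<open>A\<close> mean n + 1 brackets before reaching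
  \<open>dd 0\<close>.\<close>

lemma diff_n_dd: "diff_n A V n = dd (Suc n)"
proof -
  interpret E: module K E by simp
  let ?P = "rten n"
  let ?f = "iter (Suc n) \<circ> rebr n 0 \<circ> tmap (lten 0) ?P LLeaf (\<lambda>y. y)"
  let ?F = "\<lambda>L w. rc n 0 (LLeaf L) w"
  have P: "umodule ?P" by blast
  have r0: "klinear K E (lten 0) LLeaf"
    "h \<in> carrier H \<Longrightarrow> v \<in> carrier E \<Longrightarrow> act (lten 0) h (LLeaf v) = LLeaf (act E h v)" for h v
    using umodule_relabel(2,4)[OF E(1) inj_on_leaf(1)] by simp_all
  have f: "?f (pure E ?P L w) = ?F L w" if "L \<in> carrier E" "w \<in> carrier ?P" for L w
    using tmap_pure(1)[OF E(1) P umodule_lten P r0(1) klinear_id that] by (simp add: rc_def del: iter_commutator.simps)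
  have b: "bilin K E ?P E ?F"
    by (intro bilinI bilin_left[OF bilin_rc r0(1)] bilin_right[OF bilin_rc _ klinear_id] klinear_closed[OF r0(1)])
  have F: "equivar E ?P E ?F"
    unfolding equivar_def
  proof (intro conjI ballI b)
    fix h L w assume h: "h \<in> carrier H" and Lw: "L \<in> carrier E" "w \<in> carrier ?P"
    show "act E h (?F L w) = act2 E ?P E ?F (\<Delta> h) L w"
      unfolding equivar_act[OF equivar_rc h klinear_closed[OF r0(1) Lw(1)] Lw(2)] act2_def
      using h Lw by (intro tlift_H(3)) (auto simp: r0(2) simp del: ltensor.simps)
  qed
  have z: "zeta E ?P E ?f L = curry_h E ?P E ?F L" if "L \<in> carrier E" for L
    unfolding zeta_curry_h by (rule curry_h_cong[OF E(1) P that f])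
  have "zeta E ?P E ?f L = \<zero>\<^bsub>ihom ?P E\<^esub> \<longleftrightarrow> L \<in> dd (Suc n)" if L: "L \<in> carrier E" for L
  proof -
    have l0: "LLeaf L \<in> carrier (lten 0)" by (rule klinear_closed[OF r0(1) L])
    have i0: "iter 0 (LLeaf L) = L" using L by (simp add: inv_into_f_f[OF inj_on_leaf(1)])
    have act0: "act (lten 0) h (LLeaf L) = LLeaf (act E h L)" if "h \<in> carrier H" for h using r0(2)[OF that L] .
    have "L \<in> dd (Suc n) \<longleftrightarrow> (\<forall>h\<in>carrier H. \<forall>w\<in>carrier ?P. ?F (act E h L) w = \<zero>\<^bsub>E\<^esub>)"
      using rc_zero_iff[OF l0, of n] unfolding i0 by (simp add: act0 del: ltensor.simps)
    moreover have "curry_h E ?P E ?F L = \<zero>\<^bsub>ihom ?P E\<^esub> \<longleftrightarrow> (\<forall>h\<in>carrier H. \<forall>w\<in>carrier ?P. ?F (act E h L) w = \<zero>\<^bsub>E\<^esub>)"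
    proof
      assume c: "curry_h E ?P E ?F L = \<zero>\<^bsub>ihom ?P E\<^esub>"
      show "\<forall>h\<in>carrier H. \<forall>w\<in>carrier ?P. ?F (act E h L) w = \<zero>\<^bsub>E\<^esub>"
      proof (intro ballI)
        fix h w assume h: "h \<in> carrier H" and w: "w \<in> carrier ?P"
        have uh: "umodule (ihom ?P E)" using P E(1) by blast
        \<comment> \<open>Zero is fixed by H and currying commutes with the action, so the curried
          map vanishes on the whole orbit of \<open>L\<close>; evaluation then recovers
          \<open>?F\<close> there.\<close>
        have "act (ihom ?P E) h \<zero>\<^bsub>ihom ?P E\<^esub> = \<zero>\<^bsub>ihom ?P E\<^esub>"
          using klinear_zero[OF umodule_module[OF uh] umodule_module[OF uh] klinear_act_r[OF uh h klinear_id]] .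
        then have "curry_h E ?P E ?F (act E h L) = \<zero>\<^bsub>ihom ?P E\<^esub>"
          using curry_h_act[OF E(1) P E(1) F L h] c by simp
        moreover have "ap ?P E (curry_h E ?P E ?F (act E h L)) w = ?F (act E h L) w"
          by (rule ap_curry_h[OF E(1) P E(1) F _ w]) (use h L in simp)
        moreover have "ap ?P E \<zero>\<^bsub>ihom ?P E\<^esub> w = \<zero>\<^bsub>E\<^esub>"
          by (rule klinear_zero[OF umodule_module[OF uh] E(2) bilin_left[OF bilin_ap[OF P E(1)] klinear_id w]])
        ultimately show "?F (act E h L) w = \<zero>\<^bsub>E\<^esub>" by simp
      qed
    next
      assume Z: "\<forall>h\<in>carrier H. \<forall>w\<in>carrier ?P. ?F (act E h L) w = \<zero>\<^bsub>E\<^esub>"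
      have "tlift3 E (\<lambda>a b c. ?F (act E a L) (act ?P (b \<otimes>\<^bsub>H\<^esub> \<beta> \<otimes>\<^bsub>H\<^esub> S c) w)) \<phi>inv \<in> dd 0" if "w \<in> carrier ?P" for w
        by (rule tlift3_submodule[OF H_modules(1,1,1) phi_closed(2) E(2) dd_submodule]) (use Z that P in simp)
      then show "curry_h E ?P E ?F L = \<zero>\<^bsub>ihom ?P E\<^esub>"
        by (auto simp: curry_h_def ihom_simps(2) intro!: restrict_ext)
    qed
    ultimately show ?thesis unfolding z[OF L] by simp
  qed
  moreover have "dd (Suc n) \<subseteq> carrier E" by auto
  ultimately show ?thesis unfolding diff_n_def Let_def by blast
qed

section \<open>The algebra of differential operators\<close>

lemma dd_mono: "n \<le> m \<Longrightarrow> dd n \<subseteq> dd m"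
  by (rule lift_Suc_mono_le[where f=dd, OF dd_Suc])

lemma diff_subobject: "alg_subobject (diff_alg A V) (end_alg V)"
proof -
  interpret E: module K E by simp
  let ?D = "\<Union>n. dd (Suc n)"
  have D: "(\<Union>n. diff_n A V n) = ?D" by (simp add: diff_n_dd del: dd.simps)
  \<comment> \<open>The levels of \<open>dd\<close> increase, so any two operators have a common
    order. This is what makes their union closed under addition.\<close>
  have up: "\<exists>n. x \<in> dd (Suc n) \<and> y \<in> dd (Suc n)" if xy: "x \<in> ?D" "y \<in> ?D" for x y
  proof -
    obtain n m where "x \<in> dd (Suc n)" "y \<in> dd (Suc m)" using xy by blast
    then have "x \<in> dd (Suc (max n m))" "y \<in> dd (Suc (max n m))"
      using dd_mono[of "Suc n" "Suc (max n m)"] dd_mono[of "Suc m" "Suc (max n m)"] by (auto simp del: dd.simps)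
    then show ?thesis by blast
  qed
  have mE: "module K (end_alg V)" by (rule module_transfer[OF E(2)]) simp_all
  have sub: "submodule ?D K (end_alg V)"
    unfolding submodule_iff[OF mE]
  proof (intro conjI ballI)
    show "?D \<subseteq> carrier (end_alg V)" by auto
    show "\<zero>\<^bsub>end_alg V\<^esub> \<in> ?D" using dd_closed(2)[of "Suc 0"] by (auto simp del: dd.simps)
    show "x \<oplus>\<^bsub>end_alg V\<^esub> y \<in> ?D" if "x \<in> ?D" "y \<in> ?D" for x y
      using up[OF that] dd_closed(3) by (auto simp del: dd.simps)
    show "c \<odot>\<^bsub>end_alg V\<^esub> x \<in> ?D" if "c \<in> carrier K" "x \<in> ?D" for c x
      using that dd_closed(6) by (auto simp del: dd.simps)
  qed
  \<comment> \<open>Taking components reads only the grading, zero and sums, which the two records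
    share.\<close>
  have hc: "hcomp (end_alg V) x n = hcomp E x n" for x n
    by (simp add: hcomp_def decomposes_def finsum_def finprod_def)
  show ?thesis
    unfolding diff_alg_def D
  proof (rule alg_subobject_restrict[OF halgebra_end_alg sub])
    show "act (end_alg V) h x \<in> ?D" if "h \<in> carrier H" "x \<in> ?D" for h x
      using that dd_act by (auto simp del: dd.simps)
    show "hcomp (end_alg V) x n \<in> ?D" if "x \<in> ?D" for x n
      using that dd_hcomp by (auto simp: hc simp del: dd.simps)
    show "mu (end_alg V) (pure (end_alg V) (end_alg V) x y) \<in> ?D" if "x \<in> ?D" "y \<in> ?D" for x y
      using that dd_cmp by (fastforce simp del: dd.simps)
    show "eta (end_alg V) \<one>\<^bsub>K\<^esub> \<in> ?D" using idE_dd by (auto simp del: dd.simps)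
  qed
qed

end

theorem corollary3p16:
  fixes K :: "'k ring" and H :: "('k, 'h) quasi_hopf"
    and A :: "('k, 'h, 'a) halg" and V :: "('k, 'h, 'a, 'v) hbimod"
  assumes "quasitriangular_quasi_hopf_algebra K H"
    and "hopf_data.halgebra K H A"
    and "hopf_data.braided_commutative K H A"
    and "hopf_data.symmetric_bimodule K H A V"
  shows "hopf_data.alg_subobject K H (hopf_data.diff_alg K H A V) (hopf_data.end_alg K H V)"
proof -
  interpret quasitriangular_quasi_hopf_algebra K H by fact
  have A: "hmodule A" using assms(2) by (simp add: halgebra_def)
  have V: "hmodule V" "hmorphism (A \<boxtimes> V) V (lact V)"
    using assms(4) by (simp_all add: symmetric_bimodule_def hbimodule_def)
  interpret diff_operators K H V A
    by unfold_locales (use hmodule_umodule[OF V(1)] V A in auto)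
  show ?thesis by (rule diff_subobject)
qed

end
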